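(* Let $c > 0$ be a constant. The WSAT$^+[t]$ ($t \geq 2$) problem on circuits of genus $g(n) =\Omega(n^c)$, where $n$ is the number of variables in the circuit, is $W[t]$-complete for even $t$ and $W[t-1]$-complete for odd $t$.
   Context: A $\Pi_t$ circuit is a Boolean circuit in normalized form of depth at most $t$: the output gate is an AND-gate, every non-variable gate has outdegree at most 1, and starting from the output gate the gates alternate between AND-gates and OR-gates (no NOT-gates; input vertices are literals). A circuit is monotone if all its input literals are positive. WSAT$^+[t]$ (weighted monotone $\Pi_t$-circuit satisfiability) is the problem: given a monotone $\Pi_t$ circuit $C$ and a parameter $k$, decide whether $C$ has a satisfying assignment of weight (number of variables set to 1) exactly $k$. The genus of a circuit is the genus of its underlying undirected graph after the output gate is removed. It is known that WSAT$^+[t]$ (without genus restriction) is $W[t]$-complete for even $t$ and $W[t-1]$-complete for odd $t$. *)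

theory Defs
  imports "HOL-Analysis.Analysis" "HOL-Library.Landau_Symbols"
begin

subsection \<open>Algorithms and parameterized problems\<close>

text \<open>
  The machine model is a random access machine with addition and truncated subtraction under
  uniform cost: finitely many registers (those named in the program) and an array of natural
  numbers. Since there is no multiplication, numbers have at most \<open>O(T)\<close> more bits after \<open>T\<close>
  steps than initially, so polynomial time agrees with that of Turing machines.
\<close>

datatype aexp = Const nat | Reg nat | Cell aexp | Plus aexp aexp | Minus aexp aexp

datatype prog =
    Assign nat aexp
  | Store aexp aexp
  | Seq prog prog
  | If aexp prog prog
  | While aexp prog

type_synonym state = "(nat \<Rightarrow> nat) \<times> (nat \<Rightarrow> nat)"

fun aval :: "aexp \<Rightarrow> state \<Rightarrow> nat" where
  "aval (Const n) s = n"
| "aval (Reg i) s = fst s i"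
| "aval (Cell a) s = snd s (aval a s)"
| "aval (Plus a b) s = aval a s + aval b s"
| "aval (Minus a b) s = aval a s - aval b s"

text \<open>\<open>exec p s n s'\<close>: started in \<open>s\<close>, the program \<open>p\<close> halts in \<open>s'\<close> after \<open>n\<close> steps.
  A test succeeds iff its value is nonzero.\<close>

inductive exec :: "prog \<Rightarrow> state \<Rightarrow> nat \<Rightarrow> state \<Rightarrow> bool" where
  "exec (Assign i a) s 1 ((fst s)(i := aval a s), snd s)"
| "exec (Store a b) s 1 (fst s, (snd s)(aval a s := aval b s))"
| "exec p s m s' \<Longrightarrow> exec q s' n s'' \<Longrightarrow> exec (Seq p q) s (m + n) s''"
| "aval a s \<noteq> 0 \<Longrightarrow> exec p s n s' \<Longrightarrow> exec (If a p q) s (n + 1) s'"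
| "aval a s = 0 \<Longrightarrow> exec q s n s' \<Longrightarrow> exec (If a p q) s (n + 1) s'"
| "aval a s = 0 \<Longrightarrow> exec (While a p) s 1 s"
| "aval a s \<noteq> 0 \<Longrightarrow> exec p s m s' \<Longrightarrow> exec (While a p) s' n s'' \<Longrightarrow>
     exec (While a p) s (m + n + 1) s''"

definition computable :: "(nat \<Rightarrow> nat) \<Rightarrow> bool" where
  "computable f \<longleftrightarrow>
     (\<exists>p. \<forall>k. \<exists>n s. exec p ((\<lambda>_. 0)(0 := k), \<lambda>_. 0) n s \<and> fst s 0 = f k)"

text \<open>A string occupies an initial segment of the array; \<open>0\<close> is the blank that ends it.\<close>

definition string_cells :: "bool list \<Rightarrow> nat \<Rightarrow> nat" where
  "string_cells x i = (if i < length x then (if x ! i then 2 else 1) else 0)"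

definition initial_state :: "bool list \<Rightarrow> nat \<Rightarrow> state" where
  "initial_state x k = ((\<lambda>_. 0)(0 := k), string_cells x)"

definition outputs :: "state \<Rightarrow> bool list \<Rightarrow> nat \<Rightarrow> bool" where
  "outputs s x k \<longleftrightarrow> fst s 0 = k \<and> (\<forall>i\<le>length x. snd s i = string_cells x i)"

text \<open>
  A parameterized problem consists of its admissible instances (string, parameter) and the
  yes-instances among them. An algorithm for a problem restricted to a class of inputs is only
  ever run on inputs of that class and need not recognize the class: deciding whether the genus
  of a graph is at most a given bound is itself NP-hard. A language is the case
  \<open>instances = UNIV\<close>.
\<close>

record param_problem =
  instances :: "(bool list \<times> nat) set"
  yes_instances :: "(bool list \<times> nat) set"

definition fpt_reducible :: "param_problem \<Rightarrow> param_problem \<Rightarrow> bool" where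
  "fpt_reducible P Q \<longleftrightarrow>
     (\<exists>p f g d. computable f \<and> computable g \<and>
        (\<forall>(x, k) \<in> instances P. \<exists>n s x' k'.
           exec p (initial_state x k) n s \<and> outputs s x' k' \<and>
           n \<le> f k * (length x + 1) ^ d \<and>
           k' \<le> g k \<and>
           (x', k') \<in> instances Q \<and>
           ((x, k) \<in> yes_instances P \<longleftrightarrow> (x', k') \<in> yes_instances Q)))"

subsection \<open>Circuits\<close>

text \<open>
  A circuit is a directed acyclic graph listed in topological order. Its vertices are the list
  positions, gates refer to the positions of their inputs, and the last position is the output.
  \<open>LIT True v\<close> is the literal \<open>v\<close>, \<open>LIT False v\<close> its negation.
\<close>

datatype gate =
    is_LIT: LIT bool nat
  | is_NOT: NOT nat
  | is_AND: AND "nat list"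
  | is_OR: OR "nat list"

type_synonym circuit = "gate list"

fun fan_in :: "gate \<Rightarrow> nat list" where
  "fan_in (LIT b v) = []"
| "fan_in (NOT j) = [j]"
| "fan_in (AND js) = js"
| "fan_in (OR js) = js"

definition wf_circuit :: "circuit \<Rightarrow> bool" where
  "wf_circuit C \<longleftrightarrow>
     C \<noteq> [] \<and>
     (\<forall>i<length C. \<forall>j\<in>set (fan_in (C ! i)). j < i) \<and>
     (\<forall>G\<in>set C. distinct (fan_in G) \<and> (fan_in G = [] \<longrightarrow> is_LIT G)) \<and>
     distinct (filter is_LIT C)"

definition vars :: "circuit \<Rightarrow> nat set" where
  "vars C = {v. \<exists>b. LIT b v \<in> set C}"

text \<open>Computes a value for every vertex from the list of values of the preceding ones.\<close>

definition vertex_values :: "('a list \<Rightarrow> gate \<Rightarrow> 'a) \<Rightarrow> circuit \<Rightarrow> 'a list" where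
  "vertex_values f C = foldl (\<lambda>vs G. vs @ [f vs G]) [] C"

text \<open>An assignment is given by the set \<open>S\<close> of variables set to 1; its weight is \<open>card S\<close>.\<close>

fun gate_eval :: "nat set \<Rightarrow> bool list \<Rightarrow> gate \<Rightarrow> bool" where
  "gate_eval S vs (LIT b v) \<longleftrightarrow> (v \<in> S) = b"
| "gate_eval S vs (NOT j) \<longleftrightarrow> \<not> vs ! j"
| "gate_eval S vs (AND js) \<longleftrightarrow> (\<forall>j\<in>set js. vs ! j)"
| "gate_eval S vs (OR js) \<longleftrightarrow> (\<exists>j\<in>set js. vs ! j)"

definition satisfies :: "nat set \<Rightarrow> circuit \<Rightarrow> bool" where
  "satisfies S C \<longleftrightarrow> last (vertex_values (gate_eval S) C)"

definition weight_satisfiable :: "circuit \<Rightarrow> nat \<Rightarrow> bool" where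
  "weight_satisfiable C k \<longleftrightarrow> (\<exists>S. S \<subseteq> vars C \<and> card S = k \<and> satisfies S C)"

text \<open>The largest number of gates with property \<open>P\<close> on a path to the output.\<close>

definition max_on_path :: "(gate \<Rightarrow> bool) \<Rightarrow> circuit \<Rightarrow> nat" where
  "max_on_path P C =
     last (vertex_values
       (\<lambda>vs G. of_bool (P G) + Max (insert 0 ((\<lambda>j. vs ! j) ` set (fan_in G)))) C)"

definition depth :: "circuit \<Rightarrow> nat" where
  "depth = max_on_path (\<lambda>G. \<not> is_LIT G)"

definition weft :: "circuit \<Rightarrow> nat" where
  "weft = max_on_path (\<lambda>G. length (fan_in G) > 2)"

definition outdegree :: "circuit \<Rightarrow> nat \<Rightarrow> nat" where
  "outdegree C j = card {i. i < length C \<and> j \<in> set (fan_in (C ! i))}"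

definition Pi_circuit :: "nat \<Rightarrow> circuit \<Rightarrow> bool" where
  "Pi_circuit t C \<longleftrightarrow>
     wf_circuit C \<and> depth C \<le> t \<and> is_AND (last C) \<and>
     (\<forall>G\<in>set C. \<not> is_NOT G) \<and>
     (\<forall>j<length C. \<not> is_LIT (C ! j) \<longrightarrow> outdegree C j \<le> 1) \<and>
     (\<forall>i<length C. \<forall>j\<in>set (fan_in (C ! i)).
        \<not> (is_AND (C ! i) \<and> is_AND (C ! j)) \<and> \<not> (is_OR (C ! i) \<and> is_OR (C ! j)))"

definition monotone_circuit :: "circuit \<Rightarrow> bool" where
  "monotone_circuit C \<longleftrightarrow> (\<forall>b v. LIT b v \<in> set C \<longrightarrow> b)"

text \<open>
  Numbers are written in unary. For circuits whose variables are numbered consecutively the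
  length of the code is polynomial in the number of vertices.
\<close>

definition encode_nat :: "nat \<Rightarrow> bool list" where
  "encode_nat n = replicate n True @ [False]"

definition encode_nats :: "nat list \<Rightarrow> bool list" where
  "encode_nats ns = encode_nat (length ns) @ concat (map encode_nat ns)"

fun gate_code :: "gate \<Rightarrow> nat list" where
  "gate_code (LIT b v) = [of_bool b, v]"
| "gate_code (NOT j) = [2, j]"
| "gate_code (AND js) = 3 # js"
| "gate_code (OR js) = 4 # js"

definition encode :: "circuit \<Rightarrow> bool list" where
  "encode C = concat (map (\<lambda>G. encode_nats (gate_code G)) C)"

lemma encode_nat_append_eq:
  "encode_nat m @ xs = encode_nat n @ ys \<longleftrightarrow> m = n \<and> xs = ys"
proof (induction m arbitrary: n)
  case 0
  show ?case by (cases n) (auto simp: encode_nat_def)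
next
  case (Suc m)
  then show ?case by (cases n) (auto simp: encode_nat_def)
qed

lemma concat_encode_nat_append_eq:
  "length ms = length ns \<Longrightarrow>
   concat (map encode_nat ms) @ xs = concat (map encode_nat ns) @ ys \<longleftrightarrow> ms = ns \<and> xs = ys"
  by (induction ms ns rule: list_induct2) (auto simp: encode_nat_append_eq)

lemma encode_nats_append_eq:
  "encode_nats ms @ xs = encode_nats ns @ ys \<longleftrightarrow> ms = ns \<and> xs = ys"
  unfolding encode_nats_def
  by (cases "length ms = length ns")
     (auto simp: encode_nat_append_eq concat_encode_nat_append_eq)

lemma gate_code_eq_iff: "gate_code G = gate_code H \<longleftrightarrow> G = H"
  by (cases G; cases H) (auto simp: of_bool_def)

lemma encode_eq_iff: "encode C = encode D \<longleftrightarrow> C = D"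
proof (induction C arbitrary: D)
  case Nil
  show ?case by (cases D) (auto simp: encode_def encode_nats_def encode_nat_def)
next
  case (Cons G C)
  show ?case
  proof (cases D)
    case Nil
    then show ?thesis by (auto simp: encode_def encode_nats_def encode_nat_def)
  next
    case (Cons H D')
    then show ?thesis
      using Cons.IH[of D'] by (auto simp: encode_def encode_nats_append_eq gate_code_eq_iff)
  qed
qed

definition weighted_sat :: "(circuit \<Rightarrow> bool) \<Rightarrow> param_problem" where
  "weighted_sat \<C> =
     \<lparr>instances = {(encode C, k) | C k. \<C> C},
      yes_instances = {(encode C, k) | C k. \<C> C \<and> weight_satisfiable C k}\<rparr>"

subsection \<open>The W-hierarchy\<close>

definition W :: "nat \<Rightarrow> param_problem set" where
  "W t = {Q. \<exists>h. fpt_reducible Q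
                   (weighted_sat (\<lambda>C. wf_circuit C \<and> weft C \<le> t \<and> depth C \<le> h))}"

definition W_complete :: "nat \<Rightarrow> param_problem \<Rightarrow> bool" where
  "W_complete t Q \<longleftrightarrow> Q \<in> W t \<and> (\<forall>P\<in>W t. fpt_reducible P Q)"

subsection \<open>Genus\<close>

definition disc_with_holes :: "nat \<Rightarrow> complex set \<Rightarrow> bool" where
  "disc_with_holes h D \<longleftrightarrow>
     (\<exists>a r. (\<forall>i<h. r i > 0 \<and> cball (a i) (r i) \<subseteq> ball 0 1) \<and>
            disjoint_family_on (\<lambda>i. cball (a i) (r i)) {..<h} \<and>
            D = cball 0 1 - (\<Union>i<h. ball (a i) (r i)))"

text \<open>
  Two copies of \<open>D\<close>, one above and one below the plane, glued along the boundary of \<open>D\<close>.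
  For a disc with \<open>h\<close> holes (any positions and radii) this is the sphere with \<open>h\<close> handles.
\<close>

definition double :: "complex set \<Rightarrow> (complex \<times> real) set" where
  "double D = {(z, s). z \<in> D \<and> \<bar>s\<bar> = infdist z (frontier D)}"

definition orientable_surface :: "nat \<Rightarrow> (complex \<times> real) set \<Rightarrow> bool" where
  "orientable_surface h S \<longleftrightarrow> (\<exists>D. disc_with_holes h D \<and> S = double D)"

definition embeds_in :: "'v set \<Rightarrow> 'v set set \<Rightarrow> 'a::topological_space set \<Rightarrow> bool" where
  "embeds_in V E S \<longleftrightarrow>
     (\<exists>p \<gamma>. inj_on p V \<and> p ` V \<subseteq> S \<and>
        (\<forall>e\<in>E. arc (\<gamma> e) \<and> path_image (\<gamma> e) \<subseteq> S \<and>
               {pathstart (\<gamma> e), pathfinish (\<gamma> e)} = p ` e \<and>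
               path_image (\<gamma> e) \<inter> p ` V = p ` e) \<and>
        (\<forall>e\<in>E. \<forall>e'\<in>E. e \<noteq> e' \<longrightarrow>
               path_image (\<gamma> e) \<inter> path_image (\<gamma> e') = p ` (e \<inter> e')))"

definition graph_genus :: "'v set \<Rightarrow> 'v set set \<Rightarrow> nat" where
  "graph_genus V E = (LEAST h. \<exists>S. orientable_surface h S \<and> embeds_in V E S)"

text \<open>The graph of the circuit without the output, which is the last vertex.\<close>

definition circuit_genus :: "circuit \<Rightarrow> nat" where
  "circuit_genus C =
     graph_genus {..<length C - 1} {{i, j} | i j. i < length C - 1 \<and> j \<in> set (fan_in (C ! i))}"

definition WSAT_mono :: "nat \<Rightarrow> (nat \<Rightarrow> nat) \<Rightarrow> param_problem" where
  "WSAT_mono t g =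
     weighted_sat (\<lambda>C. Pi_circuit t C \<and> monotone_circuit C \<and> circuit_genus C \<le> g (card (vars C)))"

end

theory Submission
  imports Defs
begin

text \<open>
  A circuit of weft \<open>t\<close> and bounded depth is equivalent to a prenex formula with \<open>t + 1\<close>
  alternating quantifiers over polynomially many indices, the first one existential, whose matrix
  depends on boundedly many literals. The leading index is guessed by a variable. A chosen set \<open>S\<close>
  of size \<open>k\<close> is represented by its \<open>k + 1\<close> gaps, the pairs of consecutive elements: both
  \<open>v \<in> S\<close> and \<open>v \<notin> S\<close> then say that one of the gaps has a certain form, so negation disappears, and
  variables for tuples of gaps make the matrix a disjunction of variables. The variables form groups;
  clauses asking for one true variable in every group, with weight equal to the number of groups,
  force exactly one per group.

  The genus is no obstacle: a graph embeds in the sphere with two handles per edge, because an edge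
  can cross the others on the back of the surface, which it enters and leaves through a hole. Since
  \<open>g\<close> grows like a power of the number of variables, isolated dummy variables make \<open>g\<close> exceed
  this bound at polynomial cost.

  For membership with odd \<open>t\<close>, the bottom conjunctions of a monotone circuit have positive literals,
  so only those with at most \<open>k\<close> distinct inputs can hold in an assignment of weight \<open>k\<close>; for
  each of the \<open>2 ^ k\<close> subsets of \<open>S\<close> a gate with this set of inputs is guessed and checked against
  the gaps, so that the bottom level becomes a disjunction of variables.
\<close>

subsection \<open>Functions computed within the registers\<close>

text \<open>Weft \<open>t\<close> gives \<open>t + 1\<close> quantifiers of which the first is
  existential, but the target has an AND-gate on top and only \<open>t\<close> levels. Guessing the
  leading index turns \<exists>g. F g into \<forall>g. (the guess differs from g) or F g, and this
  universal quantifier merges with the next one: hence the R ^ 2 subtrees below the root. For even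
  \<open>t\<close> the last quantifier is existential and merges with the bottom OR-gates. The rest
  must become a disjunction of variables. For fixed indices the matrix inspects at most 2 ^ h
  literals, h being the depth of the given circuit, and each true literal is witnessed by one of k +
  1 gaps. So the matrix holds iff one of (k + 1) ^ (2 ^ h) maps from literal positions to gaps
  witnesses it; there is one group per map, holding the tuple of gaps, and their number depends on k
  only. Consistency of the groups is monotone too: "not q" is the disjunction of the other variables
  in the group of q. A reduction is an actual program with a step count. Time bounds are therefore
  obtained from closure properties: functions computed in registers, strings written to the
  array.\<close>

definition holds :: "bool list \<Rightarrow> nat \<Rightarrow> state \<Rightarrow> bool" where
  "holds x k s \<longleftrightarrow> (\<forall>i\<le>length x. snd s i = string_cells x i) \<and> fst s 0 = k \<and> fst s 1 = length x"

text \<open>Powers of this one quantity serve as time and size bounds. The factor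
  \<open>2 ^ \<rho> 0\<close> admits an exponential dependence on the parameter, the summand 2 lets
  a larger exponent absorb constants and sums, and register 2 is left out because the output pointer
  moves while a program runs.\<close>

definition bnd :: "nat \<Rightarrow> (nat \<Rightarrow> nat) \<Rightarrow> nat" where
  "bnd b \<rho> = 2 ^ \<rho> 0 * (2 + (\<Sum>i\<in>{..<b} - {2}. \<rho> i))"

type_synonym input = "bool list \<times> nat"
type_synonym 'a envfun = "input \<Rightarrow> (nat \<Rightarrow> nat) \<Rightarrow> 'a"

definition poly_bounded :: "nat \<Rightarrow> nat envfun \<Rightarrow> bool" where
  "poly_bounded b F \<longleftrightarrow> (\<exists>D. \<forall>x k \<rho>. \<rho> 0 = k \<longrightarrow> \<rho> 1 = length x \<longrightarrow> F (x, k) \<rho> \<le> bnd b \<rho> ^ D)"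

lemma poly_boundedI:
  "(\<And>x k \<rho>. \<rho> 0 = k \<Longrightarrow> \<rho> 1 = length x \<Longrightarrow> F (x, k) \<rho> \<le> bnd b \<rho> ^ D) \<Longrightarrow> poly_bounded b F"
  unfolding poly_bounded_def by blast

lemma bnd_ge_2: "2 \<le> bnd b \<rho>"
proof -
  have "1 * 2 \<le> 2 ^ \<rho> 0 * (2 + (\<Sum>i\<in>{..<b} - {2}. \<rho> i))"
    by (rule mult_le_mono) auto
  then show ?thesis by (simp add: bnd_def)
qed

lemma bnd_mono: "b \<le> c \<Longrightarrow> bnd b \<rho> \<le> bnd c \<rho>"
  unfolding bnd_def by (intro mult_le_mono2 add_left_mono sum_mono2) auto

lemma bnd_Suc: "b \<noteq> 2 \<Longrightarrow> bnd (Suc b) \<rho> = bnd b \<rho> + 2 ^ \<rho> 0 * \<rho> b"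
  by (simp add: bnd_def lessThan_Suc insert_Diff_if distrib_left)

lemma bnd_cong: "3 \<le> b \<Longrightarrow> (\<And>i. i < b \<Longrightarrow> i \<noteq> 2 \<Longrightarrow> \<rho> i = \<rho>' i) \<Longrightarrow> bnd b \<rho> = bnd b \<rho>'"
  unfolding bnd_def by (auto intro!: arg_cong2[where f="(*)"] sum.cong)

lemma reg_le_bnd: "i < b \<Longrightarrow> i \<noteq> 2 \<Longrightarrow> \<rho> i \<le> bnd b \<rho>"
proof -
  assume "i < b" "i \<noteq> 2"
  then have "\<rho> i \<le> (\<Sum>i\<in>{..<b} - {2}. \<rho> i)"
    by (intro member_le_sum) auto
  then have "1 * \<rho> i \<le> 2 ^ \<rho> 0 * (2 + (\<Sum>i\<in>{..<b} - {2}. \<rho> i))"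
    by (intro mult_le_mono) auto
  then show ?thesis by (simp add: bnd_def)
qed

lemma pow_le_bnd: "2 ^ \<rho> 0 \<le> bnd b \<rho>"
  by (simp add: bnd_def)

lemma poly_bounded_mono:
  "poly_bounded b F \<Longrightarrow> b \<le> c \<Longrightarrow>
   (\<And>x k \<rho>. \<rho> 0 = k \<Longrightarrow> \<rho> 1 = length x \<Longrightarrow> G (x, k) \<rho> \<le> F (x, k) \<rho>) \<Longrightarrow> poly_bounded c G"
proof -
  assume "poly_bounded b F" "b \<le> c"
    and G: "\<And>x k \<rho>. \<rho> 0 = k \<Longrightarrow> \<rho> 1 = length x \<Longrightarrow> G (x, k) \<rho> \<le> F (x, k) \<rho>"
  then obtain D where "\<And>x k \<rho>. \<rho> 0 = k \<Longrightarrow> \<rho> 1 = length x \<Longrightarrow> F (x, k) \<rho> \<le> bnd b \<rho> ^ D"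
    unfolding poly_bounded_def by blast
  moreover have "bnd b \<rho> ^ D \<le> bnd c \<rho> ^ D" for \<rho>
    using bnd_mono[OF \<open>b \<le> c\<close>] by (simp add: power_mono)
  ultimately show ?thesis
    using G by (intro poly_boundedI[where D=D]) (meson le_trans)
qed

lemma poly_bounded_const: "poly_bounded b (\<lambda>_ _. c)"
proof (rule poly_boundedI)
  fix x :: "bool list" and k :: nat and \<rho> :: "nat \<Rightarrow> nat"
  have "c \<le> 2 ^ c" by (simp add: less_imp_le)
  also have "\<dots> \<le> bnd b \<rho> ^ c" using bnd_ge_2 by (simp add: power_mono)
  finally show "c \<le> bnd b \<rho> ^ c" .
qed

lemma poly_bounded_add:
  assumes "poly_bounded b F" "poly_bounded b G"
  shows "poly_bounded b (\<lambda>I \<rho>. F I \<rho> + G I \<rho>)"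
proof -
  obtain D E where
    D: "\<And>x k \<rho>. \<rho> 0 = k \<Longrightarrow> \<rho> 1 = length x \<Longrightarrow> F (x, k) \<rho> \<le> bnd b \<rho> ^ D" and
    E: "\<And>x k \<rho>. \<rho> 0 = k \<Longrightarrow> \<rho> 1 = length x \<Longrightarrow> G (x, k) \<rho> \<le> bnd b \<rho> ^ E"
    using assms unfolding poly_bounded_def by metis
  show ?thesis
  proof (rule poly_boundedI)
    fix x :: "bool list" and k :: nat and \<rho> :: "nat \<Rightarrow> nat" assume H: "\<rho> 0 = k" "\<rho> 1 = length x"
    have "F (x, k) \<rho> + G (x, k) \<rho> \<le> bnd b \<rho> ^ (D + E) + bnd b \<rho> ^ (D + E)"
      using D[OF H] E[OF H] bnd_ge_2[of b \<rho>]
      by (intro add_mono order_trans[OF D[OF H]] order_trans[OF E[OF H]] power_increasing) auto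
    also have "\<dots> = 2 * bnd b \<rho> ^ (D + E)" by simp
    also have "\<dots> \<le> bnd b \<rho> * bnd b \<rho> ^ (D + E)" using bnd_ge_2 by (rule mult_le_mono1)
    finally show "F (x, k) \<rho> + G (x, k) \<rho> \<le> bnd b \<rho> ^ Suc (D + E)" by simp
  qed
qed

lemma poly_bounded_mult:
  assumes "poly_bounded b F" "poly_bounded b G"
  shows "poly_bounded b (\<lambda>I \<rho>. F I \<rho> * G I \<rho>)"
proof -
  obtain D E where
    D: "\<And>x k \<rho>. \<rho> 0 = k \<Longrightarrow> \<rho> 1 = length x \<Longrightarrow> F (x, k) \<rho> \<le> bnd b \<rho> ^ D" and
    E: "\<And>x k \<rho>. \<rho> 0 = k \<Longrightarrow> \<rho> 1 = length x \<Longrightarrow> G (x, k) \<rho> \<le> bnd b \<rho> ^ E"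
    using assms unfolding poly_bounded_def by metis
  show ?thesis
    by (rule poly_boundedI[where D="D + E"]) (simp add: power_add mult_le_mono D E)
qed

lemma poly_bounded_power: "poly_bounded b F \<Longrightarrow> poly_bounded b (\<lambda>I \<rho>. F I \<rho> ^ n)"
  by (induction n) (auto intro: poly_bounded_const poly_bounded_mult)

lemma poly_bounded_bnd: "poly_bounded b (\<lambda>I \<rho>. bnd b \<rho>)"
  by (rule poly_boundedI[where D=1]) simp

lemma poly_bounded_reg: "i < b \<Longrightarrow> i \<noteq> 2 \<Longrightarrow> poly_bounded b (\<lambda>I \<rho>. \<rho> i)"
  by (rule poly_boundedI[where D=1]) (simp add: reg_le_bnd)

lemma poly_bounded_pow: "poly_bounded b (\<lambda>I \<rho>. 2 ^ \<rho> 0)"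
  by (rule poly_boundedI[where D=1]) (metis pow_le_bnd power_one_right)

text \<open>Storing a value in the fresh register \<open>b\<close> enlarges \<open>bnd\<close> only
  by \<open>2 ^ \<rho> 0\<close> times that value, so a power of the larger bound is polynomial in
  the smaller one. This is what makes running one program after another harmless.\<close>

lemma poly_bounded_upd:
  assumes "poly_bounded (Suc b) F" "poly_bounded b G" "3 \<le> b"
  shows "poly_bounded b (\<lambda>I \<rho>. F I (\<rho>(b := G I \<rho>)))"
proof -
  obtain D where
    D: "\<And>x k \<rho>. \<rho> 0 = k \<Longrightarrow> \<rho> 1 = length x \<Longrightarrow> F (x, k) \<rho> \<le> bnd (Suc b) \<rho> ^ D"
    using assms unfolding poly_bounded_def by metis
  have "poly_bounded b (\<lambda>I \<rho>. (bnd b \<rho> + 2 ^ \<rho> 0 * G I \<rho>) ^ D)"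
    by (intro poly_bounded_power poly_bounded_add poly_bounded_mult poly_bounded_bnd
        poly_bounded_pow assms)
  then show ?thesis
  proof (rule poly_bounded_mono)
    fix x :: "bool list" and k :: nat and \<rho> :: "nat \<Rightarrow> nat" assume H: "\<rho> 0 = k" "\<rho> 1 = length x"
    let ?r = "\<rho>(b := G (x, k) \<rho>)"
    have "bnd (Suc b) ?r = bnd b \<rho> + 2 ^ \<rho> 0 * G (x, k) \<rho>"
      using \<open>3 \<le> b\<close> bnd_cong[of b ?r \<rho>] by (simp add: bnd_Suc)
    then show "F (x, k) ?r \<le> (bnd b \<rho> + 2 ^ \<rho> 0 * G (x, k) \<rho>) ^ D"
      using D[of ?r k x] H \<open>3 \<le> b\<close> by simp
  qed simp
qed

text \<open>The induction is on the number \<open>j\<close> of rounds still to come, because the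
  big-step rules unfold a loop from its front. Each round pays 1 for its test, and the last 1 is the
  failing test.\<close>

lemma exec_while_count:
  assumes "\<And>i s. i < n \<Longrightarrow> Inv i s \<Longrightarrow> aval c s \<noteq> 0 \<and> (\<exists>m s'. exec p s m s' \<and> m \<le> T \<and> Inv (Suc i) s')"
    and "\<And>s. Inv n s \<Longrightarrow> aval c s = 0"
    and "Inv 0 s"
  shows "\<exists>m s'. exec (While c p) s m s' \<and> m \<le> n * (T + 1) + 1 \<and> Inv n s'"
proof -
  have "\<exists>m s'. exec (While c p) s m s' \<and> m \<le> j * (T + 1) + 1 \<and> Inv n s'"
    if "Inv (n - j) s" "j \<le> n" for j s
    using that
  proof (induction j arbitrary: s)
    case 0
    then have "exec (While c p) s 1 s" using assms(2)[of s] exec.intros(6)[of c s p] by simp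
    moreover have "Inv n s" using 0 by simp
    ultimately show ?case by (intro exI[of _ 1] exI[of _ s]) simp
  next
    case (Suc j)
    then obtain m s' where *: "aval c s \<noteq> 0" "exec p s m s'" "m \<le> T" "Inv (Suc (n - Suc j)) s'"
      using assms(1)[of "n - Suc j" s] by auto
    then have "Inv (n - j) s'" using Suc.prems by (simp add: Suc_diff_Suc)
    then obtain m' s'' where "exec (While c p) s' m' s''" "m' \<le> j * (T + 1) + 1" "Inv n s''"
      using Suc.IH[of s'] Suc.prems by auto
    moreover have "exec (While c p) s (m + m' + 1) s''"
      using * exec.intros(7)[of c s p m s' m' s''] calculation by simp
    ultimately show ?case using *(3) by (intro exI[of _ "m + m' + 1"] exI[of _ s'']) simp
  qed
  from this[of n s] assms(3) show ?thesis by simp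
qed

text \<open>Register 2 is exempt so that values survive the writing of output in between.\<close>

definition env_local :: "nat \<Rightarrow> 'a envfun \<Rightarrow> bool" where
  "env_local a f \<longleftrightarrow> (\<forall>I \<rho> \<rho>'. (\<forall>i<a. i \<noteq> 2 \<longrightarrow> \<rho> i = \<rho>' i) \<longrightarrow> f I \<rho> = f I \<rho>')"

text \<open>Register 0 holds the parameter, 1 the length of the input and 2 the next output cell; the result
  goes to register \<open>b\<close>, and everything above \<open>b\<close> is scratch space.\<close>

definition feasible :: "nat \<Rightarrow> nat envfun \<Rightarrow> bool" where
  "feasible a f \<longleftrightarrow> 3 \<le> a \<and> env_local a f \<and> poly_bounded a f \<and>
     (\<forall>b\<ge>a. \<exists>p c. poly_bounded b c \<and> (\<forall>x k s. holds x k s \<longrightarrow>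
        (\<exists>n s'. exec p s n s' \<and> n \<le> c (x, k) (fst s) \<and> fst s' b = f (x, k) (fst s) \<and>
           (\<forall>i<b. fst s' i = fst s i) \<and> snd s' = snd s)))"

lemma feasible_ge_3: "feasible a f \<Longrightarrow> 3 \<le> a" by (simp add: feasible_def)

lemma feasible_local: "feasible a f \<Longrightarrow> (\<And>i. i < a \<Longrightarrow> i \<noteq> 2 \<Longrightarrow> \<rho> i = \<rho>' i) \<Longrightarrow> f I \<rho> = f I \<rho>'"
  unfolding feasible_def env_local_def by blast

lemma feasible_poly_bounded: "feasible a f \<Longrightarrow> a \<le> b \<Longrightarrow> poly_bounded b f"
  unfolding feasible_def using poly_bounded_mono[of a f b f] by simp

lemma feasible_prog:
  assumes "feasible a f" "a \<le> b"
  obtains p c where "poly_bounded b c"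
    "\<And>x k s. holds x k s \<Longrightarrow>
        \<exists>n s'. exec p s n s' \<and> n \<le> c (x, k) (fst s) \<and> fst s' b = f (x, k) (fst s) \<and>
           (\<forall>i<b. fst s' i = fst s i) \<and> snd s' = snd s"
  using assms unfolding feasible_def by meson

lemma feasible_mono: "feasible a f \<Longrightarrow> a \<le> b \<Longrightarrow> feasible b f"
  unfolding feasible_def env_local_def using poly_bounded_mono[of a f b f]
  by (meson le_refl le_trans less_le_trans)

lemma holds_cong: "holds x k s \<Longrightarrow> (\<forall>i<b. fst s' i = fst s i) \<Longrightarrow> snd s' = snd s \<Longrightarrow> 3 \<le> b \<Longrightarrow> holds x k s'"
  by (auto simp: holds_def)

lemma feasible_basic:
  assumes "3 \<le> a" "env_local a f" "poly_bounded a f"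
    "\<And>x k s. holds x k s \<Longrightarrow> aval e s = f (x, k) (fst s)"
  shows "feasible a f"
  unfolding feasible_def
proof (intro conjI allI impI)
  fix b assume "a \<le> b"
  show "\<exists>p c. poly_bounded b c \<and> (\<forall>x k s. holds x k s \<longrightarrow>
        (\<exists>n s'. exec p s n s' \<and> n \<le> c (x, k) (fst s) \<and> fst s' b = f (x, k) (fst s) \<and>
           (\<forall>i<b. fst s' i = fst s i) \<and> snd s' = snd s))"
  proof (intro exI[of _ "Assign b e"] exI[of _ "\<lambda>_ _. 1"] conjI allI impI)
    fix x k s assume "holds x k s"
    then show "\<exists>n s'. exec (Assign b e) s n s' \<and> n \<le> 1 \<and> fst s' b = f (x, k) (fst s) \<and>
           (\<forall>i<b. fst s' i = fst s i) \<and> snd s' = snd s"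
      using exec.intros(1)[of b e s] assms(4)
      by (intro exI[of _ 1] exI[of _ "((fst s)(b := aval e s), snd s)"]) simp
  qed (rule poly_bounded_const)
qed (use assms in auto)

lemma feasible_const: "3 \<le> a \<Longrightarrow> feasible a (\<lambda>_ _. c)"
  by (rule feasible_basic[where e="Const c"]) (auto simp: env_local_def poly_bounded_const)

lemma feasible_reg: "3 \<le> a \<Longrightarrow> i < a \<Longrightarrow> i \<noteq> 2 \<Longrightarrow> feasible a (\<lambda>_ \<rho>. \<rho> i)"
  by (rule feasible_basic[where e="Reg i"]) (auto simp: env_local_def poly_bounded_reg)

lemma feasible_param: "3 \<le> a \<Longrightarrow> feasible a (\<lambda>I _. snd I)"
  by (rule feasible_basic[where e="Reg 0"])
     (auto simp: env_local_def holds_def intro!: poly_boundedI[where D=1] reg_le_bnd)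

lemma feasible_length: "3 \<le> a \<Longrightarrow> feasible a (\<lambda>I _. length (fst I))"
proof (rule feasible_basic[where e="Reg 1"])
  assume "3 \<le> a"
  then have "\<rho> 1 \<le> bnd a \<rho>" for \<rho> by (intro reg_le_bnd) auto
  then show "poly_bounded a (\<lambda>I _. length (fst I))" by (intro poly_boundedI[where D=1]) (metis fst_conv power_one_right)
qed (auto simp: env_local_def holds_def)

text \<open>\<open>f\<close> goes to register \<open>b\<close> and \<open>g\<close> to
  \<open>b + 1\<close>, which leaves \<open>b\<close> untouched; one assignment combines them.
  \<open>H'\<close> also sees the input string, which covers array access, and its linear bound
  keeps the result polynomially bounded.\<close>

lemma feasible_op:
  assumes f: "feasible a f" and g: "feasible a g"
    and e: "\<And>b s x k. holds x k s \<Longrightarrow> 3 \<le> b \<Longrightarrow> aval (e b) s = H' x (fst s b) (fst s (Suc b))"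
    and H': "\<And>x y z. H' x y z \<le> y + z + d"
  shows "feasible a (\<lambda>I \<rho>. H' (fst I) (f I \<rho>) (g I \<rho>))"
proof -
  note a3 = feasible_ge_3[OF f]
  have "env_local a (\<lambda>I \<rho>. H' (fst I) (f I \<rho>) (g I \<rho>))"
    unfolding env_local_def
  proof (intro allI impI)
    fix I :: input and \<rho> \<rho>' :: "nat \<Rightarrow> nat" assume "\<forall>i<a. i \<noteq> 2 \<longrightarrow> \<rho> i = \<rho>' i"
    then have "f I \<rho> = f I \<rho>'" "g I \<rho> = g I \<rho>'"
      using feasible_local[OF f] feasible_local[OF g] by blast+
    then show "H' (fst I) (f I \<rho>) (g I \<rho>) = H' (fst I) (f I \<rho>') (g I \<rho>')" by simp
  qed
  moreover have "poly_bounded a (\<lambda>I \<rho>. H' (fst I) (f I \<rho>) (g I \<rho>))"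
    by (rule poly_bounded_mono[where F="\<lambda>I \<rho>. f I \<rho> + g I \<rho> + d" and b=a])
       (use H' in \<open>auto intro!: poly_bounded_add poly_bounded_const feasible_poly_bounded[OF f]
          feasible_poly_bounded[OF g]\<close>)
  moreover have "\<exists>p c. poly_bounded b c \<and> (\<forall>x k s. holds x k s \<longrightarrow>
        (\<exists>n s'. exec p s n s' \<and> n \<le> c (x, k) (fst s) \<and> fst s' b = H' x (f (x, k) (fst s)) (g (x, k) (fst s)) \<and>
           (\<forall>i<b. fst s' i = fst s i) \<and> snd s' = snd s))" if ab: "a \<le> b" for b
  proof -
    obtain p c where c: "poly_bounded b c" and
      p: "\<And>x k s. holds x k s \<Longrightarrow>
        \<exists>n s'. exec p s n s' \<and> n \<le> c (x, k) (fst s) \<and> fst s' b = f (x, k) (fst s) \<and>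
           (\<forall>i<b. fst s' i = fst s i) \<and> snd s' = snd s" by (rule feasible_prog[OF f ab]) (rule that)
    obtain q cq where d: "poly_bounded (Suc b) cq" and
      q: "\<And>x k s. holds x k s \<Longrightarrow>
        \<exists>n s'. exec q s n s' \<and> n \<le> cq (x, k) (fst s) \<and> fst s' (Suc b) = g (x, k) (fst s) \<and>
           (\<forall>i<Suc b. fst s' i = fst s i) \<and> snd s' = snd s" by (rule feasible_prog[OF g le_SucI[OF ab]]) (rule that)
    obtain D where D: "\<And>x k \<rho>. \<rho> 0 = k \<Longrightarrow> \<rho> 1 = length x \<Longrightarrow> cq (x, k) \<rho> \<le> bnd (Suc b) \<rho> ^ D"
      using d unfolding poly_bounded_def by blast
    show ?thesis
    proof (intro exI[of _ "Seq p (Seq q (Assign b (e b)))"]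
        exI[of _ "\<lambda>I \<rho>. c I \<rho> + (bnd (Suc b) (\<rho>(b := f I \<rho>)) ^ D + 1)"] conjI allI impI)
      show "poly_bounded b (\<lambda>I \<rho>. c I \<rho> + (bnd (Suc b) (\<rho>(b := f I \<rho>)) ^ D + 1))"
        using a3 ab poly_bounded_upd[OF poly_bounded_power[OF poly_bounded_bnd] feasible_poly_bounded[OF f ab], of D]
        by (intro poly_bounded_add poly_bounded_const c) auto
      fix x k s assume s: "holds x k s"
      obtain n1 s1 where 1: "exec p s n1 s1" "n1 \<le> c (x, k) (fst s)" "fst s1 b = f (x, k) (fst s)"
        "\<forall>i<b. fst s1 i = fst s i" "snd s1 = snd s" using p[OF s] by blast
      have s1: "holds x k s1" using holds_cong[OF s 1(4,5)] a3 ab by simp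
      obtain n2 s2 where 2: "exec q s1 n2 s2" "n2 \<le> cq (x, k) (fst s1)" "fst s2 (Suc b) = g (x, k) (fst s1)"
        "\<forall>i<Suc b. fst s2 i = fst s1 i" "snd s2 = snd s1" using q[OF s1] by blast
      have s2: "holds x k s2" using holds_cong[OF s1 2(4,5)] a3 ab by simp
      have "n2 \<le> bnd (Suc b) ((fst s)(b := f (x, k) (fst s))) ^ D"
        using 2(2) D[of "fst s1" k x] s1 1(3,4) bnd_cong[of "Suc b" "fst s1" "(fst s)(b := f (x, k) (fst s))"] a3 ab
        by (auto simp: holds_def less_Suc_eq)
      then have 3: "n1 + (n2 + 1) \<le> c (x, k) (fst s) + (bnd (Suc b) ((fst s)(b := f (x, k) (fst s))) ^ D + 1)"
        using 1(2) by simp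
      define s3 where "s3 = ((fst s2)(b := aval (e b) s2), snd s2)"
      have 4: "exec (Seq p (Seq q (Assign b (e b)))) s (n1 + (n2 + 1)) s3"
        unfolding s3_def by (rule exec.intros(3)[OF 1(1) exec.intros(3)[OF 2(1) exec.intros(1)]])
      have "g (x, k) (fst s1) = g (x, k) (fst s)"
        using 1(4) ab by (intro feasible_local[OF g]) auto
      then have "fst s3 b = H' x (f (x, k) (fst s)) (g (x, k) (fst s))"
        using e[OF s2, of b] a3 ab 2(3,4) 1(3) by (simp add: s3_def)
      moreover have "\<forall>i<b. fst s3 i = fst s i" "snd s3 = snd s"
        using 1(4,5) 2(4,5) by (auto simp: s3_def)
      ultimately show "\<exists>n s'. exec (Seq p (Seq q (Assign b (e b)))) s n s' \<and>
          n \<le> c (x, k) (fst s) + (bnd (Suc b) ((fst s)(b := f (x, k) (fst s))) ^ D + 1) \<and>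
          fst s' b = H' x (f (x, k) (fst s)) (g (x, k) (fst s)) \<and>
          (\<forall>i<b. fst s' i = fst s i) \<and> snd s' = snd s"
        using 3 4 by blast
    qed
  qed
  ultimately show ?thesis using a3 unfolding feasible_def by simp
qed

text \<open>A counting loop: \<open>b\<close> holds the number of rounds, \<open>b + 1\<close> the
  accumulator, \<open>b + 2\<close> the counter and \<open>b + 3\<close> the new value. The bound
  \<open>M\<close> on all intermediate values has to be supplied, since iterating a polynomially
  bounded step may grow exponentially. The step is a map on feasible functions, so its bound
  variables can be instantiated by registers as well as by constants.\<close>

lemma feasible_rec:
  assumes u: "feasible a u" and z: "feasible a z"
    and st: "\<And>v w b. a \<le> b \<Longrightarrow> feasible b v \<Longrightarrow> feasible b w \<Longrightarrow> feasible b (\<lambda>I \<rho>. st I \<rho> (v I \<rho>) (w I \<rho>))"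
    and M: "poly_bounded a M"
      "\<And>x k \<rho> i. \<rho> 0 = k \<Longrightarrow> \<rho> 1 = length x \<Longrightarrow> i \<le> u (x, k) \<rho> \<Longrightarrow>
         rec_nat (z (x, k) \<rho>) (st (x, k) \<rho>) i \<le> M (x, k) \<rho>"
  shows "feasible a (\<lambda>I \<rho>. rec_nat (z I \<rho>) (st I \<rho>) (u I \<rho>))"
proof -
  note a3 = feasible_ge_3[OF u]
  let ?f = "\<lambda>I \<rho>. rec_nat (z I \<rho>) (st I \<rho>) (u I \<rho>)"
  \<comment> \<open>Plugging in constant functions yields locality of the step for fixed
    arguments.\<close>
  have st_local: "st I \<rho> i r = st I \<rho>' i r" if "\<And>i. i < a \<Longrightarrow> i \<noteq> 2 \<Longrightarrow> \<rho> i = \<rho>' i" for I \<rho> \<rho>' i r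
    by (rule feasible_local[OF st[OF le_refl feasible_const[OF a3, of i] feasible_const[OF a3, of r]]]) (rule that)
  have "env_local a ?f"
    unfolding env_local_def
  proof (intro allI impI)
    fix I :: input and \<rho> \<rho>' :: "nat \<Rightarrow> nat" assume "\<forall>i<a. i \<noteq> 2 \<longrightarrow> \<rho> i = \<rho>' i"
    then have "u I \<rho> = u I \<rho>'" "z I \<rho> = z I \<rho>'" "st I \<rho> = st I \<rho>'"
      using feasible_local[OF u] feasible_local[OF z] st_local by blast+
    then show "?f I \<rho> = ?f I \<rho>'" by simp
  qed
  moreover have "poly_bounded a ?f"
    by (rule poly_bounded_mono[OF M(1) le_refl]) (use M(2) in auto)
  moreover have "\<exists>p c. poly_bounded b c \<and> (\<forall>x k s. holds x k s \<longrightarrow>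
        (\<exists>n s'. exec p s n s' \<and> n \<le> c (x, k) (fst s) \<and> fst s' b = ?f (x, k) (fst s) \<and>
           (\<forall>i<b. fst s' i = fst s i) \<and> snd s' = snd s))" if ab: "a \<le> b" for b
  proof -
    have b3: "3 \<le> b" using a3 ab by simp
    obtain p c where c: "poly_bounded b c" and
      p: "\<And>x k s. holds x k s \<Longrightarrow>
        \<exists>n s'. exec p s n s' \<and> n \<le> c (x, k) (fst s) \<and> fst s' b = u (x, k) (fst s) \<and>
           (\<forall>i<b. fst s' i = fst s i) \<and> snd s' = snd s" by (rule feasible_prog[OF u ab]) (rule that)
    obtain q cq where cq: "poly_bounded (Suc b) cq" and
      q: "\<And>x k s. holds x k s \<Longrightarrow>
        \<exists>n s'. exec q s n s' \<and> n \<le> cq (x, k) (fst s) \<and> fst s' (Suc b) = z (x, k) (fst s) \<and>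
           (\<forall>i<Suc b. fst s' i = fst s i) \<and> snd s' = snd s" by (rule feasible_prog[OF z le_SucI[OF ab]]) (rule that)
    have fst': "feasible (b + 3) (\<lambda>I \<rho>. st I \<rho> (\<rho> (b + 2)) (\<rho> (b + 1)))"
      by (intro st feasible_reg) (use ab b3 in auto)
    obtain r cr where cr: "poly_bounded (b + 3) cr" and
      r: "\<And>x k s. holds x k s \<Longrightarrow>
        \<exists>n s'. exec r s n s' \<and> n \<le> cr (x, k) (fst s) \<and> fst s' (b + 3) = st (x, k) (fst s) (fst s (b + 2)) (fst s (b + 1)) \<and>
           (\<forall>i<b + 3. fst s' i = fst s i) \<and> snd s' = snd s" by (rule feasible_prog[OF fst' le_refl]) (rule that)
    obtain D where D: "\<And>x k \<rho>. \<rho> 0 = k \<Longrightarrow> \<rho> 1 = length x \<Longrightarrow> cq (x, k) \<rho> \<le> bnd (Suc b) \<rho> ^ D"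
      using cq unfolding poly_bounded_def by blast
    obtain E where E: "\<And>x k \<rho>. \<rho> 0 = k \<Longrightarrow> \<rho> 1 = length x \<Longrightarrow> cr (x, k) \<rho> \<le> bnd (b + 3) \<rho> ^ E"
      using cr unfolding poly_bounded_def by blast
    \<comment> \<open>Bound for one round: in \<open>bnd (b + 3)\<close> the limit, the accumulator
      and the counter contribute at most \<open>u\<close>, \<open>M\<close> and
      \<open>u\<close>.\<close>
    define T where "T I \<rho> = (bnd b \<rho> + 2 ^ \<rho> 0 * (u I \<rho> + M I \<rho> + u I \<rho>)) ^ E" for I \<rho>
    have T: "poly_bounded b T"
      unfolding T_def
      by (intro poly_bounded_power poly_bounded_add poly_bounded_mult poly_bounded_bnd poly_bounded_pow
            feasible_poly_bounded[OF u ab] poly_bounded_mono[OF M(1) ab]) auto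
    let ?body = "Seq r (Seq (Assign (b + 1) (Reg (b + 3))) (Assign (b + 2) (Plus (Reg (b + 2)) (Const 1))))"
    let ?loop = "While (Minus (Reg b) (Reg (b + 2))) ?body"
    let ?prog = "Seq p (Seq q (Seq (Assign (b + 2) (Const 0)) (Seq ?loop (Assign b (Reg (b + 1))))))"
    show ?thesis
    proof (intro exI[of _ ?prog] exI[of _ "\<lambda>I \<rho>. c I \<rho> + (bnd (Suc b) (\<rho>(b := u I \<rho>)) ^ D + (1 + (u I \<rho> * (T I \<rho> + 3) + 1 + 1)))"] conjI allI impI)
      show "poly_bounded b (\<lambda>I \<rho>. c I \<rho> + (bnd (Suc b) (\<rho>(b := u I \<rho>)) ^ D + (1 + (u I \<rho> * (T I \<rho> + 3) + 1 + 1))))"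
        using b3 ab poly_bounded_upd[OF poly_bounded_power[OF poly_bounded_bnd] feasible_poly_bounded[OF u ab], of D]
        by (intro poly_bounded_add poly_bounded_mult poly_bounded_const c T feasible_poly_bounded[OF u]) auto
      fix x k s assume s: "holds x k s"
      have k: "fst s 0 = k" "fst s 1 = length x" using s by (auto simp: holds_def)
      let ?u = "u (x, k) (fst s)" let ?r = "rec_nat (z (x, k) (fst s)) (st (x, k) (fst s))"
      obtain n1 s1 where 1: "exec p s n1 s1" "n1 \<le> c (x, k) (fst s)" "fst s1 b = ?u"
        "\<forall>i<b. fst s1 i = fst s i" "snd s1 = snd s" using p[OF s] by blast
      have s1: "holds x k s1" using holds_cong[OF s 1(4,5)] b3 by simp
      obtain n2 s2 where 2: "exec q s1 n2 s2" "n2 \<le> cq (x, k) (fst s1)" "fst s2 (Suc b) = z (x, k) (fst s1)"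
        "\<forall>i<Suc b. fst s2 i = fst s1 i" "snd s2 = snd s1" using q[OF s1] by blast
      have n2: "n2 \<le> bnd (Suc b) ((fst s)(b := ?u)) ^ D"
        using 2(2) D[of "fst s1" k x] s1 1(3,4) bnd_cong[of "Suc b" "fst s1" "(fst s)(b := ?u)"] b3
        by (auto simp: holds_def less_Suc_eq)
      have z1: "z (x, k) (fst s1) = z (x, k) (fst s)"
        using 1(4) ab by (intro feasible_local[OF z]) auto
      define s3 where "s3 = ((fst s2)(b + 2 := 0), snd s2)"
      have 3: "exec (Assign (b + 2) (Const 0)) s2 1 s3"
        using exec.intros(1)[of "b + 2" "Const 0" s2] by (simp add: s3_def)
      define Inv where "Inv i s' \<longleftrightarrow> (\<forall>j<b. fst s' j = fst s j) \<and> snd s' = snd s \<and> fst s' b = ?u \<and>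
        fst s' (b + 1) = ?r i \<and> fst s' (b + 2) = i" for i s'
      have "\<exists>m s'. exec ?loop s3 m s' \<and> m \<le> ?u * ((T (x, k) (fst s) + 2) + 1) + 1 \<and> Inv ?u s'"
      proof (rule exec_while_count)
        show "Inv 0 s3" using 1 2 z1 by (auto simp: Inv_def s3_def)
        show "aval (Minus (Reg b) (Reg (b + 2))) s' = 0" if "Inv ?u s'" for s'
          using that by (simp add: Inv_def)
        fix i s' assume i: "i < ?u" and I: "Inv i s'"
        have h: "holds x k s'" using I holds_cong[OF s, of b s'] b3 by (simp add: Inv_def)
        obtain n4 s4 where 4: "exec r s' n4 s4" "n4 \<le> cr (x, k) (fst s')"
          "fst s4 (b + 3) = st (x, k) (fst s') (fst s' (b + 2)) (fst s' (b + 1))"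
          "\<forall>i<b + 3. fst s4 i = fst s' i" "snd s4 = snd s'" using r[OF h] by blast
        have "st (x, k) (fst s') = st (x, k) (fst s)"
          using I ab by (intro ext st_local) (auto simp: Inv_def)
        with 4(3) I have s4v: "fst s4 (b + 3) = ?r (Suc i)" by (simp add: Inv_def)
        have "bnd (b + 3) (fst s') = bnd b (fst s') + 2 ^ fst s' 0 * (fst s' b + fst s' (b + 1) + fst s' (b + 2))"
          using b3 by (simp add: bnd_Suc numeral_3_eq_3 distrib_left)
        also have "\<dots> = bnd b (fst s) + 2 ^ fst s 0 * (?u + ?r i + i)"
          using I b3 bnd_cong[of b "fst s'" "fst s"] by (simp add: Inv_def)
        also have "\<dots> \<le> bnd b (fst s) + 2 ^ fst s 0 * (?u + M (x, k) (fst s) + ?u)"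
          using i M(2)[OF k, of i] by (intro add_left_mono mult_le_mono2 add_mono) auto
        finally have "n4 \<le> T (x, k) (fst s)"
          unfolding T_def using 4(2) E[of "fst s'" k x] h by (meson holds_def le_trans power_mono zero_le)
        moreover define s5 where "s5 = ((fst s4)(b + 1 := fst s4 (b + 3)), snd s4)"
        have 5: "exec (Assign (b + 1) (Reg (b + 3))) s4 1 s5"
          using exec.intros(1)[of "b + 1" "Reg (b + 3)" s4] by (simp add: s5_def)
        moreover define s6 where "s6 = ((fst s5)(b + 2 := Suc (fst s5 (b + 2))), snd s5)"
        have 6: "exec (Assign (b + 2) (Plus (Reg (b + 2)) (Const 1))) s5 1 s6"
          using exec.intros(1)[of "b + 2" "Plus (Reg (b + 2)) (Const 1)" s5] by (simp add: s6_def)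
        moreover have "exec ?body s' (n4 + (1 + 1)) s6" by (rule exec.intros(3)[OF 4(1) exec.intros(3)[OF 5 6]])
        moreover have "Inv (Suc i) s6"
          using I 4(4,5) s4v by (auto simp: Inv_def s6_def s5_def)
        ultimately show "aval (Minus (Reg b) (Reg (b + 2))) s' \<noteq> 0 \<and>
            (\<exists>m s''. exec ?body s' m s'' \<and> m \<le> T (x, k) (fst s) + 2 \<and> Inv (Suc i) s'')"
          using i I by (intro conjI exI[of _ "n4 + (1 + 1)"] exI[of _ s6]) (auto simp: Inv_def)
      qed
      then obtain n7 s7 where 7: "exec ?loop s3 n7 s7" "n7 \<le> ?u * ((T (x, k) (fst s) + 2) + 1) + 1" "Inv ?u s7"
        by blast
      define s8 where "s8 = ((fst s7)(b := fst s7 (b + 1)), snd s7)"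
      have 8: "exec (Assign b (Reg (b + 1))) s7 1 s8"
        using exec.intros(1)[of b "Reg (b + 1)" s7] by (simp add: s8_def)
      show "\<exists>n s'. exec ?prog s n s' \<and>
          n \<le> c (x, k) (fst s) + (bnd (Suc b) ((fst s)(b := ?u)) ^ D + (1 + (?u * (T (x, k) (fst s) + 3) + 1 + 1))) \<and>
          fst s' b = ?f (x, k) (fst s) \<and> (\<forall>i<b. fst s' i = fst s i) \<and> snd s' = snd s"
      proof (intro exI conjI)
        show "exec ?prog s (n1 + (n2 + (1 + (n7 + 1)))) s8"
          by (rule exec.intros(3)[OF 1(1) exec.intros(3)[OF 2(1) exec.intros(3)[OF 3 exec.intros(3)[OF 7(1) 8]]]])
        show "n1 + (n2 + (1 + (n7 + 1))) \<le> c (x, k) (fst s) + (bnd (Suc b) ((fst s)(b := ?u)) ^ D + (1 + (?u * (T (x, k) (fst s) + 3) + 1 + 1)))"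
          using 1(2) n2 7(2) by (simp add: algebra_simps)
      qed (use 7(3) in \<open>auto simp: Inv_def s8_def\<close>)
    qed
  qed
  ultimately show ?thesis using a3 unfolding feasible_def by simp
qed

lemma feasible_bin:
  assumes "feasible a f" "feasible a g" "\<And>b s. aval (e b) s = H (fst s b) (fst s (Suc b))" "\<And>y z. H y z \<le> y + z + d"
  shows "feasible a (\<lambda>I \<rho>. H (f I \<rho>) (g I \<rho>))"
  using feasible_op[of a f g e "\<lambda>_. H" d] assms by simp

lemma feasible_add: "feasible a f \<Longrightarrow> feasible a g \<Longrightarrow> feasible a (\<lambda>I \<rho>. f I \<rho> + g I \<rho>)"
  by (rule feasible_bin[where H="\<lambda>x y. x + y" and e="\<lambda>b. Plus (Reg b) (Reg (Suc b))" and d=0]) auto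

lemma feasible_diff: "feasible a f \<Longrightarrow> feasible a g \<Longrightarrow> feasible a (\<lambda>I \<rho>. f I \<rho> - g I \<rho>)"
  by (rule feasible_bin[where H="\<lambda>x y. x - y" and e="\<lambda>b. Minus (Reg b) (Reg (Suc b))" and d=0]) auto

definition feasibleP :: "nat \<Rightarrow> bool envfun \<Rightarrow> bool" where
  "feasibleP a P \<longleftrightarrow> feasible a (\<lambda>I \<rho>. of_bool (P I \<rho>))"

text \<open>Truncated subtraction decides comparisons: \<open>1 - d\<close> is 1 iff
  \<open>d = 0\<close>, and \<open>1 - (1 - d)\<close> is 1 iff \<open>d > 0\<close>.\<close>

lemma feasibleP_less: "feasible a f \<Longrightarrow> feasible a g \<Longrightarrow> feasibleP a (\<lambda>I \<rho>. f I \<rho> < g I \<rho>)"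
  unfolding feasibleP_def
  by (rule feasible_bin[where H="\<lambda>x y. of_bool (x < y)" and e="\<lambda>b. Minus (Const 1) (Minus (Const 1) (Minus (Reg (Suc b)) (Reg b)))" and d=1]) auto

lemma feasibleP_le: "feasible a f \<Longrightarrow> feasible a g \<Longrightarrow> feasibleP a (\<lambda>I \<rho>. f I \<rho> \<le> g I \<rho>)"
  unfolding feasibleP_def
  by (rule feasible_bin[where H="\<lambda>x y. of_bool (x \<le> y)" and e="\<lambda>b. Minus (Const 1) (Minus (Reg b) (Reg (Suc b)))" and d=1]) auto

lemma feasibleP_eq: "feasible a f \<Longrightarrow> feasible a g \<Longrightarrow> feasibleP a (\<lambda>I \<rho>. f I \<rho> = g I \<rho>)"
  unfolding feasibleP_def
  by (rule feasible_bin[where H="\<lambda>x y. of_bool (x = y)" and e="\<lambda>b. Minus (Const 1) (Plus (Minus (Reg b) (Reg (Suc b))) (Minus (Reg (Suc b)) (Reg b)))" and d=1]) auto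

lemma feasibleP_not: "feasibleP a P \<Longrightarrow> feasibleP a (\<lambda>I \<rho>. \<not> P I \<rho>)"
proof -
  assume P: "feasibleP a P"
  have eq: "of_bool (\<not> P I \<rho>) = (1 - of_bool (P I \<rho>) :: nat)" for I \<rho> by auto
  show ?thesis
    unfolding feasibleP_def eq using P[unfolded feasibleP_def]
    by (intro feasible_diff feasible_const) (auto dest: feasible_ge_3)
qed

lemma feasibleP_conj: "feasibleP a P \<Longrightarrow> feasibleP a Q \<Longrightarrow> feasibleP a (\<lambda>I \<rho>. P I \<rho> \<and> Q I \<rho>)"
proof -
  assume PQ: "feasibleP a P" "feasibleP a Q"
  have eq: "of_bool (P I \<rho> \<and> Q I \<rho>) = (of_bool (P I \<rho>) - (1 - of_bool (Q I \<rho>)) :: nat)" for I \<rho> by auto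
  show ?thesis
    unfolding feasibleP_def eq using PQ[unfolded feasibleP_def]
    by (intro feasible_diff feasible_const) (auto dest: feasible_ge_3)
qed

lemma feasibleP_disj: "feasibleP a P \<Longrightarrow> feasibleP a Q \<Longrightarrow> feasibleP a (\<lambda>I \<rho>. P I \<rho> \<or> Q I \<rho>)"
proof -
  assume "feasibleP a P" "feasibleP a Q"
  then have "feasibleP a (\<lambda>I \<rho>. \<not> (\<not> P I \<rho> \<and> \<not> Q I \<rho>))" by (intro feasibleP_not feasibleP_conj)
  then show ?thesis by simp
qed

lemma feasibleP_imp: "feasibleP a P \<Longrightarrow> feasibleP a Q \<Longrightarrow> feasibleP a (\<lambda>I \<rho>. P I \<rho> \<longrightarrow> Q I \<rho>)"
  unfolding imp_conv_disj by (intro feasibleP_disj feasibleP_not)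

lemma feasibleP_const: "3 \<le> a \<Longrightarrow> feasibleP a (\<lambda>_ _. P)"
  unfolding feasibleP_def by (rule feasible_const)

text \<open>Multiplication, bounded quantifiers, division and the parser are all bounded sums. The
  terms have a common bound because evaluating \<open>t\<close> at some \<open>i \<le> u\<close>
  amounts to placing \<open>i\<close> in the fresh register \<open>a\<close>.\<close>

lemma feasible_sum:
  assumes u: "feasible a u"
    and t: "\<And>v b. a \<le> b \<Longrightarrow> feasible b v \<Longrightarrow> feasible b (\<lambda>I \<rho>. t I \<rho> (v I \<rho>))"
  shows "feasible a (\<lambda>I \<rho>. \<Sum>i<u I \<rho>. t I \<rho> i)"
proof -
  note a3 = feasible_ge_3[OF u]
  have eq: "(\<Sum>i<n. t I \<rho> i) = rec_nat 0 (\<lambda>i r. r + t I \<rho> i) n" for I \<rho> n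
    by (induction n) auto
  have tl: "t I \<rho> i = t I \<rho>' i" if "\<And>i. i < a \<Longrightarrow> i \<noteq> 2 \<Longrightarrow> \<rho> i = \<rho>' i" for I \<rho> \<rho>' i
    by (rule feasible_local[OF t[OF le_refl feasible_const[OF a3, of i]]]) (rule that)
  have "feasible (Suc a) (\<lambda>I \<rho>. t I \<rho> (\<rho> a))"
    by (intro t feasible_reg) (use a3 in auto)
  then have "poly_bounded (Suc a) (\<lambda>I \<rho>. t I \<rho> (\<rho> a))" by (rule feasible_poly_bounded) simp
  then obtain D where D: "\<And>x k \<rho>. \<rho> 0 = k \<Longrightarrow> \<rho> 1 = length x \<Longrightarrow> t (x, k) \<rho> (\<rho> a) \<le> bnd (Suc a) \<rho> ^ D"
    unfolding poly_bounded_def by blast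
  define T where "T I \<rho> = (bnd a \<rho> + 2 ^ \<rho> 0 * u I \<rho>) ^ D" for I \<rho>
  have T: "t (x, k) \<rho> i \<le> T (x, k) \<rho>" if "\<rho> 0 = k" "\<rho> 1 = length x" "i \<le> u (x, k) \<rho>" for x k \<rho> i
  proof -
    have "t (x, k) \<rho> i = t (x, k) (\<rho>(a := i)) i" by (rule tl) simp
    also have "\<dots> \<le> bnd (Suc a) (\<rho>(a := i)) ^ D"
      using D[of "\<rho>(a := i)" k x] that a3 by simp
    also have "bnd (Suc a) (\<rho>(a := i)) = bnd a \<rho> + 2 ^ \<rho> 0 * i"
      using a3 bnd_cong[of a "\<rho>(a := i)" \<rho>] by (simp add: bnd_Suc)
    also have "(bnd a \<rho> + 2 ^ \<rho> 0 * i) ^ D \<le> T (x, k) \<rho>"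
      unfolding T_def using that(3) by (intro power_mono add_left_mono mult_le_mono2) auto
    finally show ?thesis .
  qed
  show ?thesis
    unfolding eq
  proof (rule feasible_rec[where M="\<lambda>I \<rho>. u I \<rho> * T I \<rho>"])
    show "poly_bounded a (\<lambda>I \<rho>. u I \<rho> * T I \<rho>)"
      unfolding T_def
      by (intro poly_bounded_power poly_bounded_add poly_bounded_mult poly_bounded_bnd poly_bounded_pow
            feasible_poly_bounded[OF u le_refl])
    fix x :: "bool list" and k \<rho> i assume *: "\<rho> 0 = k" "\<rho> (1::nat) = length x" "i \<le> u (x, k) \<rho>"
    have "(\<Sum>j<i. t (x, k) \<rho> j) \<le> (\<Sum>j<i. T (x, k) \<rho>)"
      by (intro sum_mono T) (use * in auto)
    also have "\<dots> \<le> u (x, k) \<rho> * T (x, k) \<rho>" using *(3) by simp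
    finally show "rec_nat 0 (\<lambda>i r. r + t (x, k) \<rho> i) i \<le> u (x, k) \<rho> * T (x, k) \<rho>" by (simp add: eq)
  qed (use a3 in \<open>auto intro: u feasible_const feasible_add t\<close>)
qed

lemma feasible_mult: "feasible a f \<Longrightarrow> feasible a g \<Longrightarrow> feasible a (\<lambda>I \<rho>. f I \<rho> * g I \<rho>)"
  using feasible_sum[of a f "\<lambda>I \<rho> _. g I \<rho>"] feasible_mono[of a g] by simp

lemma feasible_power: "feasible a f \<Longrightarrow> feasible a (\<lambda>I \<rho>. f I \<rho> ^ n)"
  by (induction n) (auto intro: feasible_mult feasible_const feasible_ge_3)

lemma feasible_pow2: "3 \<le> a \<Longrightarrow> feasible a (\<lambda>I _. 2 ^ snd I)"
proof -
  assume a: "3 \<le> a"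
  have eq: "(2::nat) ^ n = rec_nat 1 (\<lambda>_ r. r + r) n" for n :: nat by (induction n) (auto simp: mult_2)
  show ?thesis
    unfolding eq
  proof (rule feasible_rec[where M="\<lambda>I \<rho>. 2 ^ \<rho> 0"])
    fix i k :: nat and \<rho> :: "nat \<Rightarrow> nat" and x :: "bool list" assume "\<rho> 0 = k" "i \<le> snd (x, k)"
    then have "(2::nat) ^ i \<le> 2 ^ \<rho> 0" by (intro power_increasing) auto
    then show "rec_nat 1 (\<lambda>_ r. r + r) i \<le> (2::nat) ^ \<rho> 0" unfolding eq[symmetric] .
  qed (use a in \<open>auto intro: feasible_param feasible_const feasible_add poly_bounded_pow\<close>)
qed

lemma feasible_if: "feasibleP a P \<Longrightarrow> feasible a f \<Longrightarrow> feasible a g \<Longrightarrow> feasible a (\<lambda>I \<rho>. if P I \<rho> then f I \<rho> else g I \<rho>)"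
proof -
  assume *: "feasibleP a P" "feasible a f" "feasible a g"
  have eq: "(if P I \<rho> then f I \<rho> else g I \<rho>) = of_bool (P I \<rho>) * f I \<rho> + (1 - of_bool (P I \<rho>)) * g I \<rho>" for I \<rho>
    by auto
  show ?thesis
    unfolding eq using * feasible_ge_3
    by (intro feasible_add feasible_mult feasible_diff feasible_const) (auto simp: feasibleP_def)
qed

lemma feasibleP_ex:
  assumes u: "feasible a u" and P: "\<And>v b. a \<le> b \<Longrightarrow> feasible b v \<Longrightarrow> feasibleP b (\<lambda>I \<rho>. P I \<rho> (v I \<rho>))"
  shows "feasibleP a (\<lambda>I \<rho>. \<exists>i<u I \<rho>. P I \<rho> i)"
proof -
  have eq: "(\<exists>i<n. P I \<rho> i) \<longleftrightarrow> 0 < (\<Sum>i<n. of_bool (P I \<rho> i) :: nat)" for I \<rho> n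
    by (simp add: sum_eq_0_iff zero_less_iff_neq_zero) blast
  show ?thesis
    unfolding eq using P feasible_ge_3[OF u]
    by (intro feasibleP_less feasible_const feasible_sum u) (auto simp: feasibleP_def)
qed

lemma feasibleP_all:
  assumes u: "feasible a u" and P: "\<And>v b. a \<le> b \<Longrightarrow> feasible b v \<Longrightarrow> feasibleP b (\<lambda>I \<rho>. P I \<rho> (v I \<rho>))"
  shows "feasibleP a (\<lambda>I \<rho>. \<forall>i<u I \<rho>. P I \<rho> i)"
  using feasibleP_not[OF feasibleP_ex[OF u feasibleP_not[OF P]]] by simp

lemma feasible_div: "feasible a f \<Longrightarrow> feasible a g \<Longrightarrow> feasible a (\<lambda>I \<rho>. f I \<rho> div g I \<rho>)"
proof -
  assume *: "feasible a f" "feasible a g"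
  \<comment> \<open>The quotient counts the positive multiples of \<open>y\<close> up to
    \<open>x\<close>; division by 0 is 0 in HOL.\<close>
  have eq: "x div y = (if y = 0 then 0 else \<Sum>i<x. of_bool ((i + 1) * y \<le> x))" for x y :: nat
  proof (cases "y = 0")
    case False
    have "i < x" if "(i + 1) * y \<le> x" for i
    proof -
      have "(i + 1) * 1 \<le> (i + 1) * y" using False by (intro mult_le_mono2) simp
      then have "i + 1 \<le> x" using that by (metis le_trans mult_1_right)
      then show ?thesis by simp
    qed
    then have "{i. i < x \<and> (i + 1) * y \<le> x} = {i. (i + 1) * y \<le> x}" by auto
    also have "\<dots> = {..<x div y}"
      using False by (auto simp: less_eq_div_iff_mult_less_eq Suc_le_eq[symmetric] simp del: mult_Suc)
    finally have "{i. i < x \<and> (i + 1) * y \<le> x} = {..<x div y}" .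
    then show ?thesis
      using False by (simp add: sum.If_cases of_bool_def Int_def)
  qed simp
  have "feasibleP b (\<lambda>I \<rho>. (v I \<rho> + 1) * g I \<rho> \<le> f I \<rho>)" if "a \<le> b" "feasible b v" for b v
    using that * feasible_ge_3[of b v]
    by (intro feasibleP_le feasible_mult feasible_add feasible_const) (auto intro: feasible_mono)
  then show ?thesis
    unfolding eq using * feasible_ge_3
    by (intro feasible_if feasible_const feasible_sum feasibleP_eq) (auto simp: feasibleP_def)
qed

lemma feasible_mod: "feasible a f \<Longrightarrow> feasible a g \<Longrightarrow> feasible a (\<lambda>I \<rho>. f I \<rho> mod g I \<rho>)"
  unfolding minus_div_mult_eq_mod[symmetric] by (intro feasible_diff feasible_mult feasible_div)

lemma feasibleP_bit: "feasible a f \<Longrightarrow> feasibleP a (\<lambda>I \<rho>. f I \<rho> < length (fst I) \<and> fst I ! f I \<rho>)"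
proof -
  assume f: "feasible a f"
  have "feasible a (\<lambda>I \<rho>. (\<lambda>x y (z::nat). string_cells x y) (fst I) (f I \<rho>) (f I \<rho>))"
    \<comment> \<open>The address \<open>b - (b - length)\<close> is the minimum of the index and
      the length. An index out of range thus reads the blank, never a cell behind it, which may
      already hold output.\<close>
    by (rule feasible_op[OF f f, where d=2 and e="\<lambda>b. Cell (Minus (Reg b) (Minus (Reg b) (Reg 1)))"])
       (auto simp: holds_def string_cells_def)
  then have "feasibleP a (\<lambda>I \<rho>. string_cells (fst I) (f I \<rho>) = 2)"
    by (intro feasibleP_eq feasible_const feasible_ge_3[OF f]) simp
  then show ?thesis by (rule back_subst[of "feasibleP a"]) (auto simp: string_cells_def fun_eq_iff)
qed

subsection \<open>Output strings\<close>

definition put :: "nat \<Rightarrow> bool list \<Rightarrow> (nat \<Rightarrow> nat) \<Rightarrow> nat \<Rightarrow> nat" where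
  "put p w A j = (if p \<le> j \<and> j < p + length w then (if w ! (j - p) then 2 else 1) else A j)"

lemma put_Nil: "put p [] A = A" by (auto simp: put_def)

lemma put_append: "put (p + length v) w (put p v A) = put p (v @ w) A"
  by (auto simp: put_def nth_append fun_eq_iff)

text \<open>Output starts behind the blank that ends the input, so the input stays readable while
  the output grows. The same \<open>c\<close> bounds time and output length, since the output is
  later moved at a cost proportional to its length.\<close>

definition emits :: "nat \<Rightarrow> bool list envfun \<Rightarrow> bool" where
  "emits a w \<longleftrightarrow> 3 \<le> a \<and> env_local a w \<and>
     (\<forall>b\<ge>a. \<exists>p c. poly_bounded b c \<and> (\<forall>x k s. holds x k s \<longrightarrow> length x < fst s 2 \<longrightarrow>
        (\<exists>n s'. exec p s n s' \<and> n \<le> c (x, k) (fst s) \<and> length (w (x, k) (fst s)) \<le> c (x, k) (fst s) \<and>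
           fst s' 2 = fst s 2 + length (w (x, k) (fst s)) \<and>
           (\<forall>i<b. i \<noteq> 2 \<longrightarrow> fst s' i = fst s i) \<and> snd s' = put (fst s 2) (w (x, k) (fst s)) (snd s))))"

lemma emits_ge_3: "emits a w \<Longrightarrow> 3 \<le> a" by (simp add: emits_def)

lemma emits_local: "emits a f \<Longrightarrow> (\<And>i. i < a \<Longrightarrow> i \<noteq> 2 \<Longrightarrow> \<rho> i = \<rho>' i) \<Longrightarrow> f I \<rho> = f I \<rho>'"
  unfolding emits_def env_local_def by blast

lemma emits_prog:
  assumes "emits a w" "a \<le> b"
  obtains p c where "poly_bounded b c"
    "\<And>x k s. holds x k s \<Longrightarrow> length x < fst s 2 \<Longrightarrow>
        \<exists>n s'. exec p s n s' \<and> n \<le> c (x, k) (fst s) \<and> length (w (x, k) (fst s)) \<le> c (x, k) (fst s) \<and>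
           fst s' 2 = fst s 2 + length (w (x, k) (fst s)) \<and>
           (\<forall>i<b. i \<noteq> 2 \<longrightarrow> fst s' i = fst s i) \<and> snd s' = put (fst s 2) (w (x, k) (fst s)) (snd s)"
  using assms unfolding emits_def by meson

lemma holds_put:
  "holds x k s \<Longrightarrow> (\<forall>i<b. i \<noteq> 2 \<longrightarrow> fst s' i = fst s i) \<Longrightarrow> snd s' = put p w (snd s) \<Longrightarrow>
   length x < p \<Longrightarrow> 3 \<le> b \<Longrightarrow> holds x k s'"
  by (auto simp: holds_def put_def)

lemma emits_single: "3 \<le> a \<Longrightarrow> emits a (\<lambda>_ _. [y])"
  unfolding emits_def
proof (intro conjI allI impI)
  fix b assume "3 \<le> a" "a \<le> b"
  let ?p = "Seq (Store (Reg 2) (Const (if y then 2 else 1))) (Assign 2 (Plus (Reg 2) (Const 1)))"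
  show "\<exists>p c. poly_bounded b c \<and> (\<forall>x k s. holds x k s \<longrightarrow> length x < fst s 2 \<longrightarrow>
        (\<exists>n s'. exec p s n s' \<and> n \<le> c (x, k) (fst s) \<and> length [y] \<le> c (x, k) (fst s) \<and>
           fst s' 2 = fst s 2 + length [y] \<and>
           (\<forall>i<b. i \<noteq> 2 \<longrightarrow> fst s' i = fst s i) \<and> snd s' = put (fst s 2) [y] (snd s)))"
  proof (intro exI[of _ ?p] exI[of _ "\<lambda>_ _. 2"] conjI allI impI poly_bounded_const)
    fix x k and s :: state
    define s1 where "s1 = (fst s, (snd s)(fst s 2 := if y then 2 else 1))"
    define s2 where "s2 = ((fst s1)(2 := fst s1 2 + 1), snd s1)"
    have "exec (Store (Reg 2) (Const (if y then 2 else 1))) s 1 s1"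
      using exec.intros(2)[of "Reg 2" "Const (if y then 2 else 1)" s] by (simp add: s1_def)
    moreover have "exec (Assign 2 (Plus (Reg 2) (Const 1))) s1 1 s2"
      using exec.intros(1)[of 2 "Plus (Reg 2) (Const 1)" s1] by (simp add: s2_def)
    ultimately have "exec ?p s (1 + 1) s2" by (rule exec.intros(3))
    then show "\<exists>n s'. exec ?p s n s' \<and> n \<le> 2 \<and> length [y] \<le> 2 \<and>
           fst s' 2 = fst s 2 + length [y] \<and>
           (\<forall>i<b. i \<noteq> 2 \<longrightarrow> fst s' i = fst s i) \<and> snd s' = put (fst s 2) [y] (snd s)"
      by (intro exI[of _ "1 + 1"] exI[of _ s2]) (auto simp: s1_def s2_def put_def)
  qed
qed (auto simp: env_local_def)

lemma emits_append:
  assumes v: "emits a v" and w: "emits a w"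
  shows "emits a (\<lambda>I \<rho>. v I \<rho> @ w I \<rho>)"
  unfolding emits_def
proof (intro conjI allI impI)
  show a3: "3 \<le> a" using v by (rule emits_ge_3)
  show "env_local a (\<lambda>I \<rho>. v I \<rho> @ w I \<rho>)"
    using v w unfolding emits_def env_local_def by metis
  fix b assume ab: "a \<le> b"
  obtain p c where c: "poly_bounded b c" and
    p: "\<And>x k s. holds x k s \<Longrightarrow> length x < fst s 2 \<Longrightarrow>
        \<exists>n s'. exec p s n s' \<and> n \<le> c (x, k) (fst s) \<and> length (v (x, k) (fst s)) \<le> c (x, k) (fst s) \<and>
           fst s' 2 = fst s 2 + length (v (x, k) (fst s)) \<and>
           (\<forall>i<b. i \<noteq> 2 \<longrightarrow> fst s' i = fst s i) \<and> snd s' = put (fst s 2) (v (x, k) (fst s)) (snd s)"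
    by (rule emits_prog[OF v ab]) (rule that)
  obtain q d where d: "poly_bounded b d" and
    q: "\<And>x k s. holds x k s \<Longrightarrow> length x < fst s 2 \<Longrightarrow>
        \<exists>n s'. exec q s n s' \<and> n \<le> d (x, k) (fst s) \<and> length (w (x, k) (fst s)) \<le> d (x, k) (fst s) \<and>
           fst s' 2 = fst s 2 + length (w (x, k) (fst s)) \<and>
           (\<forall>i<b. i \<noteq> 2 \<longrightarrow> fst s' i = fst s i) \<and> snd s' = put (fst s 2) (w (x, k) (fst s)) (snd s)"
    by (rule emits_prog[OF w ab]) (rule that)
  obtain D where D: "\<And>x k \<rho>. \<rho> 0 = k \<Longrightarrow> \<rho> 1 = length x \<Longrightarrow> d (x, k) \<rho> \<le> bnd b \<rho> ^ D"
    using d unfolding poly_bounded_def by blast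
  show "\<exists>p c. poly_bounded b c \<and> (\<forall>x k s. holds x k s \<longrightarrow> length x < fst s 2 \<longrightarrow>
        (\<exists>n s'. exec p s n s' \<and> n \<le> c (x, k) (fst s) \<and> length (v (x, k) (fst s) @ w (x, k) (fst s)) \<le> c (x, k) (fst s) \<and>
           fst s' 2 = fst s 2 + length (v (x, k) (fst s) @ w (x, k) (fst s)) \<and>
           (\<forall>i<b. i \<noteq> 2 \<longrightarrow> fst s' i = fst s i) \<and> snd s' = put (fst s 2) (v (x, k) (fst s) @ w (x, k) (fst s)) (snd s)))"
  proof (intro exI[of _ "Seq p q"] exI[of _ "\<lambda>I \<rho>. c I \<rho> + bnd b \<rho> ^ D"] conjI allI impI)
    show "poly_bounded b (\<lambda>I \<rho>. c I \<rho> + bnd b \<rho> ^ D)"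
      by (intro poly_bounded_add c poly_bounded_power poly_bounded_bnd)
    fix x k s assume s: "holds x k s" "length x < fst s 2"
    let ?v = "v (x, k) (fst s)" let ?w = "w (x, k) (fst s)"
    obtain n1 s1 where 1: "exec p s n1 s1" "n1 \<le> c (x, k) (fst s)" "length ?v \<le> c (x, k) (fst s)"
      "fst s1 2 = fst s 2 + length ?v" "\<forall>i<b. i \<noteq> 2 \<longrightarrow> fst s1 i = fst s i" "snd s1 = put (fst s 2) ?v (snd s)"
      using p[OF s] by blast
    have s1: "holds x k s1" using holds_put[OF s(1) 1(5,6) s(2)] a3 ab by simp
    have eq: "w (x, k) (fst s1) = ?w" using 1(5) ab by (intro emits_local[OF w]) auto
    obtain n2 s2 where 2: "exec q s1 n2 s2" "n2 \<le> d (x, k) (fst s1)" "length ?w \<le> d (x, k) (fst s1)"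
      "fst s2 2 = fst s1 2 + length ?w" "\<forall>i<b. i \<noteq> 2 \<longrightarrow> fst s2 i = fst s1 i" "snd s2 = put (fst s1 2) ?w (snd s1)"
      using q[OF s1] s(2) 1(4) unfolding eq by (metis trans_less_add1)
    have "d (x, k) (fst s1) \<le> bnd b (fst s1) ^ D" using D[of "fst s1" k x] s1 by (simp add: holds_def)
    also have "bnd b (fst s1) = bnd b (fst s)" using 1(5) a3 ab by (intro bnd_cong) auto
    finally have d: "d (x, k) (fst s1) \<le> bnd b (fst s) ^ D" .
    show "\<exists>n s'. exec (Seq p q) s n s' \<and> n \<le> c (x, k) (fst s) + bnd b (fst s) ^ D \<and> length (?v @ ?w) \<le> c (x, k) (fst s) + bnd b (fst s) ^ D \<and>
           fst s' 2 = fst s 2 + length (?v @ ?w) \<and>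
           (\<forall>i<b. i \<noteq> 2 \<longrightarrow> fst s' i = fst s i) \<and> snd s' = put (fst s 2) (?v @ ?w) (snd s)"
    proof (intro exI[of _ "n1 + n2"] exI[of _ s2] conjI)
      show "exec (Seq p q) s (n1 + n2) s2" by (rule exec.intros(3)[OF 1(1) 2(1)])
      show "snd s2 = put (fst s 2) (?v @ ?w) (snd s)" using 1 2 put_append[of "fst s 2" ?v ?w "snd s"] by simp
    qed (use 1 2 d in auto)
  qed
qed

lemma emits_if:
  assumes P: "feasibleP a P" and v: "emits a v" and w: "emits a w"
  shows "emits a (\<lambda>I \<rho>. if P I \<rho> then v I \<rho> else w I \<rho>)"
  unfolding emits_def
proof (intro conjI allI impI)
  have P: "feasible a (\<lambda>I \<rho>. of_bool (P I \<rho>))" using P by (simp add: feasibleP_def)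
  show a3: "3 \<le> a" using v by (rule emits_ge_3)
  show "env_local a (\<lambda>I \<rho>. if P I \<rho> then v I \<rho> else w I \<rho>)"
    unfolding env_local_def
  proof (intro allI impI)
    fix I :: input and \<rho> \<rho>' :: "nat \<Rightarrow> nat" assume *: "\<forall>i<a. i \<noteq> 2 \<longrightarrow> \<rho> i = \<rho>' i"
    then have "of_bool (P I \<rho>) = (of_bool (P I \<rho>') :: nat)" by (intro feasible_local[OF P]) auto
    moreover have "v I \<rho> = v I \<rho>'" "w I \<rho> = w I \<rho>'"
      using * by (auto intro: emits_local[OF v] emits_local[OF w])
    ultimately show "(if P I \<rho> then v I \<rho> else w I \<rho>) = (if P I \<rho>' then v I \<rho>' else w I \<rho>')" by auto
  qed
  fix b assume ab: "a \<le> b"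
  obtain r e where e: "poly_bounded b e" and
    r: "\<And>x k s. holds x k s \<Longrightarrow>
        \<exists>n s'. exec r s n s' \<and> n \<le> e (x, k) (fst s) \<and> fst s' b = of_bool (P (x, k) (fst s)) \<and>
           (\<forall>i<b. fst s' i = fst s i) \<and> snd s' = snd s"
    by (rule feasible_prog[OF P ab]) (rule that)
  obtain p c where c: "poly_bounded b c" and
    p: "\<And>x k s. holds x k s \<Longrightarrow> length x < fst s 2 \<Longrightarrow>
        \<exists>n s'. exec p s n s' \<and> n \<le> c (x, k) (fst s) \<and> length (v (x, k) (fst s)) \<le> c (x, k) (fst s) \<and>
           fst s' 2 = fst s 2 + length (v (x, k) (fst s)) \<and>
           (\<forall>i<b. i \<noteq> 2 \<longrightarrow> fst s' i = fst s i) \<and> snd s' = put (fst s 2) (v (x, k) (fst s)) (snd s)"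
    by (rule emits_prog[OF v ab]) (rule that)
  obtain q d where d: "poly_bounded b d" and
    q: "\<And>x k s. holds x k s \<Longrightarrow> length x < fst s 2 \<Longrightarrow>
        \<exists>n s'. exec q s n s' \<and> n \<le> d (x, k) (fst s) \<and> length (w (x, k) (fst s)) \<le> d (x, k) (fst s) \<and>
           fst s' 2 = fst s 2 + length (w (x, k) (fst s)) \<and>
           (\<forall>i<b. i \<noteq> 2 \<longrightarrow> fst s' i = fst s i) \<and> snd s' = put (fst s 2) (w (x, k) (fst s)) (snd s)"
    by (rule emits_prog[OF w ab]) (rule that)
  obtain C where C: "\<And>x k \<rho>. \<rho> 0 = k \<Longrightarrow> \<rho> 1 = length x \<Longrightarrow> c (x, k) \<rho> \<le> bnd b \<rho> ^ C"
    using c unfolding poly_bounded_def by blast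
  obtain D where D: "\<And>x k \<rho>. \<rho> 0 = k \<Longrightarrow> \<rho> 1 = length x \<Longrightarrow> d (x, k) \<rho> \<le> bnd b \<rho> ^ D"
    using d unfolding poly_bounded_def by blast
  let ?W = "\<lambda>I \<rho>. if P I \<rho> then v I \<rho> else w I \<rho>"
  show "\<exists>p c. poly_bounded b c \<and> (\<forall>x k s. holds x k s \<longrightarrow> length x < fst s 2 \<longrightarrow>
        (\<exists>n s'. exec p s n s' \<and> n \<le> c (x, k) (fst s) \<and> length (?W (x, k) (fst s)) \<le> c (x, k) (fst s) \<and>
           fst s' 2 = fst s 2 + length (?W (x, k) (fst s)) \<and>
           (\<forall>i<b. i \<noteq> 2 \<longrightarrow> fst s' i = fst s i) \<and> snd s' = put (fst s 2) (?W (x, k) (fst s)) (snd s)))"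
  proof (intro exI[of _ "Seq r (If (Reg b) p q)"] exI[of _ "\<lambda>I \<rho>. e I \<rho> + (bnd b \<rho> ^ C + bnd b \<rho> ^ D + 1)"] conjI allI impI)
    show "poly_bounded b (\<lambda>I \<rho>. e I \<rho> + (bnd b \<rho> ^ C + bnd b \<rho> ^ D + 1))"
      by (intro poly_bounded_add e poly_bounded_power poly_bounded_bnd poly_bounded_const)
    fix x k s assume s: "holds x k s" "length x < fst s 2"
    obtain n1 s1 where 1: "exec r s n1 s1" "n1 \<le> e (x, k) (fst s)" "fst s1 b = of_bool (P (x, k) (fst s))"
      "\<forall>i<b. fst s1 i = fst s i" "snd s1 = snd s"
      using r[OF s(1)] by blast
    have s1: "holds x k s1" using holds_cong[OF s(1) 1(4,5)] a3 ab by simp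
    have s12: "fst s1 2 = fst s 2" using 1(4) a3 ab by simp
    have veq: "v (x, k) (fst s1) = v (x, k) (fst s)" using 1(4) ab by (intro emits_local[OF v]) auto
    have weq: "w (x, k) (fst s1) = w (x, k) (fst s)" using 1(4) ab by (intro emits_local[OF w]) auto
    have beq: "bnd b (fst s1) = bnd b (fst s)" using 1(4) a3 ab by (intro bnd_cong) auto
    show "\<exists>n s'. exec (Seq r (If (Reg b) p q)) s n s' \<and> n \<le> e (x, k) (fst s) + (bnd b (fst s) ^ C + bnd b (fst s) ^ D + 1) \<and>
           length (?W (x, k) (fst s)) \<le> e (x, k) (fst s) + (bnd b (fst s) ^ C + bnd b (fst s) ^ D + 1) \<and>
           fst s' 2 = fst s 2 + length (?W (x, k) (fst s)) \<and>
           (\<forall>i<b. i \<noteq> 2 \<longrightarrow> fst s' i = fst s i) \<and> snd s' = put (fst s 2) (?W (x, k) (fst s)) (snd s)"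
    proof (cases "P (x, k) (fst s)")
      case True
      obtain n2 s2 where 2: "exec p s1 n2 s2" "n2 \<le> c (x, k) (fst s1)" "length (v (x, k) (fst s)) \<le> c (x, k) (fst s1)"
        "fst s2 2 = fst s 2 + length (v (x, k) (fst s))" "\<forall>i<b. i \<noteq> 2 \<longrightarrow> fst s2 i = fst s1 i"
        "snd s2 = put (fst s 2) (v (x, k) (fst s)) (snd s1)"
        using p[OF s1] s(2) unfolding veq s12 by blast
      have "exec (If (Reg b) p q) s1 (n2 + 1) s2" using 1(3) True 2(1) by (intro exec.intros(4)) auto
      then have "exec (Seq r (If (Reg b) p q)) s (n1 + (n2 + 1)) s2" by (rule exec.intros(3)[OF 1(1)])
      moreover have "c (x, k) (fst s1) \<le> bnd b (fst s) ^ C" using C[of "fst s1" k x] s1 beq by (simp add: holds_def)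
      ultimately show ?thesis using True 1 2
        by (intro exI[of _ "n1 + (n2 + 1)"] exI[of _ s2]) auto
    next
      case False
      obtain n2 s2 where 2: "exec q s1 n2 s2" "n2 \<le> d (x, k) (fst s1)" "length (w (x, k) (fst s)) \<le> d (x, k) (fst s1)"
        "fst s2 2 = fst s 2 + length (w (x, k) (fst s))" "\<forall>i<b. i \<noteq> 2 \<longrightarrow> fst s2 i = fst s1 i"
        "snd s2 = put (fst s 2) (w (x, k) (fst s)) (snd s1)"
        using q[OF s1] s(2) unfolding weq s12 by blast
      have "exec (If (Reg b) p q) s1 (n2 + 1) s2" using 1(3) False 2(1) by (intro exec.intros(5)) auto
      then have "exec (Seq r (If (Reg b) p q)) s (n1 + (n2 + 1)) s2" by (rule exec.intros(3)[OF 1(1)])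
      moreover have "d (x, k) (fst s1) \<le> bnd b (fst s) ^ D" using D[of "fst s1" k x] s1 beq by (simp add: holds_def)
      ultimately show ?thesis using False 1 2
        by (intro exI[of _ "n1 + (n2 + 1)"] exI[of _ s2]) auto
    qed
  qed
qed

text \<open>The body may change register 2, but the limit, the counter and all registers it reads
  stay fixed, and \<open>bnd\<close> ignores register 2. So the cost of a round is independent of
  how much has been written.\<close>

lemma emits_for:
  assumes u: "feasible a u"
    and w: "\<And>v b. a \<le> b \<Longrightarrow> feasible b v \<Longrightarrow> emits b (\<lambda>I \<rho>. w I \<rho> (v I \<rho>))"
  shows "emits a (\<lambda>I \<rho>. concat (map (w I \<rho>) [0..<u I \<rho>]))"
  unfolding emits_def
proof (intro conjI allI impI)
  show a3: "3 \<le> a" using u by (rule feasible_ge_3)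
  have w_local: "w I \<rho> i = w I \<rho>' i" if "\<And>i. i < a \<Longrightarrow> i \<noteq> 2 \<Longrightarrow> \<rho> i = \<rho>' i" for I \<rho> \<rho>' i
    by (rule emits_local[OF w[OF le_refl feasible_const[OF a3, of i]]]) (rule that)
  show "env_local a (\<lambda>I \<rho>. concat (map (w I \<rho>) [0..<u I \<rho>]))"
    unfolding env_local_def
  proof (intro allI impI)
    fix I :: input and \<rho> \<rho>' :: "nat \<Rightarrow> nat" assume "\<forall>i<a. i \<noteq> 2 \<longrightarrow> \<rho> i = \<rho>' i"
    then have "u I \<rho> = u I \<rho>'" "w I \<rho> = w I \<rho>'"
      using feasible_local[OF u] w_local by blast+
    then show "concat (map (w I \<rho>) [0..<u I \<rho>]) = concat (map (w I \<rho>') [0..<u I \<rho>'])" by simp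
  qed
  fix b assume ab: "a \<le> b"
  have b3: "3 \<le> b" using a3 ab by simp
  obtain p c where c: "poly_bounded b c" and
    p: "\<And>x k s. holds x k s \<Longrightarrow>
        \<exists>n s'. exec p s n s' \<and> n \<le> c (x, k) (fst s) \<and> fst s' b = u (x, k) (fst s) \<and>
           (\<forall>i<b. fst s' i = fst s i) \<and> snd s' = snd s"
    by (rule feasible_prog[OF u ab]) (rule that)
  have "emits (b + 2) (\<lambda>I \<rho>. w I \<rho> (\<rho> (b + 1)))"
    by (intro w feasible_reg) (use ab b3 in auto)
  then obtain q d where d: "poly_bounded (b + 2) d" and
    q: "\<And>x k s. holds x k s \<Longrightarrow> length x < fst s 2 \<Longrightarrow>
        \<exists>n s'. exec q s n s' \<and> n \<le> d (x, k) (fst s) \<and> length (w (x, k) (fst s) (fst s (b + 1))) \<le> d (x, k) (fst s) \<and>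
           fst s' 2 = fst s 2 + length (w (x, k) (fst s) (fst s (b + 1))) \<and>
           (\<forall>i<b + 2. i \<noteq> 2 \<longrightarrow> fst s' i = fst s i) \<and> snd s' = put (fst s 2) (w (x, k) (fst s) (fst s (b + 1))) (snd s)"
    by (rule emits_prog[OF _ le_refl]) (rule that)
  obtain E where E: "\<And>x k \<rho>. \<rho> 0 = k \<Longrightarrow> \<rho> 1 = length x \<Longrightarrow> d (x, k) \<rho> \<le> bnd (b + 2) \<rho> ^ E"
    using d unfolding poly_bounded_def by blast
  define T where "T I \<rho> = (bnd b \<rho> + 2 ^ \<rho> 0 * (u I \<rho> + u I \<rho>)) ^ E" for I \<rho>
  have T: "poly_bounded b T"
    unfolding T_def
    by (intro poly_bounded_power poly_bounded_add poly_bounded_mult poly_bounded_bnd poly_bounded_pow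
          feasible_poly_bounded[OF u ab])
  let ?body = "Seq q (Assign (b + 1) (Plus (Reg (b + 1)) (Const 1)))"
  let ?loop = "While (Minus (Reg b) (Reg (b + 1))) ?body"
  let ?prog = "Seq p (Seq (Assign (b + 1) (Const 0)) ?loop)"
  let ?W = "\<lambda>I \<rho>. concat (map (w I \<rho>) [0..<u I \<rho>])"
  let ?C = "\<lambda>I \<rho>. c I \<rho> + (1 + (u I \<rho> * (T I \<rho> + 1 + 1) + 1))"
  show "\<exists>p c. poly_bounded b c \<and> (\<forall>x k s. holds x k s \<longrightarrow> length x < fst s 2 \<longrightarrow>
        (\<exists>n s'. exec p s n s' \<and> n \<le> c (x, k) (fst s) \<and> length (?W (x, k) (fst s)) \<le> c (x, k) (fst s) \<and>
           fst s' 2 = fst s 2 + length (?W (x, k) (fst s)) \<and>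
           (\<forall>i<b. i \<noteq> 2 \<longrightarrow> fst s' i = fst s i) \<and> snd s' = put (fst s 2) (?W (x, k) (fst s)) (snd s)))"
  proof (intro exI[of _ ?prog] exI[of _ ?C] conjI allI impI)
    show "poly_bounded b ?C"
      by (intro poly_bounded_add poly_bounded_mult poly_bounded_const c T feasible_poly_bounded[OF u ab])
    fix x k s assume s: "holds x k s" "length x < fst s 2"
    let ?u = "u (x, k) (fst s)" let ?w = "w (x, k) (fst s)" let ?T = "T (x, k) (fst s)"
    obtain n1 s1 where 1: "exec p s n1 s1" "n1 \<le> c (x, k) (fst s)" "fst s1 b = ?u"
      "\<forall>i<b. fst s1 i = fst s i" "snd s1 = snd s"
      using p[OF s(1)] by blast
    define s2 where "s2 = ((fst s1)(b + 1 := 0), snd s1)"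
    have 2: "exec (Assign (b + 1) (Const 0)) s1 1 s2"
      using exec.intros(1)[of "b + 1" "Const 0" s1] by (simp add: s2_def)
    define cc where "cc i = concat (map ?w [0..<i])" for i
    have cc: "cc (Suc i) = cc i @ ?w i" for i by (simp add: cc_def)
    define Inv where "Inv i s' \<longleftrightarrow> (\<forall>j<b. j \<noteq> 2 \<longrightarrow> fst s' j = fst s j) \<and> fst s' b = ?u \<and> fst s' (b + 1) = i \<and>
      fst s' 2 = fst s 2 + length (cc i) \<and> snd s' = put (fst s 2) (cc i) (snd s) \<and> length (cc i) \<le> i * ?T" for i s'
    have "\<exists>m s'. exec ?loop s2 m s' \<and> m \<le> ?u * ((?T + 1) + 1) + 1 \<and> Inv ?u s'"
    proof (rule exec_while_count)
      show "Inv 0 s2" using 1 b3 by (auto simp: Inv_def s2_def cc_def put_Nil)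
      show "aval (Minus (Reg b) (Reg (b + 1))) s' = 0" if "Inv ?u s'" for s'
        using that by (simp add: Inv_def)
      fix i s' assume i: "i < ?u" and I: "Inv i s'"
      have h: "holds x k s'" using I holds_put[OF s(1), of b s' "fst s 2" "cc i"] s(2) b3 by (simp add: Inv_def)
      have o: "length x < fst s' 2" using I s(2) by (simp add: Inv_def)
      have weq: "w (x, k) (fst s') (fst s' (b + 1)) = ?w i"
        using I ab w_local[of "fst s'" "fst s"] by (simp add: Inv_def)
      obtain n4 s4 where 4: "exec q s' n4 s4" "n4 \<le> d (x, k) (fst s')" "length (?w i) \<le> d (x, k) (fst s')"
        "fst s4 2 = fst s' 2 + length (?w i)"
        "\<forall>i<b + 2. i \<noteq> 2 \<longrightarrow> fst s4 i = fst s' i" "snd s4 = put (fst s' 2) (?w i) (snd s')"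
        using q[OF h o] unfolding weq by blast
      have "bnd (b + 2) (fst s') = bnd b (fst s') + 2 ^ fst s' 0 * (fst s' b + fst s' (b + 1))"
        using b3 by (simp add: bnd_Suc numeral_2_eq_2 distrib_left)
      also have "\<dots> = bnd b (fst s) + 2 ^ fst s 0 * (?u + i)"
        using I b3 bnd_cong[of b "fst s'" "fst s"] by (simp add: Inv_def)
      also have "\<dots> \<le> bnd b (fst s) + 2 ^ fst s 0 * (?u + ?u)"
        using i by (intro add_left_mono mult_le_mono2 add_mono) auto
      finally have d: "d (x, k) (fst s') \<le> ?T"
        unfolding T_def using E[of "fst s'" k x] h by (meson holds_def le_trans power_mono zero_le)
      define s5 where "s5 = ((fst s4)(b + 1 := Suc (fst s4 (b + 1))), snd s4)"
      have 5: "exec (Assign (b + 1) (Plus (Reg (b + 1)) (Const 1))) s4 1 s5"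
        using exec.intros(1)[of "b + 1" "Plus (Reg (b + 1)) (Const 1)" s4] by (simp add: s5_def)
      have "exec ?body s' (n4 + 1) s5" by (rule exec.intros(3)[OF 4(1) 5])
      moreover have "Inv (Suc i) s5"
        using I 4(3-6) d b3 by (auto simp: Inv_def s5_def cc put_append)
      ultimately show "aval (Minus (Reg b) (Reg (b + 1))) s' \<noteq> 0 \<and>
          (\<exists>m s''. exec ?body s' m s'' \<and> m \<le> ?T + 1 \<and> Inv (Suc i) s'')"
        using i I d 4(2) by (intro conjI exI[of _ "n4 + 1"] exI[of _ s5]) (auto simp: Inv_def)
    qed
    then obtain n7 s7 where 7: "exec ?loop s2 n7 s7" "n7 \<le> ?u * ((?T + 1) + 1) + 1" "Inv ?u s7"
      by blast
    show "\<exists>n s'. exec ?prog s n s' \<and> n \<le> ?C (x, k) (fst s) \<and> length (?W (x, k) (fst s)) \<le> ?C (x, k) (fst s) \<and>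
        fst s' 2 = fst s 2 + length (?W (x, k) (fst s)) \<and>
        (\<forall>i<b. i \<noteq> 2 \<longrightarrow> fst s' i = fst s i) \<and> snd s' = put (fst s 2) (?W (x, k) (fst s)) (snd s)"
    proof (intro exI conjI)
      show "exec ?prog s (n1 + (1 + n7)) s7"
        by (rule exec.intros(3)[OF 1(1) exec.intros(3)[OF 2 7(1)]])
      show "n1 + (1 + n7) \<le> ?C (x, k) (fst s)" using 1(2) 7(2) by simp
      have "length (cc ?u) \<le> ?u * ?T" using 7(3) by (simp add: Inv_def)
      also have "\<dots> \<le> ?C (x, k) (fst s)" by simp
      finally show "length (?W (x, k) (fst s)) \<le> ?C (x, k) (fst s)" by (simp add: cc_def)
    qed (use 7(3) in \<open>auto simp: Inv_def cc_def\<close>)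
  qed
qed

lemma emits_encode_nat: "feasible a u \<Longrightarrow> emits a (\<lambda>I \<rho>. encode_nat (u I \<rho>))"
proof -
  assume u: "feasible a u"
  have eq: "encode_nat n = concat (map (\<lambda>_. [True]) [0..<n]) @ [False]" for n
    by (simp add: encode_nat_def map_replicate_const flip: concat_replicate_trivial)
  show ?thesis
    unfolding eq by (intro emits_append emits_for u emits_single) (use feasible_ge_3[OF u] in auto)
qed

lemma length_loop:
  assumes "\<forall>i\<le>length x. snd s i = string_cells x i" "fst s 1 = 0"
  shows "\<exists>n s'. exec (While (Cell (Reg 1)) (Assign 1 (Plus (Reg 1) (Const 1)))) s n s' \<and> n \<le> length x * 2 + 1 \<and>
    fst s' = (fst s)(1 := length x) \<and> snd s' = snd s"
proof -
  define Inv where "Inv i s' \<longleftrightarrow> fst s' = (fst s)(1 := i) \<and> snd s' = snd s" for i and s' :: state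
  have "\<exists>m s'. exec (While (Cell (Reg 1)) (Assign 1 (Plus (Reg 1) (Const 1)))) s m s' \<and> m \<le> length x * (1 + 1) + 1 \<and> Inv (length x) s'"
  proof (rule exec_while_count)
    show "Inv 0 s" using assms(2) by (auto simp: Inv_def fun_eq_iff)
    show "aval (Cell (Reg 1)) s' = 0" if "Inv (length x) s'" for s'
      using that assms(1) by (simp add: Inv_def string_cells_def)
    fix i s' assume i: "i < length x" "Inv i s'"
    show "aval (Cell (Reg 1)) s' \<noteq> 0 \<and>
        (\<exists>m s''. exec (Assign 1 (Plus (Reg 1) (Const 1))) s' m s'' \<and> m \<le> 1 \<and> Inv (Suc i) s'')"
      using i assms(1) exec.intros(1)[of 1 "Plus (Reg 1) (Const 1)" s']
      by (intro conjI exI[of _ 1] exI[of _ "((fst s')(1 := aval (Plus (Reg 1) (Const 1)) s'), snd s')"])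
         (auto simp: Inv_def string_cells_def)
  qed
  then show ?thesis unfolding Inv_def one_add_one .
qed

text \<open>The block is copied to lower addresses from left to right, so a cell is overwritten only
  when everything still to be read lies above it.\<close>

lemma move_loop:
  assumes "fst s 2 = length x + 1 + length w" "fst s 1 = length x" "fst s 3 = 0"
    and "\<And>i. i < length w \<Longrightarrow> snd s (length x + 1 + i) = string_cells w i"
  shows "\<exists>n s'. exec (While (Minus (Minus (Reg 2) (Plus (Reg 1) (Const 1))) (Reg 3))
      (Seq (Store (Reg 3) (Cell (Plus (Plus (Reg 1) (Const 1)) (Reg 3)))) (Assign 3 (Plus (Reg 3) (Const 1))))) s n s' \<and>
    n \<le> length w * 3 + 1 \<and> fst s' = (fst s)(3 := length w) \<and> (\<forall>i<length w. snd s' i = string_cells w i)"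
proof -
  let ?c = "Minus (Minus (Reg 2) (Plus (Reg 1) (Const 1))) (Reg 3)"
  let ?st = "Store (Reg 3) (Cell (Plus (Plus (Reg 1) (Const 1)) (Reg 3)))"
  let ?as = "Assign 3 (Plus (Reg 3) (Const 1))"
  define Inv where "Inv i s' \<longleftrightarrow> fst s' = (fst s)(3 := i) \<and> (\<forall>j<i. snd s' j = string_cells w j) \<and>
    (\<forall>j. i \<le> j \<longrightarrow> j < length w \<longrightarrow> snd s' (length x + 1 + j) = string_cells w j)" for i and s' :: state
  have "\<exists>m s'. exec (While ?c (Seq ?st ?as)) s m s' \<and> m \<le> length w * (2 + 1) + 1 \<and> Inv (length w) s'"
  proof (rule exec_while_count)
    show "Inv 0 s" using assms(3,4) by (auto simp: Inv_def fun_eq_iff)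
    show "aval ?c s' = 0" if "Inv (length w) s'" for s'
      using that assms(1,2) by (simp add: Inv_def)
    fix i s' assume i: "i < length w" "Inv i s'"
    define s1 where "s1 = (fst s', (snd s')(i := snd s' (length x + 1 + i)))"
    define s2 where "s2 = ((fst s1)(3 := Suc i), snd s1)"
    have "exec ?st s' 1 s1"
      using exec.intros(2)[of "Reg 3" "Cell (Plus (Plus (Reg 1) (Const 1)) (Reg 3))" s'] i(2) assms(2)
      by (simp add: s1_def Inv_def)
    moreover have "exec ?as s1 1 s2"
      using exec.intros(1)[of 3 "Plus (Reg 3) (Const 1)" s1] i(2) by (simp add: s1_def s2_def Inv_def)
    ultimately have "exec (Seq ?st ?as) s' (1 + 1) s2" by (rule exec.intros(3))
    moreover have "Inv (Suc i) s2" using i by (auto simp: Inv_def s1_def s2_def less_Suc_eq)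
    moreover have "aval ?c s' \<noteq> 0" using i assms(1,2) by (simp add: Inv_def)
    ultimately show "aval ?c s' \<noteq> 0 \<and> (\<exists>m s''. exec (Seq ?st ?as) s' m s'' \<and> m \<le> 2 \<and> Inv (Suc i) s'')"
      by (intro conjI exI[of _ "1 + 1"] exI[of _ s2]) auto
  qed
  then show ?thesis unfolding Inv_def by (auto simp: mult.commute)
qed

text \<open>The start state is any state that presents \<open>(x, k)\<close>, with arbitrary
  leftovers elsewhere, so the program can follow another reduction directly. The new parameter is
  computed before the output is moved over the input, on which it may depend.\<close>

lemma emits_reduction:
  assumes w: "emits 3 (\<lambda>I _. w I)" and K: "feasible 3 (\<lambda>I _. K I)"
  shows "\<exists>p D. \<forall>x k s. outputs s x k \<longrightarrow> (\<exists>n s'. exec p s n s' \<and> outputs s' (w (x, k)) (K (x, k)) \<and>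
           n \<le> (2 ^ k * (k + 2) * (length x + 1)) ^ D)"
proof -
  obtain p c where c: "poly_bounded 3 c" and
    p: "\<And>x k s. holds x k s \<Longrightarrow> length x < fst s 2 \<Longrightarrow>
        \<exists>n s'. exec p s n s' \<and> n \<le> c (x, k) (fst s) \<and> length (w (x, k)) \<le> c (x, k) (fst s) \<and>
           fst s' 2 = fst s 2 + length (w (x, k)) \<and>
           (\<forall>i<3. i \<noteq> 2 \<longrightarrow> fst s' i = fst s i) \<and> snd s' = put (fst s 2) (w (x, k)) (snd s)"
    by (rule emits_prog[OF w le_refl]) (rule that)
  obtain q d where d: "poly_bounded 3 d" and
    q: "\<And>x k s. holds x k s \<Longrightarrow>
        \<exists>n s'. exec q s n s' \<and> n \<le> d (x, k) (fst s) \<and> fst s' 3 = K (x, k) \<and>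
           (\<forall>i<3. fst s' i = fst s i) \<and> snd s' = snd s"
    by (rule feasible_prog[OF K le_refl]) (rule that)
  obtain C where C: "\<And>x k \<rho>. \<rho> 0 = k \<Longrightarrow> \<rho> 1 = length x \<Longrightarrow> c (x, k) \<rho> \<le> bnd 3 \<rho> ^ C"
    using c unfolding poly_bounded_def by blast
  obtain D where D: "\<And>x k \<rho>. \<rho> 0 = k \<Longrightarrow> \<rho> 1 = length x \<Longrightarrow> d (x, k) \<rho> \<le> bnd 3 \<rho> ^ D"
    using d unfolding poly_bounded_def by blast
  have "poly_bounded 3 (\<lambda>I \<rho>. \<rho> 1 * 2 + 7 + bnd 3 \<rho> ^ C + bnd 3 \<rho> ^ D + bnd 3 \<rho> ^ C * 3)"
    by (intro poly_bounded_add poly_bounded_mult poly_bounded_const poly_bounded_power poly_bounded_bnd poly_bounded_reg) auto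
  then obtain E where E: "\<And>x k \<rho>. \<rho> 0 = k \<Longrightarrow> \<rho> 1 = length (x :: bool list) \<Longrightarrow>
      \<rho> 1 * 2 + 7 + bnd 3 \<rho> ^ C + bnd 3 \<rho> ^ D + bnd 3 \<rho> ^ C * 3 \<le> bnd 3 \<rho> ^ E"
    unfolding poly_bounded_def by blast
  let ?l1 = "While (Cell (Reg 1)) (Assign 1 (Plus (Reg 1) (Const 1)))"
  let ?l2 = "While (Minus (Minus (Reg 2) (Plus (Reg 1) (Const 1))) (Reg 3))
      (Seq (Store (Reg 3) (Cell (Plus (Plus (Reg 1) (Const 1)) (Reg 3)))) (Assign 3 (Plus (Reg 3) (Const 1))))"
  let ?prog = "Seq (Assign 1 (Const 0)) (Seq ?l1 (Seq (Assign 2 (Plus (Reg 1) (Const 1))) (Seq p (Seq q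
    (Seq (Assign 0 (Reg 3)) (Seq (Assign 3 (Const 0)) (Seq ?l2 (Store (Reg 3) (Const 0)))))))))"
  show ?thesis
  proof (rule exI[of _ ?prog], rule exI[of _ E], intro allI impI)
    fix x k s assume s: "outputs s x k"
    let ?w = "w (x, k)"
    define s1 where "s1 = ((fst s)(1 := 0), snd s)"
    have 1: "exec (Assign 1 (Const 0)) s 1 s1"
      using exec.intros(1)[of 1 "Const 0" s] by (simp add: s1_def)
    have "\<forall>i\<le>length x. snd s1 i = string_cells x i" "fst s1 1 = 0"
      using s by (auto simp: outputs_def s1_def)
    then obtain n2 s2 where 2: "exec ?l1 s1 n2 s2" "n2 \<le> length x * 2 + 1"
      "fst s2 = (fst s1)(1 := length x)" "snd s2 = snd s1"
      using length_loop by blast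
    define s3 where "s3 = ((fst s2)(2 := length x + 1), snd s2)"
    have 3: "exec (Assign 2 (Plus (Reg 1) (Const 1))) s2 1 s3"
      using exec.intros(1)[of 2 "Plus (Reg 1) (Const 1)" s2] 2(3) by (simp add: s3_def)
    have h3: "holds x k s3" "fst s3 2 = length x + 1"
      using s 2(3,4) by (auto simp: holds_def outputs_def s3_def s1_def)
    obtain n4 s4 where 4: "exec p s3 n4 s4" "n4 \<le> c (x, k) (fst s3)" "length ?w \<le> c (x, k) (fst s3)"
      "fst s4 2 = fst s3 2 + length ?w" "\<forall>i<3. i \<noteq> 2 \<longrightarrow> fst s4 i = fst s3 i"
      "snd s4 = put (fst s3 2) ?w (snd s3)"
      using p[OF h3(1)] h3(2) by auto
    have h4: "holds x k s4" using holds_put[OF h3(1) 4(5,6)] h3(2) by simp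
    have bnd4: "bnd 3 (fst s4) = bnd 3 (fst s3)" using 4(5) by (intro bnd_cong) auto
    obtain n5 s5 where 5: "exec q s4 n5 s5" "n5 \<le> d (x, k) (fst s4)" "fst s5 3 = K (x, k)"
      "\<forall>i<3. fst s5 i = fst s4 i" "snd s5 = snd s4"
      using q[OF h4] by blast
    define s6 where "s6 = ((fst s5)(0 := K (x, k)), snd s5)"
    have 6: "exec (Assign 0 (Reg 3)) s5 1 s6"
      using exec.intros(1)[of 0 "Reg 3" s5] 5(3) by (simp add: s6_def)
    define s7 where "s7 = ((fst s6)(3 := 0), snd s6)"
    have 7: "exec (Assign 3 (Const 0)) s6 1 s7"
      using exec.intros(1)[of 3 "Const 0" s6] by (simp add: s7_def)
    have "fst s7 2 = length x + 1 + length ?w" "fst s7 1 = length x" "fst s7 3 = 0"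
      "\<And>i. i < length ?w \<Longrightarrow> snd s7 (length x + 1 + i) = string_cells ?w i"
      using 5(4,5) 4(4,5,6) h3 by (auto simp: s7_def s6_def holds_def put_def string_cells_def)
    from move_loop[OF this] obtain n8 s8 where 8: "exec ?l2 s7 n8 s8" "n8 \<le> length ?w * 3 + 1"
      "fst s8 = (fst s7)(3 := length ?w)" "\<forall>i<length ?w. snd s8 i = string_cells ?w i" by blast
    define s9 where "s9 = (fst s8, (snd s8)(length ?w := 0))"
    have 9: "exec (Store (Reg 3) (Const 0)) s8 1 s9"
      using exec.intros(2)[of "Reg 3" "Const 0" s8] 8(3) by (simp add: s9_def)
    have ex: "exec ?prog s (1 + (n2 + (1 + (n4 + (n5 + (1 + (1 + (n8 + 1)))))))) s9"
      by (rule exec.intros(3)[OF 1 exec.intros(3)[OF 2(1) exec.intros(3)[OF 3 exec.intros(3)[OF 4(1)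
         exec.intros(3)[OF 5(1) exec.intros(3)[OF 6 exec.intros(3)[OF 7 exec.intros(3)[OF 8(1) 9]]]]]]]])
    have out: "outputs s9 ?w (K (x, k))"
      using 8(3,4) by (auto simp: outputs_def s9_def s7_def s6_def string_cells_def)
    have k3: "fst s3 0 = k" "fst s3 1 = length x" using h3(1) by (auto simp: holds_def)
    have "c (x, k) (fst s3) \<le> bnd 3 (fst s3) ^ C" "d (x, k) (fst s4) \<le> bnd 3 (fst s3) ^ D"
      using C[OF k3] D[of "fst s4" k x] h4 bnd4 by (auto simp: holds_def)
    then have "1 + (n2 + (1 + (n4 + (n5 + (1 + (1 + (n8 + 1))))))) \<le>
       fst s3 1 * 2 + 7 + bnd 3 (fst s3) ^ C + bnd 3 (fst s3) ^ D + bnd 3 (fst s3) ^ C * 3"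
      using 2(2) 4(2,3) 5(2) 8(2) k3 by linarith
    also have "\<dots> \<le> bnd 3 (fst s3) ^ E" by (rule E[OF k3])
    also have "bnd 3 (fst s3) = 2 ^ k * (2 + (k + length x))"
      using k3 by (simp add: bnd_def lessThan_nat_numeral lessThan_Suc insert_Diff_if add.commute)
    also have "(2 ^ k * (2 + (k + length x))) ^ E \<le> (2 ^ k * ((k + 2) * (length x + 1))) ^ E"
      by (intro power_mono mult_le_mono2) auto
    finally show "\<exists>n s'. exec ?prog s n s' \<and> outputs s' ?w (K (x, k)) \<and> n \<le> (2 ^ k * (k + 2) * (length x + 1)) ^ E"
      using ex out unfolding mult.assoc by blast
  qed
qed

subsection \<open>Composition of reductions\<close>

fun shift_aexp :: "nat \<Rightarrow> aexp \<Rightarrow> aexp" where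
  "shift_aexp m (Const n) = Const n"
| "shift_aexp m (Reg i) = Reg (3 * i + m)"
| "shift_aexp m (Cell a) = Cell (Plus (Plus (shift_aexp m a) (shift_aexp m a)) (Const (m - 1)))"
| "shift_aexp m (Plus a b) = Plus (shift_aexp m a) (shift_aexp m b)"
| "shift_aexp m (Minus a b) = Minus (shift_aexp m a) (shift_aexp m b)"

text \<open>Relocates a program to the registers congruent to \<open>m\<close> modulo 3 and, for \<open>m\<close> = 1, 2, to the
  even or odd array cells, so that two programs can run one after the other without any cleanup.\<close>

fun shift_prog :: "nat \<Rightarrow> prog \<Rightarrow> prog" where
  "shift_prog m (Assign i a) = Assign (3 * i + m) (shift_aexp m a)"
| "shift_prog m (Store a b) = Store (Plus (Plus (shift_aexp m a) (shift_aexp m a)) (Const (m - 1))) (shift_aexp m b)"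
| "shift_prog m (Seq p q) = Seq (shift_prog m p) (shift_prog m q)"
| "shift_prog m (If a p q) = If (shift_aexp m a) (shift_prog m p) (shift_prog m q)"
| "shift_prog m (While a p) = While (shift_aexp m a) (shift_prog m p)"

definition simulates :: "nat \<Rightarrow> state \<Rightarrow> state \<Rightarrow> bool" where
  "simulates m s S \<longleftrightarrow> (\<forall>i. fst S (3 * i + m) = fst s i) \<and> (\<forall>j. snd S (j + j + (m - 1)) = snd s j)"

definition other_part_eq :: "nat \<Rightarrow> state \<Rightarrow> state \<Rightarrow> bool" where
  "other_part_eq m S S' \<longleftrightarrow> (\<forall>i. i mod 3 \<noteq> m \<longrightarrow> fst S' i = fst S i) \<and> (\<forall>j. j mod 2 \<noteq> m - 1 \<longrightarrow> snd S' j = snd S j)"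

lemma aval_shift: "simulates m s S \<Longrightarrow> aval (shift_aexp m a) S = aval a s"
  by (induction a) (auto simp: simulates_def)

text \<open>Relocated expressions keep their values, so the step count is the same. The frame
  condition \<open>other_part_eq\<close> lets a second program wait with its input intact in another
  residue class.\<close>

lemma exec_shift:
  assumes "exec p s n s'" "m = 1 \<or> m = 2" "simulates m s S"
  shows "\<exists>S'. exec (shift_prog m p) S n S' \<and> simulates m s' S' \<and> other_part_eq m S S'"
  using assms(1,3)
proof (induction arbitrary: S rule: exec.induct)
  case (1 i a s)
  let ?S' = "((fst S)(3 * i + m := aval (shift_aexp m a) S), snd S)"
  have "simulates m ((fst s)(i := aval a s), snd s) ?S'" "other_part_eq m S ?S'"
    using 1 aval_shift[OF 1] assms(2) by (auto simp: simulates_def other_part_eq_def)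
  then show ?case using exec.intros(1)[of "3 * i + m" "shift_aexp m a" S] by auto
next
  case (2 a b s)
  let ?j = "aval a s + aval a s + (m - 1)"
  let ?S' = "(fst S, (snd S)(?j := aval (shift_aexp m b) S))"
  have "?j mod 2 = m - 1" using assms(2) by (auto simp: mult_2[symmetric])
  moreover have "j + j + (m - 1) = ?j \<longleftrightarrow> j = aval a s" for j by auto
  ultimately have "simulates m (fst s, (snd s)(aval a s := aval b s)) ?S'" "other_part_eq m S ?S'"
    using 2 aval_shift[OF 2] assms(2) by (auto simp: simulates_def other_part_eq_def)
  then show ?case
    using exec.intros(2)[of "Plus (Plus (shift_aexp m a) (shift_aexp m a)) (Const (m - 1))" "shift_aexp m b" S]
      aval_shift[OF 2] by auto
next
  case (3 p s n s' q n' s'')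
  then obtain S1 where 1: "exec (shift_prog m p) S n S1" "simulates m s' S1" "other_part_eq m S S1" by blast
  then obtain S2 where 2: "exec (shift_prog m q) S1 n' S2" "simulates m s'' S2" "other_part_eq m S1 S2" using 3 by blast
  have "other_part_eq m S S2" using 1(3) 2(3) by (auto simp: other_part_eq_def)
  then show ?case using exec.intros(3)[OF 1(1) 2(1)] 2(2) unfolding shift_prog.simps by blast
next
  case (4 a s p n s' q)
  then obtain S1 where 1: "exec (shift_prog m p) S n S1" "simulates m s' S1" "other_part_eq m S S1" by blast
  then show ?case using exec.intros(4)[of "shift_aexp m a" S] aval_shift[OF 4(4)] 4(1) by (metis shift_prog.simps(4))
next
  case (5 a s q n s' p)
  then obtain S1 where 1: "exec (shift_prog m q) S n S1" "simulates m s' S1" "other_part_eq m S S1" by blast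
  then show ?case using exec.intros(5)[of "shift_aexp m a" S] aval_shift[OF 5(4)] 5(1) by (metis shift_prog.simps(4))
next
  case (6 a s p)
  have "other_part_eq m S S" by (auto simp: other_part_eq_def)
  then show ?case using exec.intros(6)[of "shift_aexp m a" S] aval_shift[OF 6(2)] 6 by (metis shift_prog.simps(5))
next
  case (7 a s p n s' n' s'')
  then obtain S1 where 1: "exec (shift_prog m p) S n S1" "simulates m s' S1" "other_part_eq m S S1" by blast
  then obtain S2 where 2: "exec (shift_prog m (While a p)) S1 n' S2" "simulates m s'' S2" "other_part_eq m S1 S2" using 7 by blast
  have "other_part_eq m S S2" using 1(3) 2(3) by (auto simp: other_part_eq_def)
  moreover have "aval (shift_aexp m a) S \<noteq> 0" using aval_shift[OF 7(6)] 7(1) by simp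
  ultimately show ?case using exec.intros(7)[of "shift_aexp m a" S, OF _ 1(1)] 2 by (metis shift_prog.simps(5))
qed

fun doubling :: "nat \<Rightarrow> prog" where
  "doubling 0 = Assign 0 (Reg 0)"
| "doubling (Suc c) = Seq (Assign 0 (Plus (Reg 0) (Reg 0))) (doubling c)"

lemma exec_doubling: "\<exists>n. exec (doubling c) s n ((fst s)(0 := 2 ^ c * fst s 0), snd s)"
proof (induction c arbitrary: s)
  case 0
  show ?case using exec.intros(1)[of 0 "Reg 0" s] by auto
next
  case (Suc c)
  let ?s = "((fst s)(0 := fst s 0 + fst s 0), snd s)"
  have "exec (Assign 0 (Plus (Reg 0) (Reg 0))) s 1 ?s"
    using exec.intros(1)[of 0 "Plus (Reg 0) (Reg 0)" s] by simp
  moreover have "2 ^ c * (fst s 0 + fst s 0) = 2 ^ Suc c * fst s 0" by simp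
  then obtain n where "exec (doubling c) ?s n ((fst s)(0 := 2 ^ Suc c * fst s 0), snd s)"
    using Suc.IH[of ?s] by (metis fst_conv fun_upd_same fun_upd_upd snd_conv)
  ultimately show ?case using exec.intros(3) unfolding doubling.simps by blast
qed

lemma exec_double_loop:
  "fst s 3 = y \<Longrightarrow> \<exists>n s'. exec (While (Reg 3) (Seq (doubling c) (Assign 3 (Minus (Reg 3) (Const 1))))) s n s' \<and>
     fst s' 0 = 2 ^ (c * y) * fst s 0"
proof (induction y arbitrary: s)
  case 0
  then show ?case using exec.intros(6)[of "Reg 3" s] by fastforce
next
  case (Suc y)
  let ?B = "Seq (doubling c) (Assign 3 (Minus (Reg 3) (Const 1)))"
  obtain n where n: "exec (doubling c) s n ((fst s)(0 := 2 ^ c * fst s 0), snd s)" using exec_doubling by blast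
  let ?s = "((fst s)(0 := 2 ^ c * fst s 0, 3 := y), snd s)"
  have "exec (Assign 3 (Minus (Reg 3) (Const 1))) ((fst s)(0 := 2 ^ c * fst s 0), snd s) 1 ?s"
    using exec.intros(1)[of 3 "Minus (Reg 3) (Const 1)" "((fst s)(0 := 2 ^ c * fst s 0), snd s)"] Suc.prems by simp
  from exec.intros(3)[OF n this] have B: "exec ?B s (n + 1) ?s" .
  have "fst ?s 3 = y" by simp
  from Suc.IH[OF this] obtain n' s' where *: "exec (While (Reg 3) ?B) ?s n' s'" "fst s' 0 = 2 ^ (c * y) * fst ?s 0"
    by blast
  have "aval (Reg 3) s \<noteq> 0" using Suc.prems by simp
  from exec.intros(7)[OF this B *(1)] have "exec (While (Reg 3) ?B) s (n + 1 + n' + 1) s'" .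
  moreover have "fst s' 0 = 2 ^ (c * Suc y) * fst s 0" using *(2) by (simp add: power_add algebra_simps)
  ultimately show ?case by blast
qed

text \<open>Both bound functions of a composed reduction have this form. The programs for
  \<open>f\<close> and \<open>g\<close> run in disjoint relocated memories, each with its own copy
  of \<open>k\<close>; the power is produced by repeated doubling.\<close>

lemma computable_power_sum:
  assumes "computable f" "computable g"
  shows "computable (\<lambda>k. 2 ^ (c * (f k + g k + 1)))"
proof -
  obtain p where p: "\<And>k. \<exists>n s. exec p ((\<lambda>_. 0)(0 := k), \<lambda>_. 0) n s \<and> fst s 0 = f k"
    using assms(1) unfolding computable_def by blast
  obtain q where q: "\<And>k. \<exists>n s. exec q ((\<lambda>_. 0)(0 := k), \<lambda>_. 0) n s \<and> fst s 0 = g k"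
    using assms(2) unfolding computable_def by blast
  let ?L = "While (Reg 3) (Seq (doubling c) (Assign 3 (Minus (Reg 3) (Const 1))))"
  let ?prog = "Seq (Assign 1 (Reg 0)) (Seq (Assign 2 (Reg 0)) (Seq (shift_prog 1 p) (Seq (shift_prog 2 q)
    (Seq (Assign 3 (Plus (Plus (Reg 1) (Reg 2)) (Const 1))) (Seq (Assign 0 (Const 1)) ?L)))))"
  show ?thesis
    unfolding computable_def
  proof (intro exI[of _ ?prog] allI)
    fix k
    define s where "s = (((\<lambda>_. 0)(0 := k), \<lambda>_. 0) :: state)"
    define s1 where "s1 = ((fst s)(1 := k), snd s)"
    define s2 where "s2 = ((fst s1)(2 := k), snd s1)"
    have 1: "exec (Assign 1 (Reg 0)) s 1 s1"
      using exec.intros(1)[of 1 "Reg 0" s] by (simp add: s1_def s_def)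
    have 2: "exec (Assign 2 (Reg 0)) s1 1 s2"
      using exec.intros(1)[of 2 "Reg 0" s1] by (simp add: s1_def s_def s2_def)
    have sim: "simulates 1 s s2" "simulates 2 s s2"
      by (auto simp: simulates_def s2_def s1_def s_def)
    obtain n3 t3 where t3: "exec p s n3 t3" "fst t3 0 = f k" using p[of k] s_def by blast
    obtain s3 where 3: "exec (shift_prog 1 p) s2 n3 s3" "simulates 1 t3 s3" "other_part_eq 1 s2 s3"
      using exec_shift[OF t3(1) _ sim(1)] by auto
    have f: "fst s3 1 = f k" using 3(2) t3(2) unfolding simulates_def by (metis add_0 mult_0_right)
    have sim3: "simulates 2 s s3"
      unfolding simulates_def
    proof (intro conjI allI)
      fix i :: nat
      have "(3 * i + 2) mod 3 \<noteq> 1" by presburger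
      then show "fst s3 (3 * i + 2) = fst s i"
        using 3(3) sim(2) by (simp add: simulates_def other_part_eq_def)
      have "(i + i + (2 - 1)) mod 2 \<noteq> (1 - 1 :: nat)" by presburger
      then show "snd s3 (i + i + (2 - 1)) = snd s i"
        using 3(3) sim(2) unfolding simulates_def other_part_eq_def by metis
    qed
    obtain n4 t4 where t4: "exec q s n4 t4" "fst t4 0 = g k" using q[of k] s_def by blast
    obtain s4 where 4: "exec (shift_prog 2 q) s3 n4 s4" "simulates 2 t4 s4" "other_part_eq 2 s3 s4"
      using exec_shift[OF t4(1) _ sim3] by auto
    have g: "fst s4 2 = g k" using 4(2) t4(2) unfolding simulates_def by (metis add_0 mult_0_right)
    have f4: "fst s4 1 = f k" using 4(3) f by (simp add: other_part_eq_def)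
    define s5 where "s5 = ((fst s4)(3 := f k + g k + 1), snd s4)"
    define s6 where "s6 = ((fst s5)(0 := 1), snd s5)"
    have 5: "exec (Assign 3 (Plus (Plus (Reg 1) (Reg 2)) (Const 1))) s4 1 s5"
      using exec.intros(1)[of 3 "Plus (Plus (Reg 1) (Reg 2)) (Const 1)" s4] f4 g by (simp add: s5_def)
    have 6: "exec (Assign 0 (Const 1)) s5 1 s6"
      using exec.intros(1)[of 0 "Const 1" s5] by (simp add: s6_def)
    obtain n7 s7 where 7: "exec ?L s6 n7 s7" "fst s7 0 = 2 ^ (c * (f k + g k + 1)) * fst s6 0"
      using exec_double_loop[of s6 "f k + g k + 1" c] by (auto simp: s6_def s5_def)
    show "\<exists>n s. exec ?prog ((\<lambda>_. 0)(0 := k), \<lambda>_. 0) n s \<and> fst s 0 = 2 ^ (c * (f k + g k + 1))"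
    proof -
      have "fst s7 0 = 2 ^ (c * (f k + g k + 1))" using 7(2) by (simp add: s6_def)
      then show ?thesis
      unfolding s_def[symmetric]
      using exec.intros(3)[OF 1 exec.intros(3)[OF 2 exec.intros(3)[OF 3(1) exec.intros(3)[OF 4(1)
         exec.intros(3)[OF 5 exec.intros(3)[OF 6 7(1)]]]]]] by blast
    qed
  qed
qed

lemma computable_const: "computable (\<lambda>_. c)"
proof -
  have "exec (Assign 0 (Const c)) s 1 ((fst s)(0 := c), snd s)" for s
    using exec.intros(1)[of 0 "Const c" s] by simp
  then show ?thesis
    unfolding computable_def by (intro exI[of _ "Assign 0 (Const c)"]) fastforce
qed

lemma computable_id: "computable (\<lambda>k. k)"
proof -
  have "exec (Assign 0 (Reg 0)) s 1 s" for s
    using exec.intros(1)[of 0 "Reg 0" s] by simp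
  then show ?thesis
    unfolding computable_def by (intro exI[of _ "Assign 0 (Reg 0)"]) fastforce
qed

lemma fpt_reducible_subproblem:
  assumes "instances P \<subseteq> instances Q"
    and "\<And>x k. (x, k) \<in> instances P \<Longrightarrow> (x, k) \<in> yes_instances P \<longleftrightarrow> (x, k) \<in> yes_instances Q"
  shows "fpt_reducible P Q"
  unfolding fpt_reducible_def
proof (rule exI[of _ "Assign 0 (Reg 0)"], rule exI[of _ "\<lambda>_. 1"], rule exI[of _ "\<lambda>k. k"], rule exI[of _ 0], intro conjI computable_const computable_id ballI)
  fix I assume I: "I \<in> instances P"
  obtain x k where [simp]: "I = (x, k)" by force
  have "exec (Assign 0 (Reg 0)) (initial_state x k) 1 (initial_state x k)"
    using exec.intros(1)[of 0 "Reg 0" "initial_state x k"] by simp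
  moreover have "outputs (initial_state x k) x k" by (simp add: outputs_def initial_state_def)
  ultimately show "case I of (x, k) \<Rightarrow> \<exists>n s x' k'. exec (Assign 0 (Reg 0)) (initial_state x k) n s \<and>
      outputs s x' k' \<and> n \<le> 1 * (length x + 1) ^ 0 \<and> k' \<le> k \<and> (x', k') \<in> instances Q \<and>
      ((x, k) \<in> yes_instances P) = ((x', k') \<in> yes_instances Q)"
    using subsetD[OF assms(1) I] assms(2)[of x k] I unfolding \<open>I = (x, k)\<close> case_prod_conv
    by (metis le_refl mult_1 power_0)
qed

lemma exec_changed_cells:
  "exec p s n s' \<Longrightarrow> \<exists>A. finite A \<and> card A \<le> n \<and> (\<forall>j. j \<notin> A \<longrightarrow> snd s' j = snd s j)"
proof (induction rule: exec.induct)
  case (1 i a s)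
  show ?case by (rule exI[of _ "{}"]) auto
next
  case (2 a b s)
  show ?case by (rule exI[of _ "{aval a s}"]) auto
next
  case (3 p s m s' q n s'')
  then obtain A B where "finite A" "card A \<le> m" "\<forall>j. j \<notin> A \<longrightarrow> snd s' j = snd s j"
    "finite B" "card B \<le> n" "\<forall>j. j \<notin> B \<longrightarrow> snd s'' j = snd s' j" by blast
  then show ?case using card_Un_le[of A B] by (intro exI[of _ "A \<union> B"]) auto
next
  case (6 a s p)
  show ?case by (rule exI[of _ "{}"]) auto
next
  case (7 a s p m s' n s'')
  then obtain A B where "finite A" "card A \<le> m" "\<forall>j. j \<notin> A \<longrightarrow> snd s' j = snd s j"
    "finite B" "card B \<le> n" "\<forall>j. j \<notin> B \<longrightarrow> snd s'' j = snd s' j" by blast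
  then show ?case using card_Un_le[of A B] by (intro exI[of _ "A \<union> B"]) auto
qed (auto intro: le_SucI)

text \<open>Every output cell behind the input was blank at first and is not blank at the end, so it
  was written, and each step writes at most one cell.\<close>

lemma output_length:
  assumes "exec p (initial_state x k) n s" "outputs s x' k'"
  shows "length x' \<le> length x + n"
proof -
  obtain A where A: "finite A" "card A \<le> n" "\<forall>j. j \<notin> A \<longrightarrow> snd s j = string_cells x j"
    using exec_changed_cells[OF assms(1)] by (auto simp: initial_state_def)
  have "j \<in> A" if "length x \<le> j" "j < length x'" for j
  proof (rule ccontr)
    assume "j \<notin> A"
    then have "snd s j = 0" using A(3) that by (simp add: string_cells_def)
    moreover have "snd s j = string_cells x' j" using assms(2) that by (simp add: outputs_def)
    ultimately show False using that by (simp add: string_cells_def split: if_splits)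
  qed
  then have "{length x..<length x'} \<subseteq> A" by auto
  then have "card {length x..<length x'} \<le> n" using A card_mono le_trans by blast
  then show ?thesis by simp
qed

text \<open>Composition of an arbitrary reduction with one that is given by its output string. By
  \<open>output_length\<close> the intermediate string is polynomial in the input up to a factor
  depending on \<open>k\<close>, and the intermediate parameter is at most \<open>g k\<close>; so
  the cost of the second program is a power of \<open>length x + 1\<close> times a function of
  \<open>k\<close>.\<close>

lemma fpt_reducible_trans_emits:
  assumes PQ: "fpt_reducible P Q"
    and w: "emits 3 (\<lambda>I _. w I)" and K: "feasible 3 (\<lambda>I _. K I)"
    and KD: "\<And>x k. K (x, k) \<le> 2 ^ (D * (k + 1))"
    and Q: "\<And>x k. (x, k) \<in> instances Q \<Longrightarrow> (w (x, k), K (x, k)) \<in> instances R \<and>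
       ((x, k) \<in> yes_instances Q \<longleftrightarrow> (w (x, k), K (x, k)) \<in> yes_instances R)"
  shows "fpt_reducible P R"
proof -
  obtain p f g d where f: "computable f" and g: "computable g" and
    p0: "\<forall>(x, k) \<in> instances P. \<exists>n s x' k'.
           exec p (initial_state x k) n s \<and> outputs s x' k' \<and>
           n \<le> f k * (length x + 1) ^ d \<and> k' \<le> g k \<and> (x', k') \<in> instances Q \<and>
           ((x, k) \<in> yes_instances P \<longleftrightarrow> (x', k') \<in> yes_instances Q)"
    using PQ unfolding fpt_reducible_def by (elim exE conjE)
  obtain q E where q: "\<And>x k s. outputs s x k \<Longrightarrow> \<exists>n s'. exec q s n s' \<and> outputs s' (w (x, k)) (K (x, k)) \<and>
           n \<le> (2 ^ k * (k + 2) * (length x + 1)) ^ E"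
    using emits_reduction[OF w K] by blast
  let ?F = "\<lambda>k. (2::nat) ^ ((3 * E + 2) * (f k + g k + 1))"
  let ?G = "\<lambda>k. (2::nat) ^ (D * (f k + g k + 1))"
  show ?thesis
    unfolding fpt_reducible_def
  proof (rule exI[of _ "Seq p q"], rule exI[of _ ?F], rule exI[of _ ?G], rule exI[of _ "d + (d + 1) * E"], intro conjI computable_power_sum f g ballI)
    fix I assume I: "I \<in> instances P"
    obtain x k where [simp]: "I = (x, k)" by force
    obtain n1 s1 x' k' where 1: "exec p (initial_state x k) n1 s1" "outputs s1 x' k'"
      "n1 \<le> f k * (length x + 1) ^ d" "k' \<le> g k" "(x', k') \<in> instances Q"
      "(x, k) \<in> yes_instances P \<longleftrightarrow> (x', k') \<in> yes_instances Q"
      using bspec[OF p0 I] unfolding \<open>I = (x, k)\<close> case_prod_conv by (elim exE conjE)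
    obtain n2 s2 where 2: "exec q s1 n2 s2" "outputs s2 (w (x', k')) (K (x', k'))"
      "n2 \<le> (2 ^ k' * (k' + 2) * (length x' + 1)) ^ E" using q[OF 1(2)] by blast
    define L where "L = length x + 1"
    \<comment> \<open>Each factor that depends on the parameter, namely \<open>f k + 1\<close>,
      \<open>k' + 2\<close> and \<open>2 ^ k'\<close>, is at most \<open>2 ^ u\<close>.\<close>
    define u where "u = f k + g k + 1"
    have L: "1 \<le> L" by (simp add: L_def)
    have pw: "n < 2 ^ n" for n :: nat by simp
    have "length x' + 1 \<le> L + f k * L ^ d"
      using output_length[OF 1(1,2)] 1(3) by (simp add: L_def)
    also have "\<dots> \<le> L ^ (d + 1) + f k * L ^ (d + 1)"
      using L by (intro add_mono mult_le_mono2 power_increasing self_le_power) auto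
    also have "\<dots> = (f k + 1) * L ^ (d + 1)" by (simp add: algebra_simps)
    also have "\<dots> \<le> 2 ^ u * L ^ (d + 1)"
      using pw[of u] by (intro mult_le_mono1) (simp add: u_def)
    finally have len: "length x' + 1 \<le> 2 ^ u * L ^ (d + 1)" .
    have "k' + 2 \<le> 2 ^ u * 1" using 1(4) pw[of u] by (simp add: u_def)
    moreover have "(2::nat) ^ k' \<le> 2 ^ u" using 1(4) by (intro power_increasing) (auto simp: u_def)
    ultimately have "2 ^ k' * (k' + 2) * (length x' + 1) \<le> 2 ^ u * (2 ^ u * 1) * (2 ^ u * L ^ (d + 1))"
      using len by (intro mult_le_mono) auto
    also have "\<dots> = 2 ^ (3 * u) * L ^ (d + 1)" by (simp add: power_add[symmetric] mult.assoc[symmetric])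
    finally have "n2 \<le> (2 ^ (3 * u) * L ^ (d + 1)) ^ E"
      using 2(3) by (meson le_trans power_mono zero_le)
    also have "\<dots> = 2 ^ (3 * E * u) * L ^ ((d + 1) * E)"
    proof -
      have "3 * E * u = 3 * u * E" by simp
      then show ?thesis unfolding power_mult_distrib power_mult[symmetric] by (simp only:)
    qed
    finally have n2: "n2 \<le> 2 ^ (3 * E * u) * L ^ ((d + 1) * E)" .
    have n1: "n1 \<le> 2 ^ u * L ^ d"
    proof -
      have "f k \<le> 2 ^ u" using pw[of u] by (simp add: u_def)
      then have "f k * L ^ d \<le> 2 ^ u * L ^ d" by (rule mult_le_mono1)
      with 1(3) show ?thesis unfolding L_def by (rule le_trans)
    qed
    have "n1 + n2 \<le> 2 ^ (3 * E * u + u) * L ^ (d + (d + 1) * E) + 2 ^ (3 * E * u + u) * L ^ (d + (d + 1) * E)"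
      using L by (intro add_mono order_trans[OF n1] order_trans[OF n2] mult_le_mono power_increasing) auto
    also have "\<dots> = 2 ^ (3 * E * u + u + 1) * L ^ (d + (d + 1) * E)" by simp
    also have "\<dots> \<le> 2 ^ ((3 * E + 2) * u) * L ^ (d + (d + 1) * E)"
      by (intro mult_le_mono1 power_increasing) (auto simp: u_def algebra_simps)
    finally have time: "n1 + n2 \<le> ?F k * (length x + 1) ^ (d + (d + 1) * E)" by (simp add: u_def L_def)
    have "K (x', k') \<le> 2 ^ (D * (k' + 1))" by (rule KD)
    also have "\<dots> \<le> ?G k" using 1(4) by (intro power_increasing mult_le_mono2) auto
    finally have "K (x', k') \<le> ?G k" .
    then show "case I of (x, k) \<Rightarrow> \<exists>n s x' k'. exec (Seq p q) (initial_state x k) n s \<and>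
        outputs s x' k' \<and> n \<le> ?F k * (length x + 1) ^ (d + (d + 1) * E) \<and> k' \<le> ?G k \<and> (x', k') \<in> instances R \<and>
        ((x, k) \<in> yes_instances P) = ((x', k') \<in> yes_instances R)"
      using exec.intros(3)[OF 1(1) 2(1)] 2(2) time Q[OF 1(5)] 1(6)
      unfolding \<open>I = (x, k)\<close> case_prod_conv by blast
  qed
qed

subsection \<open>Genus\<close>

lemma arc_compose:
  assumes "arc g" "continuous_on (path_image g) f" "inj f"
  shows "arc (f \<circ> g)"
  using assms path_continuous_image[of g f] unfolding arc_def
  by (auto intro: comp_inj_on inj_on_subset)

text \<open>The vertices \<open>z i\<close> lie on the real axis of the upper sheet. An edge rises
  from \<open>z (lo e)\<close> along a riser \<open>U\<close> to \<open>P (lo e) e\<close>, changes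
  there to the lower sheet, crosses horizontally along \<open>L e\<close> to
  \<open>P (hi e) e\<close>, changes back and descends to \<open>z (hi e)\<close>. Risers at one
  vertex form a fan, risers at different vertices lie in disjoint strips, and crossings have
  different heights. Each of the two points \<open>P\<close> of an edge lies on the boundary of its
  own hole.\<close>

lemma graph_genus_le:
  fixes n :: nat and E :: "nat set set"
  assumes E: "\<And>e. e \<in> E \<Longrightarrow> \<exists>i j. e = {i, j} \<and> i < j \<and> j < n"
  shows "graph_genus {..<n} E \<le> 2 * card E"
proof -
  have "E \<subseteq> Pow {..<n}" using E by fastforce
  then have finE: "finite E" by (rule finite_subset) simp
  define m where "m = card E"
  obtain ix where ix: "bij_betw ix E {..<m}"
    using ex_bij_betw_finite_nat[OF finE] by (auto simp: m_def atLeast0LessThan)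
  have "\<forall>e\<in>E. \<exists>i j. e = {i, j} \<and> i < j \<and> j < n" using E by blast
  then obtain lo hi where lh: "\<And>e. e \<in> E \<Longrightarrow> e = {lo e, hi e} \<and> lo e < hi e \<and> hi e < n" by metis
  \<comment> \<open>Spacing of the vertices: the \<open>n\<close> strips of width \<open>w\<close>
    fit between 0 and 1/2, well inside the unit disc.\<close>
  define w :: real where "w = 1 / (2 * real (n + 1))"
  have w0: "w > 0" by (simp add: w_def)
  have wn: "real i * w + w / 2 < 1 / 2" if "i < n" for i
  proof -
    have "real i + 1 / 2 < real (n + 1)" using that by linarith
    then have "(real i + 1 / 2) * w < real (n + 1) * w" using w0 by (rule mult_strict_right_mono)
    also have "\<dots> = 1 / 2" by (simp add: w_def)
    finally show ?thesis by (simp add: algebra_simps)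
  qed
  \<comment> \<open>A number in [0, 1) that identifies the edge; it fixes both the slope of its
    risers and the height of its crossing.\<close>
  define q :: "nat set \<Rightarrow> real" where "q e = real (ix e) / real (m + 1)" for e
  have q: "0 \<le> q e" "q e < 1" if "e \<in> E" for e
    using bij_betwE[OF ix] that by (auto simp: q_def)
  have q_inj: "e = e'" if "q e = q e'" "e \<in> E" "e' \<in> E" for e e'
    using that ix by (auto simp: q_def bij_betw_def dest: inj_onD)
  define z where "z i = Complex (real i * w) 0" for i
  define P where "P i e = Complex (real i * w + q e * (w / 2)) ((1 + q e) / 4)" for i e
  define U where "U i e = closed_segment (z i) (P i e)" for i e
  define L where "L e = closed_segment (P (lo e) e) (P (hi e) e)" for e
  have U_coord: "\<exists>u. 0 \<le> u \<and> u \<le> 1 \<and> Re x = real i * w + u * (q e * (w / 2)) \<and> Im x = u * ((1 + q e) / 4)"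
    if x: "x \<in> U i e" for x i e
  proof -
    obtain u where "0 \<le> u" "u \<le> 1" "x = (1 - u) *\<^sub>R z i + u *\<^sub>R P i e"
      using x by (auto simp: U_def in_segment)
    moreover from this have "Re x = (1 - u) * Re (z i) + u * Re (P i e)" "Im x = (1 - u) * Im (z i) + u * Im (P i e)"
      by simp_all
    ultimately show ?thesis by (intro exI[of _ u]) (simp add: z_def P_def algebra_simps add_divide_distrib)
  qed
  have U_strip: "real i * w \<le> Re x \<and> Re x < real i * w + w \<and> 0 \<le> Im x \<and> Im x \<le> (1 + q e) / 4"
    if "x \<in> U i e" "e \<in> E" for x i e
  proof -
    note T = that
    obtain u where u: "0 \<le> u" "u \<le> 1" "Re x = real i * w + u * (q e * (w / 2))" "Im x = u * ((1 + q e) / 4)"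
      using U_coord[OF T(1)] by blast
    have "0 \<le> u * (q e * (w / 2))" using u(1) q[OF T(2)] w0 by simp
    moreover have "u * (q e * (w / 2)) \<le> 1 * (1 * (w / 2))"
      using u q[OF T(2)] w0 by (intro mult_mono) auto
    moreover have "0 \<le> u * ((1 + q e) / 4)" using u(1) q[OF T(2)] by simp
    moreover have "u * ((1 + q e) / 4) \<le> 1 * ((1 + q e) / 4)"
      using u q[OF T(2)] by (intro mult_right_mono) auto
    ultimately show ?thesis using u(3,4) w0 by auto
  qed
  have U_same: "i = j" if "x \<in> U i e" "x \<in> U j e'" "e \<in> E" "e' \<in> E" for x i j e e'
  proof -
    have "real i * w < (real j + 1) * w" "real j * w < (real i + 1) * w"
      using U_strip[OF that(1,3)] U_strip[OF that(2,4)] by (auto simp: algebra_simps)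
    then have "real i < real j + 1" "real j < real i + 1" using w0 by auto
    then show ?thesis by linarith
  qed
  have U_meet: "x = z i" if "x \<in> U i e" "x \<in> U i e'" "e \<in> E" "e' \<in> E" "e \<noteq> e'" for x i e e'
  proof -
    note T = that
    obtain u where u: "Re x = real i * w + u * (q e * (w / 2))" "Im x = u * ((1 + q e) / 4)"
      using U_coord[OF T(1)] by blast
    obtain v where v: "Re x = real i * w + v * (q e' * (w / 2))" "Im x = v * ((1 + q e') / 4)"
      using U_coord[OF T(2)] by blast
    have "(u * q e) * w = (v * q e') * w" using u(1) v(1) by auto
    then have 1: "u * q e = v * q e'" using w0 by simp
    have "u + u * q e = v + v * q e'" using u(2) v(2) by (simp add: algebra_simps)
    with 1 have "u = v" by simp
    with 1 have "u = 0" using q_inj[OF _ T(3,4)] T(5) by auto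
    then show ?thesis using u by (simp add: z_def complex_eq_iff)
  qed
  have L_im: "Im x = (1 + q e) / 4 \<and> real (lo e) * w \<le> Re x \<and> Re x \<le> real (hi e) * w + w / 2"
    if x: "x \<in> L e" "e \<in> E" for x e
  proof -
    obtain u where u: "0 \<le> u" "u \<le> 1" "x = (1 - u) *\<^sub>R P (lo e) e + u *\<^sub>R P (hi e) e"
      using x by (auto simp: L_def in_segment)
    have "Re x = real (lo e) * w + u * ((real (hi e) - real (lo e)) * w) + q e * (w / 2)"
      "Im x = (1 + q e) / 4"
    proof -
      have "Re x = (1 - u) * Re (P (lo e) e) + u * Re (P (hi e) e)" "Im x = (1 - u) * Im (P (lo e) e) + u * Im (P (hi e) e)"
        using u(3) by simp_all
      then show "Re x = real (lo e) * w + u * ((real (hi e) - real (lo e)) * w) + q e * (w / 2)" "Im x = (1 + q e) / 4"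
        by (simp_all add: P_def field_simps)
    qed
    moreover have "0 \<le> (real (hi e) - real (lo e)) * w" using lh[OF x(2)] w0 by simp
    then have "0 \<le> u * ((real (hi e) - real (lo e)) * w)"
      "u * ((real (hi e) - real (lo e)) * w) \<le> 1 * ((real (hi e) - real (lo e)) * w)"
      using u(1,2) mult_left_le_one_le[of "(real (hi e) - real (lo e)) * w" u] by auto
    moreover have "0 \<le> q e * (w / 2)" "q e * (w / 2) \<le> 1 * (w / 2)" using q[OF x(2)] w0 by auto
    ultimately show ?thesis by (auto simp: algebra_simps)
  qed
  have L_meet: "e = e'" if "x \<in> L e" "x \<in> L e'" "e \<in> E" "e' \<in> E" for x e e'
    using L_im[OF that(1,3)] L_im[OF that(2,4)] q_inj that(3,4) by auto
  have PU: "P i e \<in> U i e" and zU: "z i \<in> U i e" for i e by (auto simp: U_def)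
  have PL: "P (lo e) e \<in> L e" "P (hi e) e \<in> L e" for e by (auto simp: L_def)
  have P_im: "Im (P i e) = (1 + q e) / 4" for i e by (simp add: P_def)
  have P_im0: "0 < (1 + q e) / 4" if "e \<in> E" for e using q[OF that] by simp
  have zP: "z i \<noteq> P j e" if "e \<in> E" for i j e
    using P_im0[OF that] by (simp add: z_def P_def complex_eq_iff)
  have UL: "x = P i e" if "x \<in> U i e" "x \<in> L e" "e \<in> E" for x i e
  proof -
    note T = that
    obtain u where u: "Re x = real i * w + u * (q e * (w / 2))" "Im x = u * ((1 + q e) / 4)"
      using U_coord[OF T(1)] by blast
    moreover have "u = 1"
    proof -
      have "u * ((1 + q e) / 4) = (1 + q e) / 4"
        using conjunct1[OF L_im[OF T(2,3)]] unfolding u(2) .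
      moreover have "u = 1" if "u * b = b" "b > 0" for b :: real using that by simp
      ultimately show ?thesis using P_im0[OF T(3)] by blast
    qed
    ultimately show ?thesis by (simp add: P_def complex_eq_iff)
  qed
  have norm1: "norm x < 1" if "\<bar>Re x\<bar> < 1 / 2" "\<bar>Im x\<bar> < 1 / 2" for x
    using cmod_le[of x] that by linarith
  have U_norm: "norm x < 1" if "x \<in> U i e" "e \<in> E" "i < n" for x i e
  proof (rule norm1)
    note T = that
    obtain u where u: "0 \<le> u" "u \<le> 1" "Re x = real i * w + u * (q e * (w / 2))"
      using U_coord[OF T(1)] by blast
    have "u * (q e * (w / 2)) \<le> 1 * (1 * (w / 2))"
      using u q[OF T(2)] w0 by (intro mult_mono) auto
    then show "\<bar>Re x\<bar> < 1 / 2"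
      using U_strip[OF T(1,2)] wn[OF T(3)] w0 u(3) mult_nonneg_nonneg[of "real i" w] by linarith
    show "\<bar>Im x\<bar> < 1 / 2" using U_strip[OF T(1,2)] q[OF T(2)] by auto
  qed
  have L_norm: "norm x < 1" if "x \<in> L e" "e \<in> E" for x e
  proof (rule norm1)
    have "0 \<le> real (lo e) * w" using w0 by simp
    then show "\<bar>Re x\<bar> < 1 / 2" using L_im[OF that] wn[of "hi e"] lh[OF that(2)] by linarith
    show "\<bar>Im x\<bar> < 1 / 2" using L_im[OF that] q[OF that(2)] by auto
  qed
  have z_norm: "norm (z i) < 1" if "i < n" for i
    using wn[OF that] w0 by (intro norm1) (auto simp: z_def abs_mult)
  define H where "H = (\<lambda>e. (lo e, e)) ` E \<union> (\<lambda>e. (hi e, e)) ` E"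
  have finH: "finite H" unfolding H_def using finE by blast
  have HE: "snd h \<in> E" "fst h < n" "fst h \<in> snd h" if "h \<in> H" for h
    using that lh by (force simp: H_def)+
  have cardH: "card H = 2 * m"
  proof -
    have "(\<lambda>e. (lo e, e)) ` E \<inter> (\<lambda>e. (hi e, e)) ` E = {}"
      using lh by fastforce
    then show ?thesis
      unfolding H_def using finE by (simp add: card_Un_disjoint card_image inj_on_def m_def)
  qed
  let ?P = "\<lambda>h. P (fst h) (snd h)"
  \<comment> \<open>Everything the hole at \<open>?P h\<close> has to avoid: all other risers, the
    crossings of other edges and the outside of the open unit disc.\<close>
  define X where "X h = (\<Union>h'\<in>H - {h}. U (fst h') (snd h')) \<union> (\<Union>e\<in>E - {snd h}. L e) \<union> - ball 0 1" for h
  have XU: "U (fst h') (snd h') \<subseteq> X h" if "h' \<in> H" "h' \<noteq> h" for h h'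
    unfolding X_def using that by blast
  have XL: "L e \<subseteq> X h" if "e \<in> E" "e \<noteq> snd h" for e h
    unfolding X_def using that by blast
  have "\<exists>d>0. \<forall>x\<in>X h. d \<le> dist (?P h) x" if "h \<in> H" for h
  proof (rule separate_point_closed)
    show "closed (X h)"
      unfolding X_def U_def L_def using finH finE by (intro closed_Un closed_UN) auto
    have "?P h \<notin> U (fst h') (snd h')" if "h' \<in> H" "h' \<noteq> h" for h'
    proof
      assume *: "?P h \<in> U (fst h') (snd h')"
      have "fst h = fst h'" using U_same[OF PU *] HE \<open>h \<in> H\<close> that by blast
      moreover from this have "snd h \<noteq> snd h'" using that(2) by (auto simp: prod_eq_iff)
      ultimately show False
        using U_meet[of "?P h" "fst h" "snd h" "snd h'"] PU * HE \<open>h \<in> H\<close> that zP by metis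
    qed
    moreover have "?P h \<notin> L e" if "e \<in> E" "e \<noteq> snd h" for e
      using L_im[of "?P h" e] q_inj[of e "snd h"] HE(1)[OF \<open>h \<in> H\<close>] that P_im by auto
    moreover have "?P h \<in> ball 0 1" using U_norm[OF PU] HE[OF that] by simp
    ultimately show "?P h \<notin> X h" unfolding X_def by blast
  qed
  then obtain d where d: "\<And>h. h \<in> H \<Longrightarrow> d h > 0 \<and> (\<forall>x\<in>X h. d h \<le> dist (?P h) x)" by metis
  \<comment> \<open>A disc of radius \<open>r\<close> touching \<open>?P h\<close> stays within
    \<open>2 * r\<close> of it, so the margin \<open>8 * r\<close> keeps holes apart from each other
    and from \<open>X h\<close>.\<close>
  define r where "r = Min (insert 1 (d ` H)) / 8"
  have r0: "r > 0" unfolding r_def using d finH by (auto simp: Min_gr_iff)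
  have sep: "8 * r \<le> dist (?P h) x" if "h \<in> H" "x \<in> X h" for h x
  proof -
    have "8 * r \<le> d h" unfolding r_def using finH that by (auto intro: Min_le)
    then show ?thesis using d that by fastforce
  qed
  \<comment> \<open>The hole touches \<open>?P h\<close> from above. The riser and the crossing that
    end in \<open>?P h\<close> do not exceed its height, so they miss the open disc, while
    \<open>?P h\<close> is on its boundary.\<close>
  define c where "c h = ?P h + Complex 0 r" for h
  have Pc: "dist (?P h) (c h) = r" for h using r0 by (simp add: c_def dist_norm cmod_def)
  have near: "dist (?P h) x \<le> 2 * r" if "x \<in> cball (c h) r" for h x
    using dist_triangle[of "?P h" x "c h"] Pc[of h] that by simp
  have out: "x \<notin> cball (c h) r" if "h \<in> H" "x \<in> X h" for h x
    using near[of x h] sep[OF that] r0 by fastforce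
  have below: "x \<notin> ball (c h) r" if "Im x \<le> Im (?P h)" for x h
  proof
    assume "x \<in> ball (c h) r"
    then have "\<bar>Im (c h - x)\<bar> < r" using abs_Im_le_cmod[of "c h - x"] by (simp add: dist_norm)
    then show False using that by (simp add: c_def)
  qed
  obtain en where en: "bij_betw en {..<2 * m} H"
    using ex_bij_betw_nat_finite[OF finH] cardH by (auto simp: atLeast0LessThan)
  have enH: "en i \<in> H" if "i < 2 * m" for i using bij_betwE[OF en] that by auto
  have enX: "(\<Union>i<2 * m. ball (c (en i)) r) = (\<Union>h\<in>H. ball (c h) r)"
    using bij_betw_imp_surj_on[OF en] by auto
  define D where "D = cball 0 1 - (\<Union>h\<in>H. ball (c h) r)"
  have disc: "disc_with_holes (2 * m) D"
    unfolding disc_with_holes_def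
  proof (intro exI[of _ "\<lambda>i. c (en i)"] exI[of _ "\<lambda>_. r"] conjI allI impI)
    fix i assume i: "i < 2 * m"
    show "cball (c (en i)) r \<subseteq> ball 0 1" using out[OF enH[OF i]] unfolding X_def by blast
    show "r > 0" by (rule r0)
  next
    show "D = cball 0 1 - (\<Union>i<2 * m. ball (c (en i)) r)" unfolding enX D_def ..
  next
    show "disjoint_family_on (\<lambda>i. cball (c (en i)) r) {..<2 * m}"
      unfolding disjoint_family_on_def
    proof (intro ballI impI)
      fix i j assume ij: "i \<in> {..<2 * m}" "j \<in> {..<2 * m}" "i \<noteq> j"
      then have "en i \<noteq> en j" using en by (auto simp: bij_betw_def inj_on_def)
      then have "?P (en j) \<in> X (en i)" using subsetD[OF XU[of "en j" "en i"] PU] enH ij by auto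
      then have "8 * r \<le> dist (?P (en i)) (?P (en j))" using sep enH ij by blast
      then have False if "x \<in> cball (c (en i)) r" "x \<in> cball (c (en j)) r" for x
        using near[OF that(1)] near[OF that(2)] dist_triangle2[of "?P (en i)" "?P (en j)" x] r0 by linarith
      then show "cball (c (en i)) r \<inter> cball (c (en j)) r = {}" by blast
    qed
  qed
  define F where "F = frontier D"
  have UD: "U i e \<subseteq> D" if "e \<in> E" "i \<in> e" for i e
  proof
    fix x assume x: "x \<in> U i e"
    have i: "i < n" using lh[OF that(1)] that(2) by force
    have "x \<notin> ball (c h) r" if h: "h \<in> H" for h
    proof (cases "h = (i, e)")
      case True
      then have "Im x \<le> Im (?P h)" unfolding P_im using U_strip[OF x \<open>e \<in> E\<close>] by simp
      then show ?thesis by (rule below)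
    next
      case False
      have "(i, e) \<in> H" using lh[OF \<open>e \<in> E\<close>] \<open>i \<in> e\<close> \<open>e \<in> E\<close> by (force simp: H_def)
      then have "x \<in> X h" using x False XU[of "(i, e)" h] by auto
      then show ?thesis using out[OF h] by (meson ball_subset_cball subsetD)
    qed
    then show "x \<in> D" using U_norm[OF x that(1) i] by (simp add: D_def)
  qed
  have LD: "L e \<subseteq> D" if "e \<in> E" for e
  proof
    fix x assume x: "x \<in> L e"
    have "x \<notin> ball (c h) r" if h: "h \<in> H" for h
    proof (cases "snd h = e")
      case True
      then have "Im x \<le> Im (?P h)" unfolding P_im using L_im[OF x \<open>e \<in> E\<close>] by simp
      then show ?thesis by (rule below)
    next
      case False
      then have "x \<in> X h" using x \<open>e \<in> E\<close> XL[of e h] by auto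
      then show ?thesis using out[OF h] by (meson ball_subset_cball subsetD)
    qed
    then show "x \<in> D" using L_norm[OF x that] by (simp add: D_def)
  qed
  have zD: "z v \<in> D" if "v < n" for v
  proof -
    have "z v \<notin> ball (c h) r" if h: "h \<in> H" for h
    proof (rule below)
      show "Im (z v) \<le> Im (?P h)" unfolding P_im using P_im0[OF HE(1)[OF h]] by (simp add: z_def)
    qed
    then show ?thesis using z_norm[OF that] by (simp add: D_def)
  qed
  have PF: "?P h \<in> F" if "h \<in> H" for h
  proof -
    have "?P h \<in> cball (c h) r" using Pc by (simp add: dist_commute)
    then have "?P h \<in> closure (ball (c h) r)" using r0 by simp
    moreover have "ball (c h) r \<subseteq> - D" using that by (auto simp: D_def)
    ultimately have "?P h \<in> closure (- D)" using closure_mono by blast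
    moreover have "?P h \<in> D" using UD[of "snd h" "fst h"] HE[OF that] PU by blast
    then have "?P h \<in> closure D" using closure_subset by blast
    ultimately show ?thesis by (simp add: F_def frontier_closures)
  qed
  have F_near: "norm x = 1 \<or> norm x > 1 \<or> (\<exists>h\<in>H. x \<in> cball (c h) r)" if "x \<in> F" for x
  proof -
    have "- D \<subseteq> - ball 0 1 \<union> (\<Union>h\<in>H. cball (c h) r)" by (auto simp: D_def)
    moreover have "closed (- ball 0 1 \<union> (\<Union>h\<in>H. cball (c h) r))"
      using finH by (intro closed_Un closed_UN) auto
    ultimately have "closure (- D) \<subseteq> - ball 0 1 \<union> (\<Union>h\<in>H. cball (c h) r)" by (rule closure_minimal)
    then show ?thesis using that by (auto simp: F_def frontier_closures)
  qed
  define up where "up x = (x, infdist x F)" for x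
  define dn where "dn x = (x, - infdist x F)" for x
  have inj_up: "inj up" and inj_dn: "inj dn" by (auto simp: up_def dn_def inj_def)
  have cont: "continuous_on A up" "continuous_on A dn" for A
    unfolding up_def dn_def by (intro continuous_intros)+
  have up_S: "up x \<in> double D" "dn x \<in> double D" if "x \<in> D" for x
    using that infdist_nonneg[of x F] by (auto simp: up_def dn_def double_def F_def)
  \<comment> \<open>The sheets are the graphs of the distance to \<open>F\<close> and of its
    negative, so they meet exactly over \<open>F\<close>. The distance to the empty set is 0 by
    convention, hence \<open>F\<close> must be nonempty, as the hole of any edge shows.\<close>
  have up_dn: "x = y \<and> x \<in> F" if "up x = dn y" "E \<noteq> {}" for x y
  proof -
    note T = that
    have xy: "x = y" "infdist x F = - infdist y F" using T by (auto simp: up_def dn_def)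
    then have "infdist x F = 0" using infdist_nonneg[of x F] by auto
    moreover obtain e where e: "e \<in> E" using T(2) by blast
    have "(lo e, e) \<in> H" using e by (auto simp: H_def)
    then have "F \<noteq> {}" using PF by blast
    moreover have "closed F" by (simp add: F_def)
    ultimately show ?thesis using xy in_closed_iff_infdist_zero by blast
  qed
  have PF_up: "up (P i e) = dn (P i e)" if "e \<in> E" "i \<in> e" for i e
  proof -
    have "(i, e) \<in> H" using lh[OF that(1)] that by (force simp: H_def)
    from PF[OF this] show ?thesis by (simp add: up_def dn_def)
  qed
  have loe: "lo e \<in> e" "hi e \<in> e" if "e \<in> E" for e using lh[OF that] by blast+
  define g where "g e = (up \<circ> linepath (z (lo e)) (P (lo e) e)) +++ ((dn \<circ> linepath (P (lo e) e) (P (hi e) e)) +++ (up \<circ> linepath (P (hi e) e) (z (hi e))))" for e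
  have img: "path_image (g e) = up ` U (lo e) e \<union> (dn ` L e \<union> up ` U (hi e) e)" if "e \<in> E" for e
  proof -
    note e = that
    have PF2: "up (P (lo e) e) = dn (P (lo e) e)" "up (P (hi e) e) = dn (P (hi e) e)"
      using PF_up[OF e loe(1)[OF e]] PF_up[OF e loe(2)[OF e]] by auto
    have j1: "pathfinish (dn \<circ> linepath (P (lo e) e) (P (hi e) e)) = pathstart (up \<circ> linepath (P (hi e) e) (z (hi e)))"
      using PF2 by (simp add: pathfinish_compose pathstart_compose)
    have j2: "pathfinish (up \<circ> linepath (z (lo e)) (P (lo e) e)) = pathstart ((dn \<circ> linepath (P (lo e) e) (P (hi e) e)) +++ (up \<circ> linepath (P (hi e) e) (z (hi e))))"
      using PF2 by (simp add: pathfinish_compose pathstart_compose)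
    show ?thesis
      unfolding g_def path_image_join[OF j2] path_image_join[OF j1] path_image_compose
      by (simp add: U_def L_def closed_segment_commute)
  qed
  have start: "pathstart (g e) = up (z (lo e))" "pathfinish (g e) = up (z (hi e))" for e
    by (auto simp: g_def pathstart_compose pathfinish_compose)
  have arc_g: "arc (g e)" if e: "e \<in> E" for e
  proof -
    have arcs: "arc (up \<circ> linepath (z (lo e)) (P (lo e) e))" "arc (up \<circ> linepath (P (hi e) e) (z (hi e)))"
      using zP[OF e] zP[OF e, symmetric] by (intro arc_compose cont inj_up arc_linepath; blast)+
    have "P (lo e) e \<noteq> P (hi e) e" using lh[OF e] w0 by (auto simp: P_def)
    then have arcd: "arc (dn \<circ> linepath (P (lo e) e) (P (hi e) e))" by (intro arc_compose cont inj_dn) auto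
    have ne: "E \<noteq> {}" using e by blast
    have i0: "y = up (P i e)" if y: "y \<in> up ` U i e" "y \<in> dn ` L e" for y i
    proof -
      obtain x x' where x: "y = up x" "x \<in> U i e" "y = dn x'" "x' \<in> L e" using y by blast
      then have "x = x'" using up_dn[OF _ ne, of x x'] by simp
      then show ?thesis using UL[of x i e] x e by simp
    qed
    have i1: "dn ` L e \<inter> up ` U (hi e) e \<subseteq> {up (P (hi e) e)}"
      using i0 by blast
    have i2: "up ` U (lo e) e \<inter> dn ` L e \<subseteq> {dn (P (lo e) e)}"
      unfolding PF_up[OF e loe(1)[OF e], symmetric] using i0 by blast
    have i3: "up ` U (lo e) e \<inter> up ` U (hi e) e = {}"
    proof (rule equals0I)
      fix y assume "y \<in> up ` U (lo e) e \<inter> up ` U (hi e) e"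
      then obtain x where "x \<in> U (lo e) e" "x \<in> U (hi e) e" by (auto simp: up_def)
      then have "lo e = hi e" using U_same e by blast
      then show False using lh[OF e] by simp
    qed
    have p2: "arc ((dn \<circ> linepath (P (lo e) e) (P (hi e) e)) +++ (up \<circ> linepath (P (hi e) e) (z (hi e))))"
      using i1 PF_up[OF e loe(2)[OF e]]
      by (intro arc_join arcd arcs) (auto simp: pathstart_compose pathfinish_compose path_image_compose L_def U_def closed_segment_commute)
    have "path_image ((dn \<circ> linepath (P (lo e) e) (P (hi e) e)) +++ (up \<circ> linepath (P (hi e) e) (z (hi e)))) = dn ` L e \<union> up ` U (hi e) e"
      using PF_up[OF e loe(2)[OF e]]
      by (subst path_image_join) (auto simp: pathstart_compose pathfinish_compose path_image_compose L_def U_def closed_segment_commute)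
    then show ?thesis
      unfolding g_def using i2 i3 PF_up[OF e loe(1)[OF e]]
      by (intro arc_join p2 arcs) (auto simp: pathstart_compose pathfinish_compose path_image_compose U_def)
  qed
  have "embeds_in {..<n} E (double D)"
    unfolding embeds_in_def
  proof (intro exI[of _ "\<lambda>v. up (z v)"] exI[of _ g] conjI ballI impI)
    show "inj_on (\<lambda>v. up (z v)) {..<n}"
      using w0 by (auto simp: inj_on_def up_def z_def)
    show "(\<lambda>v. up (z v)) ` {..<n} \<subseteq> double D" using up_S zD by auto
  next
    fix e assume e: "e \<in> E"
    show "arc (g e)" by (rule arc_g[OF e])
    show "path_image (g e) \<subseteq> double D"
      unfolding img[OF e] using UD[OF e loe(1)[OF e]] UD[OF e loe(2)[OF e]] LD[OF e] up_S by blast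
    show "{pathstart (g e), pathfinish (g e)} = (\<lambda>v. up (z v)) ` e"
    proof -
      have "{pathstart (g e), pathfinish (g e)} = (\<lambda>v. up (z v)) ` {lo e, hi e}" by (simp add: start)
      also have "{lo e, hi e} = e" using lh[OF e] by blast
      finally show ?thesis .
    qed
    show "path_image (g e) \<inter> (\<lambda>v. up (z v)) ` {..<n} = (\<lambda>v. up (z v)) ` e"
    proof
      have "up (z v) \<in> path_image (g e)" if "v \<in> e" for v
      proof -
        have "v = lo e \<or> v = hi e" using that lh[OF e] by blast
        then show ?thesis using img[OF e] zU by auto
      qed
      moreover have "v < n" if "v \<in> e" for v using that lh[OF e] by force
      ultimately show "(\<lambda>v. up (z v)) ` e \<subseteq> path_image (g e) \<inter> (\<lambda>v. up (z v)) ` {..<n}" by blast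
      show "path_image (g e) \<inter> (\<lambda>v. up (z v)) ` {..<n} \<subseteq> (\<lambda>v. up (z v)) ` e"
      proof
        fix y assume "y \<in> path_image (g e) \<inter> (\<lambda>v. up (z v)) ` {..<n}"
        then obtain v where v: "y = up (z v)" "v < n" and y: "y \<in> path_image (g e)" by auto
        from y img[OF e] consider x i where "i \<in> e" "x \<in> U i e" "y = up x" | x where "x \<in> L e" "y = dn x"
          using loe[OF e] by blast
        then show "y \<in> (\<lambda>v. up (z v)) ` e"
        proof cases
          case 1
          then have "z v \<in> U i e" using v inj_up by (auto simp: inj_def)
          then have "v = i" using U_same[OF zU] e by blast
          then show ?thesis using 1(1) v(1) by blast
        next
          case 2
          then have "z v \<in> L e" using v by (auto simp: up_def dn_def)
          then show ?thesis using L_im[OF _ e] P_im0[OF e] by (force simp: z_def)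
        qed
      qed
    qed
  next
    fix e e' assume e: "e \<in> E" and e': "e' \<in> E" and ne: "e \<noteq> e'"
    have neE: "E \<noteq> {}" using e by blast
    \<comment> \<open>A riser of \<open>a\<close> and a crossing of \<open>b\<close> may overlap in
      the plane, but on the surface they could meet only over \<open>F\<close>, that is on a hole.
      The riser rules out every hole except its own, and the crossing of another edge rules out that
      one.\<close>
    have cross: False if x: "up x = dn y" "x \<in> U i a" "y \<in> L b" "a \<in> E" "b \<in> E" "a \<noteq> b" "i \<in> a" for x y i a b
    proof -
      have xF: "x = y" "x \<in> F" using up_dn[OF x(1) neE] by auto
      have "norm x < 1" using L_norm[OF x(3,5)] xF by simp
      then obtain h where h: "h \<in> H" "x \<in> cball (c h) r" using F_near[OF xF(2)] by auto
      have ia: "(i, a) \<in> H" using lh[OF x(4)] x(4,7) by (force simp: H_def)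
      have "h = (i, a)" using out[OF h(1)] h(2) x(2) XU[OF ia, of h] by auto
      then have "x \<in> X h" using x(3,5,6) xF(1) XL[of b h] by auto
      then show False using out[OF h(1)] h(2) by blast
    qed
    show "path_image (g e) \<inter> path_image (g e') = (\<lambda>v. up (z v)) ` (e \<inter> e')"
    proof
      show "(\<lambda>v. up (z v)) ` (e \<inter> e') \<subseteq> path_image (g e) \<inter> path_image (g e')"
      proof
        fix y assume "y \<in> (\<lambda>v. up (z v)) ` (e \<inter> e')"
        then obtain v where v: "y = up (z v)" "v \<in> e" "v \<in> e'" by blast
        have "v = lo e \<or> v = hi e" "v = lo e' \<or> v = hi e'" using v lh[OF e] lh[OF e'] by blast+
        then show "y \<in> path_image (g e) \<inter> path_image (g e')"
          using img[OF e] img[OF e'] zU v(1) by auto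
      qed
      show "path_image (g e) \<inter> path_image (g e') \<subseteq> (\<lambda>v. up (z v)) ` (e \<inter> e')"
      proof
        fix y assume y: "y \<in> path_image (g e) \<inter> path_image (g e')"
        from y img[OF e] consider (u) x i where "i \<in> e" "x \<in> U i e" "y = up x" | (l) x where "x \<in> L e" "y = dn x"
          using loe[OF e] by blast
        then show "y \<in> (\<lambda>v. up (z v)) ` (e \<inter> e')"
        proof cases
          case u
          from y img[OF e'] consider (u') x' j where "j \<in> e'" "x' \<in> U j e'" "y = up x'" | (l') x' where "x' \<in> L e'" "y = dn x'"
            using loe[OF e'] by blast
          then show ?thesis
          proof cases
            case u'
            have "x = x'" using u(3) u'(3) inj_up by (auto simp: inj_def)
            with u' have x: "x \<in> U j e'" by simp
            have "i = j" using U_same[OF u(2) x e e'] .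
            moreover from this have "x = z i" using U_meet[OF u(2) _ e e' ne] x by simp
            ultimately show ?thesis using u u' by auto
          next
            case l'
            then show ?thesis using cross[of x x' i e e'] u e e' ne by auto
          qed
        next
          case l
          from y img[OF e'] consider (u') x' j where "j \<in> e'" "x' \<in> U j e'" "y = up x'" | (l') x' where "x' \<in> L e'" "y = dn x'"
            using loe[OF e'] by blast
          then show ?thesis
          proof cases
            case u'
            then show ?thesis using cross[of x' x j e' e] l e e' ne by auto
          next
            case l'
            then have "x = x'" using l inj_dn by (auto simp: inj_def)
            then show ?thesis using L_meet[OF l(1) _ e e'] l' ne by auto
          qed
        qed
      qed
    qed
  qed
  then have "\<exists>S. orientable_surface (2 * m) S \<and> embeds_in {..<n} E S"
    unfolding orientable_surface_def using disc by blast
  then show ?thesis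
    unfolding graph_genus_def m_def by (rule Least_le)
qed

subsection \<open>Layered circuits\<close>

lemma vertex_values_snoc: "vertex_values f (C @ [G]) = vertex_values f C @ [f (vertex_values f C) G]"
  by (simp add: vertex_values_def)

lemma length_vertex_values [simp]: "length (vertex_values f C) = length C"
  by (induction C rule: rev_induct) (auto simp: vertex_values_snoc, simp add: vertex_values_def)

lemma take_vertex_values: "take i (vertex_values f C) = vertex_values f (take i C)"
proof (induction C rule: rev_induct)
  case Nil
  show ?case by (simp add: vertex_values_def)
next
  case (snoc G C)
  then show ?case by (cases "i \<le> length C") (auto simp: vertex_values_snoc)
qed

lemma vertex_values_nth:
  assumes "i < length C"
  shows "vertex_values f C ! i = f (take i (vertex_values f C)) (C ! i)"
proof -
  have "vertex_values f C ! i = take (Suc i) (vertex_values f C) ! i" by simp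
  also have "\<dots> = vertex_values f (take i C @ [C ! i]) ! i"
    using assms by (simp only: take_vertex_values take_Suc_conv_app_nth)
  also have "\<dots> = f (vertex_values f (take i C)) (C ! i)"
    using assms by (simp add: vertex_values_snoc nth_append)
  finally show ?thesis by (simp add: take_vertex_values)
qed

definition gate_value :: "nat set \<Rightarrow> circuit \<Rightarrow> nat \<Rightarrow> bool" where
  "gate_value S C i = vertex_values (gate_eval S) C ! i"

lemma gate_eval_cong: "(\<And>j. j \<in> set (fan_in G) \<Longrightarrow> vs ! j = ws ! j) \<Longrightarrow> gate_eval S vs G = gate_eval S ws G"
  by (cases G) auto

lemma gate_value_unfold:
  assumes "wf_circuit C" "i < length C"
  shows "gate_value S C i = gate_eval S (vertex_values (gate_eval S) C) (C ! i)"
  unfolding gate_value_def vertex_values_nth[OF assms(2)]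
  using assms by (intro gate_eval_cong) (auto simp: wf_circuit_def)

lemma gate_value_simps:
  assumes "wf_circuit C" "i < length C"
  shows "C ! i = LIT b v \<Longrightarrow> gate_value S C i \<longleftrightarrow> (v \<in> S) = b"
    and "C ! i = NOT j \<Longrightarrow> gate_value S C i \<longleftrightarrow> \<not> gate_value S C j"
    and "C ! i = AND js \<Longrightarrow> gate_value S C i \<longleftrightarrow> (\<forall>j\<in>set js. gate_value S C j)"
    and "C ! i = OR js \<Longrightarrow> gate_value S C i \<longleftrightarrow> (\<exists>j\<in>set js. gate_value S C j)"
  using gate_value_unfold[OF assms] by (auto simp: gate_value_def)

lemma satisfies_gate_value: "C \<noteq> [] \<Longrightarrow> satisfies S C \<longleftrightarrow> gate_value S C (length C - 1)"
proof -
  assume "C \<noteq> []"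
  then have "vertex_values (gate_eval S) C \<noteq> []" by (metis length_0_conv length_vertex_values)
  then show ?thesis by (simp add: satisfies_def gate_value_def last_conv_nth)
qed

text \<open>Any potential that increases along the wires by the counted gates bounds the count, so
  depth and weft are estimated without evaluating the maximum.\<close>

lemma max_on_path_le:
  assumes "wf_circuit C"
    and "\<And>i j. i < length C \<Longrightarrow> j \<in> set (fan_in (C ! i)) \<Longrightarrow> of_bool (P (C ! i)) + \<rho> j \<le> \<rho> i"
    and "\<And>i. i < length C \<Longrightarrow> of_bool (P (C ! i)) \<le> \<rho> i"
  shows "max_on_path P C \<le> \<rho> (length C - 1)"
proof -
  define f :: "nat list \<Rightarrow> gate \<Rightarrow> nat"
    where "f vs G = of_bool (P G) + Max (insert 0 ((\<lambda>j. vs ! j) ` set (fan_in G)))" for vs G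
  have "vertex_values f C ! i \<le> \<rho> i" if "i < length C" for i
    using that
  proof (induction i rule: less_induct)
    case (less i)
    have "of_bool (P (C ! i)) + Max (insert 0 ((\<lambda>j. take i (vertex_values f C) ! j) ` set (fan_in (C ! i)))) \<le> \<rho> i"
    proof -
      have "of_bool (P (C ! i)) + y \<le> \<rho> i" if "y \<in> insert 0 ((\<lambda>j. take i (vertex_values f C) ! j) ` set (fan_in (C ! i)))" for y
      proof (cases "y = 0")
        case True
        then show ?thesis using assms(3) less.prems by simp
      next
        case False
        with that have "y \<in> (\<lambda>j. take i (vertex_values f C) ! j) ` set (fan_in (C ! i))" by blast
        then obtain j where j: "j \<in> set (fan_in (C ! i))" "y = take i (vertex_values f C) ! j" by blast
        then have "j < i" using assms(1) less.prems by (auto simp: wf_circuit_def)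
        then have "y \<le> \<rho> j" using less j by simp
        then show ?thesis using assms(2)[OF less.prems j(1)] by simp
      qed
      then show ?thesis using Max_in[of "insert 0 ((\<lambda>j. take i (vertex_values f C) ! j) ` set (fan_in (C ! i)))"] by blast
    qed
    then have "f (take i (vertex_values f C)) (C ! i) \<le> \<rho> i"
      by (simp only: f_def[of "take i (vertex_values f C)" "C ! i"])
    then show ?case unfolding vertex_values_nth[OF less.prems, of f] .
  qed
  moreover have "C \<noteq> []" using assms(1) by (simp add: wf_circuit_def)
  ultimately have "vertex_values f C ! (length C - 1) \<le> \<rho> (length C - 1)" by simp
  moreover have "last (vertex_values f C) = vertex_values f C ! (length C - 1)"
    using \<open>C \<noteq> []\<close> by (metis last_conv_nth length_0_conv length_vertex_values)
  ultimately show ?thesis unfolding max_on_path_def f_def by simp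
qed

lemma concat_nth_offset:
  "d < n \<Longrightarrow> j < length (L d) \<Longrightarrow> concat (map L [0..<n]) ! ((\<Sum>d'<d. length (L d')) + j) = L d ! j"
proof (induction n)
  case (Suc n)
  have len: "length (concat (map L [0..<n])) = (\<Sum>d'<n. length (L d'))" for n
    by (induction n) auto
  show ?case
  proof (cases "d = n")
    case True
    then show ?thesis using Suc.prems by (simp add: nth_append len[symmetric])
  next
    case False
    then have d: "d < n" using Suc.prems by simp
    have "(\<Sum>d'<d. length (L d')) + j < (\<Sum>d'<Suc d. length (L d'))" using Suc.prems by simp
    also have "\<dots> \<le> (\<Sum>d'<n. length (L d'))" using d by (intro sum_mono2) auto
    finally show ?thesis using Suc.IH[OF d Suc.prems(2)] by (simp add: nth_append len)
  qed
qed simp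

lemma sum_offset_cases:
  fixes s :: "nat \<Rightarrow> nat"
  shows "i < (\<Sum>d<n. s d) \<Longrightarrow> \<exists>d<n. \<exists>j<s d. i = (\<Sum>d'<d. s d') + j"
proof (induction n)
  case (Suc n)
  show ?case
  proof (cases "i < (\<Sum>d<n. s d)")
    case True
    then show ?thesis using Suc.IH less_SucI by blast
  next
    case False
    then show ?thesis using Suc.prems by (intro exI[of _ n]) (auto intro!: exI[of _ "i - (\<Sum>d<n. s d)"])
  qed
qed simp

lemma set_upt_offset: "set [a..<a + n] = (\<lambda>i. a + i) ` {..<n}"
proof -
  have "x \<in> (\<lambda>i. a + i) ` {..<n}" if "a \<le> x" "x < a + n" for x
    using that by (intro image_eqI[of _ _ "x - a"]) auto
  then show ?thesis by auto
qed

section \<open>Construction of the layered circuit\<close>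

definition level_offset :: "nat \<Rightarrow> nat \<Rightarrow> nat \<Rightarrow> nat \<Rightarrow> nat \<Rightarrow> nat" where
  "level_offset N Q R t d = N + Q + (\<Sum>d'<d. R ^ (t - d'))"

text \<open>Gate \<open>j\<close> has the children \<open>j * R, ..., j * R + R - 1\<close> one
  level below, so the index of a bottom gate spells in base \<open>R\<close> the path leading to it.
  Parity is counted from the top, which puts OR-gates directly below the root.\<close>

definition level_gate ::
  "nat \<Rightarrow> nat \<Rightarrow> nat \<Rightarrow> nat \<Rightarrow> nat \<Rightarrow> (nat \<Rightarrow> nat \<Rightarrow> bool) \<Rightarrow> nat \<Rightarrow> nat \<Rightarrow> gate" where
  "level_gate N V Q R t bt d j =
     (if d = 0 then OR (filter (bt j) [0..<Suc V])
      else if even (t - d) then OR [level_offset N Q R t (d - 1) + j * R..<level_offset N Q R t (d - 1) + j * R + R]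
      else AND [level_offset N Q R t (d - 1) + j * R..<level_offset N Q R t (d - 1) + j * R + R])"

text \<open>The literals \<open>V + 1, ..., N - 1\<close> enter no gate: they are the dummies that
  raise the admissible genus. The clauses hang directly from the root; next to them stand
  \<open>R ^ 2\<close> complete trees, with one bottom gate for each of the \<open>R ^ t\<close>
  strings of \<open>t\<close> digits.\<close>

definition layered_circuit ::
  "nat \<Rightarrow> nat \<Rightarrow> nat \<Rightarrow> nat \<Rightarrow> nat \<Rightarrow> (nat \<Rightarrow> nat \<Rightarrow> bool) \<Rightarrow> (nat \<Rightarrow> nat \<Rightarrow> bool) \<Rightarrow> circuit" where
  "layered_circuit N V Q R t cl bt =
     map (LIT True) [0..<N] @ map (\<lambda>c. OR (filter (cl c) [0..<Suc V])) [0..<Q] @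
     concat (map (\<lambda>d. map (level_gate N V Q R t bt d) [0..<R ^ (t - d)]) [0..<t - 1]) @
     [AND ([N..<N + Q] @ [level_offset N Q R t (t - 2)..<level_offset N Q R t (t - 2) + R ^ 2])]"

primrec level_value :: "nat \<Rightarrow> nat \<Rightarrow> (nat \<Rightarrow> bool) \<Rightarrow> nat \<Rightarrow> nat \<Rightarrow> bool" where
  "level_value R t p 0 j = p j"
| "level_value R t p (Suc d) j =
    (if even (t - Suc d) then \<exists>i<R. level_value R t p d (j * R + i) else \<forall>i<R. level_value R t p d (j * R + i))"

text \<open>Evenness of \<open>t\<close> makes the OR-gates at the bottom fit the alternation below
  an AND-gate; \<open>cl_ne\<close> and \<open>bt_V\<close> ensure that no OR-gate is without
  inputs.\<close>

locale layered =
  fixes N V Q R t :: nat and cl bt :: "nat \<Rightarrow> nat \<Rightarrow> bool"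
  assumes VN: "V < N" and R0: "0 < R" and t2: "2 \<le> t" and even_t: "even t"
    and cl_ne: "\<And>c. c < Q \<Longrightarrow> \<exists>r\<le>V. cl c r" and bt_V: "\<And>j. bt j V"
begin

abbreviation "off \<equiv> level_offset N Q R t"
abbreviation "C \<equiv> layered_circuit N V Q R t cl bt"

lemma off_Suc: "off (Suc d) = off d + R ^ (t - d)"
  by (simp add: level_offset_def)

lemma off_mono: "d \<le> d' \<Longrightarrow> off d \<le> off d'"
  unfolding level_offset_def by (intro add_left_mono sum_mono2) auto

lemma off_0: "off 0 = N + Q" by (simp add: level_offset_def)

lemma length_C: "length C = Suc (off (t - 1))"
  by (simp add: layered_circuit_def level_offset_def length_concat sum_list_sum_nth atLeast0LessThan)

lemma nth_lit: "i < N \<Longrightarrow> C ! i = LIT True i"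
  by (simp add: layered_circuit_def nth_append)

lemma nth_clause: "c < Q \<Longrightarrow> C ! (N + c) = OR (filter (cl c) [0..<Suc V])"
  by (simp add: layered_circuit_def nth_append del: upt_Suc)

lemma nth_level:
  assumes "d < t - 1" "j < R ^ (t - d)"
  shows "C ! (off d + j) = level_gate N V Q R t bt d j"
proof -
  let ?L = "\<lambda>d. map (level_gate N V Q R t bt d) [0..<R ^ (t - d)]"
  have "concat (map ?L [0..<t - 1]) ! ((\<Sum>d'<d. length (?L d')) + j) = ?L d ! j"
    using assms by (intro concat_nth_offset) auto
  moreover have "(\<Sum>d'<d. R ^ (t - d')) + j < (\<Sum>d'<t - 1. R ^ (t - d'))"
  proof -
    have "(\<Sum>d'<d. R ^ (t - d')) + j < (\<Sum>d'<Suc d. R ^ (t - d'))" using assms by simp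
    also have "\<dots> \<le> (\<Sum>d'<t - 1. R ^ (t - d'))" using assms by (intro sum_mono2) auto
    finally show ?thesis .
  qed
  moreover have "length (concat (map ?L [0..<t - 1])) = (\<Sum>d'<t - 1. R ^ (t - d'))"
    by (simp add: length_concat sum_list_sum_nth atLeast0LessThan)
  ultimately show ?thesis
    using assms by (simp add: layered_circuit_def nth_append level_offset_def add.assoc)
qed

lemma nth_root: "C ! off (t - 1) = AND ([N..<N + Q] @ [off (t - 2)..<off (t - 2) + R ^ 2])"
proof -
  have "C ! off (t - 1) = last C" using length_C by (metis diff_Suc_1 last_conv_nth length_0_conv nat.distinct(1))
  then show ?thesis by (simp add: layered_circuit_def)
qed

lemma vertex_cases:
  assumes "i < length C"
  obtains (lit) "i < N" | (clause) c where "c < Q" "i = N + c"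
  | (level) d j where "d < t - 1" "j < R ^ (t - d)" "i = off d + j" | (root) "i = off (t - 1)"
proof (cases "i < off (t - 1)")
  case False
  then show ?thesis using assms length_C root by simp
next
  case True
  show ?thesis
  proof (cases "i < N + Q")
    case True
    then show ?thesis using lit clause[of "i - N"] by (cases "i < N") auto
  next
    case False
    have "i - (N + Q) < (\<Sum>d<t - 1. R ^ (t - d))"
      using True False by (simp add: level_offset_def)
    from sum_offset_cases[OF this] obtain d j where
      "d < t - 1" "j < R ^ (t - d)" "i - (N + Q) = (\<Sum>d'<d. R ^ (t - d')) + j" by auto
    then show ?thesis using False level[of d j] by (simp add: level_offset_def)
  qed
qed

lemma fan_in_level_Suc:
  "0 < d \<Longrightarrow> set (fan_in (level_gate N V Q R t bt d j)) = {off (d - 1) + j * R..<off (d - 1) + j * R + R}"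
  by (simp add: level_gate_def)

lemma level_child:
  assumes "Suc d < t - 1" "j < R ^ (t - Suc d)" "i < R"
  shows "j * R + i < R ^ (t - d)"
proof -
  have "j * R + i < (j + 1) * R" using assms(3) by simp
  also have "\<dots> \<le> R ^ (t - Suc d) * R" using assms(2) by (intro mult_le_mono1) simp
  also have "\<dots> = R ^ (t - d)" using assms(1) by (metis Suc_diff_Suc Suc_lessD diff_le_self less_le_trans power_Suc2)
  finally show ?thesis .
qed

lemma child_cases:
  assumes "i < length C" "j \<in> set (fan_in (C ! i))"
  obtains (lit) "j \<le> V" "N \<le> i" "is_OR (C ! i)" "i < off (t - 1)" "i < off 1"
  | (level) d j' a where "Suc d < t - 1" "j' < R ^ (t - Suc d)" "i = off (Suc d) + j'" "a < R" "j = off d + (j' * R + a)"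
      "j' * R + a < R ^ (t - d)"
  | (root_clause) c where "i = off (t - 1)" "c < Q" "j = N + c"
  | (root_level) j' where "i = off (t - 1)" "j' < R ^ 2" "j = off (t - 2) + j'"
  using assms(1)
proof (cases rule: vertex_cases)
  case lit
  then show ?thesis using assms(2) nth_lit by simp
next
  case (clause c)
  then have "j \<le> V" using assms(2) nth_clause by (auto simp del: upt_Suc)
  moreover have "i < off 0" using clause off_0 by simp
  moreover have "off 0 \<le> off 1" "off 1 \<le> off (t - 1)" using t2 by (auto intro: off_mono)
  ultimately show ?thesis using that(1) clause nth_clause by simp
next
  case (level d j')
  show ?thesis
  proof (cases d)
    case 0
    then have "C ! i = OR (filter (bt j') [0..<Suc V])" using level nth_level by (simp add: level_gate_def)
    moreover from this have "j \<le> V" using assms(2) by (auto simp del: upt_Suc)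
    moreover have "i < off 1" using level 0 off_Suc[of 0] by simp
    moreover have "off 1 \<le> off (t - 1)" using t2 by (auto intro: off_mono)
    moreover have "N \<le> i" using level 0 off_0 by simp
    ultimately show ?thesis using that(1) by simp
  next
    case (Suc d')
    then have "j \<in> {off d' + j' * R..<off d' + j' * R + R}"
      using assms(2) level nth_level fan_in_level_Suc[of d j'] by simp
    then obtain a where "a < R" "j = off d' + (j' * R + a)"
      by (auto simp: add.assoc intro: that[of "j - (off d' + j' * R)"])
    then show ?thesis using that(2)[of d' j' a] level Suc level_child[of d' j' a] by simp
  qed
next
  case root
  then have "j \<in> {N..<N + Q} \<union> {off (t - 2)..<off (t - 2) + R ^ 2}" using assms(2) nth_root by simp
  then consider "j \<in> {N..<N + Q}" | "j \<in> {off (t - 2)..<off (t - 2) + R ^ 2}" by blast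
  then show ?thesis
  proof cases
    case 1
    then show ?thesis using root that(3)[of "j - N"] by auto
  next
    case 2
    then show ?thesis using root that(4)[of "j - off (t - 2)"] by auto
  qed
qed

lemma off_top: "off (t - 1) = off (t - 2) + R ^ 2"
  using off_Suc[of "t - 2"] t2 by (simp add: Suc_diff_Suc numeral_2_eq_2)

lemma t_diff: "t - (t - 2) = 2" using t2 by simp

lemma N_le_off: "N \<le> off d" by (simp add: level_offset_def)

lemma wf_C: "wf_circuit C"
  unfolding wf_circuit_def
proof (intro conjI allI impI ballI)
  show "C \<noteq> []" by (simp add: layered_circuit_def)
  fix i j assume ij: "i < length C" "j \<in> set (fan_in (C ! i))"
  then show "j < i"
  proof (cases rule: child_cases)
    case lit
    then show ?thesis using VN by simp
  next
    case (level d j' a)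
    then show ?thesis using off_Suc[of d] by simp
  next
    case (root_clause c)
    then show ?thesis using off_mono[of 0 "t - 1"] off_0 by simp
  next
    case (root_level j')
    then show ?thesis using off_top by simp
  qed
next
  fix G assume "G \<in> set C"
  then obtain i where i: "i < length C" "G = C ! i" by (auto simp: in_set_conv_nth)
  from i(1) have "distinct (fan_in G) \<and> (fan_in G = [] \<longrightarrow> is_LIT G)"
  proof (cases rule: vertex_cases)
    case lit
    then show ?thesis using i nth_lit by simp
  next
    case (clause c)
    then show ?thesis using i nth_clause cl_ne[of c] by (auto simp: filter_empty_conv simp del: upt_Suc)
  next
    case (level d j)
    then have "G = level_gate N V Q R t bt d j" using i nth_level by simp
    then show ?thesis
      using R0 bt_V[of j] by (auto simp: level_gate_def filter_empty_conv simp del: upt_Suc)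
  next
    case root
    have "N + Q \<le> off (t - 2)" using off_mono[of 0 "t - 2"] off_0 by simp
    then show ?thesis using i root nth_root R0 by auto
  qed
  then show "distinct (fan_in G)" "fan_in G = [] \<Longrightarrow> is_LIT G" by auto
next
  have "filter is_LIT (map (level_gate N V Q R t bt d) xs) = []" for d xs
    by (auto simp: filter_empty_conv level_gate_def)
  then have "filter is_LIT (concat (map (\<lambda>d. map (level_gate N V Q R t bt d) [0..<R ^ (t - d)]) [0..<n])) = []" for n
    by (induction n) auto
  moreover have "filter is_LIT (map (\<lambda>c. OR (filter (cl c) [0..<Suc V])) [0..<Q]) = []"
    by (auto simp: filter_empty_conv)
  moreover have "filter is_LIT (map (LIT True) [0..<N]) = map (LIT True) [0..<N]"
    by (auto simp: filter_id_conv)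
  ultimately have "filter is_LIT C = map (LIT True) [0..<N]"
    unfolding layered_circuit_def filter_append by simp
  then show "distinct (filter is_LIT C)" by (simp add: distinct_map inj_on_def)
qed

lemma is_level_gate:
  assumes "d < t - 1" "j < R ^ (t - d)"
  shows "is_OR (C ! (off d + j)) \<longleftrightarrow> even d" "is_AND (C ! (off d + j)) \<longleftrightarrow> odd d"
  using nth_level[OF assms] even_t assms(1) by (auto simp: level_gate_def)

lemma nonLIT: "is_OR (C ! i) \<or> is_AND (C ! i)" if "N \<le> i" "i < length C"
  using that(2)
proof (cases rule: vertex_cases)
  case lit
  then show ?thesis using that by simp
next
  case (clause c)
  then show ?thesis using nth_clause by simp
next
  case (level d j)
  then show ?thesis using is_level_gate[of d j] by blast
next
  case root
  then show ?thesis using nth_root by simp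
qed

lemma monotone_C: "monotone_circuit C"
  unfolding monotone_circuit_def
proof (intro allI impI)
  fix b v assume "LIT b v \<in> set C"
  then obtain i where i: "i < length C" "C ! i = LIT b v" by (auto simp: in_set_conv_nth)
  then have "i < N" using nonLIT[of i] by (cases "i < N") auto
  then show b using i nth_lit by simp
qed

lemma vars_C: "vars C = {..<N}"
proof -
  have "(\<exists>b. LIT b v \<in> set C) \<longleftrightarrow> v < N" for v
  proof
    assume "\<exists>b. LIT b v \<in> set C"
    then obtain i b where i: "i < length C" "C ! i = LIT b v" by (auto simp: in_set_conv_nth)
    then have "i < N" using nonLIT[of i] by (cases "i < N") auto
    then show "v < N" using i nth_lit by simp
  next
    assume v: "v < N"
    then have "v < length C" using length_C N_le_off[of "t - 1"] by simp
    then have "C ! v \<in> set C" by (rule nth_mem)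
    then show "\<exists>b. LIT b v \<in> set C" using nth_lit[OF v] by auto
  qed
  then show ?thesis by (auto simp: vars_def)
qed

text \<open>Height in the circuit, the potential for \<open>max_on_path_le\<close>; the greatest
  \<open>d\<close> with \<open>off d \<le> i\<close> recovers the level of vertex
  \<open>i\<close>.\<close>

definition rank :: "nat \<Rightarrow> nat" where
  "rank i = (if i < N then 0 else if i < N + Q then 1 else if i = off (t - 1) then t else Suc (GREATEST d. d < t - 1 \<and> off d \<le> i))"

lemma rank_level:
  assumes "d < t - 1" "j < R ^ (t - d)"
  shows "rank (off d + j) = Suc d"
proof -
  have "off d + j < off (Suc d)" using assms off_Suc by simp
  have "(GREATEST d'. d' < t - 1 \<and> off d' \<le> off d + j) = d"
  proof (rule Greatest_equality)
    fix d' assume d': "d' < t - 1 \<and> off d' \<le> off d + j"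
    show "d' \<le> d"
    proof (rule ccontr)
      assume "\<not> d' \<le> d"
      then have "off (Suc d) \<le> off d'" by (intro off_mono) simp
      then show False using d' \<open>off d + j < off (Suc d)\<close> by simp
    qed
  qed (use assms in simp)
  moreover have "N + Q \<le> off d + j" using off_mono[of 0 d] off_0 by simp
  moreover have "off d + j \<noteq> off (t - 1)"
    using \<open>off d + j < off (Suc d)\<close> off_mono[of "Suc d" "t - 1"] assms(1) by simp
  ultimately show ?thesis by (simp add: rank_def)
qed

lemma off_root_ge: "N + Q < off (t - 1)"
  using off_top off_mono[of 0 "t - 2"] off_0 zero_less_power[OF R0, of 2] by linarith

lemma rank_root: "rank (off (t - 1)) = t"
  using off_root_ge by (simp add: rank_def)

lemma depth_C: "depth C \<le> t"
proof -
  have "max_on_path (\<lambda>G. \<not> is_LIT G) C \<le> rank (length C - 1)"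
  proof (rule max_on_path_le[OF wf_C])
    fix i assume i: "i < length C"
    then show "of_bool (\<not> is_LIT (C ! i)) \<le> rank i"
    proof (cases rule: vertex_cases)
      case lit
      then show ?thesis using nth_lit by simp
    next
      case (clause c)
      then show ?thesis by (simp add: rank_def)
    next
      case (level d j)
      then show ?thesis using rank_level by simp
    next
      case root
      then show ?thesis using rank_root t2 by simp
    qed
    fix j assume "j \<in> set (fan_in (C ! i))"
    with i show "of_bool (\<not> is_LIT (C ! i)) + rank j \<le> rank i"
    proof (cases rule: child_cases)
      case lit
      then have "rank j = 0" using VN by (simp add: rank_def)
      moreover have "1 \<le> rank i" using lit t2 by (simp add: rank_def)
      ultimately show ?thesis by simp
    next
      case (level d j' a)
      then show ?thesis using rank_level[of "Suc d" j'] rank_level[of d "j' * R + a"] by simp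
    next
      case (root_clause c)
      then show ?thesis using rank_root t2 by (simp add: rank_def[of "N + c"])
    next
      case (root_level j')
      then have "rank j = Suc (t - 2)" using rank_level[of "t - 2" j'] t2 t_diff by simp
      moreover have "of_bool (\<not> is_LIT (C ! i)) \<le> (1::nat)" by simp
      moreover have "rank i = t" using rank_root root_level(1) by simp
      ultimately show ?thesis using t2 by linarith
    qed
  qed
  then show ?thesis using rank_root length_C by (simp add: depth_def)
qed

lemma outdegree_C:
  assumes "N \<le> j"
  shows "outdegree C j \<le> 1"
proof -
  \<comment> \<open>The only possible parent of \<open>j\<close>: the root for clauses and the
    topmost level, otherwise the gate whose index is that of \<open>j\<close> within its level
    divided by \<open>R\<close>.\<close>
  define p where "p = (if j < N + Q \<or> rank j = t - 1 then off (t - 1) else off (rank j) + (j - off (rank j - 1)) div R)"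
  have "i = p" if i: "i < length C" "j \<in> set (fan_in (C ! i))" for i
    using i
  proof (cases rule: child_cases)
    case lit
    then show ?thesis using assms VN by simp
  next
    case (level d j' a)
    have "rank j = Suc d" using rank_level[of d "j' * R + a"] level by simp
    moreover have "N + Q \<le> j" using level off_mono[of 0 d] off_0 by simp
    moreover have "(j - off d) div R = j'" using level by simp
    ultimately show ?thesis using level by (simp add: p_def)
  next
    case (root_clause c)
    then show ?thesis by (simp add: p_def)
  next
    case (root_level j')
    then have "rank j = Suc (t - 2)" using rank_level[of "t - 2" j'] t2 t_diff by simp
    then have "rank j = t - 1" using t2 by simp
    then show ?thesis using root_level(1) by (simp add: p_def)
  qed
  then have "{i. i < length C \<and> j \<in> set (fan_in (C ! i))} \<subseteq> {p}" by blast
  from card_mono[OF _ this] show ?thesis by (simp add: outdegree_def)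
qed

lemma Pi_C: "Pi_circuit t C"
  unfolding Pi_circuit_def
proof (intro conjI allI impI ballI wf_C depth_C)
  show "is_AND (last C)" by (simp add: layered_circuit_def)
  show "\<not> is_NOT G" if "G \<in> set C" for G
  proof -
    from that obtain i where i: "i < length C" "G = C ! i" by (auto simp: in_set_conv_nth)
    show ?thesis using nonLIT[of i] nth_lit[of i] i by (cases "i < N"; cases G) auto
  qed
  show "outdegree C j \<le> 1" if "j < length C" "\<not> is_LIT (C ! j)" for j
  proof (rule outdegree_C, rule ccontr)
    assume "\<not> N \<le> j"
    then show False using nth_lit[of j] that(2) by simp
  qed
  fix i j assume ij: "i < length C" "j \<in> set (fan_in (C ! i))"
  have "\<not> (is_AND (C ! i) \<and> is_AND (C ! j)) \<and> \<not> (is_OR (C ! i) \<and> is_OR (C ! j))"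
    using ij
  proof (cases rule: child_cases)
    case lit
    then show ?thesis using nth_lit[of j] VN by simp
  next
    case (level d j' a)
    then show ?thesis using is_level_gate[of "Suc d" j'] is_level_gate[of d "j' * R + a"] by auto
  next
    case (root_clause c)
    then show ?thesis using nth_root nth_clause by simp
  next
    case (root_level j')
    then show ?thesis using nth_root is_level_gate[of "t - 2" j'] t2 even_t by auto
  qed
  then show "\<not> (is_AND (C ! i) \<and> is_AND (C ! j))" "\<not> (is_OR (C ! i) \<and> is_OR (C ! j))" by auto
qed

lemma gate_value_lit: "r \<le> V \<Longrightarrow> gate_value S C r \<longleftrightarrow> r \<in> S"
  using gate_value_simps(1)[OF wf_C, of r True r S] nth_lit[of r] VN length_C N_le_off[of "t - 1"] by simp

lemma gate_value_level:
  assumes "d < t - 1" "j < R ^ (t - d)"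
  shows "gate_value S C (off d + j) \<longleftrightarrow> level_value R t (\<lambda>j. \<exists>r\<le>V. bt j r \<and> r \<in> S) d j"
  using assms
proof (induction d arbitrary: j)
  case 0
  have "off (Suc 0) \<le> off (t - 1)" using t2 by (intro off_mono) linarith
  then have "off 0 + j < length C" using 0 off_Suc[of 0] length_C by simp
  moreover have "C ! (off 0 + j) = OR (filter (bt j) [0..<Suc V])" using nth_level 0 by (simp add: level_gate_def)
  ultimately have "gate_value S C (off 0 + j) \<longleftrightarrow> (\<exists>r\<in>set (filter (bt j) [0..<Suc V]). gate_value S C r)"
    using gate_value_simps(4)[OF wf_C] by blast
  also have "\<dots> \<longleftrightarrow> (\<exists>r\<le>V. bt j r \<and> r \<in> S)" by (auto simp: gate_value_lit less_Suc_eq_le simp del: upt_Suc)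
  finally show ?case by simp
next
  case (Suc d)
  have i: "off (Suc d) + j < length C" using Suc.prems off_Suc[of "Suc d"] off_mono[of "Suc (Suc d)" "t - 1"] length_C by simp
  let ?js = "[off d + j * R..<off d + j * R + R]"
  have IH: "gate_value S C (off d + (j * R + a)) \<longleftrightarrow> level_value R t (\<lambda>j. \<exists>r\<le>V. bt j r \<and> r \<in> S) d (j * R + a)" if "a < R" for a
    using Suc.IH[of "j * R + a"] level_child[OF Suc.prems that] Suc.prems by simp
  have set: "set ?js = (\<lambda>a. off d + (j * R + a)) ` {..<R}"
    using set_upt_offset[of "off d + j * R" R] by (simp add: add.assoc)
  show ?case
  proof (cases "even (t - Suc d)")
    case True
    then have "C ! (off (Suc d) + j) = OR ?js" using nth_level[OF Suc.prems] by (simp add: level_gate_def)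
    from gate_value_simps(4)[OF wf_C i this]
    have "gate_value S C (off (Suc d) + j) \<longleftrightarrow> (\<exists>a<R. gate_value S C (off d + (j * R + a)))"
      unfolding set by blast
    also have "\<dots> \<longleftrightarrow> (\<exists>a<R. level_value R t (\<lambda>j. \<exists>r\<le>V. bt j r \<and> r \<in> S) d (j * R + a))"
      using IH by blast
    finally show ?thesis using True by simp
  next
    case False
    then have "C ! (off (Suc d) + j) = AND ?js" using nth_level[OF Suc.prems] by (simp add: level_gate_def)
    from gate_value_simps(3)[OF wf_C i this]
    have "gate_value S C (off (Suc d) + j) \<longleftrightarrow> (\<forall>a<R. gate_value S C (off d + (j * R + a)))"
      unfolding set by blast
    also have "\<dots> \<longleftrightarrow> (\<forall>a<R. level_value R t (\<lambda>j. \<exists>r\<le>V. bt j r \<and> r \<in> S) d (j * R + a))"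
      using IH by blast
    finally show ?thesis using False by simp
  qed
qed

lemma satisfies_C:
  "satisfies S C \<longleftrightarrow> (\<forall>c<Q. \<exists>r\<le>V. cl c r \<and> r \<in> S) \<and>
     (\<forall>j<R ^ 2. level_value R t (\<lambda>j. \<exists>r\<le>V. bt j r \<and> r \<in> S) (t - 2) j)"
proof -
  have ne: "C \<noteq> []" using length_C by auto
  have "satisfies S C \<longleftrightarrow> gate_value S C (off (t - 1))" using satisfies_gate_value[OF ne] length_C by simp
  also have "\<dots> \<longleftrightarrow> (\<forall>j\<in>set ([N..<N + Q] @ [off (t - 2)..<off (t - 2) + R ^ 2]). gate_value S C j)"
    using gate_value_simps(3)[OF wf_C _ nth_root] length_C by simp
  also have "set ([N..<N + Q] @ [off (t - 2)..<off (t - 2) + R ^ 2]) = (+) N ` {..<Q} \<union> (+) (off (t - 2)) ` {..<R ^ 2}"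
    unfolding set_append set_upt_offset ..
  also have "(\<forall>j\<in>\<dots>. gate_value S C j) \<longleftrightarrow> (\<forall>c<Q. gate_value S C (N + c)) \<and> (\<forall>j<R ^ 2. gate_value S C (off (t - 2) + j))"
    by auto
  also have "(\<forall>c<Q. gate_value S C (N + c)) \<longleftrightarrow> (\<forall>c<Q. \<exists>r\<le>V. cl c r \<and> r \<in> S)"
  proof -
    have "gate_value S C (N + c) \<longleftrightarrow> (\<exists>r\<le>V. cl c r \<and> r \<in> S)" if "c < Q" for c
    proof -
      have "N + c < length C" using that off_root_ge length_C by simp
      then have "gate_value S C (N + c) \<longleftrightarrow> (\<exists>r\<in>set (filter (cl c) [0..<Suc V]). gate_value S C r)"
        using gate_value_simps(4)[OF wf_C _ nth_clause[OF that]] by blast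
      then show ?thesis by (auto simp: gate_value_lit less_Suc_eq_le simp del: upt_Suc)
    qed
    then show ?thesis by blast
  qed
  also have "(\<forall>j<R ^ 2. gate_value S C (off (t - 2) + j)) \<longleftrightarrow> (\<forall>j<R ^ 2. level_value R t (\<lambda>j. \<exists>r\<le>V. bt j r \<and> r \<in> S) (t - 2) j)"
    using gate_value_level[of "t - 2"] t2 by simp
  finally show ?thesis .
qed

text \<open>The bound is free of \<open>N\<close>: without the root, edges join only the first
  \<open>V + 1\<close> literals and the gates. Hence dummies can be added without raising
  it.\<close>

lemma genus_C: "circuit_genus C \<le> 2 * (V + 1 + (off (t - 1) - N)) ^ 2"
proof -
  let ?E = "{{i, j} | i j. i < length C - 1 \<and> j \<in> set (fan_in (C ! i))}"
  let ?X = "{..V} \<union> {N..<off (t - 1)}"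
  have mem: "i \<in> ?X \<and> j \<in> ?X \<and> j < i" if ij: "i < length C - 1" "j \<in> set (fan_in (C ! i))" for i j
  proof -
    have i: "i < length C" "i < off (t - 1)" using ij length_C by auto
    have "j < i" using wf_C i ij by (auto simp: wf_circuit_def)
    moreover from i(1) ij(2) have "N \<le> i \<and> j \<in> ?X"
    proof (cases rule: child_cases)
      case (level d j' a)
      then show ?thesis using N_le_off[of "Suc d"] N_le_off[of d] \<open>j < i\<close> i by simp
    qed (use i in auto)
    ultimately show ?thesis using i by simp
  qed
  have "graph_genus {..<length C - 1} ?E \<le> 2 * card ?E"
  proof (rule graph_genus_le)
    fix e assume "e \<in> ?E"
    then obtain i j where ij: "e = {i, j}" "i < length C - 1" "j \<in> set (fan_in (C ! i))" by blast
    then show "\<exists>i j. e = {i, j} \<and> i < j \<and> j < length C - 1"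
      using mem[of i j] by (intro exI[of _ j] exI[of _ i]) auto
  qed
  moreover have "card ?E \<le> (V + 1 + (off (t - 1) - N)) ^ 2"
  proof -
    have "?E \<subseteq> (\<lambda>(i, j). {i, j}) ` (?X \<times> ?X)"
    proof
      fix e assume "e \<in> ?E"
      then obtain i j where ij: "e = {i, j}" "i < length C - 1" "j \<in> set (fan_in (C ! i))" by blast
      then show "e \<in> (\<lambda>(i, j). {i, j}) ` (?X \<times> ?X)" using mem[of i j] by blast
    qed
    then have "card ?E \<le> card ((\<lambda>(i, j). {i, j}) ` (?X \<times> ?X))" by (rule card_mono[rotated]) simp
    also have "\<dots> \<le> card (?X \<times> ?X)" by (rule card_image_le) simp
    also have "\<dots> = card ?X * card ?X" by (simp add: card_cartesian_product)
    also have "card ?X \<le> V + 1 + (off (t - 1) - N)" using card_Un_le[of "{..V}" "{N..<off (t - 1)}"] by simp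
    finally show ?thesis by (simp add: power2_eq_square mult_le_mono)
  qed
  ultimately show ?thesis unfolding circuit_genus_def by linarith
qed

end

subsection \<open>Choosing one value in every group\<close>

primrec alt :: "nat \<Rightarrow> bool \<Rightarrow> nat \<Rightarrow> (nat list \<Rightarrow> bool) \<Rightarrow> bool" where
  "alt R b 0 P = P []"
| "alt R b (Suc n) P = (if b then \<exists>g<R. alt R (\<not> b) n (\<lambda>gs. P (g # gs)) else \<forall>g<R. alt R (\<not> b) n (\<lambda>gs. P (g # gs)))"

lemma alt_cong:
  "(\<And>gs. length gs = n \<Longrightarrow> (\<forall>g\<in>set gs. g < R) \<Longrightarrow> P gs = P' gs) \<Longrightarrow> alt R b n P = alt R b n P'"
proof (induction n arbitrary: b P P')
  case (Suc n)
  have "alt R (\<not> b) n (\<lambda>gs. P (g # gs)) = alt R (\<not> b) n (\<lambda>gs. P' (g # gs))" if "g < R" for g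
    using that by (intro Suc.IH Suc.prems) auto
  then show ?case by auto
qed simp

lemma alt_const: "0 < R \<Longrightarrow> alt R b n (\<lambda>_. c) = c"
  by (induction n arbitrary: b) auto

text \<open>The most significant digit comes first, with \<open>horner R 0\<close> as inverse: the
  digits of a bottom gate are the choices on its path from the root.\<close>

definition digits :: "nat \<Rightarrow> nat \<Rightarrow> nat \<Rightarrow> nat list" where
  "digits R t j = map (\<lambda>p. j div R ^ (t - 1 - p) mod R) [0..<t]"

abbreviation horner :: "nat \<Rightarrow> nat \<Rightarrow> nat list \<Rightarrow> nat" where
  "horner R \<equiv> foldl (\<lambda>a g. a * R + g)"

lemma digits_snoc: "g < R \<Longrightarrow> digits R (Suc t) (j * R + g) = digits R t j @ [g]"
proof -
  assume g: "g < R"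
  have "(j * R + g) div R ^ (t - p) mod R = j div R ^ (t - 1 - p) mod R" if "p < t" for p
  proof -
    have "t - p = Suc (t - 1 - p)" using that by simp
    then have "(j * R + g) div R ^ (t - p) = (j * R + g) div R div R ^ (t - 1 - p)" by (simp add: div_mult2_eq)
    also have "(j * R + g) div R = j" using g by simp
    finally show ?thesis by simp
  qed
  then show ?thesis using g by (auto simp: digits_def)
qed

lemma digits_horner: "\<forall>g\<in>set gs. g < R \<Longrightarrow> digits R (length gs) (horner R 0 gs) = gs"
proof (induction gs rule: rev_induct)
  case Nil
  show ?case by (simp add: digits_def)
next
  case (snoc g gs)
  then show ?case by (simp add: digits_snoc)
qed

lemma level_value_alt:
  "d \<le> t \<Longrightarrow> level_value R t p d j \<longleftrightarrow> alt R (even (t - d)) d (\<lambda>gs. p (horner R j gs))"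
proof (induction d arbitrary: j)
  case (Suc d)
  then have "even (t - d) \<longleftrightarrow> \<not> even (t - Suc d)" by (simp add: Suc_diff_le)
  then show ?case using Suc by simp
qed simp

text \<open>The indices \<open>g * R + g'\<close> below the root stand for two universal quantifiers
  in a row. The outer one is split off, since it is going to be tied to the guessed index.\<close>

lemma all_level_value_alt:
  assumes "2 \<le> t" "even t" "0 < R"
  shows "(\<forall>j<R ^ 2. level_value R t (\<lambda>j. P (digits R t j)) (t - 2) j) \<longleftrightarrow>
    (\<forall>g<R. alt R False (t - 1) (\<lambda>gs. P (g # gs)))"
proof -
  have t: "t - 1 = Suc (t - 2)" "t - (t - 2) = 2" using assms(1) by auto
  have "level_value R t (\<lambda>j. P (digits R t j)) (t - 2) (g * R + g') \<longleftrightarrow> alt R True (t - 2) (\<lambda>gs. P (g # g' # gs))"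
    if "g < R" "g' < R" for g g'
  proof -
    have "level_value R t (\<lambda>j. P (digits R t j)) (t - 2) (g * R + g') \<longleftrightarrow>
      alt R True (t - 2) (\<lambda>gs. P (digits R t (horner R (g * R + g') gs)))"
      using level_value_alt[of "t - 2" t R] t(2) by simp
    also have "\<dots> \<longleftrightarrow> alt R True (t - 2) (\<lambda>gs. P (g # g' # gs))"
    proof (rule alt_cong)
      fix gs assume gs: "length gs = t - 2" "\<forall>x\<in>set gs. x < R"
      have len: "length (g # g' # gs) = t" using gs(1) assms(1) by simp
      have "\<forall>x\<in>set (g # g' # gs). x < R" using gs(2) that by simp
      from digits_horner[OF this] have "digits R t (horner R 0 (g # g' # gs)) = g # g' # gs"
        unfolding len .
      then show "P (digits R t (horner R (g * R + g') gs)) = P (g # g' # gs)" by simp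
    qed
    finally show ?thesis .
  qed
  moreover have "(\<forall>j<R ^ 2. Q j) \<longleftrightarrow> (\<forall>g<R. \<forall>g'<R. Q (g * R + g'))" for Q
  proof
    assume Q: "\<forall>j<R ^ 2. Q j"
    have "g * R + g' < R ^ 2" if "g < R" "g' < R" for g g'
    proof -
      have "g * R + g' < (g + 1) * R" using that by simp
      also have "\<dots> \<le> R * R" using that by (intro mult_le_mono1) simp
      finally show ?thesis by (simp add: power2_eq_square)
    qed
    then show "\<forall>g<R. \<forall>g'<R. Q (g * R + g')" using Q by blast
  next
    assume Q: "\<forall>g<R. \<forall>g'<R. Q (g * R + g')"
    show "\<forall>j<R ^ 2. Q j"
    proof (intro allI impI)
      fix j assume "j < R ^ 2"
      then have "j div R < R" by (simp add: less_mult_imp_div_less power2_eq_square)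
      then show "Q j" using Q[rule_format, of "j div R" "j mod R"] assms(3) by simp
    qed
  qed
  ultimately show ?thesis unfolding t(1) by simp
qed

text \<open>Variable \<open>J * B + v\<close> states that group \<open>J\<close> has value \<open>v\<close>. The variable \<open>K * B\<close> only keeps
  disjunctions nonempty: it is false since the weight is used up by the groups.\<close>

definition csp_clause :: "nat \<Rightarrow> nat \<Rightarrow> (nat \<Rightarrow> nat \<Rightarrow> bool) \<Rightarrow> nat \<Rightarrow> nat \<Rightarrow> bool" where
  "csp_clause K B allowed c r \<longleftrightarrow>
     (r = K * B \<and> c div K < K * B) \<or>
     (r < K * B \<and> ((c div K < K * B \<and> r div B = c div K div B \<and> r \<noteq> c div K) \<or>
                    (r div B = c mod K \<and> (c div K < K * B \<longrightarrow> allowed (c div K) r))))"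

definition csp_solution :: "nat \<Rightarrow> nat \<Rightarrow> (nat \<Rightarrow> nat \<Rightarrow> bool) \<Rightarrow> (nat \<Rightarrow> nat) \<Rightarrow> bool" where
  "csp_solution K B allowed ch \<longleftrightarrow> (\<forall>J<K. ch J < B) \<and>
     (\<forall>J<K. \<forall>J'<K. allowed (J * B + ch J) (J' * B + ch J'))"

lemma csp_var_less:
  assumes "J < (K::nat)" "c < B" shows "J * B + c < K * B"
proof -
  have "J * B + c < (J + 1) * B" using assms by simp
  also have "\<dots> \<le> K * B" using assms by (intro mult_le_mono1) simp
  finally show ?thesis .
qed

lemma csp_var_div_mod: "c < B \<Longrightarrow> (J * B + c) div B = J" "c < B \<Longrightarrow> (J * B + c) mod B = c" for B :: nat
  by simp_all

text \<open>Write \<open>c = q * K + J\<close>. For \<open>q = K * B\<close> the clause demands a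
  value for group \<open>J\<close>; these \<open>K\<close> demands and the weight \<open>K\<close>
  leave exactly one true variable per group and none besides. For \<open>q < K * B\<close> it says
  that \<open>q\<close> is compatible with the value of group \<open>J\<close>, and "not q" is
  expressed by the other variables of the group of \<open>q\<close>.\<close>

lemma csp_clauses:
  assumes S: "finite S" "card S = K" and B: "0 < B"
  shows "(\<forall>c<(K * B + 1) * K. \<exists>r\<le>K * B. csp_clause K B allowed c r \<and> r \<in> S) \<longleftrightarrow>
     (\<exists>ch. csp_solution K B allowed ch \<and> S = (\<lambda>J. J * B + ch J) ` {..<K})"
    (is "?L \<longleftrightarrow> ?R")
proof
  assume L: ?L
  have cl: "\<exists>r\<le>K * B. csp_clause K B allowed (q * K + J) r \<and> r \<in> S" if "q \<le> K * B" "J < K" for q J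
    using L csp_var_less[of q "K * B + 1" J K] that by simp
  have "\<exists>r\<in>S. r < K * B \<and> r div B = J" if "J < K" for J
  proof -
    have "(K * B * K + J) div K = K * B" "(K * B * K + J) mod K = J" using that by simp_all
    then show ?thesis using cl[OF le_refl that] by (auto simp: csp_clause_def)
  qed
  then obtain rr where rr: "\<And>J. J < K \<Longrightarrow> rr J \<in> S \<and> rr J < K * B \<and> rr J div B = J" by metis
  have "inj_on rr {..<K}" by (rule inj_onI) (metis lessThan_iff rr)
  then have "card (rr ` {..<K}) = K" by (simp add: card_image)
  moreover have "rr ` {..<K} \<subseteq> S" using rr by auto
  ultimately have Seq: "S = rr ` {..<K}" using S by (metis card_subset_eq)
  define ch where "ch J = rr J mod B" for J
  have rch: "J * B + ch J = rr J" if "J < K" for J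
    using rr[OF that] div_mult_mod_eq[of "rr J" B] by (simp add: ch_def)
  have uniq: "r = rr (r div B)" if "r \<in> S" for r
    using that rr unfolding Seq by auto
  have "allowed (rr J) (rr J')" if J: "J < K" "J' < K" for J J'
  proof -
    have "rr J < K * B" using rr[OF J(1)] by simp
    moreover have "(rr J * K + J') div K = rr J" "(rr J * K + J') mod K = J'" using J by simp_all
    ultimately obtain r where r: "r \<in> S" "r = K * B \<or> (r < K * B \<and> (r div B = J \<and> r \<noteq> rr J \<or> r div B = J' \<and> allowed (rr J) r))"
      using cl[of "rr J" J'] J rr[OF J(1)] by (auto simp: csp_clause_def)
    obtain J0 where "J0 < K" "r = rr J0" using r(1) Seq by blast
    then have "r \<noteq> K * B" using rr[of J0] by simp
    then show ?thesis using r uniq[OF r(1)] by auto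
  qed
  then have "csp_solution K B allowed ch"
    unfolding csp_solution_def using rch B by (auto simp: ch_def)
  moreover have "S = (\<lambda>J. J * B + ch J) ` {..<K}" unfolding Seq using rch by (intro image_cong) auto
  ultimately show ?R by blast
next
  assume ?R
  then obtain ch where ch: "\<And>J. J < K \<Longrightarrow> ch J < B" "\<And>J J'. J < K \<Longrightarrow> J' < K \<Longrightarrow> allowed (J * B + ch J) (J' * B + ch J')"
    and Seq: "S = (\<lambda>J. J * B + ch J) ` {..<K}" by (auto simp: csp_solution_def)
  show ?L
  proof (intro allI impI)
    fix c assume c: "c < (K * B + 1) * K"
    then have K: "0 < K" by (cases K) auto
    define q J' where "q = c div K" and "J' = c mod K"
    have J': "J' < K" using K by (simp add: J'_def)
    have lt: "J * B + ch J < K * B" "(J * B + ch J) div B = J" "J * B + ch J \<in> S" if "J < K" for J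
      using csp_var_less[OF that ch(1)[OF that]] ch(1)[OF that] that by (auto simp: Seq)
    show "\<exists>r\<le>K * B. csp_clause K B allowed c r \<and> r \<in> S"
    proof (cases "q < K * B")
      case False
      then show ?thesis
        using lt[OF J'] by (intro exI[of _ "J' * B + ch J'"]) (auto simp: csp_clause_def q_def J'_def)
    next
      case True
      define J where "J = q div B"
      have J: "J < K" using True by (simp add: J_def less_mult_imp_div_less)
      show ?thesis
      proof (cases "q = J * B + ch J")
        case True
        have "allowed q (J' * B + ch J')" using ch(2)[OF J J'] True by simp
        then show ?thesis
          using lt[OF J'] by (intro exI[of _ "J' * B + ch J'"]) (auto simp: csp_clause_def q_def J'_def)
      next
        case False
        then show ?thesis
          using lt[OF J] \<open>q < K * B\<close> by (intro exI[of _ "J * B + ch J"]) (auto simp: csp_clause_def q_def J_def)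
      qed
    qed
  qed
qed

definition csp_circuit ::
  "nat \<Rightarrow> nat \<Rightarrow> nat \<Rightarrow> nat \<Rightarrow> nat \<Rightarrow> (nat \<Rightarrow> nat \<Rightarrow> bool) \<Rightarrow> (nat list \<Rightarrow> nat \<Rightarrow> bool) \<Rightarrow> circuit" where
  "csp_circuit N K B R t allowed lf =
     layered_circuit N (K * B) ((K * B + 1) * K) R t (csp_clause K B allowed)
       (\<lambda>j r. r = K * B \<or> (r < K * B \<and> lf (digits R t j) r))"

text \<open>Counts the vertices that can be endpoints of edges after the output is removed; its
  square enters the genus bound.\<close>

definition csp_size :: "nat \<Rightarrow> nat \<Rightarrow> nat \<Rightarrow> nat \<Rightarrow> nat" where
  "csp_size K B R t = K * B + 1 + ((K * B + 1) * K + (\<Sum>d<t - 1. R ^ (t - d)))"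

lemma csp_circuit:
  fixes allowed :: "nat \<Rightarrow> nat \<Rightarrow> bool" and lf :: "nat list \<Rightarrow> nat \<Rightarrow> bool"
  assumes "K * B < N" "0 < B" "0 < R" "2 \<le> t" "even t"
  defines "C \<equiv> csp_circuit N K B R t allowed lf"
  shows "Pi_circuit t C" "monotone_circuit C" "vars C = {..<N}"
    "circuit_genus C \<le> 2 * csp_size K B R t ^ 2"
    "weight_satisfiable C K \<longleftrightarrow> (\<exists>ch. csp_solution K B allowed ch \<and>
       (\<forall>g<R. alt R False (t - 1) (\<lambda>gs. \<exists>J<K. lf (g # gs) (J * B + ch J))))"
proof -
  interpret layered N "K * B" "(K * B + 1) * K" R t "csp_clause K B allowed"
    "\<lambda>j r. r = K * B \<or> (r < K * B \<and> lf (digits R t j) r)"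
  proof
    fix c assume c: "c < (K * B + 1) * K"
    then have K: "0 < K" by (cases K) auto
    show "\<exists>r\<le>K * B. csp_clause K B allowed c r"
    proof (cases "c div K < K * B")
      case True
      then show ?thesis by (intro exI[of _ "K * B"]) (auto simp: csp_clause_def)
    next
      case False
      have "c mod K < K" using K by simp
      then show ?thesis
        using False csp_var_less[of "c mod K" K 0 B] assms(2)
        by (intro exI[of _ "c mod K * B"]) (auto simp: csp_clause_def)
    qed
  qed (use assms in auto)
  have Ceq: "C = layered_circuit N (K * B) ((K * B + 1) * K) R t (csp_clause K B allowed)
       (\<lambda>j r. r = K * B \<or> (r < K * B \<and> lf (digits R t j) r))"
    by (simp add: C_def csp_circuit_def)
  show "Pi_circuit t C" "monotone_circuit C" "vars C = {..<N}"
    unfolding Ceq by (rule Pi_C monotone_C vars_C)+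
  have "off (t - 1) - N = (K * B + 1) * K + (\<Sum>d<t - 1. R ^ (t - d))" by (simp add: level_offset_def)
  then show "circuit_genus C \<le> 2 * csp_size K B R t ^ 2"
    using genus_C unfolding Ceq csp_size_def by simp
  have sat: "satisfies S C \<longleftrightarrow> (\<exists>ch. csp_solution K B allowed ch \<and> S = (\<lambda>J. J * B + ch J) ` {..<K}) \<and>
     (\<forall>g<R. alt R False (t - 1) (\<lambda>gs. \<exists>r\<le>K * B. (r = K * B \<or> (r < K * B \<and> lf (g # gs) r)) \<and> r \<in> S))"
    if "finite S" "card S = K" for S
    unfolding Ceq satisfies_C csp_clauses[OF that assms(2)]
    using all_level_value_alt[OF assms(4,5,3), of "\<lambda>gs. \<exists>r\<le>K * B. (r = K * B \<or> (r < K * B \<and> lf gs r)) \<and> r \<in> S"] by simp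
  have leaf: "(\<exists>r\<le>K * B. (r = K * B \<or> (r < K * B \<and> lf gs r)) \<and> r \<in> (\<lambda>J. J * B + ch J) ` {..<K}) \<longleftrightarrow>
      (\<exists>J<K. lf gs (J * B + ch J))" if ch: "csp_solution K B allowed ch" for ch gs
  proof -
    have "J * B + ch J < K * B" if "J < K" for J
      using csp_var_less[OF that] ch that by (simp add: csp_solution_def)
    note lt = this
    show ?thesis
    proof
      assume "\<exists>r\<le>K * B. (r = K * B \<or> (r < K * B \<and> lf gs r)) \<and> r \<in> (\<lambda>J. J * B + ch J) ` {..<K}"
      then obtain r where r: "r = K * B \<or> (r < K * B \<and> lf gs r)" "r \<in> (\<lambda>J. J * B + ch J) ` {..<K}" by blast
      from r(2) obtain J where "J < K" "r = J * B + ch J" by blast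
      with r(1) have "J < K" "J * B + ch J = K * B \<or> lf gs (J * B + ch J)" by auto
      then show "\<exists>J<K. lf gs (J * B + ch J)" using lt[of J] by auto
    next
      assume "\<exists>J<K. lf gs (J * B + ch J)"
      then obtain J where "J < K" "lf gs (J * B + ch J)" by blast
      then show "\<exists>r\<le>K * B. (r = K * B \<or> (r < K * B \<and> lf gs r)) \<and> r \<in> (\<lambda>J. J * B + ch J) ` {..<K}"
        using lt[of J] by (intro exI[of _ "J * B + ch J"]) auto
    qed
  qed
  show "weight_satisfiable C K \<longleftrightarrow> (\<exists>ch. csp_solution K B allowed ch \<and>
       (\<forall>g<R. alt R False (t - 1) (\<lambda>gs. \<exists>J<K. lf (g # gs) (J * B + ch J))))"
  proof
    assume "weight_satisfiable C K"
    then obtain S where S: "S \<subseteq> {..<N}" "card S = K" "satisfies S C"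
      using \<open>vars C = {..<N}\<close> by (auto simp: weight_satisfiable_def)
    have fin: "finite S" using S(1) by (rule finite_subset) simp
    obtain ch where ch: "csp_solution K B allowed ch" "S = (\<lambda>J. J * B + ch J) ` {..<K}"
      and al: "\<forall>g<R. alt R False (t - 1) (\<lambda>gs. \<exists>r\<le>K * B. (r = K * B \<or> (r < K * B \<and> lf (g # gs) r)) \<and> r \<in> S)"
      using S(3) sat[OF fin S(2)] by blast
    show "\<exists>ch. csp_solution K B allowed ch \<and>
       (\<forall>g<R. alt R False (t - 1) (\<lambda>gs. \<exists>J<K. lf (g # gs) (J * B + ch J)))"
      using ch(1) al unfolding ch(2) leaf[OF ch(1)] by blast
  next
    assume "\<exists>ch. csp_solution K B allowed ch \<and>
       (\<forall>g<R. alt R False (t - 1) (\<lambda>gs. \<exists>J<K. lf (g # gs) (J * B + ch J)))"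
    then obtain ch where ch: "csp_solution K B allowed ch" and
      al: "\<forall>g<R. alt R False (t - 1) (\<lambda>gs. \<exists>J<K. lf (g # gs) (J * B + ch J))" by blast
    define S where "S = (\<lambda>J. J * B + ch J) ` {..<K}"
    have chB: "ch J < B" if "J < K" for J using ch that by (simp add: csp_solution_def)
    have "inj_on (\<lambda>J. J * B + ch J) {..<K}"
    proof (rule inj_onI)
      fix J J' assume J: "J \<in> {..<K}" "J' \<in> {..<K}" "J * B + ch J = J' * B + ch J'"
      then have "(J * B + ch J) div B = (J' * B + ch J') div B" by simp
      then show "J = J'" using csp_var_div_mod(1)[OF chB] J(1,2) by simp
    qed
    then have card: "card S = K" by (simp add: S_def card_image)
    have "S \<subseteq> {..<N}" unfolding S_def using csp_var_less[OF _ chB] assms(1) by fastforce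
    moreover have "satisfies S C"
      using sat[of S] card ch al leaf[OF ch] by (auto simp: S_def)
    ultimately show "weight_satisfiable C K"
      using card \<open>vars C = {..<N}\<close> by (auto simp: weight_satisfiable_def)
  qed
qed

section \<open>Sets described by their gaps\<close>

definition gaps :: "nat \<Rightarrow> nat \<Rightarrow> nat set \<Rightarrow> (nat \<Rightarrow> nat) \<Rightarrow> bool" where
  "gaps k M S U \<longleftrightarrow> U 0 = 0 \<and> U (k + 1) = M - 1 \<and> (\<forall>i\<le>k. U i < U (i + 1)) \<and> S = (\<lambda>i. U i - 1) ` {1..k}"

lemma gaps_less: "gaps k M S U \<Longrightarrow> i < j \<Longrightarrow> j \<le> k + 1 \<Longrightarrow> U i < U j"
proof (induction j)
  case (Suc j)
  have "U j < U (Suc j)" using Suc.prems by (simp add: gaps_def)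
  then show ?case using Suc by (cases "i = j") auto
qed simp

lemma gaps_pos: "gaps k M S U \<Longrightarrow> 1 \<le> i \<Longrightarrow> i \<le> k + 1 \<Longrightarrow> 1 \<le> U i"
  using gaps_less[of k M S U 0 i] by simp

lemma gaps_card: "gaps k M S U \<Longrightarrow> card S = k"
proof -
  assume g: "gaps k M S U"
  have "inj_on (\<lambda>i. U i - 1) {1..k}"
  proof (rule linorder_inj_onI')
    fix i j assume ij: "i \<in> {1..k}" "j \<in> {1..k}" "i < j"
    then have "U i < U j" "1 \<le> U i" using gaps_less[OF g] gaps_pos[OF g] by auto
    then show "U i - 1 \<noteq> U j - 1" by simp
  qed
  then show ?thesis using g by (simp add: gaps_def card_image)
qed

lemma gaps_mem: "gaps k M S U \<Longrightarrow> v \<in> S \<longleftrightarrow> (\<exists>i\<le>k. U i = v + 1)"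
proof
  assume g: "gaps k M S U" and "v \<in> S"
  then obtain i where "i \<in> {1..k}" "v = U i - 1" by (auto simp: gaps_def)
  then show "\<exists>i\<le>k. U i = v + 1" using gaps_pos[OF g, of i] by (intro exI[of _ i]) auto
next
  assume g: "gaps k M S U" and "\<exists>i\<le>k. U i = v + 1"
  then obtain i where i: "i \<le> k" "U i = v + 1" by blast
  have "U 0 = 0" using g by (simp add: gaps_def)
  then have "i \<noteq> 0" using i(2) by (intro notI) simp
  then show "v \<in> S" using g i by (auto simp: gaps_def intro!: image_eqI[of _ _ i])
qed

text \<open>The witness is the last \<open>i\<close> with \<open>U i \<le> v + 1\<close>; the upper
  sentinel exceeds \<open>v + 1\<close>, so the right end of that gap does too. Absence from
  \<open>S\<close> thereby becomes a statement about the form of one gap.\<close>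

lemma gaps_not_mem:
  assumes g: "gaps k M S U" and v: "v + 1 < M - 1"
  shows "v \<notin> S \<longleftrightarrow> (\<exists>i\<le>k. U i < v + 1 \<and> v + 1 < U (i + 1))"
proof
  assume nv: "v \<notin> S"
  have "U 0 \<le> v + 1" using g by (simp add: gaps_def)
  moreover have bound: "\<And>y. y \<le> k \<and> U y \<le> v + 1 \<Longrightarrow> y \<le> k" by simp
  ultimately obtain i where i: "i \<le> k" "U i \<le> v + 1" and max: "\<And>j. j \<le> k \<Longrightarrow> U j \<le> v + 1 \<Longrightarrow> j \<le> i"
    using Greatest_le_nat[of "\<lambda>y. y \<le> k \<and> U y \<le> v + 1" _ k] GreatestI_nat[of "\<lambda>y. y \<le> k \<and> U y \<le> v + 1" 0 k] by blast
  have "v + 1 < U (i + 1)"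
  proof (cases "i = k")
    case True
    then show ?thesis using g v by (simp add: gaps_def)
  next
    case False
    then show ?thesis using max[of "i + 1"] i(1) by (cases "U (i + 1) \<le> v + 1") auto
  qed
  moreover have "U i \<noteq> v + 1" using gaps_mem[OF g] nv i(1) by blast
  ultimately show "\<exists>i\<le>k. U i < v + 1 \<and> v + 1 < U (i + 1)" using i by (intro exI[of _ i]) auto
next
  assume "\<exists>i\<le>k. U i < v + 1 \<and> v + 1 < U (i + 1)"
  then obtain i where i: "i \<le> k" "U i < v + 1" "v + 1 < U (i + 1)" by blast
  show "v \<notin> S"
  proof
    assume "v \<in> S"
    then obtain j where j: "j \<le> k" "U j = v + 1" using gaps_mem[OF g] by blast
    have "\<not> j < i" "i \<noteq> j" using gaps_less[OF g, of j i] i j by auto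
    moreover have "\<not> i + 1 < j" "j \<noteq> i + 1" using gaps_less[OF g, of "i + 1" j] i j by auto
    ultimately show False by simp
  qed
qed

lemma gaps_exists:
  assumes "finite S" "card S = k" "\<And>v. v \<in> S \<Longrightarrow> v + 1 < M - 1" "2 \<le> M"
  shows "\<exists>U. gaps k M S U"
proof -
  define xs where "xs = map Suc (sorted_list_of_set S)"
  define ys where "ys = 0 # xs @ [M - 1]"
  have len: "length xs = k" using assms(1,2) by (simp add: xs_def)
  have "sorted_wrt (<) xs" unfolding xs_def by (simp add: sorted_wrt_map)
  moreover have set: "set xs = Suc ` S" using assms(1) by (simp add: xs_def)
  ultimately have "sorted_wrt (<) ys"
    using assms(3,4) by (auto simp: ys_def sorted_wrt_append)
  then have step: "ys ! i < ys ! (i + 1)" if "i \<le> k" for i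
    using that len sorted_wrt_nth_less[of "(<)" ys i "i + 1"] by (simp add: ys_def)
  have "(\<lambda>i. ys ! i - 1) ` {1..k} = S"
  proof -
    have "(\<lambda>i. ys ! i - 1) ` {1..k} = (\<lambda>i. xs ! i - 1) ` {..<k}"
    proof -
      have "{1..k} = Suc ` {..<k}" by (simp add: image_Suc_lessThan)
      then have "(\<lambda>i. ys ! i - 1) ` {1..k} = (\<lambda>i. ys ! Suc i - 1) ` {..<k}" by (simp add: image_image)
      also have "\<dots> = (\<lambda>i. xs ! i - 1) ` {..<k}"
        using len by (intro image_cong) (auto simp: ys_def nth_append)
      finally show ?thesis .
    qed
    also have "\<dots> = (\<lambda>x. x - 1) ` ((!) xs ` {..<k})" by (simp add: image_image)
    also have "(!) xs ` {..<k} = Suc ` S" using len set by (metis atLeast0LessThan nth_image order_refl take_all_iff)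
    finally show ?thesis by (simp add: image_image)
  qed
  then show ?thesis
    using step len by (intro exI[of _ "(!) ys"]) (auto simp: gaps_def ys_def nth_append)
qed

text \<open>Group 0 holds a guessed index, groups \<open>1, \<dots>, k + 1\<close> hold the pairs of consecutive elements of
  the chosen set (shifted by one, between the sentinels 0 and \<open>M - 1\<close>), and the remaining groups
  hold values that are checked against these gaps.\<close>

definition slot_ok ::
  "nat \<Rightarrow> nat \<Rightarrow> nat \<Rightarrow> (nat \<Rightarrow> bool) \<Rightarrow> (nat \<Rightarrow> nat \<Rightarrow> nat \<Rightarrow> nat \<Rightarrow> nat \<Rightarrow> bool) \<Rightarrow>
   nat \<Rightarrow> nat \<Rightarrow> nat \<Rightarrow> nat \<Rightarrow> bool" where
  "slot_ok k M R isv xc J v J' v' \<longleftrightarrow>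
     (J = 0 \<longrightarrow> v < R) \<and>
     (1 \<le> J \<and> J \<le> k + 1 \<longrightarrow>
        v div M < v mod M \<and> (J = 1 \<longrightarrow> v div M = 0) \<and> (J \<noteq> 1 \<longrightarrow> isv (v div M - 1)) \<and>
        (J = k + 1 \<longrightarrow> v mod M = M - 1) \<and>
        (J' = J + 1 \<and> J \<le> k \<longrightarrow> v mod M = v' div M) \<and>
        (k + 2 \<le> J' \<longrightarrow> xc (J - 1) (v div M) (v mod M) (J' - (k + 2)) v'))"

text \<open>The guess is tested negatively: a bottom gate is satisfied at once if group 0 holds a
  value other than \<open>hd gs\<close>. So only the branch of the guessed index imposes a
  condition, and a universal quantifier does the work of an existential one.\<close>

definition slot_leaf ::
  "nat \<Rightarrow> nat \<Rightarrow> (nat list \<Rightarrow> nat \<Rightarrow> nat \<Rightarrow> bool) \<Rightarrow> nat list \<Rightarrow> nat \<Rightarrow> bool" where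
  "slot_leaf k B cert gs r \<longleftrightarrow>
     (r div B = 0 \<and> r mod B \<noteq> hd gs) \<or> (k + 2 \<le> r div B \<and> cert gs (r div B - (k + 2)) (r mod B))"

text \<open>Binary constraints suffice: neighbouring gap groups agree on their common endpoint, and
  each further group is compared with every gap separately. From a solution, \<open>U\<close> is
  read off the left endpoints \<open>ch (i + 1) div M\<close>.\<close>

lemma slot_solution:
  fixes k M B R :: nat and xc :: "nat \<Rightarrow> nat \<Rightarrow> nat \<Rightarrow> nat \<Rightarrow> nat \<Rightarrow> bool"
  assumes M: "2 \<le> M" and isv: "\<And>v. isv v \<Longrightarrow> v + 1 < M - 1" and B: "M * M \<le> B" "R \<le> B" and R: "0 < R"
  defines "allowed \<equiv> \<lambda>q r. slot_ok k M R isv xc (q div B) (q mod B) (r div B) (r mod B)"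
  shows "(\<exists>ch. csp_solution (k + 2 + E) B allowed ch \<and>
       (\<forall>g<R. alt R False n (\<lambda>gs. \<exists>J<k + 2 + E. slot_leaf k B cert (g # gs) (J * B + ch J)))) \<longleftrightarrow>
     (\<exists>S U g x. S \<subseteq> Collect isv \<and> gaps k M S U \<and> g < R \<and> (\<forall>e<E. x e < B \<and> (\<forall>i\<le>k. xc i (U i) (U (i + 1)) e (x e))) \<and>
       alt R False n (\<lambda>gs. \<exists>e<E. cert (g # gs) e (x e)))"
    (is "?L \<longleftrightarrow> ?R")
proof -
  let ?K = "k + 2 + E"
  have B0: "0 < B" using R B by simp
  have sol: "csp_solution ?K B allowed ch \<longleftrightarrow> (\<forall>J<?K. ch J < B) \<and> (\<forall>J<?K. \<forall>J'<?K. slot_ok k M R isv xc J (ch J) J' (ch J'))" for ch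
    unfolding csp_solution_def allowed_def
    by (rule conj_cong[OF refl]) (simp add: csp_var_div_mod)
  have leaf: "(\<exists>J<?K. slot_leaf k B cert (g # gs) (J * B + ch J)) \<longleftrightarrow> ch 0 \<noteq> g \<or> (\<exists>e<E. cert (g # gs) e (ch (k + 2 + e)))"
    if "\<forall>J<?K. ch J < B" for ch g gs
  proof -
    have "slot_leaf k B cert (g # gs) (J * B + ch J) \<longleftrightarrow> (J = 0 \<and> ch J \<noteq> g) \<or> (k + 2 \<le> J \<and> cert (g # gs) (J - (k + 2)) (ch J))"
      if "J < ?K" for J
      unfolding slot_leaf_def csp_var_div_mod(1)[OF \<open>\<forall>J<?K. ch J < B\<close>[rule_format, OF that]]
        csp_var_div_mod(2)[OF \<open>\<forall>J<?K. ch J < B\<close>[rule_format, OF that]] by auto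
    then have "(\<exists>J<?K. slot_leaf k B cert (g # gs) (J * B + ch J)) \<longleftrightarrow>
       (\<exists>J<?K. (J = 0 \<and> ch J \<noteq> g) \<or> (k + 2 \<le> J \<and> cert (g # gs) (J - (k + 2)) (ch J)))" by blast
    also have "\<dots> \<longleftrightarrow> ch 0 \<noteq> g \<or> (\<exists>J<?K. k + 2 \<le> J \<and> cert (g # gs) (J - (k + 2)) (ch J))" by auto
    also have "(\<exists>J<?K. k + 2 \<le> J \<and> cert (g # gs) (J - (k + 2)) (ch J)) \<longleftrightarrow> (\<exists>e<E. cert (g # gs) e (ch (k + 2 + e)))"
    proof
      assume "\<exists>J<?K. k + 2 \<le> J \<and> cert (g # gs) (J - (k + 2)) (ch J)"
      then obtain J where J: "J < ?K" "k + 2 \<le> J" "cert (g # gs) (J - (k + 2)) (ch J)" by blast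
      have "J - (k + 2) < E" "k + 2 + (J - (k + 2)) = J" using J(1,2) by linarith+
      then show "\<exists>e<E. cert (g # gs) e (ch (k + 2 + e))" using J(3) by metis
    next
      assume "\<exists>e<E. cert (g # gs) e (ch (k + 2 + e))"
      then obtain e where "e < E" "cert (g # gs) e (ch (k + 2 + e))" by blast
      then show "\<exists>J<?K. k + 2 \<le> J \<and> cert (g # gs) (J - (k + 2)) (ch J)" by (intro exI[of _ "k + 2 + e"]) auto
    qed
    finally show ?thesis .
  qed
  \<comment> \<open>Branches with \<open>g\<close> different from the guess hold trivially, so the
    quantifier over \<open>g\<close> collapses to the value \<open>ch 0\<close>.\<close>
  have al: "(\<forall>g<R. alt R False n (\<lambda>gs. \<exists>J<?K. slot_leaf k B cert (g # gs) (J * B + ch J))) \<longleftrightarrow>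
      (ch 0 < R \<longrightarrow> alt R False n (\<lambda>gs. \<exists>e<E. cert (ch 0 # gs) e (ch (k + 2 + e))))" if ch: "\<forall>J<?K. ch J < B" for ch
  proof -
    have "alt R False n (\<lambda>gs. ch 0 \<noteq> g \<or> (\<exists>e<E. cert (g # gs) e (ch (k + 2 + e)))) \<longleftrightarrow>
        (ch 0 = g \<longrightarrow> alt R False n (\<lambda>gs. \<exists>e<E. cert (ch 0 # gs) e (ch (k + 2 + e))))" for g
      by (cases "ch 0 = g") (auto simp: alt_const[OF R])
    then show ?thesis unfolding leaf[OF ch] by auto
  qed
  show ?thesis
  proof
    assume ?L
    then obtain ch where chB: "\<forall>J<?K. ch J < B" and
      ok: "\<And>J J'. J < ?K \<Longrightarrow> J' < ?K \<Longrightarrow> slot_ok k M R isv xc J (ch J) J' (ch J')" and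
      AL: "\<forall>g<R. alt R False n (\<lambda>gs. \<exists>J<?K. slot_leaf k B cert (g # gs) (J * B + ch J))"
      unfolding sol by blast
    have g: "ch 0 < R" using ok[of 0 0] by (simp add: slot_ok_def)
    define U where "U i = (if i \<le> k then ch (i + 1) div M else M - 1)" for i
    have W: "ch (i + 1) mod M = U (i + 1)" if "i \<le> k" for i
    proof (cases "i = k")
      case True
      then show ?thesis using ok[of "i + 1" 0] by (simp add: slot_ok_def U_def)
    next
      case False
      then show ?thesis using that ok[of "i + 1" "i + 2"] by (auto simp: slot_ok_def U_def)
    qed
    have step: "U i < U (i + 1)" if "i \<le> k" for i
    proof -
      have "ch (i + 1) div M < ch (i + 1) mod M" using that ok[of "i + 1" 0] by (auto simp: slot_ok_def)
      then show ?thesis using W[OF that] that by (simp add: U_def)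
    qed
    have U0: "U 0 = 0" using ok[of 1 0] by (auto simp: slot_ok_def U_def)
    define S where "S = (\<lambda>i. U i - 1) ` {1..k}"
    have "isv (U i - 1)" if "i \<in> {1..k}" for i
      using that ok[of "i + 1" 0] by (auto simp: slot_ok_def U_def)
    then have "S \<subseteq> Collect isv" by (auto simp: S_def)
    moreover have "gaps k M S U" using U0 step by (auto simp: gaps_def S_def U_def)
    moreover have "xc i (U i) (U (i + 1)) e (ch (k + 2 + e))" if "e < E" "i \<le> k" for e i
      using ok[of "i + 1" "k + 2 + e"] that W[of i] by (auto simp: slot_ok_def U_def)
    ultimately show ?R
      using g chB AL unfolding al[OF chB]
      by (intro exI[of _ S] exI[of _ U] exI[of _ "ch 0"] exI[of _ "\<lambda>e. ch (k + 2 + e)"]) auto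
  next
    assume ?R
    then obtain S U g x where S: "S \<subseteq> Collect isv" and gp: "gaps k M S U" and g: "g < R" and
      x: "\<And>e. e < E \<Longrightarrow> x e < B" "\<And>e i. e < E \<Longrightarrow> i \<le> k \<Longrightarrow> xc i (U i) (U (i + 1)) e (x e)" and
      AL: "alt R False n (\<lambda>gs. \<exists>e<E. cert (g # gs) e (x e))" by blast
    define ch where "ch J = (if J = 0 then g else if J \<le> k + 1 then U (J - 1) * M + U J else x (J - (k + 2)))" for J
    have UM: "U i < M" if "i \<le> k + 1" for i
    proof (cases "i = k + 1")
      case True
      then show ?thesis using gp M by (simp add: gaps_def)
    next
      case False
      then show ?thesis using gaps_less[OF gp, of i "k + 1"] that gp M by (simp add: gaps_def)
    qed
    have dm: "ch J div M = U (J - 1)" "ch J mod M = U J" if "1 \<le> J" "J \<le> k + 1" for J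
      using that UM[of J] by (auto simp: ch_def)
    have chB: "\<forall>J<?K. ch J < B"
    proof (intro allI impI)
      fix J assume J: "J < ?K"
      consider "J = 0" | "1 \<le> J" "J \<le> k + 1" | "k + 2 \<le> J" by linarith
      then show "ch J < B"
      proof cases
        case 1
        then show ?thesis using g B by (simp add: ch_def)
      next
        case 2
        then have "U (J - 1) * M + U J < M * M" using UM by (intro csp_var_less) auto
        then show ?thesis using 2 B(1) by (simp add: ch_def)
      next
        case 3
        then show ?thesis using J x(1)[of "J - (k + 2)"] by (simp add: ch_def)
      qed
    qed
    have "slot_ok k M R isv xc J (ch J) J' (ch J')" if J: "J < ?K" "J' < ?K" for J J'
      unfolding slot_ok_def
    proof (intro conjI impI; (elim conjE)?)
      assume "J = 0"
      then show "ch J < R" using g by (simp add: ch_def)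
    next
      assume J1: "1 \<le> J" "J \<le> k + 1"
      show "ch J div M < ch J mod M"
        using dm[OF J1] gp J1 unfolding gaps_def by (metis Suc_eq_plus1 Suc_pred' le_diff_conv less_eq_Suc_le not_less_eq_eq One_nat_def)
      show "ch J div M = 0" if "J = 1" using dm[OF J1] that gp by (simp add: gaps_def)
      show "isv (ch J div M - 1)" if "J \<noteq> 1"
      proof -
        have "J - 1 \<in> {1..k}" using J1 that by auto
        then have "U (J - 1) - 1 \<in> S" using gp unfolding gaps_def by blast
        then show ?thesis using dm[OF J1] S by auto
      qed
      show "ch J mod M = M - 1" if "J = k + 1" using dm[OF J1] that gp by (simp add: gaps_def)
      show "ch J mod M = ch J' div M" if "J' = J + 1" "J \<le> k"
        using dm(2)[OF J1] dm(1)[of J'] that by simp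
      show "xc (J - 1) (ch J div M) (ch J mod M) (J' - (k + 2)) (ch J')" if "k + 2 \<le> J'"
        using x(2)[of "J' - (k + 2)" "J - 1"] dm[OF J1] J1 J that by (simp add: ch_def)
    qed
    with chB have "csp_solution ?K B allowed ch" unfolding sol by blast
    moreover have "\<forall>g<R. alt R False n (\<lambda>gs. \<exists>J<?K. slot_leaf k B cert (g # gs) (J * B + ch J))"
    proof -
      have "ch 0 = g" "\<And>e. ch (k + 2 + e) = x e" by (auto simp: ch_def)
      then show ?thesis unfolding al[OF chB] using AL by simp
    qed
    ultimately show ?L by blast
  qed
qed

subsection \<open>Writing the circuit\<close>

lemma emits_Nil: "3 \<le> a \<Longrightarrow> emits a (\<lambda>_ _. [])"
  using emits_for[OF feasible_const[of a 0], of "\<lambda>_ _ _. [True]"] emits_single by (auto dest: emits_ge_3)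

lemma emits_concat_const:
  "3 \<le> a \<Longrightarrow> (\<And>d. d < n \<Longrightarrow> emits a (\<lambda>I \<rho>. w d I \<rho>)) \<Longrightarrow> emits a (\<lambda>I \<rho>. concat (map (\<lambda>d. w d I \<rho>) [0..<n]))"
proof (induction n)
  case 0
  then show ?case by (simp add: emits_Nil)
next
  case (Suc n)
  have "emits a (\<lambda>I \<rho>. concat (map (\<lambda>d. w d I \<rho>) [0..<n]) @ w n I \<rho>)"
    by (rule emits_append) (use Suc in auto)
  then show ?case by simp
qed

lemma feasible_sum_const:
  fixes n :: nat
  shows "3 \<le> a \<Longrightarrow> (\<And>d. d < n \<Longrightarrow> feasible a (\<lambda>I \<rho>. f d I \<rho>)) \<Longrightarrow> feasible a (\<lambda>I \<rho>. \<Sum>d<n. f d I \<rho>)"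
  by (induction n) (auto intro: feasible_const feasible_add)

lemma feasibleP_all_const:
  fixes n :: nat
  shows "3 \<le> a \<Longrightarrow> (\<And>d. d < n \<Longrightarrow> feasibleP a (\<lambda>I \<rho>. P d I \<rho>)) \<Longrightarrow> feasibleP a (\<lambda>I \<rho>. \<forall>d<n. P d I \<rho>)"
  by (induction n) (auto simp: All_less_Suc intro: feasibleP_const feasibleP_conj)

lemmas feasible_rules = feasible_const feasible_param feasible_length feasible_add feasible_diff feasible_mult feasible_power feasible_pow2 feasible_if
  feasible_div feasible_mod feasibleP_less feasibleP_le feasibleP_eq feasibleP_not feasibleP_conj feasibleP_disj feasibleP_imp feasibleP_const

lemma feasibleP_if: "feasibleP a P \<Longrightarrow> feasibleP a Q \<Longrightarrow> feasibleP a Q' \<Longrightarrow> feasibleP a (\<lambda>I \<rho>. if P I \<rho> then Q I \<rho> else Q' I \<rho>)"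
  unfolding if_bool_eq_conj by (intro feasible_rules)

lemma encode_append: "encode (C @ D) = encode C @ encode D"
  by (simp add: encode_def)

lemma encode_map: "encode (map f xs) = concat (map (\<lambda>x. encode [f x]) xs)"
  by (induction xs) (auto simp: encode_def)

lemma encode_concat: "encode (concat (map f xs)) = concat (map (\<lambda>x. encode (f x)) xs)"
  by (induction xs) (auto simp: encode_append, simp add: encode_def)

lemma emits_gate_lits:
  assumes "feasible a n" "\<And>v b. a \<le> b \<Longrightarrow> feasible b v \<Longrightarrow> feasibleP b (\<lambda>I \<rho>. P I \<rho> (v I \<rho>))"
  shows "emits a (\<lambda>I \<rho>. encode [OR (filter (P I \<rho>) [0..<n I \<rho>])])"
proof -
  \<comment> \<open>The code of a gate is preceded by its length, so the literals are counted before
    they are listed; the extra 1 is for the kind number 4.\<close>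
  have eq: "encode [OR (filter p [0..<m])] = encode_nat ((\<Sum>i<m. of_bool (p i)) + 1) @ encode_nat 4 @
      concat (map (\<lambda>i. if p i then encode_nat i else []) [0..<m])" for p m
  proof -
    have "length (filter p [0..<m]) = (\<Sum>i<m. of_bool (p i))" by (induction m) auto
    moreover have "concat (map encode_nat (filter p [0..<m])) = concat (map (\<lambda>i. if p i then encode_nat i else []) [0..<m])"
      by (induction m) auto
    ultimately show ?thesis by (simp add: encode_def encode_nats_def)
  qed
  show ?thesis
    unfolding eq using assms feasible_ge_3[OF assms(1)]
    by (intro emits_append emits_encode_nat feasible_add feasible_sum feasible_const emits_for emits_if emits_Nil)
       (auto simp: feasibleP_def)
qed

lemma emits_gate_interval:
  assumes "feasible a f" "feasible a n"
  shows "emits a (\<lambda>I \<rho>. encode [OR [f I \<rho>..<f I \<rho> + n I \<rho>]])" "emits a (\<lambda>I \<rho>. encode [AND [f I \<rho>..<f I \<rho> + n I \<rho>]])"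
proof -
  have up: "concat (map encode_nat [s..<s + m]) = concat (map (\<lambda>i. encode_nat (s + i)) [0..<m])" for s m
    by (induction m) auto
  have 1: "encode [OR [s..<s + m]] = encode_nat (m + 1) @ encode_nat 4 @ concat (map (\<lambda>i. encode_nat (s + i)) [0..<m])" for s m
    by (simp add: encode_def encode_nats_def up)
  have 2: "encode [AND [s..<s + m]] = encode_nat (m + 1) @ encode_nat 3 @ concat (map (\<lambda>i. encode_nat (s + i)) [0..<m])" for s m
    by (simp add: encode_def encode_nats_def up)
  have f: "feasible b (\<lambda>I \<rho>. f I \<rho> + v I \<rho>)" if "a \<le> b" "feasible b v" for b v
    using that assms(1) by (intro feasible_add feasible_mono[of a f b])
  have loop: "emits a (\<lambda>I \<rho>. concat (map (\<lambda>i. encode_nat (f I \<rho> + i)) [0..<n I \<rho>]))"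
    by (intro emits_for emits_encode_nat f assms)
  show "emits a (\<lambda>I \<rho>. encode [OR [f I \<rho>..<f I \<rho> + n I \<rho>]])"
    unfolding 1 using assms feasible_ge_3[OF assms(1)]
    by (intro emits_append loop emits_encode_nat feasible_add feasible_const)
  show "emits a (\<lambda>I \<rho>. encode [AND [f I \<rho>..<f I \<rho> + n I \<rho>]])"
    unfolding 2 using assms feasible_ge_3[OF assms(1)]
    by (intro emits_append loop emits_encode_nat feasible_add feasible_const)
qed

lemma emits_root:
  assumes "feasible a f" "feasible a n" "feasible a g" "feasible a m"
  shows "emits a (\<lambda>I \<rho>. encode [AND ([f I \<rho>..<f I \<rho> + n I \<rho>] @ [g I \<rho>..<g I \<rho> + m I \<rho>])])"
proof -
  have up: "concat (map encode_nat [s..<s + m]) = concat (map (\<lambda>i. encode_nat (s + i)) [0..<m])" for s m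
    by (induction m) auto
  have 1: "encode [AND ([s..<s + m] @ [s'..<s' + m'])] = encode_nat (m + m' + 1) @ encode_nat 3 @
     concat (map (\<lambda>i. encode_nat (s + i)) [0..<m]) @ concat (map (\<lambda>i. encode_nat (s' + i)) [0..<m'])" for s m s' m'
    by (simp add: encode_def encode_nats_def up)
  have f: "feasible b (\<lambda>I \<rho>. f I \<rho> + v I \<rho>)" "feasible b (\<lambda>I \<rho>. g I \<rho> + v I \<rho>)" if "a \<le> b" "feasible b v" for b v
    using that assms by (auto intro!: feasible_add intro: feasible_mono[of a f b] feasible_mono[of a g b])
  have loop: "emits a (\<lambda>I \<rho>. concat (map (\<lambda>i. encode_nat (f I \<rho> + i)) [0..<n I \<rho>]))"
    "emits a (\<lambda>I \<rho>. concat (map (\<lambda>i. encode_nat (g I \<rho> + i)) [0..<m I \<rho>]))"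
    by (intro emits_for emits_encode_nat f assms; assumption)+
  show ?thesis
    unfolding 1 using assms feasible_ge_3[OF assms(1)]
    by (intro emits_append loop emits_encode_nat feasible_add feasible_const)
qed

text \<open>Since \<open>t\<close> is a constant, levels and digit strings are finite lists treated
  entry by entry, and \<open>lf\<close> takes a list of feasible functions; \<open>N\<close>,
  \<open>K\<close>, \<open>B\<close> and \<open>R\<close> depend on the input and are treated by
  loops.\<close>

lemma emits_csp_circuit:
  assumes N: "feasible 3 (\<lambda>I _. N I)" and K: "feasible 3 (\<lambda>I _. K I)" and B: "feasible 3 (\<lambda>I _. B I)" and R: "feasible 3 (\<lambda>I _. R I)"
    and allowed: "\<And>v w b. 3 \<le> b \<Longrightarrow> feasible b v \<Longrightarrow> feasible b w \<Longrightarrow> feasibleP b (\<lambda>I \<rho>. allowed I (v I \<rho>) (w I \<rho>))"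
    and lf: "\<And>vs w b. 3 \<le> b \<Longrightarrow> length vs = t \<Longrightarrow> (\<forall>v\<in>set vs. feasible b v) \<Longrightarrow> feasible b w \<Longrightarrow>
       feasibleP b (\<lambda>I \<rho>. lf I (map (\<lambda>v. v I \<rho>) vs) (w I \<rho>))"
  shows "emits 3 (\<lambda>I _. encode (csp_circuit (N I) (K I) (B I) (R I) t (allowed I) (lf I)))"
proof -
  have mN: "feasible b (\<lambda>I \<rho>. N I)" and mK: "feasible b (\<lambda>I \<rho>. K I)" and mB: "feasible b (\<lambda>I \<rho>. B I)" and mR: "feasible b (\<lambda>I \<rho>. R I)"
    if "3 \<le> b" for b using that N K B R feasible_mono by blast+
  note basic = mN mK mB mR
  define V where "V I = K I * B I" for I
  define Q where "Q I = (V I + 1) * K I" for I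
  define cl where "cl I = csp_clause (K I) (B I) (allowed I)" for I
  define bt where "bt I j r \<longleftrightarrow> r = V I \<or> (r < V I \<and> lf I (digits (R I) t j) r)" for I j r
  define off where "off d I = level_offset (N I) (Q I) (R I) t d" for d I
  have mV: "feasible b (\<lambda>I \<rho>. V I)" if "3 \<le> b" for b
    unfolding V_def using that by (intro feasible_mult basic)
  have mQ: "feasible b (\<lambda>I \<rho>. Q I)" if "3 \<le> b" for b
    unfolding Q_def using that by (intro feasible_mult feasible_add feasible_const basic mV)
  have moff: "feasible b (\<lambda>I \<rho>. off d I)" if "3 \<le> b" for b d
    unfolding off_def level_offset_def using that by (intro feasible_add feasible_sum_const feasible_power basic mQ)
  have mcl: "feasibleP b (\<lambda>I \<rho>. cl I (v I \<rho>) (w I \<rho>))" if "3 \<le> b" "feasible b v" "feasible b w" for b v w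
    unfolding cl_def csp_clause_def V_def[symmetric] using that by (intro feasible_rules basic mV allowed)
  have mbt: "feasibleP b (\<lambda>I \<rho>. bt I (v I \<rho>) (w I \<rho>))" if "3 \<le> b" "feasible b v" "feasible b w" for b v w
  proof -
    have "feasibleP b (\<lambda>I \<rho>. lf I (map (\<lambda>f. f I \<rho>) (map (\<lambda>p I \<rho>. v I \<rho> div R I ^ (t - 1 - p) mod R I) [0..<t])) (w I \<rho>))"
      using that by (intro lf) (auto intro!: feasible_rules basic)
    then have "feasibleP b (\<lambda>I \<rho>. lf I (digits (R I) t (v I \<rho>)) (w I \<rho>))" by (simp add: digits_def comp_def)
    then show ?thesis unfolding bt_def using that by (intro feasible_rules mV)
  qed
  have lits: "emits 3 (\<lambda>I \<rho>. concat (map (\<lambda>x. encode [LIT True x]) [0..<N I]))"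
  proof (intro emits_for mN)
    fix v b assume b: "3 \<le> b" "feasible b v"
    have eq: "encode [LIT True x] = encode_nat 2 @ encode_nat 1 @ encode_nat x" for x
      by (simp add: encode_def encode_nats_def numeral_2_eq_2)
    show "emits b (\<lambda>I \<rho>. encode [LIT True (v I \<rho>)])"
      unfolding eq using b by (intro emits_append emits_encode_nat feasible_const)
  qed simp
  have clauses: "emits 3 (\<lambda>I \<rho>. concat (map (\<lambda>c. encode [OR (filter (cl I c) [0..<Suc (V I)])]) [0..<Q I]))"
  proof (intro emits_for mQ)
    fix v b assume b: "3 \<le> b" "feasible b v"
    show "emits b (\<lambda>I \<rho>. encode [OR (filter (cl I (v I \<rho>)) [0..<Suc (V I)])])"
    proof (rule emits_gate_lits)
      show "feasible b (\<lambda>I \<rho>. Suc (V I))" unfolding Suc_eq_plus1 using b by (intro feasible_add feasible_const mV)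
      show "feasibleP c (\<lambda>I \<rho>. cl I (v I \<rho>) (w I \<rho>))" if "b \<le> c" "feasible c w" for w c
        using b that by (intro mcl) (auto intro: feasible_mono)
    qed
  qed simp
  have level: "emits 3 (\<lambda>I \<rho>. concat (map (\<lambda>j. encode [level_gate (N I) (V I) (Q I) (R I) t (bt I) d j]) [0..<R I ^ (t - d)]))" for d
  proof (intro emits_for feasible_power mR)
    fix v b assume b: "3 \<le> b" "feasible b v"
    show "emits b (\<lambda>I \<rho>. encode [level_gate (N I) (V I) (Q I) (R I) t (bt I) d (v I \<rho>)])"
    proof (cases "d = 0")
      case True
      have "emits b (\<lambda>I \<rho>. encode [OR (filter (bt I (v I \<rho>)) [0..<Suc (V I)])])"
      proof (rule emits_gate_lits)
        show "feasible b (\<lambda>I \<rho>. Suc (V I))" unfolding Suc_eq_plus1 using b by (intro feasible_add feasible_const mV)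
        show "feasibleP c (\<lambda>I \<rho>. bt I (v I \<rho>) (w I \<rho>))" if "b \<le> c" "feasible c w" for w c
          using b that by (intro mbt) (auto intro: feasible_mono)
      qed
      then show ?thesis using True by (simp add: level_gate_def del: upt_Suc)
    next
      case False
      have "feasible b (\<lambda>I \<rho>. off (d - 1) I + v I \<rho> * R I)" using b by (intro feasible_add feasible_mult moff mR)
      from emits_gate_interval[OF this mR[OF b(1)]] show ?thesis
        using False unfolding off_def level_gate_def by (cases "even (t - d)") simp_all
    qed
  qed simp
  have levels: "emits 3 (\<lambda>I \<rho>. concat (map (\<lambda>d. concat (map (\<lambda>j. encode [level_gate (N I) (V I) (Q I) (R I) t (bt I) d j]) [0..<R I ^ (t - d)])) [0..<t - 1]))"
    by (intro emits_concat_const level) simp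
  have root: "emits 3 (\<lambda>I \<rho>. encode [AND ([N I..<N I + Q I] @ [off (t - 2) I..<off (t - 2) I + R I ^ 2])])"
    by (intro emits_root mN mQ moff feasible_power mR) simp_all
  have eq: "encode (csp_circuit (N I) (K I) (B I) (R I) t (allowed I) (lf I)) =
      concat (map (\<lambda>x. encode [LIT True x]) [0..<N I]) @
      concat (map (\<lambda>c. encode [OR (filter (cl I c) [0..<Suc (V I)])]) [0..<Q I]) @
      concat (map (\<lambda>d. concat (map (\<lambda>j. encode [level_gate (N I) (V I) (Q I) (R I) t (bt I) d j]) [0..<R I ^ (t - d)])) [0..<t - 1]) @
      encode [AND ([N I..<N I + Q I] @ [off (t - 2) I..<off (t - 2) I + R I ^ 2])]" for I
    unfolding csp_circuit_def layered_circuit_def encode_append encode_concat encode_map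
      V_def Q_def cl_def bt_def[abs_def] off_def ..
  show ?thesis unfolding eq by (intro emits_append lits clauses levels root)
qed

subsection \<open>Parsing a circuit\<close>

text \<open>Every unary number ends in one \<open>False\<close>, so this counts the numbers
  completed before position \<open>a\<close>. The doubled guard gives the test the shape of
  \<open>feasibleP_bit\<close>.\<close>

definition falses :: "bool list \<Rightarrow> nat \<Rightarrow> nat" where
  "falses x a = (\<Sum>b<a. of_bool (b < length x \<and> \<not> (b < length x \<and> x ! b)))"

text \<open>The entries \<open>True\<close> preceded by exactly \<open>p\<close> terminators are the
  strokes of number \<open>p\<close>, counted from 0; a missing number reads as 0.\<close>

definition token :: "bool list \<Rightarrow> nat \<Rightarrow> nat" where
  "token x p = (\<Sum>a<length x. of_bool ((a < length x \<and> x ! a) \<and> falses x a = p))"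

lemma falses_Suc: "falses x (Suc a) = falses x a + of_bool (a < length x \<and> \<not> x ! a)"
  unfolding falses_def by auto

lemma sum_lessThan_add: "(\<Sum>a<m + n. f a) = (\<Sum>a<m. f a) + (\<Sum>b<n. f (m + b))" for m n :: nat
  by (induction n) (auto simp: add.assoc)

lemma falses_encode_nat:
  "a \<le> n \<Longrightarrow> falses (encode_nat n @ y) a = 0"
  "falses (encode_nat n @ y) (n + 1 + b) = 1 + falses y b"
proof -
  have T: "(encode_nat n @ y) ! a" if "a < n" for a
    using that by (simp add: encode_nat_def nth_append)
  have F: "\<not> (encode_nat n @ y) ! n" by (simp add: encode_nat_def nth_append)
  have len: "length (encode_nat n @ y) = n + 1 + length y" by (simp add: encode_nat_def)
  have 1: "falses (encode_nat n @ y) a = 0" if "a \<le> n" for a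
    unfolding falses_def using T that len by (intro sum.neutral) auto
  then show "a \<le> n \<Longrightarrow> falses (encode_nat n @ y) a = 0" .
  have y: "(encode_nat n @ y) ! (n + 1 + b) = y ! b" for b
    by (simp add: encode_nat_def nth_append)
  have "falses (encode_nat n @ y) (Suc n) = 1" unfolding falses_Suc using 1[of n] F len by simp
  then show "falses (encode_nat n @ y) (n + 1 + b) = 1 + falses y b"
  proof (induction b)
    case 0
    then show ?case by (simp add: falses_def)
  next
    case (Suc b)
    have "falses (encode_nat n @ y) (n + 1 + Suc b) = falses (encode_nat n @ y) (Suc (n + 1 + b))" by simp
    also have "\<dots> = falses (encode_nat n @ y) (n + 1 + b) + of_bool (n + 1 + b < n + 1 + length y \<and> \<not> y ! b)"
      unfolding falses_Suc len y ..
    also have "\<dots> = 1 + falses y b + of_bool (b < length y \<and> \<not> y ! b)" using Suc by simp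
    finally show ?case by (simp add: falses_Suc)
  qed
qed

lemma falses_concat: "falses (concat (map encode_nat ns)) (length (concat (map encode_nat ns))) = length ns"
proof (induction ns)
  case (Cons n ns)
  have "length (encode_nat n @ concat (map encode_nat ns)) = n + 1 + length (concat (map encode_nat ns))"
    by (simp add: encode_nat_def)
  then show ?case using Cons.IH falses_encode_nat(2)[of n "concat (map encode_nat ns)" "length (concat (map encode_nat ns))"]
    by (simp only: list.map concat.simps list.size)
qed (simp add: falses_def)

lemma token_concat: "token (concat (map encode_nat ns)) p = (if p < length ns then ns ! p else 0)"
proof (induction ns arbitrary: p)
  case Nil
  show ?case by (simp add: token_def)
next
  case (Cons n ns)
  define y where "y = concat (map encode_nat ns)"
  define x where "x = encode_nat n @ y"
  have len: "length x = n + 1 + length y" by (simp add: x_def encode_nat_def)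
  have 1: "x ! a \<and> falses x a = 0" if "a < n" for a
    using that falses_encode_nat(1)[of a n y] by (simp add: x_def encode_nat_def nth_append)
  have 2: "\<not> x ! n" by (simp add: x_def encode_nat_def nth_append)
  have 3: "x ! (n + 1 + b) = y ! b" "falses x (n + 1 + b) = 1 + falses y b" for b
    using falses_encode_nat(2)[of n y b] by (simp_all add: x_def encode_nat_def nth_append)
  have "token x p = (\<Sum>a<n + 1. of_bool ((a < length x \<and> x ! a) \<and> falses x a = p)) +
      (\<Sum>b<length y. of_bool ((n + 1 + b < length x \<and> x ! (n + 1 + b)) \<and> falses x (n + 1 + b) = p))"
    unfolding token_def len by (rule sum_lessThan_add)
  also have "(\<Sum>a<n + 1. of_bool ((a < length x \<and> x ! a) \<and> falses x a = p)) = (\<Sum>a<n. of_bool (p = 0) :: nat)"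
  proof -
    have "(\<Sum>a<n + 1. of_bool ((a < length x \<and> x ! a) \<and> falses x a = p)) =
        (\<Sum>a<n. of_bool ((a < length x \<and> x ! a) \<and> falses x a = p) :: nat)" using 2 by simp
    also have "\<dots> = (\<Sum>a<n. of_bool (p = 0))"
    proof (rule sum.cong[OF refl])
      fix a assume "a \<in> {..<n}"
      then show "of_bool ((a < length x \<and> x ! a) \<and> falses x a = p) = (of_bool (p = 0) :: nat)"
        using 1[of a] len by auto
    qed
    finally show ?thesis .
  qed
  also have "\<dots> = (if p = 0 then n else 0)" by simp
  also have "(\<Sum>b<length y. of_bool ((n + 1 + b < length x \<and> x ! (n + 1 + b)) \<and> falses x (n + 1 + b) = p)) =
      (if p = 0 then 0 else token y (p - 1))"
    unfolding 3 len token_def by (cases p) (auto intro!: sum.cong)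
  finally have "token x p = (if p = 0 then n else token y (p - 1))" by simp
  then show ?case using Cons.IH[of "p - 1"] by (cases p) (simp_all add: x_def y_def)
qed

text \<open>An index into the list of numbers, not into the string: a gate takes its length entry
  and as many further entries as that entry says.\<close>

definition gate_start :: "bool list \<Rightarrow> nat \<Rightarrow> nat" where
  "gate_start x i = rec_nat 0 (\<lambda>_ r. r + 1 + token x r) i"

definition num_gates :: "bool list \<Rightarrow> nat" where
  "num_gates x = (\<Sum>i<length x. of_bool (gate_start x i < falses x (length x)))"

definition gate_kind :: "bool list \<Rightarrow> nat \<Rightarrow> nat" where
  "gate_kind x i = token x (gate_start x i + 1)"

definition num_args :: "bool list \<Rightarrow> nat \<Rightarrow> nat" where
  "num_args x i = token x (gate_start x i) - 1"

definition gate_arg :: "bool list \<Rightarrow> nat \<Rightarrow> nat \<Rightarrow> nat" where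
  "gate_arg x i p = token x (gate_start x i + 2 + p)"

definition tokens :: "circuit \<Rightarrow> nat list" where
  "tokens C = concat (map (\<lambda>i. length (gate_code (C ! i)) # gate_code (C ! i)) [0..<length C])"

lemma encode_tokens: "encode C = concat (map encode_nat (tokens C))"
proof -
  have "encode D = concat (map encode_nat (concat (map (\<lambda>G. length (gate_code G) # gate_code G) D)))" for D
    by (induction D) (auto simp: encode_def encode_nats_def)
  moreover have "map (\<lambda>G. length (gate_code G) # gate_code G) C = map (\<lambda>i. length (gate_code (C ! i)) # gate_code (C ! i)) [0..<length C]"
    by (rule nth_equalityI) auto
  ultimately show ?thesis by (simp add: tokens_def)
qed

lemma token_encode: "token (encode C) p = (if p < length (tokens C) then tokens C ! p else 0)"
  unfolding encode_tokens by (rule token_concat)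

lemma length_tokens: "length (tokens C) = (\<Sum>i<length C. 1 + length (gate_code (C ! i)))"
  by (simp add: tokens_def length_concat sum_list_sum_nth atLeast0LessThan)

lemma sum_lessThan_mono: "i \<le> j \<Longrightarrow> (\<Sum>a<i. f a) \<le> (\<Sum>a<j. f a :: nat)" for i j :: nat
  by (intro sum_mono2) auto

lemma tokens_nth:
  assumes "i < length C" "q \<le> length (gate_code (C ! i))"
  defines "s \<equiv> \<Sum>i'<i. 1 + length (gate_code (C ! i'))"
  shows "s + q < length (tokens C)" "tokens C ! (s + q) = (length (gate_code (C ! i)) # gate_code (C ! i)) ! q"
proof -
  have "s + q < (\<Sum>i'<Suc i. 1 + length (gate_code (C ! i')))" using assms by simp
  also have "\<dots> \<le> length (tokens C)" unfolding length_tokens using assms(1) by (intro sum_lessThan_mono) simp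
  finally show "s + q < length (tokens C)" .
  show "tokens C ! (s + q) = (length (gate_code (C ! i)) # gate_code (C ! i)) ! q"
    using concat_nth_offset[of i "length C" q "\<lambda>i. length (gate_code (C ! i)) # gate_code (C ! i)"] assms
    by (simp add: tokens_def)
qed

lemma gate_start_encode:
  "i \<le> length C \<Longrightarrow> gate_start (encode C) i = (\<Sum>i'<i. 1 + length (gate_code (C ! i')))"
proof (induction i)
  case (Suc i)
  then have "gate_start (encode C) i = (\<Sum>i'<i. 1 + length (gate_code (C ! i')))" by simp
  moreover have "token (encode C) (\<Sum>i'<i. 1 + length (gate_code (C ! i'))) = length (gate_code (C ! i))"
    using tokens_nth[of i C 0] Suc.prems by (simp add: token_encode)
  ultimately show ?case by (simp add: gate_start_def)
qed (simp add: gate_start_def)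

lemma gate_start_mono: "i \<le> j \<Longrightarrow> gate_start x i \<le> gate_start x j"
  by (rule lift_Suc_mono_le[of "gate_start x"]) (auto simp: gate_start_def)

lemma length_le_encode: "length C \<le> length (encode C)"
  by (induction C) (auto simp: encode_def encode_nats_def encode_nat_def)

lemma num_gates_encode: "num_gates (encode C) = length C"
proof -
  have F: "falses (encode C) (length (encode C)) = length (tokens C)"
    unfolding encode_tokens by (rule falses_concat)
  have "gate_start (encode C) i < length (tokens C) \<longleftrightarrow> i < length C" for i
  proof
    assume "i < length C"
    then show "gate_start (encode C) i < length (tokens C)"
      using tokens_nth(1)[of i C 0] by (simp add: gate_start_encode)
  next
    assume *: "gate_start (encode C) i < length (tokens C)"
    show "i < length C"
    proof (rule ccontr)
      assume "\<not> i < length C"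
      then have "gate_start (encode C) (length C) \<le> gate_start (encode C) i" by (intro gate_start_mono) simp
      then show False using * by (simp add: gate_start_encode length_tokens)
    qed
  qed
  then have "num_gates (encode C) = (\<Sum>i<length (encode C). of_bool (i < length C))" by (simp add: num_gates_def F)
  also have "\<dots> = card {i. i < length (encode C) \<and> i < length C}" by (simp add: of_bool_def sum.If_cases Int_def)
  also have "{i. i < length (encode C) \<and> i < length C} = {..<length C}" using length_le_encode[of C] by auto
  finally show ?thesis by simp
qed

lemma gate_code_parse:
  assumes "i < length C"
  shows "num_args (encode C) i = length (gate_code (C ! i)) - 1"
    "gate_kind (encode C) i = gate_code (C ! i) ! 0"
    "p + 1 < length (gate_code (C ! i)) \<Longrightarrow> gate_arg (encode C) i p = gate_code (C ! i) ! (p + 1)"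
proof -
  have st: "gate_start (encode C) i = (\<Sum>i'<i. 1 + length (gate_code (C ! i')))" using assms by (intro gate_start_encode) simp
  show "num_args (encode C) i = length (gate_code (C ! i)) - 1"
    using tokens_nth[OF assms, of 0] by (simp add: num_args_def token_encode st)
  have ne: "gate_code (C ! i) \<noteq> []" by (cases "C ! i") auto
  then have "1 \<le> length (gate_code (C ! i))" by (cases "gate_code (C ! i)") auto
  then show "gate_kind (encode C) i = gate_code (C ! i) ! 0"
    using tokens_nth[OF assms, of 1] by (simp add: gate_kind_def token_encode st)
  show "gate_arg (encode C) i p = gate_code (C ! i) ! (p + 1)" if "p + 1 < length (gate_code (C ! i))"
    using tokens_nth[OF assms, of "p + 2"] that by (simp add: gate_arg_def token_encode st add.assoc)
qed

lemma gate_parse: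
  assumes "i < length C"
  shows "C ! i = LIT b v \<Longrightarrow> gate_kind (encode C) i = of_bool b \<and> gate_arg (encode C) i 0 = v"
    and "C ! i = NOT j \<Longrightarrow> gate_kind (encode C) i = 2 \<and> num_args (encode C) i = 1 \<and> gate_arg (encode C) i 0 = j"
    and "C ! i = AND js \<Longrightarrow> gate_kind (encode C) i = 3 \<and> num_args (encode C) i = length js \<and> (\<forall>p<length js. gate_arg (encode C) i p = js ! p)"
    and "C ! i = OR js \<Longrightarrow> gate_kind (encode C) i = 4 \<and> num_args (encode C) i = length js \<and> (\<forall>p<length js. gate_arg (encode C) i p = js ! p)"
  using gate_code_parse[OF assms] by auto

lemma feasible_falses: "feasible a v \<Longrightarrow> feasible a (\<lambda>I \<rho>. falses (fst I) (v I \<rho>))"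
proof -
  assume v: "feasible a v"
  have "feasibleP b (\<lambda>I \<rho>. w I \<rho> < length (fst I) \<and> \<not> (w I \<rho> < length (fst I) \<and> fst I ! w I \<rho>))" if "feasible b w" for b w
    using that feasible_ge_3[OF that] by (intro feasibleP_conj feasibleP_less feasibleP_not feasibleP_bit feasible_length)
  then show ?thesis
    unfolding falses_def by (intro feasible_sum v) (simp add: feasibleP_def)
qed

lemma feasible_token: "feasible a v \<Longrightarrow> feasible a (\<lambda>I \<rho>. token (fst I) (v I \<rho>))"
proof -
  assume v: "feasible a v"
  have "feasibleP b (\<lambda>I \<rho>. (w I \<rho> < length (fst I) \<and> fst I ! w I \<rho>) \<and> falses (fst I) (w I \<rho>) = v I \<rho>)" if "a \<le> b" "feasible b w" for b w
    using that feasible_mono[OF v that(1)] by (intro feasibleP_conj feasibleP_eq feasibleP_bit feasible_falses)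
  then show ?thesis
    unfolding token_def by (intro feasible_sum feasible_length feasible_ge_3[OF v]) (simp add: feasibleP_def)
qed

text \<open>Keeps the recursion for \<open>gate_start\<close> polynomial, and bounds all variable
  names and arguments by the input length.\<close>

lemma token_le_length: "token x p \<le> length x"
proof -
  have "token x p \<le> (\<Sum>a<length x. 1)" unfolding token_def by (intro sum_mono) simp
  then show ?thesis by simp
qed

lemma feasible_gate_start: "feasible a v \<Longrightarrow> feasible a (\<lambda>I \<rho>. gate_start (fst I) (v I \<rho>))"
proof -
  assume v: "feasible a v"
  note a3 = feasible_ge_3[OF v]
  show ?thesis
    unfolding gate_start_def
  proof (rule feasible_rec[OF v feasible_const[OF a3], where M="\<lambda>I \<rho>. v I \<rho> * (length (fst I) + 1)"])
    show "feasible b (\<lambda>I \<rho>. wa I \<rho> + 1 + token (fst I) (wa I \<rho>))" if "a \<le> b" "feasible b va" "feasible b wa" for va wa b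
      using that by (intro feasible_add feasible_const feasible_token feasible_ge_3[of b va])
    show "poly_bounded a (\<lambda>I \<rho>. v I \<rho> * (length (fst I) + 1))"
      by (intro poly_bounded_mult poly_bounded_add poly_bounded_const feasible_poly_bounded[OF v le_refl]
          feasible_poly_bounded[OF feasible_length[OF a3] le_refl])
    fix x :: "bool list" and k \<rho> i assume "i \<le> v (x, k) \<rho>"
    have "rec_nat 0 (\<lambda>_ r. r + 1 + token x r) i \<le> i * (length x + 1)"
    proof (induction i)
      case (Suc i)
      then show ?case using token_le_length[of x "rec_nat 0 (\<lambda>_ r. r + 1 + token x r) i"] by simp
    qed simp
    also have "\<dots> \<le> v (x, k) \<rho> * (length x + 1)" using \<open>i \<le> v (x, k) \<rho>\<close> by (rule mult_le_mono1)
    finally show "rec_nat 0 (\<lambda>_ r. r + 1 + token (fst (x, k)) r) i \<le> v (x, k) \<rho> * (length (fst (x, k)) + 1)" by simp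
  qed
qed

lemma feasible_num_gates: "3 \<le> a \<Longrightarrow> feasible a (\<lambda>I \<rho>. num_gates (fst I))"
proof -
  assume a: "3 \<le> a"
  have "feasibleP b (\<lambda>I \<rho>. gate_start (fst I) (w I \<rho>) < falses (fst I) (length (fst I)))" if "feasible b w" for b w
    using that feasible_ge_3[OF that] by (intro feasibleP_less feasible_gate_start feasible_falses feasible_length)
  then show ?thesis
    unfolding num_gates_def using a by (intro feasible_sum feasible_length) (simp_all add: feasibleP_def)
qed

lemma feasible_gate_kind: "feasible a v \<Longrightarrow> feasible a (\<lambda>I \<rho>. gate_kind (fst I) (v I \<rho>))"
  unfolding gate_kind_def by (intro feasible_token feasible_add feasible_gate_start feasible_const feasible_ge_3[of a v])

lemma feasible_num_args: "feasible a v \<Longrightarrow> feasible a (\<lambda>I \<rho>. num_args (fst I) (v I \<rho>))"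
  unfolding num_args_def by (intro feasible_diff feasible_token feasible_gate_start feasible_const feasible_ge_3[of a v])

lemma feasible_gate_arg: "feasible a v \<Longrightarrow> feasible a w \<Longrightarrow> feasible a (\<lambda>I \<rho>. gate_arg (fst I) (v I \<rho>) (w I \<rho>))"
  unfolding gate_arg_def by (intro feasible_token feasible_add feasible_gate_start feasible_const feasible_ge_3[of a v])

subsection \<open>The common reduction\<close>

text \<open>For large \<open>n\<close> the value \<open>g n\<close> is at least \<epsilon> times
  \<open>n powr c\<close>. With \<open>D * c \<ge> 3\<close>, any
  \<open>N \<ge> (T + c0) ^ D\<close> has \<open>g N\<close> at least \<epsilon> times
  \<open>(T + c0) ^ 3\<close>: two factors pay for \<open>T ^ 2\<close>, the third, at least
  \<open>c0\<close>, pays for the constant 2. Also \<open>c0 \<ge> N0\<close>, so \<open>N\<close>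
  is large enough.\<close>

lemma genus_padding:
  assumes c: "c > 0" and g: "(\<lambda>n. real (g n)) \<in> \<Omega>(\<lambda>n. real n powr c)"
  obtains c0 D where "\<And>T N. (T + c0) ^ D \<le> N \<Longrightarrow> 2 * T ^ 2 \<le> g N"
proof -
  obtain \<epsilon> where \<epsilon>: "\<epsilon> > 0" and ev: "eventually (\<lambda>n. norm (real (g n)) \<ge> \<epsilon> * norm (real n powr c)) at_top"
    using landau_omega.bigE[OF g] by blast
  obtain N0 where N0: "\<And>n. N0 \<le> n \<Longrightarrow> \<epsilon> * real n powr c \<le> real (g n)"
    using ev unfolding eventually_at_top_linorder by auto
  obtain c0 :: nat where c0: "real N0 + 2 / \<epsilon> + 1 \<le> real c0" using real_nat_ceiling_ge by blast
  have N0c: "N0 \<le> c0" "1 \<le> c0" "2 \<le> \<epsilon> * real c0"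
  proof -
    have "2 / \<epsilon> > 0" using \<epsilon> by simp
    then have "real N0 \<le> real c0" "1 \<le> real c0" "2 / \<epsilon> \<le> real c0" using c0 by linarith+
    then show "N0 \<le> c0" "1 \<le> c0" "2 \<le> \<epsilon> * real c0" using \<epsilon> by (auto simp: field_simps)
  qed
  obtain D :: nat where D: "3 / c + 1 \<le> real D" using real_nat_ceiling_ge by blast
  have "3 / c > 0" using c by simp
  then have D1: "1 \<le> D" and D3: "3 \<le> real D * c"
  proof -
    have "1 \<le> real D" using D \<open>3 / c > 0\<close> by linarith
    then show "1 \<le> D" by simp
    have "3 / c \<le> real D" using D by linarith
    then show "3 \<le> real D * c" using c by (simp add: field_simps)
  qed
  have "2 * T ^ 2 \<le> g N" if N: "(T + c0) ^ D \<le> N" for T N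
  proof -
    define a where "a = T + c0"
    have a1: "1 \<le> a" using N0c by (simp add: a_def)
    have "a \<le> a ^ D" using a1 D1 by (simp add: self_le_power)
    then have "N0 \<le> N" using N N0c by (simp add: a_def)
    have "real a ^ 3 = real a powr 3" using a1 powr_numeral[of "real a" "num.Bit1 num.One"] by simp
    also have "\<dots> \<le> real a powr (real D * c)" using a1 D3 by (intro powr_mono) auto
    also have "\<dots> = (real a ^ D) powr c" using a1 by (simp add: powr_powr[symmetric] powr_realpow)
    also have "\<dots> \<le> real N powr c" using N c a1 by (intro powr_mono2) (auto simp: a_def of_nat_power[symmetric] simp del: of_nat_power of_nat_add)
    finally have "real a ^ 3 \<le> real N powr c" .
    then have "\<epsilon> * real a ^ 3 \<le> real (g N)" using N0[OF \<open>N0 \<le> N\<close>] \<epsilon> by (meson less_imp_le mult_left_mono order_trans)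
    moreover have "2 * real T ^ 2 \<le> \<epsilon> * real a ^ 3"
    proof -
      have "2 * real T ^ 2 \<le> (\<epsilon> * real c0) * real a ^ 2"
        using N0c(3) by (intro mult_mono power_mono) (auto simp: a_def)
      also have "\<dots> \<le> (\<epsilon> * real a) * real a ^ 2" using \<epsilon> by (intro mult_right_mono mult_left_mono) (auto simp: a_def)
      finally show ?thesis by (simp add: power2_eq_square power3_eq_cube mult.assoc)
    qed
    ultimately have "real (2 * T ^ 2) \<le> real (g N)" by simp
    then show ?thesis by (simp only: of_nat_le_iff)
  qed
  then show ?thesis using that by blast
qed

text \<open>Splits off the innermost quantifier, which the bottom disjunctions absorb when it is
  existential. It has the type of the outermost one iff an even number of quantifiers precedes
  it.\<close>

lemma alt_snoc:
  "alt R b (Suc n) P \<longleftrightarrow> alt R b n (\<lambda>gs. if b = even n then \<exists>h<R. P (gs @ [h]) else \<forall>h<R. P (gs @ [h]))"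
proof (induction n arbitrary: b P)
  case 0
  show ?case by simp
next
  case (Suc n)
  have "alt R b (Suc (Suc n)) P \<longleftrightarrow> (if b then \<exists>g<R. alt R (\<not> b) (Suc n) (\<lambda>gs. P (g # gs)) else \<forall>g<R. alt R (\<not> b) (Suc n) (\<lambda>gs. P (g # gs)))"
    by (rule alt.simps)
  also have "\<dots> \<longleftrightarrow> alt R b (Suc n) (\<lambda>gs. if b = even (Suc n) then \<exists>h<R. P (gs @ [h]) else \<forall>h<R. P (gs @ [h]))"
    unfolding Suc.IH[of "\<not> b"] by (cases b) simp_all
  finally show ?case .
qed

lemma fpt_reducible_weaken:
  assumes "fpt_reducible P Q" "instances Q \<subseteq> instances R"
    and "\<And>x k. (x, k) \<in> instances Q \<Longrightarrow> (x, k) \<in> yes_instances Q \<longleftrightarrow> (x, k) \<in> yes_instances R"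
  shows "fpt_reducible P R"
proof -
  obtain p f g d where fg: "computable f" "computable g" and
    p: "\<forall>(x, k) \<in> instances P. \<exists>n s x' k'.
           exec p (initial_state x k) n s \<and> outputs s x' k' \<and>
           n \<le> f k * (length x + 1) ^ d \<and> k' \<le> g k \<and> (x', k') \<in> instances Q \<and>
           ((x, k) \<in> yes_instances P \<longleftrightarrow> (x', k') \<in> yes_instances Q)"
    using assms(1) unfolding fpt_reducible_def by (elim exE conjE)
  have "\<forall>(x, k) \<in> instances P. \<exists>n s x' k'.
           exec p (initial_state x k) n s \<and> outputs s x' k' \<and>
           n \<le> f k * (length x + 1) ^ d \<and> k' \<le> g k \<and> (x', k') \<in> instances R \<and>
           ((x, k) \<in> yes_instances P \<longleftrightarrow> (x', k') \<in> yes_instances R)"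
  proof (intro ballI)
    fix I assume I: "I \<in> instances P"
    obtain x k where [simp]: "I = (x, k)" by force
    obtain n s x' k' where *: "exec p (initial_state x k) n s" "outputs s x' k'"
      "n \<le> f k * (length x + 1) ^ d" "k' \<le> g k" "(x', k') \<in> instances Q"
      "(x, k) \<in> yes_instances P \<longleftrightarrow> (x', k') \<in> yes_instances Q"
      using bspec[OF p I] unfolding \<open>I = (x, k)\<close> case_prod_conv by (elim exE conjE)
    have "(x', k') \<in> instances R" "(x, k) \<in> yes_instances P \<longleftrightarrow> (x', k') \<in> yes_instances R"
      using *(5,6) assms(2,3) by auto
    with *(1-4) show "case I of (x, k) \<Rightarrow> \<exists>n s x' k'.
           exec p (initial_state x k) n s \<and> outputs s x' k' \<and>
           n \<le> f k * (length x + 1) ^ d \<and> k' \<le> g k \<and> (x', k') \<in> instances R \<and>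
           ((x, k) \<in> yes_instances P \<longleftrightarrow> (x', k') \<in> yes_instances R)"
      unfolding \<open>I = (x, k)\<close> case_prod_conv by blast
  qed
  then show ?thesis unfolding fpt_reducible_def using fg by blast
qed

lemma weighted_sat_instances:
  "(encode C, k) \<in> instances (weighted_sat \<C>) \<longleftrightarrow> \<C> C"
  "(encode C, k) \<in> yes_instances (weighted_sat \<C>) \<longleftrightarrow> \<C> C \<and> weight_satisfiable C k"
  "(x, k) \<in> instances (weighted_sat \<C>) \<longleftrightarrow> (\<exists>C. x = encode C \<and> \<C> C)"
  by (auto simp: weighted_sat_def encode_eq_iff)

lemma weighted_sat_mono:
  assumes "\<And>C. \<C> C \<Longrightarrow> \<D> C"
  shows "instances (weighted_sat \<C>) \<subseteq> instances (weighted_sat \<D>)"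
    "(x, k) \<in> instances (weighted_sat \<C>) \<Longrightarrow>
      (x, k) \<in> yes_instances (weighted_sat \<C>) \<longleftrightarrow> (x, k) \<in> yes_instances (weighted_sat \<D>)"
  using assms by (auto simp: weighted_sat_def encode_eq_iff)

text \<open>The frame shared by hardness and by membership for odd depth. What remains to be
  supplied is a description of the yes-instances by a set, a guess, further values checked against
  the gaps, and a matrix that is a disjunction over the further groups. The number \<open>E\<close>
  of these groups enters the new parameter, so it is bounded in terms of \<open>k\<close>
  alone.\<close>

lemma slot_reduction:
  fixes E M R B :: "input \<Rightarrow> nat" and isv :: "input \<Rightarrow> nat \<Rightarrow> bool"
    and xc :: "input \<Rightarrow> nat \<Rightarrow> nat \<Rightarrow> nat \<Rightarrow> nat \<Rightarrow> nat \<Rightarrow> bool"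
    and cert :: "input \<Rightarrow> nat list \<Rightarrow> nat \<Rightarrow> nat \<Rightarrow> bool"
  assumes PQ: "fpt_reducible P Q" and t: "2 \<le> t" "even t"
    and g: "c > 0" "(\<lambda>n. real (g n)) \<in> \<Omega>(\<lambda>n. real n powr c)"
    and E: "feasible 3 (\<lambda>I _. E I)" and M: "feasible 3 (\<lambda>I _. M I)" and R: "feasible 3 (\<lambda>I _. R I)" and B: "feasible 3 (\<lambda>I _. B I)"
    and isv: "\<And>v b. 3 \<le> b \<Longrightarrow> feasible b v \<Longrightarrow> feasibleP b (\<lambda>I \<rho>. isv I (v I \<rho>))"
    and xc: "\<And>v1 v2 v3 v4 v5 b. 3 \<le> b \<Longrightarrow> feasible b v1 \<Longrightarrow> feasible b v2 \<Longrightarrow> feasible b v3 \<Longrightarrow> feasible b v4 \<Longrightarrow> feasible b v5 \<Longrightarrow>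
      feasibleP b (\<lambda>I \<rho>. xc I (v1 I \<rho>) (v2 I \<rho>) (v3 I \<rho>) (v4 I \<rho>) (v5 I \<rho>))"
    and cert: "\<And>vs v w b. 3 \<le> b \<Longrightarrow> length vs = t \<Longrightarrow> (\<forall>v\<in>set vs. feasible b v) \<Longrightarrow> feasible b v \<Longrightarrow> feasible b w \<Longrightarrow>
       feasibleP b (\<lambda>I \<rho>. cert I (map (\<lambda>v. v I \<rho>) vs) (v I \<rho>) (w I \<rho>))"
    and ED: "\<And>x k. E (x, k) \<le> 2 ^ (D * (k + 1))"
    and M2: "\<And>I. 2 \<le> M I" and isvM: "\<And>I v. isv I v \<Longrightarrow> v + 1 < M I - 1"
    and BM: "\<And>I. M I * M I \<le> B I" "\<And>I. R I \<le> B I" and R0: "\<And>I. 0 < R I"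
    and correct: "\<And>x k. (x, k) \<in> instances Q \<Longrightarrow> (x, k) \<in> yes_instances Q \<longleftrightarrow>
       (\<exists>S U g y. S \<subseteq> Collect (isv (x, k)) \<and> gaps k (M (x, k)) S U \<and> g < R (x, k) \<and>
          (\<forall>e<E (x, k). y e < B (x, k) \<and> (\<forall>i\<le>k. xc (x, k) i (U i) (U (i + 1)) e (y e))) \<and>
          alt (R (x, k)) False (t - 1) (\<lambda>gs. \<exists>e<E (x, k). cert (x, k) (g # gs) e (y e)))"
  shows "fpt_reducible P (WSAT_mono t g)"
proof -
  obtain c0 D' where pad: "\<And>T N. (T + c0) ^ D' \<le> N \<Longrightarrow> 2 * T ^ 2 \<le> g N" using genus_padding[OF g] by blast
  define K where "K I = snd I + 2 + E I" for I :: input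
  \<comment> \<open>The variables of the groups, the filler \<open>K * B\<close>, and enough dummies
    for \<open>genus_padding\<close> with \<open>T\<close> the number of vertices that carry
    edges.\<close>
  define N where "N I = K I * B I + 1 + (csp_size (K I) (B I) (R I) t + c0) ^ D'" for I
  define allowed where "allowed I q r \<longleftrightarrow> slot_ok (snd I) (M I) (R I) (isv I) (xc I) (q div B I) (q mod B I) (r div B I) (r mod B I)" for I q r
  define lf where "lf I = slot_leaf (snd I) (B I) (cert I)" for I
  define C where "C I = csp_circuit (N I) (K I) (B I) (R I) t (allowed I) (lf I)" for I
  have mE: "feasible b (\<lambda>I \<rho>. E I)" and mM: "feasible b (\<lambda>I \<rho>. M I)" and mR: "feasible b (\<lambda>I \<rho>. R I)" and mB: "feasible b (\<lambda>I \<rho>. B I)"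
    if "3 \<le> b" for b using that E M R B feasible_mono by blast+
  have mK: "feasible b (\<lambda>I \<rho>. K I)" if "3 \<le> b" for b
    unfolding K_def using that by (intro feasible_add feasible_param feasible_const mE)
  have mN: "feasible b (\<lambda>I \<rho>. N I)" if "3 \<le> b" for b
    unfolding N_def csp_size_def using that
    by (intro feasible_add feasible_mult feasible_power feasible_const feasible_sum_const mK mB mR)
  have mallowed: "feasibleP b (\<lambda>I \<rho>. allowed I (v I \<rho>) (w I \<rho>))" if "3 \<le> b" "feasible b v" "feasible b w" for b v w
    unfolding allowed_def slot_ok_def using that
    by (intro feasible_rules mB mM mR isv xc)
  have mlf: "feasibleP b (\<lambda>I \<rho>. lf I (map (\<lambda>v. v I \<rho>) vs) (w I \<rho>))"
    if "3 \<le> b" "length vs = t" "\<forall>v\<in>set vs. feasible b v" "feasible b w" for b vs w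
  proof -
    have ne: "vs \<noteq> []" using that(2) t by auto
    then have hd: "hd (map (\<lambda>v. v I \<rho>) vs) = hd vs I \<rho>" for I \<rho> by (simp add: hd_map)
    have "feasible b (hd vs)" using that(3) ne by simp
    then show ?thesis
      unfolding lf_def slot_leaf_def hd using that
      by (intro feasible_rules mB cert) simp_all
  qed
    have e1: "emits 3 (\<lambda>I _. encode (C I))"
      unfolding C_def by (intro emits_csp_circuit mN mK mB mR mallowed mlf) simp_all
    have e2: "feasible 3 (\<lambda>I _. K I)" by (rule mK) simp
    have e3: "K (x, k) \<le> 2 ^ ((D + 2) * (k + 1))" for x k
    proof -
      have "k + 2 \<le> 2 ^ (k + 1)" by (induction k) auto
      also have "\<dots> \<le> 2 ^ ((D + 1) * (k + 1))" by (intro power_increasing) auto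
      finally have "k + 2 \<le> 2 ^ ((D + 1) * (k + 1))" .
      moreover have "E (x, k) \<le> 2 ^ ((D + 1) * (k + 1))"
        using ED[of x k] by (rule order_trans) (intro power_increasing, auto)
      ultimately have "K (x, k) \<le> 2 * 2 ^ ((D + 1) * (k + 1))" by (simp add: K_def)
      also have "\<dots> = 2 ^ ((D + 1) * (k + 1) + 1)" by simp
      also have "\<dots> \<le> 2 ^ ((D + 2) * (k + 1))" by (intro power_increasing) auto
      finally show ?thesis .
    qed
    have e4: "(encode (C (x, k)), K (x, k)) \<in> instances (WSAT_mono t g) \<and>
       ((x, k) \<in> yes_instances Q \<longleftrightarrow> (encode (C (x, k)), K (x, k)) \<in> yes_instances (WSAT_mono t g))"
       if xk: "(x, k) \<in> instances Q" for x k
    proof -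
    let ?I = "(x, k)"
    have B0: "0 < B ?I" using R0[of ?I] BM(2)[of ?I] by simp
    have KN: "K ?I * B ?I < N ?I" by (simp add: N_def)
    have C1: "Pi_circuit t (C ?I)" "monotone_circuit (C ?I)" "vars (C ?I) = {..<N ?I}"
      unfolding C_def by (rule csp_circuit[OF KN B0 R0 t])+
    have C4: "circuit_genus (C ?I) \<le> 2 * csp_size (K ?I) (B ?I) (R ?I) t ^ 2"
      unfolding C_def by (rule csp_circuit[OF KN B0 R0 t])
    have C5: "weight_satisfiable (C ?I) (K ?I) \<longleftrightarrow> (\<exists>ch. csp_solution (K ?I) (B ?I) (allowed ?I) ch \<and>
       (\<forall>g<R ?I. alt (R ?I) False (t - 1) (\<lambda>gs. \<exists>J<K ?I. lf ?I (g # gs) (J * B ?I + ch J))))"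
      unfolding C_def by (rule csp_circuit[OF KN B0 R0 t])
    have "(csp_size (K ?I) (B ?I) (R ?I) t + c0) ^ D' \<le> N ?I" by (simp add: N_def)
    from pad[OF this] have genus: "circuit_genus (C ?I) \<le> g (card (vars (C ?I)))"
      using C1(3) C4 by simp
    have "weight_satisfiable (C ?I) (K ?I) \<longleftrightarrow>
      (\<exists>S U g y. S \<subseteq> Collect (isv ?I) \<and> gaps k (M ?I) S U \<and> g < R ?I \<and>
          (\<forall>e<E ?I. y e < B ?I \<and> (\<forall>i\<le>k. xc ?I i (U i) (U (i + 1)) e (y e))) \<and>
          alt (R ?I) False (t - 1) (\<lambda>gs. \<exists>e<E ?I. cert ?I (g # gs) e (y e)))"
      using C5 slot_solution[of "M ?I" "isv ?I" "B ?I" "R ?I" k "E ?I" "xc ?I" "t - 1" "cert ?I", OF M2 isvM BM R0]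
      by (simp add: K_def allowed_def[abs_def] lf_def)
    with C1(1,2) genus show ?thesis
      unfolding WSAT_mono_def weighted_sat_instances(1,2) correct[OF xk] by simp
    qed
  show ?thesis by (rule fpt_reducible_trans_emits[OF PQ e1 e2 e3 e4])
qed

subsection \<open>Prenex form of circuits of bounded weft\<close>

lemma ex_pair_less: "(\<exists>g<r * r. P (g div r) (g mod r)) \<longleftrightarrow> (\<exists>a<r. \<exists>c<r. P a c)" for r :: nat
proof
  assume "\<exists>g<r * r. P (g div r) (g mod r)"
  then obtain g where g: "g < r * r" "P (g div r) (g mod r)" by blast
  then have "0 < r" by (cases r) auto
  then show "\<exists>a<r. \<exists>c<r. P a c" using g by (intro exI[of _ "g div r"] exI[of _ "g mod r"] conjI) (auto simp: less_mult_imp_div_less)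
next
  assume "\<exists>a<r. \<exists>c<r. P a c"
  then obtain a c where "a < r" "c < r" "P a c" by blast
  then show "\<exists>g<r * r. P (g div r) (g mod r)"
    using csp_var_less[of a r c r] by (intro exI[of _ "a * r + c"]) simp
qed

lemma all_pair_less: "(\<forall>g<r * r. P (g div r) (g mod r)) \<longleftrightarrow> (\<forall>a<r. \<forall>c<r. P a c)" for r :: nat
  using ex_pair_less[of r "\<lambda>a c. \<not> P a c"] by blast

text \<open>One quantifier over pairs serves two formulas with the same prefix. This works for both
  types, because a disjunction commutes with quantifiers over separate nonempty ranges.\<close>

lemma alt_pair_or:
  "0 < r \<Longrightarrow> alt (r * r) b n (\<lambda>gs. A (map (\<lambda>g. g div r) gs) \<or> D (map (\<lambda>g. g mod r) gs)) \<longleftrightarrow> alt r b n A \<or> alt r b n D"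
proof (induction n arbitrary: b A D)
  case (Suc n)
  have IH: "alt (r * r) (\<not> b) n (\<lambda>gs. A (x # map (\<lambda>g. g div r) gs) \<or> D (y # map (\<lambda>g. g mod r) gs)) \<longleftrightarrow>
      alt r (\<not> b) n (\<lambda>gs. A (x # gs)) \<or> alt r (\<not> b) n (\<lambda>gs. D (y # gs))" for x y
    using Suc.IH[OF Suc.prems, of "\<not> b" "\<lambda>gs. A (x # gs)" "\<lambda>gs. D (y # gs)"] .
  show ?case
  proof (cases b)
    case True
    then show ?thesis
      using Suc.prems ex_pair_less[of r "\<lambda>x y. alt r False n (\<lambda>gs. A (x # gs)) \<or> alt r False n (\<lambda>gs. D (y # gs))"] IH by auto
  next
    case False
    then show ?thesis
      using Suc.prems all_pair_less[of r "\<lambda>x y. alt r True n (\<lambda>gs. A (x # gs)) \<or> alt r True n (\<lambda>gs. D (y # gs))"] IH by auto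
  qed
qed simp

lemma alt_not: "alt r b n (\<lambda>gs. \<not> A gs) \<longleftrightarrow> \<not> alt r (\<not> b) n A"
  by (induction n arbitrary: b A) auto

lemma alt_pair_and:
  assumes "0 < r"
  shows "alt (r * r) b n (\<lambda>gs. A (map (\<lambda>g. g div r) gs) \<and> D (map (\<lambda>g. g mod r) gs)) \<longleftrightarrow> alt r b n A \<and> alt r b n D"
proof -
  have "alt (r * r) b n (\<lambda>gs. A (map (\<lambda>g. g div r) gs) \<and> D (map (\<lambda>g. g mod r) gs)) \<longleftrightarrow>
      alt (r * r) b n (\<lambda>gs. \<not> (\<not> A (map (\<lambda>g. g div r) gs) \<or> \<not> D (map (\<lambda>g. g mod r) gs)))" by simp
  also have "\<dots> \<longleftrightarrow> \<not> (alt r (\<not> b) n (\<lambda>gs. \<not> A gs) \<or> alt r (\<not> b) n (\<lambda>gs. \<not> D gs))"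
    by (subst alt_not, subst alt_pair_or[OF assms]) simp
  finally show ?thesis by (simp add: alt_not)
qed

lemma alt_div: "0 < r \<Longrightarrow> alt (r * r) b n (\<lambda>gs. A (map (\<lambda>g. g div r) gs)) \<longleftrightarrow> alt r b n A"
  using alt_pair_or[of r b n A "\<lambda>_. False"] by (simp add: alt_const)

lemma alt_mod: "0 < r \<Longrightarrow> alt (r * r) b n (\<lambda>gs. A (map (\<lambda>g. g mod r) gs)) \<longleftrightarrow> alt r b n A"
  using alt_pair_or[of r b n "\<lambda>_. False" A] by (simp add: alt_const)

text \<open>The choice of an input \<open>a\<close> and the leading existential quantifier of its
  formula become one quantifier over pairs; pairs that name no input fail.\<close>

lemma alt_big_or:
  assumes "0 < r" "len \<le> r"
  shows "alt (r * r) True (Suc n) (\<lambda>gs. case gs of [] \<Rightarrow> False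
      | g # hs \<Rightarrow> g div r < len \<and> A (g div r) (map (\<lambda>g. g mod r) (g # hs))) \<longleftrightarrow> (\<exists>a<len. alt r True (Suc n) (A a))"
proof -
  have c: "alt (r * r) False n (\<lambda>hs. P \<and> F hs) \<longleftrightarrow> P \<and> alt (r * r) False n F" for P F
    using assms(1) by (cases P) (simp_all add: alt_const)
  have "alt (r * r) True (Suc n) (\<lambda>gs. case gs of [] \<Rightarrow> False
      | g # hs \<Rightarrow> g div r < len \<and> A (g div r) (map (\<lambda>g. g mod r) (g # hs))) \<longleftrightarrow>
      (\<exists>g<r * r. g div r < len \<and> alt r False n (\<lambda>hs. A (g div r) (g mod r # hs)))"
    using alt_mod[OF assms(1), of False n "\<lambda>hs. A a (c # hs)" for a c] by (simp add: c)
  also have "\<dots> \<longleftrightarrow> (\<exists>a<r. \<exists>c<r. a < len \<and> alt r False n (\<lambda>hs. A a (c # hs)))"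
    by (rule ex_pair_less)
  also have "\<dots> \<longleftrightarrow> (\<exists>a<len. \<exists>c<r. alt r False n (\<lambda>hs. A a (c # hs)))"
    using assms(2) less_le_trans by blast
  also have "\<dots> \<longleftrightarrow> (\<exists>a<len. alt r True (Suc n) (A a))" by simp
  finally show ?thesis .
qed

lemma alt_big_and:
  assumes "0 < r" "len \<le> r"
  shows "alt (r * r) False (Suc n) (\<lambda>gs. case gs of [] \<Rightarrow> False
      | g # hs \<Rightarrow> g div r < len \<longrightarrow> A (g div r) (map (\<lambda>g. g mod r) (g # hs))) \<longleftrightarrow> (\<forall>a<len. alt r False (Suc n) (A a))"
proof -
  have c: "alt (r * r) True n (\<lambda>hs. P \<longrightarrow> F hs) \<longleftrightarrow> (P \<longrightarrow> alt (r * r) True n F)" for P F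
    using assms(1) by (cases P) (simp_all add: alt_const)
  have "alt (r * r) False (Suc n) (\<lambda>gs. case gs of [] \<Rightarrow> False
      | g # hs \<Rightarrow> g div r < len \<longrightarrow> A (g div r) (map (\<lambda>g. g mod r) (g # hs))) \<longleftrightarrow>
      (\<forall>g<r * r. g div r < len \<longrightarrow> alt r True n (\<lambda>hs. A (g div r) (g mod r # hs)))"
    using alt_mod[OF assms(1), of True n "\<lambda>hs. A a (c # hs)" for a c] by (simp add: c)
  also have "\<dots> \<longleftrightarrow> (\<forall>a<r. \<forall>c<r. a < len \<longrightarrow> alt r True n (\<lambda>hs. A a (c # hs)))"
    by (rule all_pair_less)
  also have "\<dots> \<longleftrightarrow> (\<forall>a<len. \<forall>c<r. alt r True n (\<lambda>hs. A a (c # hs)))"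
    using assms(2) less_le_trans by blast
  also have "\<dots> \<longleftrightarrow> (\<forall>a<len. alt r False (Suc n) (A a))" by simp
  finally show ?thesis .
qed

text \<open>The value of vertex \<open>i\<close> (or of its negation, if \<open>b\<close> is false) as the matrix of a prenex
  formula whose quantifiers range over the list \<open>gs\<close>; the leading quantifier is existential iff
  \<open>q\<close>. At a gate of fan-in at most 2 every index encodes a pair of indices, one for each input;
  a large gate is absorbed into the next quantifier of its own type, whose index also encodes
  the chosen input. The leaves are addressed by the numbers \<open>p, \<dots>, p + 2 ^ n - 1\<close>.\<close>

primrec prenex :: "bool list \<Rightarrow> nat \<Rightarrow> (bool \<Rightarrow> nat \<Rightarrow> nat \<Rightarrow> bool) \<Rightarrow> nat \<Rightarrow> bool \<Rightarrow> bool \<Rightarrow> nat \<Rightarrow> nat list \<Rightarrow> nat \<Rightarrow> bool" where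
  "prenex x m lf 0 b q i gs p = lf (b = (gate_kind x i = 1)) (gate_arg x i 0) p"
| "prenex x m lf (Suc n) b q i gs p =
    (let r = m ^ (2 ^ n) in
     if gate_kind x i \<le> 1 then lf (b = (gate_kind x i = 1)) (gate_arg x i 0) p
     else if gate_kind x i = 2 then prenex x m lf n (\<not> b) q (gate_arg x i 0) (map (\<lambda>g. g div r) gs) p
     else if num_args x i \<le> 2 then
       (if (gate_kind x i = 4) = b
        then prenex x m lf n b q (gate_arg x i 0) (map (\<lambda>g. g div r) gs) p \<or>
             prenex x m lf n b q (gate_arg x i (num_args x i - 1)) (map (\<lambda>g. g mod r) gs) (p + 2 ^ n)
        else prenex x m lf n b q (gate_arg x i 0) (map (\<lambda>g. g div r) gs) p \<and>
             prenex x m lf n b q (gate_arg x i (num_args x i - 1)) (map (\<lambda>g. g mod r) gs) (p + 2 ^ n))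
     else
       (if (gate_kind x i = 4) = b
        then (case (if q then gs else tl gs) of [] \<Rightarrow> False
              | g # hs \<Rightarrow> g div r < num_args x i \<and>
                  prenex x m lf n b True (gate_arg x i (g div r)) (map (\<lambda>g. g mod r) (g # hs)) p)
        else (case (if q then tl gs else gs) of [] \<Rightarrow> False
              | g # hs \<Rightarrow> g div r < num_args x i \<longrightarrow>
                  prenex x m lf n b False (gate_arg x i (g div r)) (map (\<lambda>g. g mod r) (g # hs)) p)))"

definition path_value :: "(gate \<Rightarrow> bool) \<Rightarrow> circuit \<Rightarrow> nat \<Rightarrow> nat" where
  "path_value P C i = vertex_values (\<lambda>vs G. of_bool (P G) + Max (insert 0 ((\<lambda>j. vs ! j) ` set (fan_in G)))) C ! i"

lemma path_value_fan_in:
  assumes "wf_circuit C" "i < length C" "j \<in> set (fan_in (C ! i))"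
  shows "of_bool (P (C ! i)) + path_value P C j \<le> path_value P C i"
proof -
  define f :: "nat list \<Rightarrow> gate \<Rightarrow> nat"
    where "f vs G = of_bool (P G) + Max (insert 0 ((\<lambda>j. vs ! j) ` set (fan_in G)))" for vs G
  have "j < i" using assms by (auto simp: wf_circuit_def)
  then have "vertex_values f C ! j \<in> insert 0 ((\<lambda>j. take i (vertex_values f C) ! j) ` set (fan_in (C ! i)))"
    using assms(3) by (intro insertI2 image_eqI[of _ _ j]) auto
  then have "vertex_values f C ! j \<le> Max (insert 0 ((\<lambda>j. take i (vertex_values f C) ! j) ` set (fan_in (C ! i))))"
    by (intro Max_ge) auto
  then have "of_bool (P (C ! i)) + vertex_values f C ! j \<le> f (take i (vertex_values f C)) (C ! i)"
    by (simp add: f_def[of "take i (vertex_values f C)" "C ! i"])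
  then have "of_bool (P (C ! i)) + vertex_values f C ! j \<le> vertex_values f C ! i"
    unfolding vertex_values_nth[OF assms(2), of f] .
  then show ?thesis unfolding path_value_def f_def[abs_def] .
qed

lemma path_value_ge:
  assumes "i < length C"
  shows "of_bool (P (C ! i)) \<le> path_value P C i"
  unfolding path_value_def vertex_values_nth[OF assms] by simp

lemma max_on_path_path_value: "C \<noteq> [] \<Longrightarrow> max_on_path P C = path_value P C (length C - 1)"
proof -
  assume "C \<noteq> []"
  then have "vertex_values f C \<noteq> []" for f :: "nat list \<Rightarrow> gate \<Rightarrow> nat" by (metis length_0_conv length_vertex_values)
  then show ?thesis by (simp add: max_on_path_def path_value_def last_conv_nth)
qed

text \<open>Negations and small gates use up no quantifier. A large gate whose type differs from the
  leading quantifier leaves that one idle and works with the next; its inputs have smaller weft, so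
  having more quantifiers than weft is preserved. Pairing squares the range of the indices at each
  level, which gives \<open>m ^ (2 ^ n)\<close>.\<close>

lemma prenex_correct:
  assumes wf: "wf_circuit C" and m: "length C + 2 \<le> m"
    and "i < length C" "path_value (\<lambda>G. \<not> is_LIT G) C i \<le> n" "path_value (\<lambda>G. 2 < length (fan_in G)) C i < L"
  shows "alt (m ^ (2 ^ n)) q L (\<lambda>gs. prenex (encode C) m (\<lambda>b v p. (v \<in> S) = b) n b q i gs p) \<longleftrightarrow> gate_value S C i = b"
  using assms(3-5)
proof (induction n arbitrary: i b q p L)
  case 0
  then obtain c v where G: "C ! i = LIT c v"
    using path_value_ge[of i C "\<lambda>G. \<not> is_LIT G"] by (cases "C ! i") auto
  have r0: "0 < m ^ (2 ^ 0)" using m by simp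
  have "gate_value S C i \<longleftrightarrow> (v \<in> S) = c" using gate_value_simps(1)[OF wf 0(1) G] .
  then show ?case using gate_parse(1)[OF 0(1) G] alt_const[OF r0] by auto
next
  case (Suc n)
  define r where "r = m ^ (2 ^ n)"
  have r0: "0 < r" using m by (simp add: r_def)
  have rr: "m ^ (2 ^ Suc n) = r * r" by (simp add: r_def power_mult_distrib power2_eq_square mult_2 power_add)
  have rm: "m \<le> r" unfolding r_def using m by (intro self_le_power) auto
  let ?lf = "\<lambda>b v p. (v \<in> S) = b" let ?x = "encode C"
  have child: "j < length C \<and> path_value (\<lambda>G. \<not> is_LIT G) C j \<le> n \<and>
      path_value (\<lambda>G. 2 < length (fan_in G)) C j + of_bool (2 < length (fan_in (C ! i))) < L"
    if "j \<in> set (fan_in (C ! i))" for j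
  proof -
    have "j < i" using wf Suc.prems(1) that by (auto simp: wf_circuit_def)
    moreover have "\<not> is_LIT (C ! i)" using that by (cases "C ! i") auto
    ultimately show ?thesis
      using path_value_fan_in[OF wf Suc.prems(1) that, of "\<lambda>G. \<not> is_LIT G"]
        path_value_fan_in[OF wf Suc.prems(1) that, of "\<lambda>G. 2 < length (fan_in G)"] Suc.prems by auto
  qed
  have IH: "alt r q' L' (\<lambda>gs. prenex ?x m ?lf n b' q' j gs p') \<longleftrightarrow> gate_value S C j = b'"
    if "j \<in> set (fan_in (C ! i))" "path_value (\<lambda>G. 2 < length (fan_in G)) C j < L'" for j b' q' p' L'
    using Suc.IH[of j L' q' b' p'] child[OF that(1)] that(2) by (simp add: r_def)
  have IH0: "alt r q' L (\<lambda>gs. prenex ?x m ?lf n b' q' j gs p') \<longleftrightarrow> gate_value S C j = b'"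
    if "j \<in> set (fan_in (C ! i))" for j b' q' p'
    using child[OF that] by (intro IH that) simp
  have gate: ?case
    if fan: "fan_in (C ! i) = js" "js \<noteq> []" and K: "gate_kind ?x i = K" "K = 3 \<or> K = 4"
      and args: "num_args ?x i = length js" "\<forall>p<length js. gate_arg ?x i p = js ! p"
      and val: "gate_value S C i = b \<longleftrightarrow> (if (K = 4) = b then \<exists>j\<in>set js. gate_value S C j = b else \<forall>j\<in>set js. gate_value S C j = b)"
    for js K
  proof -
    have len: "length js \<le> r"
    proof -
      have "distinct js" "set js \<subseteq> {..<length C}"
        using wf Suc.prems(1) fan(1) child by (auto simp: wf_circuit_def)
      then have "length js \<le> length C" by (metis card_lessThan card_mono distinct_card finite_lessThan)
      then show ?thesis using m rm by linarith
    qed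
    have kinds: "\<not> gate_kind ?x i \<le> 1" "gate_kind ?x i \<noteq> 2" using K by auto
    show ?thesis
    proof (cases "length js \<le> 2")
      case True
      have l0: "0 < length js" using fan(2) by simp
      \<comment> \<open>Fan-in 1 is treated as two equal inputs: the first and the last argument
        then coincide.\<close>
      define u w where "u = js ! 0" and "w = js ! (length js - 1)"
      have uw: "gate_arg ?x i 0 = u" "gate_arg ?x i (length js - 1) = w" "set js = {u, w}"
      proof -
        show "gate_arg ?x i 0 = u" "gate_arg ?x i (length js - 1) = w" using args(2) l0 by (auto simp: u_def w_def)
        have "length js = 1 \<or> length js = 2" using True l0 by linarith
        then show "set js = {u, w}"
          by (auto simp: u_def w_def length_Suc_conv numeral_2_eq_2)
      qed
      have uwm: "u \<in> set (fan_in (C ! i))" "w \<in> set (fan_in (C ! i))" using uw(3) fan(1) by auto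
      have eq: "prenex ?x m ?lf (Suc n) b q i gs p =
         (if (K = 4) = b
          then prenex ?x m ?lf n b q u (map (\<lambda>g. g div r) gs) p \<or> prenex ?x m ?lf n b q w (map (\<lambda>g. g mod r) gs) (p + 2 ^ n)
          else prenex ?x m ?lf n b q u (map (\<lambda>g. g div r) gs) p \<and> prenex ?x m ?lf n b q w (map (\<lambda>g. g mod r) gs) (p + 2 ^ n))" for gs
        using kinds True K(1) args(1) uw(1,2) by (simp add: Let_def r_def)
      show ?thesis
      proof (cases "(K = 4) = b")
        case T: True
        then show ?thesis
          unfolding rr eq val uw(3) using alt_pair_or[OF r0, of q L "\<lambda>gs. prenex ?x m ?lf n b q u gs p" "\<lambda>gs. prenex ?x m ?lf n b q w gs (p + 2 ^ n)"]
            IH0[OF uwm(1), of q b p] IH0[OF uwm(2), of q b "p + 2 ^ n"] by simp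
      next
        case F: False
        then show ?thesis
          unfolding rr eq val uw(3) using alt_pair_and[OF r0, of q L "\<lambda>gs. prenex ?x m ?lf n b q u gs p" "\<lambda>gs. prenex ?x m ?lf n b q w gs (p + 2 ^ n)"]
            IH0[OF uwm(1), of q b p] IH0[OF uwm(2), of q b "p + 2 ^ n"] by simp
      qed
    next
      case False
      have mem: "js ! a \<in> set (fan_in (C ! i))" if "a < length js" for a using that fan(1) by simp
      have wl: "path_value (\<lambda>G. 2 < length (fan_in G)) C (js ! a) + 1 < L" if "a < length js" for a
        using child[OF mem[OF that]] False fan(1) by simp
      have "\<exists>L0. L = Suc (Suc L0)" using wl[of 0] fan(2) by (cases L; cases "L - 1") auto
      then obtain L0 where L0: "L = Suc (Suc L0)" by blast
      define A where "A q' a gs = prenex ?x m ?lf n b q' (gate_arg ?x i a) gs p" for q' a gs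
      have IHA: "alt r q' L (A q' a) \<longleftrightarrow> gate_value S C (js ! a) = b" "alt r q' (Suc L0) (A q' a) \<longleftrightarrow> gate_value S C (js ! a) = b"
        if "a < length js" for a q'
        using IH[OF mem[OF that], of L q' b p] IH[OF mem[OF that], of "Suc L0" q' b p] wl[OF that] L0 args(2) that
        by (auto simp: A_def[abs_def])
      have set: "(\<exists>j\<in>set js. P j) \<longleftrightarrow> (\<exists>a<length js. P (js ! a))" "(\<forall>j\<in>set js. P j) \<longleftrightarrow> (\<forall>a<length js. P (js ! a))" for P
        by (metis in_set_conv_nth)+
      have kindsK: "\<not> K \<le> 1" "K \<noteq> 2" using K(2) by auto
      have cst: "(\<forall>g<r * r. P) \<longleftrightarrow> P" "(\<exists>g<r * r. P) \<longleftrightarrow> P" for P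
        using mult_pos_pos[OF r0 r0] by blast+
      show ?thesis
      proof (cases "(K = 4) = b")
        case T: True
        let ?F = "\<lambda>gs. case gs of [] \<Rightarrow> False | g # hs \<Rightarrow> g div r < length js \<and> A True (g div r) (map (\<lambda>g. g mod r) (g # hs))"
        have eq: "prenex ?x m ?lf (Suc n) b q i gs p = ?F (if q then gs else tl gs)" for gs
          unfolding prenex.simps(2) Let_def r_def[symmetric] A_def
          by (simp only: K(1) kindsK args(1) False T simp_thms if_False if_True)
        have v: "(gate_value S C i = b) = (\<exists>a<length js. gate_value S C (js ! a) = b)" using val T set by simp
        show ?thesis
        proof (cases q)
          case True
          then show ?thesis
            unfolding rr eq v using alt_big_or[OF r0 len, of "Suc L0" "A True"] IHA(1)[of _ True] L0 by auto
        next
          case False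
          \<comment> \<open>The leading universal quantifier has the wrong type for a disjunction;
            the matrix ignores its index.\<close>
          have "alt (r * r) False L (\<lambda>gs. ?F (tl gs)) \<longleftrightarrow> alt (r * r) True (Suc L0) ?F"
            unfolding L0 alt.simps(2)[of "r * r" False "Suc L0"] list.sel(3) by (simp only: if_False not_False_eq_True cst)
          then show ?thesis
            unfolding rr eq v using alt_big_or[OF r0 len, of L0 "A True"] IHA(2)[of _ True] False by auto
        qed
      next
        case F: False
        let ?F = "\<lambda>gs. case gs of [] \<Rightarrow> False | g # hs \<Rightarrow> g div r < length js \<longrightarrow> A False (g div r) (map (\<lambda>g. g mod r) (g # hs))"
        have eq: "prenex ?x m ?lf (Suc n) b q i gs p = ?F (if q then tl gs else gs)" for gs
          unfolding prenex.simps(2) Let_def r_def[symmetric] A_def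
          by (simp only: K(1) kindsK args(1) False F simp_thms if_False if_True)
        have v: "(gate_value S C i = b) = (\<forall>a<length js. gate_value S C (js ! a) = b)" using val F set by simp
        show ?thesis
        proof (cases q)
          case False
          then show ?thesis
            unfolding rr eq v using alt_big_and[OF r0 len, of "Suc L0" "A False"] IHA(1)[of _ False] L0 by auto
        next
          case True
          have "alt (r * r) True L (\<lambda>gs. ?F (tl gs)) \<longleftrightarrow> alt (r * r) False (Suc L0) ?F"
            unfolding L0 alt.simps(2)[of "r * r" True "Suc L0"] list.sel(3) by (simp only: if_True not_True_eq_False cst)
          then show ?thesis
            unfolding rr eq v using alt_big_and[OF r0 len, of L0 "A False"] IHA(2)[of _ False] True by auto
        qed
      qed
    qed
  qed
  show ?case
  proof (cases "C ! i")
    case (LIT c v)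
    have "gate_value S C i \<longleftrightarrow> (v \<in> S) = c" using gate_value_simps(1)[OF wf Suc.prems(1) LIT] .
    then show ?thesis
      using gate_parse(1)[OF Suc.prems(1) LIT] alt_const[of "r * r"] r0 unfolding rr by (auto simp: Let_def)
  next
    case (NOT j)
    have "gate_value S C i \<longleftrightarrow> \<not> gate_value S C j" using gate_value_simps(2)[OF wf Suc.prems(1) NOT] .
    then show ?thesis
      using gate_parse(2)[OF Suc.prems(1) NOT] alt_div[OF r0, of q L "\<lambda>gs. prenex ?x m ?lf n (\<not> b) q j gs p"]
        IH0[of j q "\<not> b" p] NOT unfolding rr by (auto simp: Let_def r_def[symmetric])
  next
    case (AND js)
    have "js \<noteq> []" using wf nth_mem[OF Suc.prems(1)] AND by (force simp: wf_circuit_def)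
    then show ?thesis
      using gate_parse(3)[OF Suc.prems(1) AND] gate_value_simps(3)[OF wf Suc.prems(1) AND, of S] AND
      by (intro gate[of js 3]) auto
  next
    case (OR js)
    have "js \<noteq> []" using wf nth_mem[OF Suc.prems(1)] OR by (force simp: wf_circuit_def)
    then show ?thesis
      using gate_parse(4)[OF Suc.prems(1) OR] gate_value_simps(4)[OF wf Suc.prems(1) OR, of S] OR
      by (intro gate[of js 4]) auto
  qed
qed

text \<open>Negations are carried down as polarities, so leaves occur only positively in the matrix,
  and only at the positions \<open>p, ..., p + 2 ^ n - 1\<close>.\<close>

lemma prenex_mono:
  assumes "prenex x m lf n b q i gs p"
    and "\<And>pol j p'. p \<le> p' \<Longrightarrow> p' < p + 2 ^ n \<Longrightarrow> lf pol (gate_arg x j 0) p' \<Longrightarrow> lf' pol (gate_arg x j 0) p'"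
  shows "prenex x m lf' n b q i gs p"
  using assms
proof (induction n arbitrary: b q i gs p)
  case 0
  then show ?case by simp
next
  case (Suc n)
  have IH1: "prenex x m lf' n b' q' j hs p" if "prenex x m lf n b' q' j hs p" for b' q' j hs
  proof (rule Suc.IH[OF that])
    fix pol j p' assume "p \<le> p'" "p' < p + 2 ^ n" "lf pol (gate_arg x j 0) p'"
    then show "lf' pol (gate_arg x j 0) p'" using Suc.prems(2)[of p' pol j] by simp
  qed
  have IH2: "prenex x m lf' n b' q' j hs (p + 2 ^ n)" if "prenex x m lf n b' q' j hs (p + 2 ^ n)" for b' q' j hs
  proof (rule Suc.IH[OF that])
    fix pol j p' assume "(p + 2 ^ n) \<le> p'" "p' < (p + 2 ^ n) + 2 ^ n" "lf pol (gate_arg x j 0) p'"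
    then show "lf' pol (gate_arg x j 0) p'" using Suc.prems(2)[of p' pol j] by simp
  qed
  have leaf: "lf pol (gate_arg x j 0) p \<Longrightarrow> lf' pol (gate_arg x j 0) p" for pol j
    using Suc.prems(2)[of p] by simp
  show ?case
    using Suc.prems(1) unfolding prenex.simps Let_def
    by (auto intro: IH1 IH2 leaf split: if_splits list.splits)
qed

text \<open>A witness for every leaf becomes one function of the leaf position. In a conjunction the
  two sides occupy adjacent position ranges, so their functions are glued at
  \<open>p + 2 ^ n\<close>; this is what positions are for.\<close>

lemma prenex_choose:
  fixes k :: nat
  assumes "prenex x m (\<lambda>pol v p. \<exists>\<sigma>\<le>k. ce \<sigma> pol v) n b q i gs p"
  shows "\<exists>f. (\<forall>p. f p \<le> k) \<and> prenex x m (\<lambda>pol v p. ce (f p) pol v) n b q i gs p"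
  using assms
proof (induction n arbitrary: b q i gs p)
  case 0
  then obtain \<sigma> where "\<sigma> \<le> (k::nat)" "ce \<sigma> (b = (gate_kind x i = 1)) (gate_arg x i 0)" by auto
  then show ?case by (intro exI[of _ "\<lambda>_. \<sigma>"]) simp
next
  case (Suc n)
  define r where "r = m ^ (2 ^ n)"
  let ?lf = "\<lambda>(pol::bool) (v::nat) (p::nat). \<exists>\<sigma>\<le>k. ce \<sigma> pol v" let ?ch = "\<lambda>f (pol::bool) (v::nat) (p::nat). ce (f p) pol v"
  let ?P0 = "prenex x m ?lf n b q (gate_arg x i 0) (map (\<lambda>g. g div r) gs) p"
  let ?P1 = "prenex x m ?lf n b q (gate_arg x i (num_args x i - 1)) (map (\<lambda>g. g mod r) gs) (p + 2 ^ n)"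
  consider (leaf) "gate_kind x i \<le> 1" | (neg) "gate_kind x i = 2"
    | (or) "\<not> gate_kind x i \<le> 1" "gate_kind x i \<noteq> 2" "num_args x i \<le> 2" "(gate_kind x i = 4) = b"
    | (conj) "\<not> gate_kind x i \<le> 1" "gate_kind x i \<noteq> 2" "num_args x i \<le> 2" "(gate_kind x i = 4) \<noteq> b"
    | (big) "\<not> gate_kind x i \<le> 1" "gate_kind x i \<noteq> 2" "\<not> num_args x i \<le> 2"
    by blast
  then show ?case
  proof cases
    case leaf
    then obtain \<sigma> where "\<sigma> \<le> k" "ce \<sigma> (b = (gate_kind x i = 1)) (gate_arg x i 0)" using Suc.prems by (auto simp: Let_def)
    then show ?thesis using leaf by (intro exI[of _ "\<lambda>_. \<sigma>"]) (simp add: Let_def)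
  next
    case neg
    then have "prenex x m ?lf n (\<not> b) q (gate_arg x i 0) (map (\<lambda>g. g div r) gs) p" using Suc.prems by (simp add: Let_def r_def)
    from Suc.IH[OF this] show ?thesis using neg by (simp add: Let_def r_def)
  next
    case or
    then have "?P0 \<or> ?P1" using Suc.prems by (simp add: Let_def r_def)
    then show ?thesis
    proof
      assume ?P0
      from Suc.IH[OF this] show ?thesis using or by (auto simp: Let_def r_def)
    next
      assume ?P1
      from Suc.IH[OF this] show ?thesis using or by (auto simp: Let_def r_def)
    qed
  next
    case conj
    then have "?P0" "?P1" using Suc.prems by (simp_all add: Let_def r_def)
    from Suc.IH[OF this(1)] Suc.IH[OF this(2)] obtain f f' where f: "\<forall>p. f p \<le> k" "\<forall>p. f' p \<le> k"
      "prenex x m (?ch f) n b q (gate_arg x i 0) (map (\<lambda>g. g div r) gs) p"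
      "prenex x m (?ch f') n b q (gate_arg x i (num_args x i - 1)) (map (\<lambda>g. g mod r) gs) (p + 2 ^ n)" by blast
    define h where "h p' = (if p' < p + 2 ^ n then f p' else f' p')" for p'
    have "prenex x m (?ch h) n b q (gate_arg x i 0) (map (\<lambda>g. g div r) gs) p"
      by (rule prenex_mono[OF f(3)]) (simp add: h_def)
    moreover have "prenex x m (?ch h) n b q (gate_arg x i (num_args x i - 1)) (map (\<lambda>g. g mod r) gs) (p + 2 ^ n)"
      by (rule prenex_mono[OF f(4)]) (simp add: h_def)
    moreover have "\<forall>p. h p \<le> k" using f(1,2) by (simp add: h_def)
    ultimately show ?thesis using conj by (intro exI[of _ h]) (simp add: Let_def r_def)
  next
    case big
    have st: "prenex x m lf (Suc n) b q i gs p =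
       (if (gate_kind x i = 4) = b
        then (case (if q then gs else tl gs) of [] \<Rightarrow> False
              | g # hs \<Rightarrow> g div r < num_args x i \<and>
                  prenex x m lf n b True (gate_arg x i (g div r)) (map (\<lambda>g. g mod r) (g # hs)) p)
        else (case (if q then tl gs else gs) of [] \<Rightarrow> False
              | g # hs \<Rightarrow> g div r < num_args x i \<longrightarrow>
                  prenex x m lf n b False (gate_arg x i (g div r)) (map (\<lambda>g. g mod r) (g # hs)) p))" for lf
      unfolding prenex.simps(2) Let_def r_def[symmetric] by (simp only: big simp_thms if_False)
    show ?thesis
    proof (cases "(gate_kind x i = 4) = b")
      case T: True
      then obtain g hs where g: "(if q then gs else tl gs) = g # hs" "g div r < num_args x i"
        "prenex x m ?lf n b True (gate_arg x i (g div r)) (map (\<lambda>g. g mod r) (g # hs)) p"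
        using Suc.prems unfolding st by (cases "if q then gs else tl gs") (simp_all only: if_True list.case simp_thms)
      from Suc.IH[OF g(3)] show ?thesis unfolding st g(1) using T g(2) by (simp only: if_True list.case simp_thms)
    next
      case F: False
      then obtain g hs where g: "(if q then tl gs else gs) = g # hs" "g div r < num_args x i \<longrightarrow>
        prenex x m ?lf n b False (gate_arg x i (g div r)) (map (\<lambda>g. g mod r) (g # hs)) p"
        using Suc.prems unfolding st by (cases "if q then tl gs else gs") (simp_all only: if_False list.case simp_thms)
      show ?thesis
      proof (cases "g div r < num_args x i")
        case True
        with g(2) have "prenex x m ?lf n b False (gate_arg x i (g div r)) (map (\<lambda>g. g mod r) (g # hs)) p" by blast
        from Suc.IH[OF this] show ?thesis unfolding st g(1) using F True by (simp only: if_False list.case simp_thms)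
      next
        case False
        then show ?thesis unfolding st g(1) using F by (intro exI[of _ "\<lambda>_. 0"]) (simp only: if_False list.case simp_thms le0)
      qed
    qed
  qed
qed

text \<open>Used twice: to number the maps from positions to gaps, and to pack a tuple of gaps into
  one value. The least significant digit comes first here.\<close>

lemma digits_exist:
  fixes B :: nat
  assumes "\<And>p. p < d \<Longrightarrow> f p < B"
  shows "\<exists>y<B ^ d. \<forall>p<d. y div B ^ p mod B = f p"
  using assms
proof (induction d)
  case (Suc d)
  then obtain y where y: "y < B ^ d" "\<forall>p<d. y div B ^ p mod B = f p" by auto
  have fd: "f d < B" using Suc.prems by simp
  have "(f d * B ^ d + y) div B ^ p mod B = f p" if "p < Suc d" for p
  proof (cases "p = d")
    case True
    then show ?thesis using y(1) fd by simp
  next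
    case False
    then have p: "p < d" using that by simp
    then have "B ^ d = B ^ p * (B * B ^ (d - p - 1))"
      by (simp flip: power_Suc power_add)
    then have "f d * B ^ d + y = y + B ^ p * (f d * (B * B ^ (d - p - 1)))" by simp
    moreover have "B ^ p \<noteq> 0" using fd by simp
    ultimately have "(f d * B ^ d + y) div B ^ p = y div B ^ p + f d * (B * B ^ (d - p - 1))"
      using div_mult_self2[of "B ^ p" y "f d * (B * B ^ (d - p - 1))"] by (metis add.commute)
    also have "\<dots> mod B = y div B ^ p mod B" by (metis mod_mult_self2 mult.left_commute)
    finally show ?thesis using y(2) p by simp
  qed
  moreover have "f d * B ^ d + y < B ^ Suc d" using csp_var_less[OF fd y(1)] by simp
  ultimately show ?case by blast
qed simp

lemma feasibleP_iff_const:
  assumes "feasibleP a P"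
  shows "feasibleP a (\<lambda>I \<rho>. P I \<rho> = b)" "feasibleP a (\<lambda>I \<rho>. b = P I \<rho>)"
  using assms feasibleP_not[OF assms] by (cases b; simp)+

text \<open>Depth, polarity, leading type and position are constants of the recursion, so the matrix
  unfolds into a fixed combination of tests.\<close>

lemma feasibleP_prenex:
  assumes m: "feasible a (\<lambda>I \<rho>. m I)"
    and lf: "\<And>pol v p. feasible a v \<Longrightarrow> feasibleP a (\<lambda>I \<rho>. lf I \<rho> pol (v I \<rho>) p)"
    and "feasible a i" "\<forall>g\<in>set gs. feasible a g"
  shows "feasibleP a (\<lambda>I \<rho>. prenex (fst I) (m I) (lf I \<rho>) n b q (i I \<rho>) (map (\<lambda>g. g I \<rho>) gs) p)"
  using assms(3,4)
proof (induction n arbitrary: b q i gs p)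
  have a3: "3 \<le> a" using m by (rule feasible_ge_3)
  have leaf: "feasibleP a (\<lambda>I \<rho>. lf I \<rho> (b = (gate_kind (fst I) (i I \<rho>) = 1)) (gate_arg (fst I) (i I \<rho>) 0) p)" if i: "feasible a i" for b i p
  proof -
    have "feasibleP a (\<lambda>I \<rho>. if b = (gate_kind (fst I) (i I \<rho>) = 1) then lf I \<rho> True (gate_arg (fst I) (i I \<rho>) 0) p
        else lf I \<rho> False (gate_arg (fst I) (i I \<rho>) 0) p)"
      using a3 i by (intro feasibleP_if feasibleP_iff_const lf feasible_gate_arg feasibleP_eq feasible_gate_kind feasible_const)
    then show ?thesis by (rule back_subst[of "feasibleP a"]) (auto simp: fun_eq_iff)
  qed
  {
    case 0
    then show ?case using leaf by simp
  next
    case (Suc n)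
    note i = Suc.prems(1)
    let ?r = "\<lambda>I. m I ^ (2 ^ n)"
    have r: "feasible a (\<lambda>I \<rho>. ?r I)" using m by (intro feasible_power)
    have arg: "feasible a (\<lambda>I \<rho>. gate_arg (fst I) (i I \<rho>) (v I \<rho>))" if "feasible a v" for v
      using i that by (rule feasible_gate_arg)
    have na: "feasible a (\<lambda>I \<rho>. num_args (fst I) (i I \<rho>))" using i by (rule feasible_num_args)
    have gk: "feasible a (\<lambda>I \<rho>. gate_kind (fst I) (i I \<rho>))" using i by (rule feasible_gate_kind)
    have dv: "feasible a (\<lambda>I \<rho>. g I \<rho> div ?r I)" "feasible a (\<lambda>I \<rho>. g I \<rho> mod ?r I)" if "feasible a g" for g
      using that r by (auto intro: feasible_div feasible_mod)
    have IHdiv: "feasibleP a (\<lambda>I \<rho>. prenex (fst I) (m I) (lf I \<rho>) n b' q' (j I \<rho>) (map (\<lambda>g. g div ?r I) (map (\<lambda>g. g I \<rho>) hs)) p')"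
      if "feasible a j" "\<forall>g\<in>set hs. feasible a g" for b' q' j hs p'
    proof -
      have "feasibleP a (\<lambda>I \<rho>. prenex (fst I) (m I) (lf I \<rho>) n b' q' (j I \<rho>) (map (\<lambda>g. g I \<rho>) (map (\<lambda>g I \<rho>. g I \<rho> div ?r I) hs)) p')"
        by (rule Suc.IH) (use that dv in auto)
      then show ?thesis by (simp add: comp_def)
    qed
    have IHmod: "feasibleP a (\<lambda>I \<rho>. prenex (fst I) (m I) (lf I \<rho>) n b' q' (j I \<rho>) (map (\<lambda>g. g mod ?r I) (map (\<lambda>g. g I \<rho>) hs)) p')"
      if "feasible a j" "\<forall>g\<in>set hs. feasible a g" for b' q' j hs p'
    proof -
      have "feasibleP a (\<lambda>I \<rho>. prenex (fst I) (m I) (lf I \<rho>) n b' q' (j I \<rho>) (map (\<lambda>g. g I \<rho>) (map (\<lambda>g I \<rho>. g I \<rho> mod ?r I) hs)) p')"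
        by (rule Suc.IH) (use that dv in auto)
      then show ?thesis by (simp add: comp_def)
    qed
    have kb: "feasibleP a (\<lambda>I \<rho>. (gate_kind (fst I) (i I \<rho>) = 4) = b)"
      using gk a3 by (intro feasibleP_iff_const feasibleP_eq feasible_const)
    have big1: "feasibleP a (\<lambda>I \<rho>. case map (\<lambda>g. g I \<rho>) hs of [] \<Rightarrow> False
          | g # hs \<Rightarrow> g div ?r I < num_args (fst I) (i I \<rho>) \<and>
              prenex (fst I) (m I) (lf I \<rho>) n b True (gate_arg (fst I) (i I \<rho>) (g div ?r I)) (map (\<lambda>g. g mod ?r I) (g # hs)) p)"
      if hs: "\<forall>g\<in>set hs. feasible a g" for hs
    proof (cases hs)
      case Nil
      then show ?thesis using a3 by (simp add: feasibleP_const)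
    next
      case (Cons g hs')
      have "feasibleP a (\<lambda>I \<rho>. g I \<rho> div ?r I < num_args (fst I) (i I \<rho>) \<and>
              prenex (fst I) (m I) (lf I \<rho>) n b True (gate_arg (fst I) (i I \<rho>) (g I \<rho> div ?r I)) (map (\<lambda>g. g mod ?r I) (map (\<lambda>g. g I \<rho>) (g # hs'))) p)"
        using hs Cons by (intro feasibleP_conj feasibleP_less na IHmod arg dv) auto
      then show ?thesis using Cons by simp
    qed
    have big2: "feasibleP a (\<lambda>I \<rho>. case map (\<lambda>g. g I \<rho>) hs of [] \<Rightarrow> False
          | g # hs \<Rightarrow> g div ?r I < num_args (fst I) (i I \<rho>) \<longrightarrow>
              prenex (fst I) (m I) (lf I \<rho>) n b False (gate_arg (fst I) (i I \<rho>) (g div ?r I)) (map (\<lambda>g. g mod ?r I) (g # hs)) p)"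
      if hs: "\<forall>g\<in>set hs. feasible a g" for hs
    proof (cases hs)
      case Nil
      then show ?thesis using a3 by (simp add: feasibleP_const)
    next
      case (Cons g hs')
      have "feasibleP a (\<lambda>I \<rho>. g I \<rho> div ?r I < num_args (fst I) (i I \<rho>) \<longrightarrow>
              prenex (fst I) (m I) (lf I \<rho>) n b False (gate_arg (fst I) (i I \<rho>) (g I \<rho> div ?r I)) (map (\<lambda>g. g mod ?r I) (map (\<lambda>g. g I \<rho>) (g # hs'))) p)"
        using hs Cons by (intro feasibleP_imp feasibleP_less na IHmod arg dv) auto
      then show ?thesis using Cons by simp
    qed
    have tl: "(if c then map (\<lambda>g. g I \<rho>) gs else tl (map (\<lambda>g. g I \<rho>) gs)) = map (\<lambda>g. g I \<rho>) (if c then gs else tl gs)"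
      "(if c then tl (map (\<lambda>g. g I \<rho>) gs) else map (\<lambda>g. g I \<rho>) gs) = map (\<lambda>g. g I \<rho>) (if c then tl gs else gs)" for c I \<rho>
      by (auto simp: map_tl)
    have hs: "\<forall>g\<in>set (if q then gs else tl gs). feasible a g" "\<forall>g\<in>set (if q then tl gs else gs). feasible a g"
    proof -
      have "set (tl gs) \<subseteq> set gs" by (cases gs) auto
      then show "\<forall>g\<in>set (if q then gs else tl gs). feasible a g" "\<forall>g\<in>set (if q then tl gs else gs). feasible a g"
        using Suc.prems(2) by auto
    qed
    show ?case
      unfolding prenex.simps Let_def tl
      by (intro feasibleP_if leaf i IHdiv IHmod kb big1[OF hs(1)] big2[OF hs(2)] feasibleP_le feasibleP_eq gk na arg feasible_const a3
          feasibleP_disj feasibleP_conj feasible_diff Suc.prems(2))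
  }
qed

subsection \<open>Hardness\<close>

text \<open>The bound by \<open>length x\<close> keeps every variable below the upper sentinel,
  whatever the input string.\<close>

definition is_variable :: "bool list \<Rightarrow> nat \<Rightarrow> bool" where
  "is_variable x v \<longleftrightarrow> v \<le> length x \<and> (\<exists>i<num_gates x. gate_kind x i \<le> 1 \<and> gate_arg x i 0 = v)"

lemma gate_kind_le_1:
  assumes "i < length C"
  shows "gate_kind (encode C) i \<le> 1 \<longleftrightarrow> is_LIT (C ! i)"
  using gate_parse[OF assms] by (cases "C ! i") auto

lemma gate_arg_le_length: "gate_arg x i p \<le> length x"
  unfolding gate_arg_def by (rule token_le_length)

lemma is_variable_vars: "Collect (is_variable (encode C)) = vars C"
proof -
  have "is_variable (encode C) v \<longleftrightarrow> (\<exists>b. LIT b v \<in> set C)" for v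
  proof
    assume "is_variable (encode C) v"
    then obtain i where i: "i < length C" "gate_kind (encode C) i \<le> 1" "gate_arg (encode C) i 0 = v"
      by (auto simp: is_variable_def num_gates_encode)
    then obtain b w where G: "C ! i = LIT b w" using gate_kind_le_1[OF i(1)] by (cases "C ! i") auto
    then have "w = v" using gate_parse(1)[OF i(1) G] i(3) by simp
    then show "\<exists>b. LIT b v \<in> set C" using nth_mem[OF i(1)] G by auto
  next
    assume "\<exists>b. LIT b v \<in> set C"
    then obtain b i where i: "i < length C" "C ! i = LIT b v" by (auto simp: in_set_conv_nth)
    then have "gate_kind (encode C) i \<le> 1" "gate_arg (encode C) i 0 = v"
      using gate_parse(1)[OF i] by auto
    then show "is_variable (encode C) v"
      using i(1) gate_arg_le_length[of "encode C" i 0] by (auto simp: is_variable_def num_gates_encode)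
  qed
  then show ?thesis by (auto simp: vars_def)
qed

lemma feasibleP_is_variable: "feasible b v \<Longrightarrow> feasibleP b (\<lambda>I \<rho>. is_variable (fst I) (v I \<rho>))"
  unfolding is_variable_def
proof (intro feasibleP_conj feasibleP_le feasible_length feasibleP_ex feasible_num_gates)
  assume v: "feasible b v"
  then show "3 \<le> b" "3 \<le> b" by (auto dest: feasible_ge_3)
  fix w c assume "b \<le> c" "feasible c w"
  then show "feasible c (\<lambda>I \<rho>. gate_kind (fst I) (w I \<rho>))" "feasible c (\<lambda>I \<rho>. 1)"
    by (auto intro: feasible_gate_kind feasible_const dest: feasible_ge_3)
  show "feasibleP c (\<lambda>I \<rho>. gate_arg (fst I) (w I \<rho>) 0 = v I \<rho>)"
    using \<open>b \<le> c\<close> \<open>feasible c w\<close> feasible_mono[OF v \<open>b \<le> c\<close>] feasible_ge_3[OF \<open>feasible c w\<close>]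
    by (intro feasibleP_eq feasible_gate_arg feasible_const)
qed

text \<open>\<open>c\<close> codes a gap as two digits in base \<open>M\<close>. The left endpoint
  witnesses membership, the interior witnesses absence.\<close>

definition lit_cert :: "nat \<Rightarrow> nat \<Rightarrow> bool \<Rightarrow> nat \<Rightarrow> bool" where
  "lit_cert M c pol v \<longleftrightarrow> (if pol then c div M = v + 1 else c div M < v + 1 \<and> v + 1 < c mod M)"

lemma gaps_lit_cert:
  assumes "gaps k M S U" "v + 1 < M - 1" "2 \<le> M"
  shows "(v \<in> S) = pol \<longleftrightarrow> (\<exists>i\<le>k. lit_cert M (U i * M + U (i + 1)) pol v)"
proof -
  have UM: "U i < M" if "i \<le> k + 1" for i
    using gaps_less[OF assms(1), of i "k + 1"] assms(1,3) that by (cases "i = k + 1") (auto simp: gaps_def)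
  have "(U i * M + U (i + 1)) div M = U i" "(U i * M + U (i + 1)) mod M = U (i + 1)" if "i \<le> k" for i
    using UM[of "i + 1"] that by simp_all
  then have eq: "lit_cert M (U i * M + U (i + 1)) pol v \<longleftrightarrow> (if pol then U i = v + 1 else U i < v + 1 \<and> v + 1 < U (i + 1))" if "i \<le> k" for i
    using that unfolding lit_cert_def by simp
  show ?thesis
  proof (cases pol)
    case True
    then show ?thesis using gaps_mem[OF assms(1), of v] eq by auto
  next
    case False
    then show ?thesis using gaps_not_mem[OF assms(1,2)] eq by auto
  qed
qed

text \<open>Group \<open>e\<close> of the further groups stands for the map whose digits in base
  \<open>k + 1\<close> are those of \<open>e\<close>; it sends each of the \<open>d = 2 ^ h\<close>
  leaf positions to a gap, and its value packs the gaps so chosen. Since \<open>t\<close> is even,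
  the last of the \<open>t + 1\<close> quantifiers is existential and moves into
  \<open>cert\<close>, hence into the bottom disjunctions.\<close>

lemma WSAT_mono_W_hard:
  assumes t: "2 \<le> t" "even t" and g: "c > 0" "(\<lambda>n. real (g n)) \<in> \<Omega>(\<lambda>n. real n powr c)" and P: "P \<in> W t"
  shows "fpt_reducible P (WSAT_mono t g)"
proof -
  obtain h where PQ: "fpt_reducible P (weighted_sat (\<lambda>C. wf_circuit C \<and> weft C \<le> t \<and> depth C \<le> h))"
    using P by (auto simp: W_def)
  define d :: nat where "d = 2 ^ h"
  define E where "E I = (snd I + 1) ^ d" for I :: input
  define M where "M I = length (fst I) + 3" for I :: input
  define m where "m I = num_gates (fst I) + 2" for I :: input
  define R where "R I = m I ^ (2 ^ h)" for I
  \<comment> \<open>Room for a single gap, a guessed index and a \<open>d\<close>-tuple of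
    gaps.\<close>
  define B where "B I = M I * M I + R I + (M I * M I) ^ d" for I
  \<comment> \<open>If digit \<open>p\<close> of the group number \<open>e\<close> names gap
    \<open>i\<close>, then digit \<open>p\<close> of the value must be that gap. Each condition
    concerns one gap and one further group, so it is a binary constraint.\<close>
  define xc where "xc I i u w e y \<longleftrightarrow> (\<forall>p<d. e div (snd I + 1) ^ p mod (snd I + 1) = i \<longrightarrow>
     y div (M I * M I) ^ p mod (M I * M I) = u * M I + w)" for I :: input and i u w e y
  define lf where "lf I y pol v p \<longleftrightarrow> lit_cert (M I) (y div (M I * M I) ^ p mod (M I * M I)) pol v" for I :: input and y pol v and p :: nat
  define cert where "cert I gs e y \<longleftrightarrow> (\<exists>a<R I. prenex (fst I) (m I) (lf I y) h True True (num_gates (fst I) - 1) (gs @ [a]) 0)"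
    for I and gs :: "nat list" and e y :: nat
  have mM: "feasible b (\<lambda>I \<rho>. M I)" if "3 \<le> b" for b
    unfolding M_def using that by (intro feasible_add feasible_length feasible_const)
  have mm: "feasible b (\<lambda>I \<rho>. m I)" if "3 \<le> b" for b
    unfolding m_def using that by (intro feasible_add feasible_num_gates feasible_const)
  have mR: "feasible b (\<lambda>I \<rho>. R I)" if "3 \<le> b" for b
    unfolding R_def using that by (intro feasible_power mm)
  have mB: "feasible b (\<lambda>I \<rho>. B I)" if "3 \<le> b" for b
    unfolding B_def using that by (intro feasible_add feasible_mult feasible_power mM mR)
  have mE: "feasible b (\<lambda>I \<rho>. E I)" if "3 \<le> b" for b
    unfolding E_def using that by (intro feasible_add feasible_param feasible_power feasible_const)
  show ?thesis
  proof (rule slot_reduction[where E=E and M=M and R=R and B=B and isv="\<lambda>I. is_variable (fst I)" and xc=xc and cert=cert and D=d,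
        OF PQ t g mE mM mR mB])
    show "3 \<le> (3::nat)" "3 \<le> (3::nat)" "3 \<le> (3::nat)" "3 \<le> (3::nat)" by simp_all
    show "feasibleP b (\<lambda>I \<rho>. is_variable (fst I) (v I \<rho>))" if "feasible b v" for v b using that by (rule feasibleP_is_variable)
    show "feasibleP b (\<lambda>I \<rho>. xc I (v1 I \<rho>) (v2 I \<rho>) (v3 I \<rho>) (v4 I \<rho>) (v5 I \<rho>))"
      if "3 \<le> b" "feasible b v1" "feasible b v2" "feasible b v3" "feasible b v4" "feasible b v5" for v1 v2 v3 v4 v5 b
      unfolding xc_def using that by (intro feasibleP_all_const feasible_rules mM)
    show "feasibleP b (\<lambda>I \<rho>. cert I (map (\<lambda>v. v I \<rho>) vs) (v I \<rho>) (w I \<rho>))"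
      if b: "3 \<le> b" and vs: "length vs = t" "\<forall>v\<in>set vs. feasible b v" and w: "feasible b v" "feasible b w" for vs v w b
      unfolding cert_def
    proof (rule feasibleP_ex[OF mR[OF b]])
      fix u c assume c: "b \<le> c" "feasible c u"
      have c3: "3 \<le> c" using b c by simp
      have "feasibleP c (\<lambda>I \<rho>. prenex (fst I) (m I) (lf I (w I \<rho>)) h True True (num_gates (fst I) - 1) (map (\<lambda>v. v I \<rho>) (vs @ [u])) 0)"
      proof (rule feasibleP_prenex)
        show "feasible c (\<lambda>I \<rho>. num_gates (fst I) - 1)" using c3 by (intro feasible_diff feasible_num_gates feasible_const)
        show "\<forall>g\<in>set (vs @ [u]). feasible c g" using vs(2) c feasible_mono by auto
        show "feasibleP c (\<lambda>I \<rho>. lf I (w I \<rho>) pol (v' I \<rho>) p)" if "feasible c v'" for pol v' p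
          using feasible_mono[OF w(2) c(1)] that c3 unfolding lf_def lit_cert_def
          by (intro feasibleP_if feasible_rules mM)
      qed (rule mm[OF c3])
      then show "feasibleP c (\<lambda>I \<rho>. prenex (fst I) (m I) (lf I (w I \<rho>)) h True True (num_gates (fst I) - 1) (map (\<lambda>v. v I \<rho>) vs @ [u I \<rho>]) 0)"
        by simp
    qed
    show "E (x, k) \<le> 2 ^ (d * (k + 1))" for x k
    proof -
      have "k + 1 \<le> 2 ^ (k + 1)" by (induction k) auto
      then have "(k + 1) ^ d \<le> (2 ^ (k + 1)) ^ d" by (rule power_mono) simp
      then show ?thesis by (simp only: E_def snd_conv power_mult[symmetric] mult.commute[of d])
    qed
    show "2 \<le> M I" for I by (simp add: M_def)
    show "v + 1 < M I - 1" if "is_variable (fst I) v" for I v using that by (simp add: is_variable_def M_def)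
    show "M I * M I \<le> B I" "R I \<le> B I" for I by (auto simp: B_def)
    show R0: "0 < R I" for I by (simp add: R_def m_def)
    fix x k assume "(x, k) \<in> instances (weighted_sat (\<lambda>C. wf_circuit C \<and> weft C \<le> t \<and> depth C \<le> h))"
    then obtain C where x: "x = encode C" and C: "wf_circuit C" "weft C \<le> t" "depth C \<le> h"
      unfolding weighted_sat_instances(3) by blast
    let ?I = "(x, k)"
    have ng: "num_gates x = length C" by (simp add: x num_gates_encode)
    have ne: "C \<noteq> []" using C(1) by (simp add: wf_circuit_def)
    have root: "length C - 1 < length C" using ne by (cases C) auto
    let ?S = "\<lambda>S (b::bool) v (p::nat). (v \<in> S) = b"
    have sem: "(\<exists>g<R ?I. alt (R ?I) False (t - 1) (\<lambda>gs. \<exists>a<R ?I. prenex x (m ?I) (?S S) h True True (length C - 1) ((g # gs) @ [a]) 0)) \<longleftrightarrow>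
        satisfies S C" for S
    proof -
      have "alt (R ?I) True (Suc t) (\<lambda>gs. prenex x (m ?I) (?S S) h True True (length C - 1) gs 0) \<longleftrightarrow> gate_value S C (length C - 1) = True"
        unfolding R_def x
      proof (rule prenex_correct[OF C(1) _ root])
        show "length C + 2 \<le> m (encode C, k)" by (simp add: m_def num_gates_encode)
        show "path_value (\<lambda>G. \<not> is_LIT G) C (length C - 1) \<le> h"
          using C(3) by (simp add: depth_def max_on_path_path_value[OF ne])
        show "path_value (\<lambda>G. 2 < length (fan_in G)) C (length C - 1) < Suc t"
          using C(2) by (simp add: weft_def max_on_path_path_value[OF ne])
      qed
      also have "alt (R ?I) True (Suc t) (\<lambda>gs. prenex x (m ?I) (?S S) h True True (length C - 1) gs 0) \<longleftrightarrow>
         (\<exists>g<R ?I. alt (R ?I) False (Suc (t - 1)) (\<lambda>gs. prenex x (m ?I) (?S S) h True True (length C - 1) (g # gs) 0))"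
        using t(1) by simp
      also have "\<dots> \<longleftrightarrow> (\<exists>g<R ?I. alt (R ?I) False (t - 1) (\<lambda>gs. \<exists>a<R ?I. prenex x (m ?I) (?S S) h True True (length C - 1) ((g # gs) @ [a]) 0))"
        unfolding alt_snoc using t by simp
      finally show ?thesis using satisfies_gate_value[OF ne] by simp
    qed
    have arg: "gate_arg x j 0 + 1 < M ?I - 1" for j using gate_arg_le_length[of x j 0] by (simp add: M_def)
    have M2: "2 \<le> M ?I" by (simp add: M_def)
    \<comment> \<open>A certificate is sound because its digits are real gaps of \<open>S\<close>,
      and complete because \<open>prenex_choose\<close> yields a map from positions to gaps, which
      is the number of some group.\<close>
    have leaf: "(\<exists>e<E ?I. cert ?I gs e (y e)) \<longleftrightarrow> (\<exists>a<R ?I. prenex x (m ?I) (?S S) h True True (length C - 1) (gs @ [a]) 0)"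
      if gp: "gaps k (M ?I) S U" and y: "\<forall>e<E ?I. y e < B ?I \<and> (\<forall>i\<le>k. xc ?I i (U i) (U (i + 1)) e (y e))" for S U y gs
    proof
      assume "\<exists>e<E ?I. cert ?I gs e (y e)"
      then obtain e a where e: "e < E ?I" "a < R ?I" and
        pr: "prenex x (m ?I) (lf ?I (y e)) h True True (length C - 1) (gs @ [a]) 0"
        by (auto simp: cert_def ng)
      have "prenex x (m ?I) (?S S) h True True (length C - 1) (gs @ [a]) 0"
      proof (rule prenex_mono[OF pr])
        fix pol j p assume p: "p < 0 + 2 ^ h" "lf ?I (y e) pol (gate_arg x j 0) p"
        define i where "i = e div (k + 1) ^ p mod (k + 1)"
        have i: "i \<le> k" unfolding i_def using mod_less_divisor[of "k + 1"] by (simp add: less_Suc_eq_le)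
        have "y e div (M ?I * M ?I) ^ p mod (M ?I * M ?I) = U i * M ?I + U (i + 1)"
          using y e(1) i p(1) unfolding xc_def d_def i_def by (metis add_0 snd_conv)
        then have "lit_cert (M ?I) (U i * M ?I + U (i + 1)) pol (gate_arg x j 0)" using p(2) by (simp add: lf_def)
        then show "(gate_arg x j 0 \<in> S) = pol" using gaps_lit_cert[OF gp arg M2] i by blast
      qed
      then show "\<exists>a<R ?I. prenex x (m ?I) (?S S) h True True (length C - 1) (gs @ [a]) 0" using e(2) by blast
    next
      assume "\<exists>a<R ?I. prenex x (m ?I) (?S S) h True True (length C - 1) (gs @ [a]) 0"
      then obtain a where a: "a < R ?I" and pr: "prenex x (m ?I) (?S S) h True True (length C - 1) (gs @ [a]) 0" by blast
      have "prenex x (m ?I) (\<lambda>pol v p. \<exists>i\<le>k. lit_cert (M ?I) (U i * M ?I + U (i + 1)) pol v) h True True (length C - 1) (gs @ [a]) 0"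
        by (rule prenex_mono[OF pr]) (use gaps_lit_cert[OF gp arg M2] in blast)
      from prenex_choose[OF this] obtain f where f: "\<forall>p. f p \<le> k" and
        pr: "prenex x (m ?I) (\<lambda>pol v p. lit_cert (M ?I) (U (f p) * M ?I + U (f p + 1)) pol v) h True True (length C - 1) (gs @ [a]) 0" by blast
      have "\<exists>e<(k + 1) ^ d. \<forall>p<d. e div (k + 1) ^ p mod (k + 1) = f p"
        using f by (intro digits_exist) (simp add: less_Suc_eq_le)
      then obtain e where e: "e < E ?I" "\<And>p. p < d \<Longrightarrow> e div (k + 1) ^ p mod (k + 1) = f p" by (auto simp: E_def)
      have "prenex x (m ?I) (lf ?I (y e)) h True True (length C - 1) (gs @ [a]) 0"
      proof (rule prenex_mono[OF pr])
        fix pol j p assume p: "p < 0 + 2 ^ h" "lit_cert (M ?I) (U (f p) * M ?I + U (f p + 1)) pol (gate_arg x j 0)"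
        have "y e div (M ?I * M ?I) ^ p mod (M ?I * M ?I) = U (f p) * M ?I + U (f p + 1)"
          using y e(1) e(2)[of p] f p(1) unfolding xc_def d_def by (metis add_0 snd_conv)
        then show "lf ?I (y e) pol (gate_arg x j 0) p" using p(2) by (simp add: lf_def)
      qed
      then show "\<exists>e<E ?I. cert ?I gs e (y e)" using a e(1) by (auto simp: cert_def ng)
    qed
    show "(x, k) \<in> yes_instances (weighted_sat (\<lambda>C. wf_circuit C \<and> weft C \<le> t \<and> depth C \<le> h)) \<longleftrightarrow>
       (\<exists>S U g y. S \<subseteq> Collect (is_variable (fst (x, k))) \<and> gaps k (M (x, k)) S U \<and> g < R (x, k) \<and>
          (\<forall>e<E (x, k). y e < B (x, k) \<and> (\<forall>i\<le>k. xc (x, k) i (U i) (U (i + 1)) e (y e))) \<and>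
          alt (R (x, k)) False (t - 1) (\<lambda>gs. \<exists>e<E (x, k). cert (x, k) (g # gs) e (y e)))" (is "?Y \<longleftrightarrow> ?Z")
    proof
      assume ?Y
      then obtain S where S: "S \<subseteq> vars C" "card S = k" "satisfies S C"
        unfolding x weighted_sat_instances(2) weight_satisfiable_def by blast
      have Sv: "S \<subseteq> Collect (is_variable (fst ?I))" using S(1) by (simp add: x is_variable_vars)
      have SM: "v + 1 < M ?I - 1" if "v \<in> S" for v using Sv that by (auto simp: is_variable_def M_def)
      then have "S \<subseteq> {..<M ?I}" by force
      then have "finite S" by (rule finite_subset) simp
      from gaps_exists[OF this S(2) SM M2] obtain U where gp: "gaps k (M ?I) S U" by blast
      have UM: "U i < M ?I" if "i \<le> k + 1" for i
        using gaps_less[OF gp, of i "k + 1"] gp that M2 by (cases "i = k + 1") (auto simp: gaps_def)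
      have "\<exists>y<(M ?I * M ?I) ^ d. \<forall>p<d. y div (M ?I * M ?I) ^ p mod (M ?I * M ?I) =
          U (e div (k + 1) ^ p mod (k + 1)) * M ?I + U (e div (k + 1) ^ p mod (k + 1) + 1)" for e
      proof (rule digits_exist)
        fix p
        have "e div (k + 1) ^ p mod (k + 1) < k + 1" by (rule mod_less_divisor) simp
        then show "U (e div (k + 1) ^ p mod (k + 1)) * M ?I + U (e div (k + 1) ^ p mod (k + 1) + 1) < M ?I * M ?I"
          by (intro csp_var_less UM) simp_all
      qed
      then obtain y where y: "\<And>e. y e < (M ?I * M ?I) ^ d" "\<And>e p. p < d \<Longrightarrow> y e div (M ?I * M ?I) ^ p mod (M ?I * M ?I) =
          U (e div (k + 1) ^ p mod (k + 1)) * M ?I + U (e div (k + 1) ^ p mod (k + 1) + 1)" by metis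
      have yx: "\<forall>e<E ?I. y e < B ?I \<and> (\<forall>i\<le>k. xc ?I i (U i) (U (i + 1)) e (y e))"
        using y by (auto simp: B_def xc_def trans_less_add2)
      obtain g where "g < R ?I" "alt (R ?I) False (t - 1) (\<lambda>gs. \<exists>a<R ?I. prenex x (m ?I) (?S S) h True True (length C - 1) ((g # gs) @ [a]) 0)"
        using S(3) sem[of S] by blast
      then show ?Z using Sv gp yx unfolding leaf[OF gp yx, symmetric] by blast
    next
      assume ?Z
      then obtain S U g y where S: "S \<subseteq> Collect (is_variable (fst ?I))" and gp: "gaps k (M ?I) S U" and g: "g < R ?I" and
        y: "\<forall>e<E ?I. y e < B ?I \<and> (\<forall>i\<le>k. xc ?I i (U i) (U (i + 1)) e (y e))" and
        al: "alt (R ?I) False (t - 1) (\<lambda>gs. \<exists>e<E ?I. cert ?I (g # gs) e (y e))" by blast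
      have "satisfies S C" using al g unfolding leaf[OF gp y] using sem[of S] by blast
      moreover have "S \<subseteq> vars C" using S by (simp add: x is_variable_vars)
      moreover have "card S = k" using gaps_card[OF gp] .
      ultimately show ?Y unfolding x weighted_sat_instances(2) weight_satisfiable_def using C by blast
    qed
  qed
qed

subsection \<open>Odd depth\<close>

text \<open>\<open>b\<close> tells whether the current quantifier is existential. A literal reached
  early is kept until the indices run out, and an index beyond the fan-in yields \<not> b, the
  neutral value of that quantifier.\<close>

primrec walk :: "bool list \<Rightarrow> (nat \<Rightarrow> bool) \<Rightarrow> nat list \<Rightarrow> bool \<Rightarrow> nat \<Rightarrow> bool" where
  "walk x pr [] b i = pr i"
| "walk x pr (g # gs) b i =
    (if gate_kind x i \<le> 1 then walk x pr gs (\<not> b) i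
     else if g < num_args x i then walk x pr gs (\<not> b) (gate_arg x i g) else \<not> b)"

lemma walk_mono: "walk x pr gs b i \<Longrightarrow> (\<And>j. pr j \<Longrightarrow> pr' j) \<Longrightarrow> walk x pr' gs b i"
  by (induction gs arbitrary: b i) (auto split: if_splits)

text \<open>A walk consults its predicate at most once, so a disjunction can be pulled out of it; a
  walk that ends in a neutral value needs the range of \<open>e\<close> to be nonempty.\<close>

lemma walk_ex: "0 < E \<Longrightarrow> (\<exists>e<E. walk x (pr e) gs b i) \<longleftrightarrow> walk x (\<lambda>j. \<exists>e<E. pr e j) gs b i" for E :: nat
  by (induction gs arbitrary: b i) auto

lemma alt_mono: "alt R b n P \<Longrightarrow> (\<And>gs. P gs \<Longrightarrow> P' gs) \<Longrightarrow> alt R b n P'"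
proof (induction n arbitrary: b P P')
  case (Suc n)
  have "alt R (\<not> b) n (\<lambda>gs. P' (g # gs))" if "alt R (\<not> b) n (\<lambda>gs. P (g # gs))" for g
    using that Suc.prems(2) by (rule Suc.IH)
  then show ?case using Suc.prems(1) by (auto split: if_splits)
qed simp

lemma fan_in_less:
  assumes "wf_circuit C" "i < length C" "j \<in> set (fan_in (C ! i))"
  shows "j < length C"
proof -
  have "j < i" using assms by (auto simp: wf_circuit_def)
  then show ?thesis using assms(2) by simp
qed

text \<open>Gates alternate, so the parity of \<open>n\<close> determines the type of the current
  gate and each level takes one quantifier. After \<open>n\<close> levels the height is at most 1
  and OR-gates are excluded: what is left is a literal or a conjunction of literals, where
  \<open>pr\<close> takes over.\<close>

lemma walk_correct:
  assumes Pi: "Pi_circuit t C" and R: "length C < R"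
    and pr: "\<And>j. j < length C \<Longrightarrow> is_LIT (C ! j) \<or> (is_AND (C ! j) \<and> (\<forall>c\<in>set (fan_in (C ! j)). is_LIT (C ! c))) \<Longrightarrow> pr j = gate_value S C j"
    and "i < length C" "path_value (\<lambda>G. \<not> is_LIT G) C i \<le> n + 1" "is_LIT (C ! i) \<or> is_OR (C ! i) = odd n"
  shows "alt R (odd n) n (\<lambda>gs. walk (encode C) pr gs (odd n) i) \<longleftrightarrow> gate_value S C i"
  using assms(4-6)
proof (induction n arbitrary: i)
  have wf: "wf_circuit C" using Pi by (simp add: Pi_circuit_def)
  have R0: "0 < R" using R by simp
  have notN: "\<not> is_NOT (C ! i)" if "i < length C" for i using Pi nth_mem[OF that] by (simp add: Pi_circuit_def)
  {
    case 0
    have "pr i = gate_value S C i"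
    proof (rule pr[OF 0(1)])
      show "is_LIT (C ! i) \<or> (is_AND (C ! i) \<and> (\<forall>c\<in>set (fan_in (C ! i)). is_LIT (C ! c)))"
      proof (cases "is_LIT (C ! i)")
        case False
        then have "is_AND (C ! i)" using 0(3) notN[OF 0(1)] by (cases "C ! i") auto
        moreover have "is_LIT (C ! c)" if c: "c \<in> set (fan_in (C ! i))" for c
        proof -
          have "c < length C" using wf 0(1) c by (rule fan_in_less)
          then show ?thesis
            using path_value_fan_in[OF wf 0(1) c, of "\<lambda>G. \<not> is_LIT G"] path_value_ge[of c C "\<lambda>G. \<not> is_LIT G"] False 0(2)
            by (cases "is_LIT (C ! c)") auto
        qed
        ultimately show ?thesis by blast
      qed simp
    qed
    then show ?case by simp
  next
    case (Suc n)
    let ?x = "encode C"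
    have odd: "(\<not> odd (Suc n)) = odd n" by simp
    have step: "alt R (odd (Suc n)) (Suc n) (\<lambda>gs. walk ?x pr gs (odd (Suc n)) i) \<longleftrightarrow>
        (if odd (Suc n) then \<exists>g<R. alt R (odd n) n (\<lambda>gs. walk ?x pr (g # gs) (odd (Suc n)) i)
         else \<forall>g<R. alt R (odd n) n (\<lambda>gs. walk ?x pr (g # gs) (odd (Suc n)) i))"
      unfolding alt.simps(2) odd ..
    show ?case
    proof (cases "is_LIT (C ! i)")
      case True
      have "path_value (\<lambda>G. \<not> is_LIT G) C i = 0"
      proof -
        have "fan_in (C ! i) = []" using True by (cases "C ! i") auto
        then show ?thesis using True unfolding path_value_def vertex_values_nth[OF Suc.prems(1)] by simp
      qed
      then have "alt R (odd n) n (\<lambda>gs. walk ?x pr gs (odd n) i) \<longleftrightarrow> gate_value S C i"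
        using Suc.IH[of i] Suc.prems(1) True by simp
      moreover have "gate_kind ?x i \<le> 1" using gate_kind_le_1[OF Suc.prems(1)] True by simp
      ultimately have eq: "alt R (odd n) n (\<lambda>gs. walk ?x pr (g # gs) (odd (Suc n)) i) \<longleftrightarrow> gate_value S C i" for g
        by simp
      show ?thesis unfolding step eq using R0 by auto
    next
      case False
      then have nk: "\<not> gate_kind ?x i \<le> 1" using gate_kind_le_1[OF Suc.prems(1)] by simp
      have IH: "alt R (odd n) n (\<lambda>gs. walk ?x pr gs (odd n) j) \<longleftrightarrow> gate_value S C j" if j: "j \<in> set (fan_in (C ! i))" for j
      proof (rule Suc.IH)
        show jl: "j < length C" using wf Suc.prems(1) j by (rule fan_in_less)
        show "path_value (\<lambda>G. \<not> is_LIT G) C j \<le> n + 1"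
          using path_value_fan_in[OF wf Suc.prems(1) j, of "\<lambda>G. \<not> is_LIT G"] Suc.prems(2) False by simp
        have alt: "\<not> (is_AND (C ! i) \<and> is_AND (C ! j)) \<and> \<not> (is_OR (C ! i) \<and> is_OR (C ! j))"
          using Pi Suc.prems(1) j unfolding Pi_circuit_def by blast
        show "is_LIT (C ! j) \<or> is_OR (C ! j) = odd n"
          using alt notN[OF Suc.prems(1)] notN[OF jl] Suc.prems(3) False by (cases "C ! i"; cases "C ! j") auto
      qed
      have main: ?thesis if js: "fan_in (C ! i) = js" and na: "num_args ?x i = length js" "\<forall>p<length js. gate_arg ?x i p = js ! p"
        and val: "gate_value S C i \<longleftrightarrow> (if odd (Suc n) then \<exists>j\<in>set js. gate_value S C j else \<forall>j\<in>set js. gate_value S C j)" for js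
      proof -
        have len: "length js \<le> R"
        proof -
          have "distinct js" using wf js nth_mem[OF Suc.prems(1)] by (auto simp: wf_circuit_def)
          moreover have "set js \<subseteq> {..<length C}" using wf Suc.prems(1) js by (force simp: wf_circuit_def)
          ultimately have "length js \<le> length C" by (metis card_lessThan card_mono distinct_card finite_lessThan)
          then show ?thesis using R by simp
        qed
        have w: "alt R (odd n) n (\<lambda>gs. walk ?x pr (g # gs) (odd (Suc n)) i) \<longleftrightarrow>
            (if g < length js then gate_value S C (js ! g) else \<not> odd (Suc n))" for g
        proof (cases "g < length js")
          case True
          then show ?thesis using nk na IH[of "js ! g"] js by simp
        next
          case False
          then show ?thesis using nk na alt_const[OF R0] by simp
        qed
        have set: "(\<exists>j\<in>set js. P j) \<longleftrightarrow> (\<exists>a<length js. P (js ! a))" "(\<forall>j\<in>set js. P j) \<longleftrightarrow> (\<forall>a<length js. P (js ! a))" for P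
          by (metis in_set_conv_nth)+
        show ?thesis unfolding step w val set using len by (auto split: if_splits)
      qed
      show ?thesis
      proof (cases "C ! i")
        case (AND js)
        then have "\<not> odd (Suc n)" using Suc.prems(3) by simp
        then show ?thesis
          using gate_parse(3)[OF Suc.prems(1) AND] gate_value_simps(3)[OF wf Suc.prems(1) AND, of S] AND
          by (intro main[of js]) auto
      next
        case (OR js)
        then have "odd (Suc n)" using Suc.prems(3) by simp
        then show ?thesis
          using gate_parse(4)[OF Suc.prems(1) OR] gate_value_simps(4)[OF wf Suc.prems(1) OR, of S] OR
          by (intro main[of js]) auto
      qed (use False notN[OF Suc.prems(1)] in auto)
    qed
  }
qed

text \<open>The variables of a bottom vertex, which is a literal or an AND-gate on literals.\<close>

definition occurs :: "bool list \<Rightarrow> nat \<Rightarrow> nat \<Rightarrow> bool" where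
  "occurs x i v \<longleftrightarrow> (gate_kind x i \<le> 1 \<and> gate_arg x i 0 = v) \<or>
     (gate_kind x i = 3 \<and> (\<exists>p<num_args x i. gate_arg x (gate_arg x i p) 0 = v))"

lemma occurs_le_length: "occurs x i v \<Longrightarrow> v \<le> length x"
  unfolding occurs_def using gate_arg_le_length by blast

text \<open>With positive literals a bottom vertex is determined by its set of variables, and it is
  true iff this set is one of the \<open>2 ^ k\<close> subsets of \<open>S\<close>.\<close>

lemma gate_value_occurs:
  assumes wf: "wf_circuit C" and mono: "monotone_circuit C" and j: "j < length C"
    and bottom: "is_LIT (C ! j) \<or> (is_AND (C ! j) \<and> (\<forall>c\<in>set (fan_in (C ! j)). is_LIT (C ! c)))"
  shows "gate_value S C j \<longleftrightarrow> Collect (occurs (encode C) j) \<subseteq> S"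
proof -
  have lit: "gate_value S C i \<longleftrightarrow> gate_arg (encode C) i 0 \<in> S" if "i < length C" "is_LIT (C ! i)" for i
  proof -
    from that(2) obtain b v where G: "C ! i = LIT b v" by (cases "C ! i") auto
    have b using mono nth_mem[OF that(1)] G unfolding monotone_circuit_def by auto
    then show ?thesis using gate_value_simps(1)[OF wf that(1) G, of S] gate_parse(1)[OF that(1) G] by simp
  qed
  show ?thesis
  proof (cases "is_LIT (C ! j)")
    case True
    then have "gate_kind (encode C) j \<le> 1" using gate_kind_le_1[OF j] by simp
    then show ?thesis using lit[OF j True] by (auto simp: occurs_def)
  next
    case False
    then obtain js where G: "C ! j = AND js" using bottom by (cases "C ! j") auto
    have js: "c < length C \<and> is_LIT (C ! c)" if "c \<in> set js" for c
      using bottom False G that wf j by (force simp: wf_circuit_def)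
    note ps = gate_parse(3)[OF j G]
    have occ: "occurs (encode C) j v \<longleftrightarrow> (\<exists>c\<in>set js. gate_arg (encode C) c 0 = v)" for v
    proof -
      have "occurs (encode C) j v \<longleftrightarrow> (\<exists>p<length js. gate_arg (encode C) (js ! p) 0 = v)"
        unfolding occurs_def using ps by auto
      also have "\<dots> \<longleftrightarrow> (\<exists>c\<in>set js. gate_arg (encode C) c 0 = v)" by (metis in_set_conv_nth)
      finally show ?thesis .
    qed
    have "gate_value S C j \<longleftrightarrow> (\<forall>c\<in>set js. gate_arg (encode C) c 0 \<in> S)"
      using gate_value_simps(3)[OF wf j G, of S] lit js by auto
    then show ?thesis unfolding occ by auto
  qed
qed

lemma feasibleP_walk:
  assumes a3: "3 \<le> a" and pr: "\<And>v. feasible a v \<Longrightarrow> feasibleP a (\<lambda>I \<rho>. pr I \<rho> (v I \<rho>))"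
    and "feasible a i" "\<forall>g\<in>set gs. feasible a g"
  shows "feasibleP a (\<lambda>I \<rho>. walk (fst I) (pr I \<rho>) (map (\<lambda>g. g I \<rho>) gs) b (i I \<rho>))"
  using assms(3,4)
proof (induction gs arbitrary: b i)
  case (Cons g gs)
  have "feasible a g" using Cons.prems(2) by simp
  have *: "feasibleP a (\<lambda>I \<rho>. walk (fst I) (pr I \<rho>) (map (\<lambda>g. g I \<rho>) gs) (\<not> b) (j I \<rho>))" if "feasible a j" for j
    using that Cons.prems(2) by (intro Cons.IH) auto
  have "feasibleP a (\<lambda>I \<rho>. if gate_kind (fst I) (i I \<rho>) \<le> 1 then walk (fst I) (pr I \<rho>) (map (\<lambda>g. g I \<rho>) gs) (\<not> b) (i I \<rho>)
     else if g I \<rho> < num_args (fst I) (i I \<rho>) then walk (fst I) (pr I \<rho>) (map (\<lambda>g. g I \<rho>) gs) (\<not> b) (gate_arg (fst I) (i I \<rho>) (g I \<rho>)) else \<not> b)"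
    using a3 Cons.prems(1) \<open>feasible a g\<close>
    by (intro feasibleP_if * feasibleP_const feasibleP_le feasibleP_less feasible_gate_kind feasible_num_args feasible_gate_arg feasible_const)
  then show ?case by simp
qed (simp add: pr)

lemma feasibleP_occurs: "feasible a v \<Longrightarrow> feasible a w \<Longrightarrow> feasibleP a (\<lambda>I \<rho>. occurs (fst I) (v I \<rho>) (w I \<rho>))"
proof -
  assume v: "feasible a v" and w: "feasible a w"
  note a3 = feasible_ge_3[OF v]
  have "feasibleP a (\<lambda>I \<rho>. \<exists>p<num_args (fst I) (v I \<rho>). gate_arg (fst I) (gate_arg (fst I) (v I \<rho>) p) 0 = w I \<rho>)"
  proof (rule feasibleP_ex[OF feasible_num_args[OF v]])
    fix u b assume b: "a \<le> b" "feasible b u"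
    show "feasibleP b (\<lambda>I \<rho>. gate_arg (fst I) (gate_arg (fst I) (v I \<rho>) (u I \<rho>)) 0 = w I \<rho>)"
      using b feasible_mono[OF v b(1)] feasible_mono[OF w b(1)] feasible_ge_3[OF b(2)]
      by (intro feasibleP_eq feasible_gate_arg feasible_const)
  qed
  then show ?thesis
    unfolding occurs_def using v w a3
    by (intro feasibleP_disj feasibleP_conj feasibleP_le feasibleP_eq feasible_gate_kind feasible_gate_arg feasible_const)
qed

text \<open>A bottom vertex is true iff one of the further groups holds a vertex with the same
  variables. This is a disjunction of new variables, so it merges with the OR-gates above it, and
  depth \<open>t - 1\<close> remains.\<close>

lemma WSAT_mono_odd_reduction:
  assumes t: "3 \<le> t" "odd t" and g: "c > 0" "(\<lambda>n. real (g n)) \<in> \<Omega>(\<lambda>n. real n powr c)"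
  shows "fpt_reducible (WSAT_mono t g) (WSAT_mono (t - 1) g)"
proof -
  define E where "E I = (2::nat) ^ snd I" for I :: input
  define M where "M I = length (fst I) + 3" for I :: input
  define R where "R I = num_gates (fst I) + 1" for I :: input
  define B where "B I = M I * M I + R I" for I
  \<comment> \<open>No variable of vertex \<open>y\<close> lies strictly inside a gap; over all gaps
    this says that its variables belong to \<open>S\<close>. Values from \<open>num_gates\<close> on
    mean "no vertex" and always pass.\<close>
  define xc where "xc I i u w e y \<longleftrightarrow> (y < num_gates (fst I) \<longrightarrow>
     \<not> (\<exists>v<length (fst I) + 1. u < v + 1 \<and> v + 1 < w \<and> occurs (fst I) y v))" for I :: input and i u w e y :: nat
  define pr where "pr I y j \<longleftrightarrow> y < num_gates (fst I) \<and> (\<forall>v<length (fst I) + 1. occurs (fst I) j v = occurs (fst I) y v)"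
    for I :: input and y j
  \<comment> \<open>The walk takes \<open>t - 1\<close> indices: the \<open>t - 2\<close> in
    \<open>tl gs\<close> and the existential \<open>a\<close>, which goes into the bottom
    disjunctions. The index \<open>hd gs\<close> belongs to group 0, whose value may be any index
    here.\<close>
  define cert where "cert I gs e y \<longleftrightarrow> (\<exists>a<R I. walk (fst I) (pr I y) (tl gs @ [a]) False (num_gates (fst I) - 1))"
    for I and gs :: "nat list" and e y :: nat
  have mM: "feasible b (\<lambda>I \<rho>. M I)" if "3 \<le> b" for b
    unfolding M_def using that by (intro feasible_add feasible_length feasible_const)
  have mR: "feasible b (\<lambda>I \<rho>. R I)" if "3 \<le> b" for b
    unfolding R_def using that by (intro feasible_add feasible_num_gates feasible_const)
  have mB: "feasible b (\<lambda>I \<rho>. B I)" if "3 \<le> b" for b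
    unfolding B_def using that by (intro feasible_add feasible_mult mM mR)
  have mE: "feasible b (\<lambda>I \<rho>. E I)" if "3 \<le> b" for b
    unfolding E_def using that by (rule feasible_pow2)
  have mpr: "feasibleP b (\<lambda>I \<rho>. pr I (w I \<rho>) (v I \<rho>))" if "feasible b w" "feasible b v" for b v w
  proof -
    have "feasibleP b (\<lambda>I \<rho>. \<forall>u<length (fst I) + 1. occurs (fst I) (v I \<rho>) u = occurs (fst I) (w I \<rho>) u)"
    proof (rule feasibleP_all)
      show "feasible b (\<lambda>I \<rho>. length (fst I) + 1)" using feasible_ge_3[OF that(1)] by (intro feasible_add feasible_length feasible_const)
      fix u c assume c: "b \<le> c" "feasible c u"
      have "feasibleP c (\<lambda>I \<rho>. (occurs (fst I) (v I \<rho>) (u I \<rho>) \<longrightarrow> occurs (fst I) (w I \<rho>) (u I \<rho>)) \<and>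
          (occurs (fst I) (w I \<rho>) (u I \<rho>) \<longrightarrow> occurs (fst I) (v I \<rho>) (u I \<rho>)))"
        using c feasible_mono[OF that(1) c(1)] feasible_mono[OF that(2) c(1)] by (intro feasibleP_conj feasibleP_imp feasibleP_occurs)
      then show "feasibleP c (\<lambda>I \<rho>. occurs (fst I) (v I \<rho>) (u I \<rho>) = occurs (fst I) (w I \<rho>) (u I \<rho>))"
        by (rule back_subst[of "feasibleP c"]) (auto simp: fun_eq_iff)
    qed
    then show ?thesis
      unfolding pr_def using that feasible_ge_3[OF that(1)] by (intro feasibleP_conj feasibleP_less feasible_num_gates)
  qed
  have t': "2 \<le> t - 1" "even (t - 1)" using t by auto
  show ?thesis
  proof (rule slot_reduction[where E=E and M=M and R=R and B=B and isv="\<lambda>I. is_variable (fst I)" and xc=xc and cert=cert and D=1,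
        OF fpt_reducible_subproblem[OF subset_refl refl] t' g mE mM mR mB])
    show "3 \<le> (3::nat)" "3 \<le> (3::nat)" "3 \<le> (3::nat)" "3 \<le> (3::nat)" by simp_all
    show "feasibleP b (\<lambda>I \<rho>. is_variable (fst I) (v I \<rho>))" if "feasible b v" for v b using that by (rule feasibleP_is_variable)
    show "feasibleP b (\<lambda>I \<rho>. xc I (v1 I \<rho>) (v2 I \<rho>) (v3 I \<rho>) (v4 I \<rho>) (v5 I \<rho>))"
      if b: "3 \<le> b" and v: "feasible b v1" "feasible b v2" "feasible b v3" "feasible b v4" "feasible b v5" for v1 v2 v3 v4 v5 b
    proof -
      have "feasibleP b (\<lambda>I \<rho>. \<exists>v<length (fst I) + 1. v2 I \<rho> < v + 1 \<and> v + 1 < v3 I \<rho> \<and> occurs (fst I) (v5 I \<rho>) v)"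
      proof (rule feasibleP_ex)
        show "feasible b (\<lambda>I \<rho>. length (fst I) + 1)" using b by (intro feasible_add feasible_length feasible_const)
        fix u c assume c: "b \<le> c" "feasible c u"
        show "feasibleP c (\<lambda>I \<rho>. v2 I \<rho> < u I \<rho> + 1 \<and> u I \<rho> + 1 < v3 I \<rho> \<and> occurs (fst I) (v5 I \<rho>) (u I \<rho>))"
          using c feasible_mono[OF v(2) c(1)] feasible_mono[OF v(3) c(1)] feasible_mono[OF v(5) c(1)] feasible_ge_3[OF c(2)]
          by (intro feasibleP_conj feasibleP_less feasible_add feasible_const feasibleP_occurs)
      qed
      then show ?thesis
        unfolding xc_def using b v by (intro feasibleP_imp feasibleP_not feasibleP_less feasible_num_gates)
    qed
    show "feasibleP b (\<lambda>I \<rho>. cert I (map (\<lambda>v. v I \<rho>) vs) (v I \<rho>) (w I \<rho>))"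
      if b: "3 \<le> b" and vs: "length vs = t - 1" "\<forall>v\<in>set vs. feasible b v" and w: "feasible b v" "feasible b w" for vs v w b
      unfolding cert_def
    proof (rule feasibleP_ex[OF mR[OF b]])
      fix u c assume c: "b \<le> c" "feasible c u"
      have c3: "3 \<le> c" using b c by simp
      have tlvs: "set (tl vs) \<subseteq> set vs" by (cases vs) auto
      have "feasibleP c (\<lambda>I \<rho>. walk (fst I) (pr I (w I \<rho>)) (map (\<lambda>v. v I \<rho>) (tl vs @ [u])) False (num_gates (fst I) - 1))"
      proof (rule feasibleP_walk[OF c3])
        show "feasible c (\<lambda>I \<rho>. num_gates (fst I) - 1)" using c3 by (intro feasible_diff feasible_num_gates feasible_const)
        show "\<forall>g\<in>set (tl vs @ [u]). feasible c g" using vs(2) c(2) feasible_mono[OF _ c(1)] tlvs by auto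
        show "feasibleP c (\<lambda>I \<rho>. pr I (w I \<rho>) (v' I \<rho>))" if "feasible c v'" for v'
          using feasible_mono[OF w(2) c(1)] that by (rule mpr)
      qed
      then show "feasibleP c (\<lambda>I \<rho>. walk (fst I) (pr I (w I \<rho>)) (tl (map (\<lambda>v. v I \<rho>) vs) @ [u I \<rho>]) False (num_gates (fst I) - 1))"
        by (simp add: map_tl)
    qed
    show "E (x, k) \<le> 2 ^ (1 * (k + 1))" for x k by (simp add: E_def)
    show "2 \<le> M I" for I by (simp add: M_def)
    show "v + 1 < M I - 1" if "is_variable (fst I) v" for I v using that by (simp add: is_variable_def M_def)
    show "M I * M I \<le> B I" "R I \<le> B I" for I by (auto simp: B_def)
    show "0 < R I" for I by (simp add: R_def)
    fix x k assume "(x, k) \<in> instances (WSAT_mono t g)"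
    then obtain C where x: "x = encode C" and C: "Pi_circuit t C" "monotone_circuit C" "circuit_genus C \<le> g (card (vars C))"
      unfolding WSAT_mono_def weighted_sat_instances(3) by blast
    let ?I = "(x, k)"
    have wf: "wf_circuit C" using C(1) by (simp add: Pi_circuit_def)
    have ng: "num_gates x = length C" by (simp add: x num_gates_encode)
    have ne: "C \<noteq> []" using wf by (simp add: wf_circuit_def)
    have root: "length C - 1 < length C" using ne by (cases C) auto
    have M2: "2 \<le> M ?I" by (simp add: M_def)
    have tn: "t - 1 = Suc (t - 2)" "t - 1 - 1 = t - 2" "False = even (t - 2)" using t by auto
    have sat: "alt (R ?I) False (t - 1 - 1) (\<lambda>gs. \<exists>a<R ?I. walk x pr' (gs @ [a]) False (length C - 1)) \<longleftrightarrow> satisfies S C"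
      if pr': "\<And>j. j < length C \<Longrightarrow> is_LIT (C ! j) \<or> (is_AND (C ! j) \<and> (\<forall>c\<in>set (fan_in (C ! j)). is_LIT (C ! c))) \<Longrightarrow> pr' j = gate_value S C j"
      for pr' S
    proof -
      have "odd (t - 1) = False" using t' by simp
      have "alt (R ?I) (odd (t - 1)) (t - 1) (\<lambda>gs. walk x pr' gs (odd (t - 1)) (length C - 1)) \<longleftrightarrow> gate_value S C (length C - 1)"
        unfolding x
      proof (rule walk_correct[OF C(1) _ pr' root])
        show "length C < R (encode C, k)" by (simp add: R_def num_gates_encode)
        have "depth C \<le> t" using C(1) by (simp add: Pi_circuit_def)
        then show "path_value (\<lambda>G. \<not> is_LIT G) C (length C - 1) \<le> t - 1 + 1"
          using t by (simp add: depth_def max_on_path_path_value[OF ne])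
        have "is_AND (C ! (length C - 1))" using C(1) ne by (simp add: Pi_circuit_def last_conv_nth)
        then show "is_LIT (C ! (length C - 1)) \<or> is_OR (C ! (length C - 1)) = odd (t - 1)"
          using t' by (cases "C ! (length C - 1)") auto
      qed simp_all
      then have "alt (R ?I) False (t - 1) (\<lambda>gs. walk x pr' gs False (length C - 1)) \<longleftrightarrow> gate_value S C (length C - 1)"
        unfolding \<open>odd (t - 1) = False\<close> .
      then have "alt (R ?I) False (Suc (t - 2)) (\<lambda>gs. walk x pr' gs False (length C - 1)) \<longleftrightarrow> gate_value S C (length C - 1)"
        unfolding tn(1) .
      then show ?thesis
        unfolding alt_snoc tn(2) satisfies_gate_value[OF ne] using tn(3) by simp
    qed
    have E0: "0 < E ?I" by (simp add: E_def)
    have leaf: "(\<exists>e<E ?I. cert ?I (g # gs) e (y e)) \<longleftrightarrow> (\<exists>a<R ?I. walk x (\<lambda>j. \<exists>e<E ?I. pr ?I (y e) j) (gs @ [a]) False (length C - 1))" for g gs y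
    proof -
      have "(\<exists>e<E ?I. cert ?I (g # gs) e (y e)) \<longleftrightarrow> (\<exists>a<R ?I. \<exists>e<E ?I. walk x (pr ?I (y e)) (gs @ [a]) False (length C - 1))"
        by (auto simp: cert_def ng)
      then show ?thesis unfolding walk_ex[OF E0] .
    qed
    have occ_eq: "pr ?I y j \<longleftrightarrow> y < length C \<and> Collect (occurs x j) = Collect (occurs x y)" for y j
      unfolding pr_def using occurs_le_length[of x] by (auto simp: ng less_Suc_eq_le)
    have in_S: "Collect (occurs x y) \<subseteq> S" if gp: "gaps k (M ?I) S U" and y: "y < length C" and yx: "\<forall>i\<le>k. xc ?I i (U i) (U (i + 1)) e y" for S U e y
    proof
      fix v assume v: "v \<in> Collect (occurs x y)"
      then have vl: "v \<le> length x" using occurs_le_length by blast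
      then have vM: "v + 1 < M ?I - 1" by (simp add: M_def)
      show "v \<in> S"
      proof (rule ccontr)
        assume "v \<notin> S"
        then obtain i where "i \<le> k" "U i < v + 1" "v + 1 < U (i + 1)" using gaps_not_mem[OF gp vM] by blast
        then show False using yx y v vl by (auto simp: xc_def ng less_Suc_eq_le)
      qed
    qed
    show "(x, k) \<in> yes_instances (WSAT_mono t g) \<longleftrightarrow>
       (\<exists>S U g y. S \<subseteq> Collect (is_variable (fst (x, k))) \<and> gaps k (M (x, k)) S U \<and> g < R (x, k) \<and>
          (\<forall>e<E (x, k). y e < B (x, k) \<and> (\<forall>i\<le>k. xc (x, k) i (U i) (U (i + 1)) e (y e))) \<and>
          alt (R (x, k)) False (t - 1 - 1) (\<lambda>gs. \<exists>e<E (x, k). cert (x, k) (g # gs) e (y e)))" (is "?Y \<longleftrightarrow> ?Z")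
    proof
      assume ?Y
      then obtain S where S: "S \<subseteq> vars C" "card S = k" "satisfies S C"
        unfolding x WSAT_mono_def weighted_sat_instances(2) weight_satisfiable_def by blast
      have Sv: "S \<subseteq> Collect (is_variable (fst ?I))" using S(1) by (simp add: x is_variable_vars)
      have SM: "v + 1 < M ?I - 1" if "v \<in> S" for v using Sv that by (auto simp: is_variable_def M_def)
      then have "S \<subseteq> {..<M ?I}" by force
      then have fin: "finite S" by (rule finite_subset) simp
      from gaps_exists[OF this S(2) SM M2] obtain U where gp: "gaps k (M ?I) S U" by blast
      have "card (Pow S) = E ?I" using fin S(2) by (simp add: E_def card_Pow)
      then obtain f where f: "bij_betw f {0..<E ?I} (Pow S)" using ex_bij_betw_nat_finite[of "Pow S"] fin by auto
      \<comment> \<open>A vertex whose variables form the subset \<open>f e\<close> of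
        \<open>S\<close> if there is one, otherwise the value meaning "no vertex".\<close>
      define y where "y e = (if \<exists>j<length C. Collect (occurs x j) = f e then SOME j. j < length C \<and> Collect (occurs x j) = f e else length C)" for e
      have y1: "y e < length C \<and> Collect (occurs x (y e)) = f e" if "\<exists>j<length C. Collect (occurs x j) = f e" for e
        using someI_ex[OF that] that by (simp add: y_def)
      have y2: "y e \<le> length C" for e using y1[of e] by (cases "\<exists>j<length C. Collect (occurs x j) = f e") (auto simp: y_def)
      have y3: "Collect (occurs x (y e)) = f e" if "y e < length C" for e
        using that y1[of e] by (auto simp: y_def split: if_splits)
      have yx: "\<forall>e<E ?I. y e < B ?I \<and> (\<forall>i\<le>k. xc ?I i (U i) (U (i + 1)) e (y e))"
      proof (intro allI impI conjI)
        fix e assume e: "e < E ?I"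
        show "y e < B ?I" using y2[of e] by (simp add: B_def R_def ng)
        fix i assume i: "i \<le> k"
        show "xc ?I i (U i) (U (i + 1)) e (y e)"
          unfolding xc_def
        proof (intro impI notI)
          assume ye: "y e < num_gates (fst ?I)"
            and "\<exists>v<length (fst ?I) + 1. U i < v + 1 \<and> v + 1 < U (i + 1) \<and> occurs (fst ?I) (y e) v"
          then obtain v where v: "U i < v + 1" "v + 1 < U (i + 1)" "occurs x (y e) v" "v \<le> length x" by auto
          have "f e \<subseteq> S" using bij_betwE[OF f] e by auto
          then have "v \<in> S" using y3[of e] ye ng v(3) by auto
          moreover have "v + 1 < M ?I - 1" using v(4) by (simp add: M_def)
          ultimately show False using gaps_not_mem[OF gp] v(1,2) i by blast
        qed
      qed
      have "(\<exists>e<E ?I. pr ?I (y e) j) = gate_value S C j"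
        if j: "j < length C" "is_LIT (C ! j) \<or> (is_AND (C ! j) \<and> (\<forall>c\<in>set (fan_in (C ! j)). is_LIT (C ! c)))" for j
      proof -
        note gv = gate_value_occurs[OF wf C(2) j, of S, folded x]
        show ?thesis
        proof
          assume "\<exists>e<E ?I. pr ?I (y e) j"
          then obtain e where "e < E ?I" "y e < length C" "Collect (occurs x j) = Collect (occurs x (y e))" unfolding occ_eq by blast
          then show "gate_value S C j" using in_S[OF gp] yx unfolding gv by blast
        next
          assume "gate_value S C j"
          then have "Collect (occurs x j) \<in> Pow S" unfolding gv by blast
          then have "Collect (occurs x j) \<in> f ` {0..<E ?I}" using bij_betw_imp_surj_on[OF f] by simp
          then obtain e where e: "e < E ?I" "f e = Collect (occurs x j)" by auto
          then have "y e < length C \<and> Collect (occurs x (y e)) = f e" using y1[of e] j(1) by auto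
          then show "\<exists>e<E ?I. pr ?I (y e) j" using e unfolding occ_eq by auto
        qed
      qed
      from sat[of "\<lambda>j. \<exists>e<E ?I. pr ?I (y e) j" S, OF this]
      have "alt (R ?I) False (t - 1 - 1) (\<lambda>gs. \<exists>e<E ?I. cert ?I (0 # gs) e (y e))"
        using S(3) unfolding leaf by blast
      moreover have "0 < R ?I" by (simp add: R_def)
      ultimately show ?Z using Sv gp yx by blast
    next
      assume ?Z
      then obtain S U g y where S: "S \<subseteq> Collect (is_variable (fst ?I))" and gp: "gaps k (M ?I) S U" and
        y: "\<forall>e<E ?I. y e < B ?I \<and> (\<forall>i\<le>k. xc ?I i (U i) (U (i + 1)) e (y e))" and
        al: "alt (R ?I) False (t - 1 - 1) (\<lambda>gs. \<exists>e<E ?I. cert ?I (g # gs) e (y e))" by blast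
      \<comment> \<open>In this direction the groups may miss subsets of \<open>S\<close>, but what
        they certify is true. Adding \<open>gate_value S C j\<close> makes the predicate exact, and
        monotonicity of the walk carries satisfaction over.\<close>
      let ?pr = "\<lambda>j. (\<exists>e<E ?I. pr ?I (y e) j) \<or> gate_value S C j"
      have "alt (R ?I) False (t - 1 - 1) (\<lambda>gs. \<exists>a<R ?I. walk x ?pr (gs @ [a]) False (length C - 1))"
      proof (rule alt_mono[OF al])
        fix gs assume "\<exists>e<E ?I. cert ?I (g # gs) e (y e)"
        then obtain a where "a < R ?I" "walk x (\<lambda>j. \<exists>e<E ?I. pr ?I (y e) j) (gs @ [a]) False (length C - 1)" unfolding leaf by blast
        then show "\<exists>a<R ?I. walk x ?pr (gs @ [a]) False (length C - 1)" using walk_mono[of x "\<lambda>j. \<exists>e<E ?I. pr ?I (y e) j" _ _ _ ?pr] by blast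
      qed
      moreover have "?pr j = gate_value S C j"
        if j: "j < length C" "is_LIT (C ! j) \<or> (is_AND (C ! j) \<and> (\<forall>c\<in>set (fan_in (C ! j)). is_LIT (C ! c)))" for j
      proof -
        note gv = gate_value_occurs[OF wf C(2) j, of S, folded x]
        have "gate_value S C j" if "\<exists>e<E ?I. pr ?I (y e) j"
        proof -
          from that obtain e where "e < E ?I" "y e < length C" "Collect (occurs x j) = Collect (occurs x (y e))"
            unfolding occ_eq by blast
          then show ?thesis using in_S[OF gp] y unfolding gv by blast
        qed
        then show ?thesis by blast
      qed
      ultimately have "satisfies S C" using sat[of ?pr S] by blast
      moreover have "S \<subseteq> vars C" using S by (simp add: x is_variable_vars)
      moreover have "card S = k" using gaps_card[OF gp] .
      ultimately show ?Y unfolding x WSAT_mono_def weighted_sat_instances(2) weight_satisfiable_def using C by blast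
    qed
  qed
qed

lemma weft_le_depth:
  assumes "wf_circuit C"
  shows "weft C \<le> depth C"
proof -
  have "C \<noteq> []" using assms by (simp add: wf_circuit_def)
  have "is_LIT G \<Longrightarrow> fan_in G = []" for G by (cases G) auto
  then have "of_bool (2 < length (fan_in G)) \<le> (of_bool (\<not> is_LIT G) :: nat)" for G by fastforce
  then have "max_on_path (\<lambda>G. 2 < length (fan_in G)) C \<le> path_value (\<lambda>G. \<not> is_LIT G) C (length C - 1)"
    using path_value_fan_in[OF assms, of _ _ "\<lambda>G. \<not> is_LIT G"] path_value_ge[of _ C "\<lambda>G. \<not> is_LIT G"]
    by (intro max_on_path_le[OF assms]) (meson add_le_mono1 le_trans)+
  then show ?thesis using max_on_path_path_value[OF \<open>C \<noteq> []\<close>] by (simp add: weft_def depth_def)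
qed

text \<open>The depth bound \<open>t\<close> of the instances also bounds their weft, so they are
  instances of the problem defining \<open>W t\<close>, with \<open>h = t\<close>.\<close>

lemma WSAT_mono_in_W: "fpt_reducible P (WSAT_mono t g) \<Longrightarrow> P \<in> W t"
proof -
  assume P: "fpt_reducible P (WSAT_mono t g)"
  have imp: "wf_circuit C \<and> weft C \<le> t \<and> depth C \<le> t" if "Pi_circuit t C \<and> monotone_circuit C \<and> circuit_genus C \<le> g (card (vars C))" for C
    using that weft_le_depth[of C] by (auto simp: Pi_circuit_def)
  have "fpt_reducible P (weighted_sat (\<lambda>C. wf_circuit C \<and> weft C \<le> t \<and> depth C \<le> t))"
    by (rule fpt_reducible_weaken[OF P[unfolded WSAT_mono_def] weighted_sat_mono(1)[OF imp] weighted_sat_mono(2)[OF imp]])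
  then show ?thesis unfolding W_def by blast
qed

theorem theorem4:
  fixes c :: real and g :: "nat \<Rightarrow> nat" and t :: nat
  assumes "c > 0"
    and "(\<lambda>n. real (g n)) \<in> \<Omega>(\<lambda>n. real n powr c)"
    and "t \<ge> 2"
  shows "(even t \<longrightarrow> W_complete t (WSAT_mono t g)) \<and>
         (odd t \<longrightarrow> W_complete (t - 1) (WSAT_mono t g))"
proof (intro conjI impI)
  assume "even t"
  have "fpt_reducible (WSAT_mono t g) (WSAT_mono t g)"
    by (rule fpt_reducible_subproblem) simp_all
  then have "WSAT_mono t g \<in> W t" by (rule WSAT_mono_in_W)
  then show "W_complete t (WSAT_mono t g)"
    unfolding W_complete_def using WSAT_mono_W_hard[OF assms(3) \<open>even t\<close> assms(1,2)] by blast
next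
  assume "odd t"
  then have t: "3 \<le> t" "2 \<le> t - 1" "even (t - 1)" using assms(3) by presburger+
  have "WSAT_mono t g \<in> W (t - 1)"
    by (rule WSAT_mono_in_W) (rule WSAT_mono_odd_reduction[OF t(1) \<open>odd t\<close> assms(1,2)])
  \<comment> \<open>A circuit of depth at most \<open>t - 1\<close> is also an instance for
    \<open>t\<close>, so hardness carries over from the even case.\<close>
  moreover have "fpt_reducible P (WSAT_mono t g)" if "P \<in> W (t - 1)" for P
  proof (rule fpt_reducible_weaken[OF WSAT_mono_W_hard[OF t(2,3) assms(1,2) that]])
    have "Pi_circuit t C" if "Pi_circuit (t - 1) C" for C using that by (auto simp: Pi_circuit_def)
    then show "instances (WSAT_mono (t - 1) g) \<subseteq> instances (WSAT_mono t g)"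
      "(x, k) \<in> instances (WSAT_mono (t - 1) g) \<Longrightarrow>
        (x, k) \<in> yes_instances (WSAT_mono (t - 1) g) \<longleftrightarrow> (x, k) \<in> yes_instances (WSAT_mono t g)" for x k
      unfolding WSAT_mono_def by (intro weighted_sat_mono; blast)+
  qed
  ultimately show "W_complete (t - 1) (WSAT_mono t g)"
    unfolding W_complete_def by blast
qed

end
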